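(* Let $\Lambda$ be an artin algebra. Then the following conditions are equivalent. (1) $\Lambda$ is $\tau$-tilting finite, that is, there are only finitely many torsion classes in $\mathsf{mod}\,\Lambda$. (2) There are only finitely many IE-closed subcategories of $\mathsf{mod}\,\Lambda$. (3) Every IE-closed subcategory of $\mathsf{mod}\,\Lambda$ is functorially finite.
   Context: An artin algebra is an algebra over a commutative artinian ring $R$ that is finitely generated as an $R$-module; $\mathsf{mod}\,\Lambda$ is the category of finitely generated right $\Lambda$-modules. All subcategories are full, additive and closed under isomorphisms. A subcategory $\mathcal{C}$ of $\mathsf{mod}\,\Lambda$ is closed under extensions if for each short exact sequence $0\to L\to M\to N\to 0$ with $L,N\in\mathcal{C}$ we have $M\in\mathcal{C}$; it is closed under images if $\operatorname{Im}\varphi\in\mathcal{C}$ for every map $\varphi\colon C_1\to C_2$ with $C_1,C_2\in\mathcal{C}$. $\mathcal{C}$ is IE-closed if it is closed under images and extensions. A torsion class in $\mathsf{mod}\,\Lambda$ is a subcategory closed under extensions and under quotient modules. A left $\mathcal{C}$-approximation of $M$ is a map $f\colon M\to C$ with $C\in\mathcal{C}$ such that every map $M\to C'$ with $C'\in\mathcal{C}$ factors through $f$; right approximations are dual. $\mathcal{C}$ is covariantly (resp. contravariantly) finite if every $M\in\mathsf{mod}\,\Lambda$ has a left (resp. right) $\mathcal{C}$-approximation, and functorially finite if both hold. *)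

theory Defs
  imports "HOL-Algebra.Module" "HOL-Algebra.Ideal"
begin

section \<open>Artin algebras\<close>

definition artinian_ring :: "('r, 'q) ring_scheme \<Rightarrow> bool"
  where "artinian_ring R \<longleftrightarrow>
    ring R \<and>
    (\<forall>I :: nat \<Rightarrow> 'r set. (\<forall>n. ideal (I n) R) \<longrightarrow> (\<forall>n. I (Suc n) \<subseteq> I n) \<longrightarrow>
      (\<exists>k. \<forall>n\<ge>k. I n = I k))"

text \<open>
  The locale \<^locale>\<open>algebra\<close> of the library requires a commutative algebra, so it cannot be
  used here. The two compatibility axioms say that the image of \<open>R\<close> in \<open>\<Lambda>\<close> is central.
\<close>

locale artin_algebra = R?: cring R + module R \<Lambda> + \<Lambda>?: ring \<Lambda>
  for R :: "('r, 'q) ring_scheme" (structure) and \<Lambda> :: "('r, 'a, 'k) module_scheme" (structure) +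
  assumes artinian: "artinian_ring R"
    and smult_mult_left:
      "\<lbrakk>r \<in> carrier R; a \<in> carrier \<Lambda>; b \<in> carrier \<Lambda>\<rbrakk> \<Longrightarrow>
        (r \<odot>\<^bsub>\<Lambda>\<^esub> a) \<otimes>\<^bsub>\<Lambda>\<^esub> b = r \<odot>\<^bsub>\<Lambda>\<^esub> (a \<otimes>\<^bsub>\<Lambda>\<^esub> b)"
    and smult_mult_right:
      "\<lbrakk>r \<in> carrier R; a \<in> carrier \<Lambda>; b \<in> carrier \<Lambda>\<rbrakk> \<Longrightarrow>
        a \<otimes>\<^bsub>\<Lambda>\<^esub> (r \<odot>\<^bsub>\<Lambda>\<^esub> b) = r \<odot>\<^bsub>\<Lambda>\<^esub> (a \<otimes>\<^bsub>\<Lambda>\<^esub> b)"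
    and fin_gen_over_base:
      "\<exists>S. finite S \<and> S \<subseteq> carrier \<Lambda> \<and> (\<forall>U. submodule U R \<Lambda> \<longrightarrow> S \<subseteq> U \<longrightarrow> U = carrier \<Lambda>)"

section \<open>Right modules\<close>

text \<open>
  As for the library's modules, the fields \<open>mult\<close> and \<open>one\<close> inherited from \<^typ>\<open>'m ring\<close> are not
  used. All notions below are invariant under changing them.
\<close>

record ('a, 'm) rmodule = "'m ring" +
  ract :: "'m \<Rightarrow> 'a \<Rightarrow> 'm" (infixl \<open>\<triangleleft>\<index>\<close> 70)

locale right_module = \<Lambda>?: ring \<Lambda> + M?: abelian_group M
  for \<Lambda> :: "('a, 'k) ring_scheme" (structure) and M :: "('a, 'm) rmodule" (structure) +
  assumes ract_closed [simp, intro]: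
      "\<lbrakk>x \<in> carrier M; a \<in> carrier \<Lambda>\<rbrakk> \<Longrightarrow> x \<triangleleft>\<^bsub>M\<^esub> a \<in> carrier M"
    and ract_r_distr:
      "\<lbrakk>x \<in> carrier M; a \<in> carrier \<Lambda>; b \<in> carrier \<Lambda>\<rbrakk> \<Longrightarrow>
        x \<triangleleft>\<^bsub>M\<^esub> (a \<oplus>\<^bsub>\<Lambda>\<^esub> b) = x \<triangleleft>\<^bsub>M\<^esub> a \<oplus>\<^bsub>M\<^esub> x \<triangleleft>\<^bsub>M\<^esub> b"
    and ract_l_distr:
      "\<lbrakk>x \<in> carrier M; y \<in> carrier M; a \<in> carrier \<Lambda>\<rbrakk> \<Longrightarrow>
        (x \<oplus>\<^bsub>M\<^esub> y) \<triangleleft>\<^bsub>M\<^esub> a = x \<triangleleft>\<^bsub>M\<^esub> a \<oplus>\<^bsub>M\<^esub> y \<triangleleft>\<^bsub>M\<^esub> a"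
    and ract_assoc:
      "\<lbrakk>x \<in> carrier M; a \<in> carrier \<Lambda>; b \<in> carrier \<Lambda>\<rbrakk> \<Longrightarrow>
        x \<triangleleft>\<^bsub>M\<^esub> (a \<otimes>\<^bsub>\<Lambda>\<^esub> b) = (x \<triangleleft>\<^bsub>M\<^esub> a) \<triangleleft>\<^bsub>M\<^esub> b"
    and ract_one [simp]:
      "x \<in> carrier M \<Longrightarrow> x \<triangleleft>\<^bsub>M\<^esub> \<one>\<^bsub>\<Lambda>\<^esub> = x"

definition rsubmodule :: "('a, 'k) ring_scheme \<Rightarrow> ('a, 'm) rmodule \<Rightarrow> 'm set \<Rightarrow> bool"
  where "rsubmodule \<Lambda> M U \<longleftrightarrow>
    subgroup U (add_monoid M) \<and> (\<forall>x\<in>U. \<forall>a\<in>carrier \<Lambda>. x \<triangleleft>\<^bsub>M\<^esub> a \<in> U)"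

definition fin_gen :: "('a, 'k) ring_scheme \<Rightarrow> ('a, 'm) rmodule \<Rightarrow> bool"
  where "fin_gen \<Lambda> M \<longleftrightarrow>
    (\<exists>S. finite S \<and> S \<subseteq> carrier M \<and> (\<forall>U. rsubmodule \<Lambda> M U \<longrightarrow> S \<subseteq> U \<longrightarrow> U = carrier M))"

definition fg_mods :: "('a, 'k) ring_scheme \<Rightarrow> ('a, 'm) rmodule set"
  where "fg_mods \<Lambda> = {M. right_module \<Lambda> M \<and> fin_gen \<Lambda> M}"

text \<open>
  Homomorphisms are total functions of which only the restriction to the carrier matters; two of
  them are regarded as equal if they agree on the carrier of the domain.
\<close>

definition rhom :: "('a, 'k) ring_scheme \<Rightarrow> ('a, 'm) rmodule \<Rightarrow> ('a, 'n) rmodule \<Rightarrow> ('m \<Rightarrow> 'n) set"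
  where "rhom \<Lambda> M N =
    {f \<in> carrier M \<rightarrow> carrier N.
      (\<forall>x\<in>carrier M. \<forall>y\<in>carrier M. f (x \<oplus>\<^bsub>M\<^esub> y) = f x \<oplus>\<^bsub>N\<^esub> f y) \<and>
      (\<forall>x\<in>carrier M. \<forall>a\<in>carrier \<Lambda>. f (x \<triangleleft>\<^bsub>M\<^esub> a) = f x \<triangleleft>\<^bsub>N\<^esub> a)}"

definition riso :: "('a, 'k) ring_scheme \<Rightarrow> ('a, 'm) rmodule \<Rightarrow> ('a, 'n) rmodule \<Rightarrow> bool"
  where "riso \<Lambda> M N \<longleftrightarrow> (\<exists>f\<in>rhom \<Lambda> M N. bij_betw f (carrier M) (carrier N))"

definition dsum :: "('a, 'm) rmodule \<Rightarrow> ('a, 'n) rmodule \<Rightarrow> ('a, 'm \<times> 'n) rmodule"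
  where "dsum M N =
    \<lparr>carrier = carrier M \<times> carrier N, mult = undefined, one = undefined,
     zero = (\<zero>\<^bsub>M\<^esub>, \<zero>\<^bsub>N\<^esub>),
     add = (\<lambda>(x, y) (x', y'). (x \<oplus>\<^bsub>M\<^esub> x', y \<oplus>\<^bsub>N\<^esub> y')),
     ract = (\<lambda>(x, y) a. (x \<triangleleft>\<^bsub>M\<^esub> a, y \<triangleleft>\<^bsub>N\<^esub> a))\<rparr>"

definition im_mod :: "('a, 'm) rmodule \<Rightarrow> ('a, 'n) rmodule \<Rightarrow> ('m \<Rightarrow> 'n) \<Rightarrow> ('a, 'n) rmodule"
  where "im_mod M N f = N\<lparr>carrier := f ` carrier M\<rparr>"

definition short_exact ::
  "('a, 'k) ring_scheme \<Rightarrow> ('a, 'l) rmodule \<Rightarrow> ('l \<Rightarrow> 'm) \<Rightarrow> ('a, 'm) rmodule \<Rightarrow>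
    ('m \<Rightarrow> 'n) \<Rightarrow> ('a, 'n) rmodule \<Rightarrow> bool"
  where "short_exact \<Lambda> L f M g N \<longleftrightarrow>
    f \<in> rhom \<Lambda> L M \<and> g \<in> rhom \<Lambda> M N \<and> inj_on f (carrier L) \<and>
    f ` carrier L = {x \<in> carrier M. g x = \<zero>\<^bsub>N\<^esub>} \<and> g ` carrier M = carrier N"

section \<open>The universe\<close>

text \<open>
  A finitely generated module is a quotient of \<open>\<Lambda>\<^sup>n\<close> for some \<open>n\<close>, so up to isomorphism its elements
  are sets of coefficient vectors. The type of sets of functions from \<^typ>\<open>nat\<close> to \<^typ>\<open>'a\<close> therefore
  contains the carriers of a representative of every isomorphism class of finitely generated
  modules (lemma \<open>fg_mods_universe\<close> below), and isomorphism-closed subcategories of all finitely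
  generated modules correspond to isomorphism-closed sets of modules with carriers in this type.
\<close>

type_synonym 'a fgmod = "('a, (nat \<Rightarrow> 'a) set) rmodule"

lemma rsubmoduleI:
  assumes "right_module \<Lambda> M" and sub: "U \<subseteq> carrier M" and zero: "\<zero>\<^bsub>M\<^esub> \<in> U"
    and add: "\<And>x y. x \<in> U \<Longrightarrow> y \<in> U \<Longrightarrow> x \<oplus>\<^bsub>M\<^esub> y \<in> U"
    and act: "\<And>x a. x \<in> U \<Longrightarrow> a \<in> carrier \<Lambda> \<Longrightarrow> x \<triangleleft>\<^bsub>M\<^esub> a \<in> U"
  shows "rsubmodule \<Lambda> M U"
proof -
  interpret right_module \<Lambda> M by fact
  have neg: "\<ominus>\<^bsub>M\<^esub> x \<in> U" if "x \<in> U" for x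
  proof -
    have x: "x \<in> carrier M" using that sub by auto
    have "x \<triangleleft>\<^bsub>M\<^esub> \<zero>\<^bsub>\<Lambda>\<^esub> \<oplus>\<^bsub>M\<^esub> x \<triangleleft>\<^bsub>M\<^esub> \<zero>\<^bsub>\<Lambda>\<^esub> = x \<triangleleft>\<^bsub>M\<^esub> \<zero>\<^bsub>\<Lambda>\<^esub>"
      using ract_r_distr[OF x, of "\<zero>\<^bsub>\<Lambda>\<^esub>" "\<zero>\<^bsub>\<Lambda>\<^esub>"] by simp
    then have z: "x \<triangleleft>\<^bsub>M\<^esub> \<zero>\<^bsub>\<Lambda>\<^esub> = \<zero>\<^bsub>M\<^esub>"
      using M.add.l_cancel_one[of "x \<triangleleft>\<^bsub>M\<^esub> \<zero>\<^bsub>\<Lambda>\<^esub>" "x \<triangleleft>\<^bsub>M\<^esub> \<zero>\<^bsub>\<Lambda>\<^esub>"] x by simp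
    have "x \<triangleleft>\<^bsub>M\<^esub> (\<ominus>\<^bsub>\<Lambda>\<^esub> \<one>\<^bsub>\<Lambda>\<^esub>) \<oplus>\<^bsub>M\<^esub> x = \<zero>\<^bsub>M\<^esub>"
      using ract_r_distr[OF x, of "\<ominus>\<^bsub>\<Lambda>\<^esub> \<one>\<^bsub>\<Lambda>\<^esub>" "\<one>\<^bsub>\<Lambda>\<^esub>"] x z by (simp add: \<Lambda>.l_neg)
    then have "\<ominus>\<^bsub>M\<^esub> x = x \<triangleleft>\<^bsub>M\<^esub> (\<ominus>\<^bsub>\<Lambda>\<^esub> \<one>\<^bsub>\<Lambda>\<^esub>)"
      using x by (intro M.minus_equality) auto
    then show ?thesis using act[OF that, of "\<ominus>\<^bsub>\<Lambda>\<^esub> \<one>\<^bsub>\<Lambda>\<^esub>"] by simp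
  qed
  have "subgroup U (add_monoid M)"
    using sub zero add neg by (intro M.add.subgroupI) (auto simp: a_inv_def)
  then show ?thesis using act by (auto simp: rsubmodule_def)
qed

lemma right_module_transport:
  fixes \<Lambda> :: "('a, 'k) ring_scheme" and M :: "('a, 'm) rmodule" and \<iota> :: "'m \<Rightarrow> 'n"
  assumes "right_module \<Lambda> M" and inj: "inj_on \<iota> (carrier M)"
  shows "\<exists>N :: ('a, 'n) rmodule. right_module \<Lambda> N \<and> \<iota> \<in> rhom \<Lambda> M N \<and> bij_betw \<iota> (carrier M) (carrier N)"
proof -
  interpret right_module \<Lambda> M by fact
  define \<kappa> where "\<kappa> = inv_into (carrier M) \<iota>"
  have \<kappa> [simp]: "\<kappa> (\<iota> x) = x" if "x \<in> carrier M" for x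
    using that inj by (simp add: \<kappa>_def)
  define N :: "('a, 'n) rmodule" where "N = \<lparr>carrier = \<iota> ` carrier M, mult = undefined, one = undefined,
    zero = \<iota> \<zero>\<^bsub>M\<^esub>, add = (\<lambda>X Y. \<iota> (\<kappa> X \<oplus>\<^bsub>M\<^esub> \<kappa> Y)), ract = (\<lambda>X a. \<iota> (\<kappa> X \<triangleleft>\<^bsub>M\<^esub> a))\<rparr>"
  have ab: "abelian_group N"
  proof (rule abelian_groupI)
    fix X assume "X \<in> carrier N"
    then obtain x where x: "x \<in> carrier M" "X = \<iota> x" by (auto simp: N_def)
    then show "\<exists>Y\<in>carrier N. Y \<oplus>\<^bsub>N\<^esub> X = \<zero>\<^bsub>N\<^esub>"
      by (intro bexI[of _ "\<iota> (\<ominus>\<^bsub>M\<^esub> x)"]) (auto simp: N_def M.l_neg)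
  qed (auto simp: N_def M.a_ac)
  have "right_module \<Lambda> N"
    by (intro right_module.intro right_module_axioms.intro ab \<Lambda>.ring_axioms)
      (auto simp: N_def ract_r_distr ract_l_distr ract_assoc)
  moreover have "\<iota> \<in> rhom \<Lambda> M N" by (auto simp: rhom_def N_def)
  moreover have "bij_betw \<iota> (carrier M) (carrier N)"
    using inj by (auto simp: bij_betw_def N_def)
  ultimately show ?thesis by blast
qed

lemma fin_gen_epi:
  assumes "right_module \<Lambda> M" "right_module \<Lambda> N" and fg: "fin_gen \<Lambda> M"
    and f: "f \<in> rhom \<Lambda> M N" and surj: "f ` carrier M = carrier N"
  shows "fin_gen \<Lambda> N"
proof -
  interpret M: right_module \<Lambda> M by fact
  interpret N: right_module \<Lambda> N by fact
  obtain S where S: "finite S" "S \<subseteq> carrier M"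
    "\<And>U. rsubmodule \<Lambda> M U \<Longrightarrow> S \<subseteq> U \<Longrightarrow> U = carrier M"
    using fg by (auto simp: fin_gen_def)
  have f': "f x \<in> carrier N" "f (x \<oplus>\<^bsub>M\<^esub> y) = f x \<oplus>\<^bsub>N\<^esub> f y" "a \<in> carrier \<Lambda> \<Longrightarrow> f (x \<triangleleft>\<^bsub>M\<^esub> a) = f x \<triangleleft>\<^bsub>N\<^esub> a"
    if "x \<in> carrier M" "y \<in> carrier M" for x y a
    using f that by (auto simp: rhom_def)
  have f0: "f \<zero>\<^bsub>M\<^esub> = \<zero>\<^bsub>N\<^esub>"
    using f'(2)[of "\<zero>\<^bsub>M\<^esub>" "\<zero>\<^bsub>M\<^esub>"] f'(1)[of "\<zero>\<^bsub>M\<^esub>" "\<zero>\<^bsub>M\<^esub>"]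
      N.M.add.l_cancel_one[of "f \<zero>\<^bsub>M\<^esub>" "f \<zero>\<^bsub>M\<^esub>"] by simp
  have "U = carrier N" if U: "rsubmodule \<Lambda> N U" "f ` S \<subseteq> U" for U
  proof -
    have sg: "subgroup U (add_monoid N)" using U(1) by (simp add: rsubmodule_def)
    have "rsubmodule \<Lambda> M {x \<in> carrier M. f x \<in> U}"
      using U(1) subgroup.one_closed[OF sg] subgroup.m_closed[OF sg]
      by (intro rsubmoduleI M.right_module_axioms) (auto simp: f' f0 rsubmodule_def)
    from S(3)[OF this] have "carrier M = {x \<in> carrier M. f x \<in> U}"
      using U(2) S(2) by blast
    then have "f ` carrier M \<subseteq> U" by blast
    then have "carrier N \<subseteq> U" by (simp add: surj)
    then show ?thesis using subgroup.subset[OF sg] by auto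
  qed
  then show ?thesis using S(1,2) surj by (auto simp: fin_gen_def intro!: exI[of _ "f ` S"])
qed

lemma fg_mods_universe:
  fixes M :: "('a, 'm) rmodule"
  assumes "M \<in> fg_mods \<Lambda>"
  shows "\<exists>N :: 'a fgmod. N \<in> fg_mods \<Lambda> \<and> riso \<Lambda> M N"
proof -
  interpret right_module \<Lambda> M using assms by (simp add: fg_mods_def)
  obtain S where S: "finite S" "S \<subseteq> carrier M"
    "\<And>U. rsubmodule \<Lambda> M U \<Longrightarrow> S \<subseteq> U \<Longrightarrow> U = carrier M"
    using assms by (auto simp: fg_mods_def fin_gen_def)
  obtain m :: "nat \<Rightarrow> 'm" and n where m: "S = m ` {..<n}"
    using S(1) finite_imp_nat_seg_image_inj_on[of S] by (auto simp: lessThan_def)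
  have mc: "m i \<in> carrier M" if "i < n" for i using S(2) m that by auto
  define c where "c v = finsum M (\<lambda>i. m i \<triangleleft>\<^bsub>M\<^esub> v i) {..<n}" for v
  define V where "V = {..<n} \<rightarrow> carrier \<Lambda>"
  have c0: "x \<triangleleft>\<^bsub>M\<^esub> \<zero>\<^bsub>\<Lambda>\<^esub> = \<zero>\<^bsub>M\<^esub>" if "x \<in> carrier M" for x
    using ract_r_distr[OF that, of "\<zero>\<^bsub>\<Lambda>\<^esub>" "\<zero>\<^bsub>\<Lambda>\<^esub>"] that
      M.add.l_cancel_one[of "x \<triangleleft>\<^bsub>M\<^esub> \<zero>\<^bsub>\<Lambda>\<^esub>" "x \<triangleleft>\<^bsub>M\<^esub> \<zero>\<^bsub>\<Lambda>\<^esub>"] by simp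
  have c0': "\<zero>\<^bsub>M\<^esub> \<triangleleft>\<^bsub>M\<^esub> a = \<zero>\<^bsub>M\<^esub>" if "a \<in> carrier \<Lambda>" for a
    using ract_l_distr[of "\<zero>\<^bsub>M\<^esub>" "\<zero>\<^bsub>M\<^esub>", OF _ _ that] that
      M.add.l_cancel_one[of "\<zero>\<^bsub>M\<^esub> \<triangleleft>\<^bsub>M\<^esub> a" "\<zero>\<^bsub>M\<^esub> \<triangleleft>\<^bsub>M\<^esub> a"] by simp
  have c_closed: "c v \<in> carrier M" if "v \<in> V" for v
    unfolding c_def using that mc by (intro M.finsum_closed) (auto simp: V_def Pi_iff)
  have c_add: "c v \<oplus>\<^bsub>M\<^esub> c w = c (\<lambda>i. v i \<oplus>\<^bsub>\<Lambda>\<^esub> w i)" if "v \<in> V" "w \<in> V" for v w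
  proof -
    have "c (\<lambda>i. v i \<oplus>\<^bsub>\<Lambda>\<^esub> w i) = finsum M (\<lambda>i. m i \<triangleleft>\<^bsub>M\<^esub> v i \<oplus>\<^bsub>M\<^esub> m i \<triangleleft>\<^bsub>M\<^esub> w i) {..<n}"
      unfolding c_def using that mc
      by (intro M.finsum_cong') (auto simp: V_def Pi_iff ract_r_distr)
    also have "\<dots> = c v \<oplus>\<^bsub>M\<^esub> c w"
      unfolding c_def using that mc by (intro M.finsum_addf) (auto simp: V_def Pi_iff)
    finally show ?thesis by simp
  qed
  have act_sum: "finsum M g A \<triangleleft>\<^bsub>M\<^esub> a = finsum M (\<lambda>i. g i \<triangleleft>\<^bsub>M\<^esub> a) A"
    if "finite A" "g \<in> A \<rightarrow> carrier M" "a \<in> carrier \<Lambda>" for g a and A :: "nat set"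
    using that
  proof (induction A rule: finite_induct)
    case empty then show ?case by (simp add: c0')
  next
    case (insert i A)
    then have "(\<lambda>i. g i \<triangleleft>\<^bsub>M\<^esub> a) \<in> A \<rightarrow> carrier M" "g \<in> A \<rightarrow> carrier M" "g i \<in> carrier M"
      by (auto simp: Pi_iff)
    with insert show ?case by (simp add: M.finsum_insert ract_l_distr)
  qed
  have c_act: "c v \<triangleleft>\<^bsub>M\<^esub> a = c (\<lambda>i. v i \<otimes>\<^bsub>\<Lambda>\<^esub> a)" if "v \<in> V" "a \<in> carrier \<Lambda>" for v a
  proof -
    have "c v \<triangleleft>\<^bsub>M\<^esub> a = finsum M (\<lambda>i. (m i \<triangleleft>\<^bsub>M\<^esub> v i) \<triangleleft>\<^bsub>M\<^esub> a) {..<n}"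
      unfolding c_def using that mc by (intro act_sum) (auto simp: V_def Pi_iff)
    also have "\<dots> = c (\<lambda>i. v i \<otimes>\<^bsub>\<Lambda>\<^esub> a)"
      unfolding c_def using that mc
      by (intro M.finsum_cong') (auto simp: V_def Pi_iff ract_assoc)
    finally show ?thesis .
  qed
  have "rsubmodule \<Lambda> M (c ` V)"
  proof (rule rsubmoduleI)
    have "c (\<lambda>_. \<zero>\<^bsub>\<Lambda>\<^esub>) = finsum M (\<lambda>i. \<zero>\<^bsub>M\<^esub>) {..<n}"
      unfolding c_def by (intro M.finsum_cong') (auto simp: c0 mc)
    then show "\<zero>\<^bsub>M\<^esub> \<in> c ` V" by (auto simp: V_def image_iff intro!: bexI[of _ "\<lambda>_. \<zero>\<^bsub>\<Lambda>\<^esub>"])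
  qed (auto simp: c_closed c_add c_act right_module_axioms V_def Pi_iff intro!: imageI)
  moreover have "S \<subseteq> c ` V"
  proof
    fix x assume "x \<in> S"
    then obtain j where j: "j < n" "x = m j" using m by auto
    have "c (\<lambda>i. if i = j then \<one>\<^bsub>\<Lambda>\<^esub> else \<zero>\<^bsub>\<Lambda>\<^esub>) = finsum M (\<lambda>i. if j = i then m i else \<zero>\<^bsub>M\<^esub>) {..<n}"
      unfolding c_def using mc by (intro M.finsum_cong') (auto simp: c0)
    also have "\<dots> = m j" using j mc by (intro M.add.finprod_singleton) auto
    finally show "x \<in> c ` V"
      using j by (intro image_eqI[of _ _ "\<lambda>i. if i = j then \<one>\<^bsub>\<Lambda>\<^esub> else \<zero>\<^bsub>\<Lambda>\<^esub>"]) (auto simp: V_def)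
  qed
  ultimately have cV: "c ` V = carrier M" by (rule S(3))
  define \<iota> where "\<iota> x = {v \<in> V. c v = x}" for x
  have "inj_on \<iota> (carrier M)"
  proof (rule inj_onI)
    fix x y assume "x \<in> carrier M" "y \<in> carrier M" and eq: "\<iota> x = \<iota> y"
    then have "x \<in> c ` V" by (simp add: cV)
    then obtain v where "v \<in> V" "c v = x" by blast
    then show "x = y" using eq by (auto simp: \<iota>_def)
  qed
  from right_module_transport[OF right_module_axioms this] obtain N
    where N: "right_module \<Lambda> N" "\<iota> \<in> rhom \<Lambda> M N" "bij_betw \<iota> (carrier M) (carrier N)" by blast
  have "fin_gen \<Lambda> N"
    using fin_gen_epi[OF right_module_axioms N(1) _ N(2)] N(3) assms
    by (auto simp: fg_mods_def bij_betw_def)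
  then show ?thesis using N by (auto simp: fg_mods_def riso_def)
qed

section \<open>Subcategories\<close>

text \<open>
  A full subcategory is given by its class of objects. Additivity is closure under finite direct
  sums, the empty one included.
\<close>

definition subcategory :: "('a, 'k) ring_scheme \<Rightarrow> 'a fgmod set \<Rightarrow> bool"
  where "subcategory \<Lambda> C \<longleftrightarrow>
    C \<subseteq> fg_mods \<Lambda> \<and>
    (\<forall>M\<in>C. \<forall>N\<in>fg_mods \<Lambda>. riso \<Lambda> M N \<longrightarrow> N \<in> C) \<and>
    (\<forall>Z\<in>fg_mods \<Lambda>. carrier Z = {\<zero>\<^bsub>Z\<^esub>} \<longrightarrow> Z \<in> C) \<and>
    (\<forall>M\<in>C. \<forall>N\<in>C. \<forall>D\<in>fg_mods \<Lambda>. riso \<Lambda> (dsum M N) D \<longrightarrow> D \<in> C)"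

definition ext_closed :: "('a, 'k) ring_scheme \<Rightarrow> 'a fgmod set \<Rightarrow> bool"
  where "ext_closed \<Lambda> C \<longleftrightarrow>
    (\<forall>L\<in>C. \<forall>N\<in>C. \<forall>M\<in>fg_mods \<Lambda>. \<forall>f g. short_exact \<Lambda> L f M g N \<longrightarrow> M \<in> C)"

definition image_closed :: "('a, 'k) ring_scheme \<Rightarrow> 'a fgmod set \<Rightarrow> bool"
  where "image_closed \<Lambda> C \<longleftrightarrow>
    (\<forall>C1\<in>C. \<forall>C2\<in>C. \<forall>\<phi>\<in>rhom \<Lambda> C1 C2. im_mod C1 C2 \<phi> \<in> C)"

text \<open>Quotients of \<open>M\<close> are taken up to isomorphism, that is, as targets of epimorphisms from \<open>M\<close>.\<close>

definition quotient_closed :: "('a, 'k) ring_scheme \<Rightarrow> 'a fgmod set \<Rightarrow> bool"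
  where "quotient_closed \<Lambda> C \<longleftrightarrow>
    (\<forall>M\<in>C. \<forall>N\<in>fg_mods \<Lambda>. \<forall>\<pi>\<in>rhom \<Lambda> M N. \<pi> ` carrier M = carrier N \<longrightarrow> N \<in> C)"

definition IE_closed :: "('a, 'k) ring_scheme \<Rightarrow> 'a fgmod set \<Rightarrow> bool"
  where "IE_closed \<Lambda> C \<longleftrightarrow> subcategory \<Lambda> C \<and> image_closed \<Lambda> C \<and> ext_closed \<Lambda> C"

definition torsion_class :: "('a, 'k) ring_scheme \<Rightarrow> 'a fgmod set \<Rightarrow> bool"
  where "torsion_class \<Lambda> T \<longleftrightarrow> subcategory \<Lambda> T \<and> ext_closed \<Lambda> T \<and> quotient_closed \<Lambda> T"

definition tau_tilting_finite :: "('a, 'k) ring_scheme \<Rightarrow> bool"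
  where "tau_tilting_finite \<Lambda> \<longleftrightarrow> finite {T. torsion_class \<Lambda> T}"

section \<open>Approximations\<close>

definition left_approx ::
  "('a, 'k) ring_scheme \<Rightarrow> 'a fgmod set \<Rightarrow> 'a fgmod \<Rightarrow> 'a fgmod \<Rightarrow>
    ((nat \<Rightarrow> 'a) set \<Rightarrow> (nat \<Rightarrow> 'a) set) \<Rightarrow> bool"
  where "left_approx \<Lambda> C M X f \<longleftrightarrow>
    X \<in> C \<and> f \<in> rhom \<Lambda> M X \<and>
    (\<forall>Y\<in>C. \<forall>g\<in>rhom \<Lambda> M Y. \<exists>h\<in>rhom \<Lambda> X Y. \<forall>x\<in>carrier M. g x = h (f x))"

definition right_approx ::
  "('a, 'k) ring_scheme \<Rightarrow> 'a fgmod set \<Rightarrow> 'a fgmod \<Rightarrow> 'a fgmod \<Rightarrow>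
    ((nat \<Rightarrow> 'a) set \<Rightarrow> (nat \<Rightarrow> 'a) set) \<Rightarrow> bool"
  where "right_approx \<Lambda> C M X f \<longleftrightarrow>
    X \<in> C \<and> f \<in> rhom \<Lambda> X M \<and>
    (\<forall>Y\<in>C. \<forall>g\<in>rhom \<Lambda> Y M. \<exists>h\<in>rhom \<Lambda> Y X. \<forall>y\<in>carrier Y. g y = f (h y))"

definition covariantly_finite :: "('a, 'k) ring_scheme \<Rightarrow> 'a fgmod set \<Rightarrow> bool"
  where "covariantly_finite \<Lambda> C \<longleftrightarrow> (\<forall>M\<in>fg_mods \<Lambda>. \<exists>X f. left_approx \<Lambda> C M X f)"

definition contravariantly_finite :: "('a, 'k) ring_scheme \<Rightarrow> 'a fgmod set \<Rightarrow> bool"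
  where "contravariantly_finite \<Lambda> C \<longleftrightarrow> (\<forall>M\<in>fg_mods \<Lambda>. \<exists>X f. right_approx \<Lambda> C M X f)"

definition functorially_finite :: "('a, 'k) ring_scheme \<Rightarrow> 'a fgmod set \<Rightarrow> bool"
  where "functorially_finite \<Lambda> C \<longleftrightarrow> covariantly_finite \<Lambda> C \<and> contravariantly_finite \<Lambda> C"

end

theory Submission
  imports Defs
begin

text \<open>
  An IE-closed subcategory \<open>C\<close> is the intersection of the torsion class \<open>lperp (rperp C)\<close> and the
  torsion-free class \<open>rperp (lperp C)\<close>, so there are finitely many of them if there are finitely many
  torsion classes, and approximations by \<open>C\<close> are obtained from approximations by the two classes.

  If there are finitely many torsion classes, one descends from \<open>mod \<Lambda>\<close> along covers. When \<open>U\<close> is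
  covariantly finite and \<open>T\<close> is a lower cover of \<open>U\<close>, the class \<open>T\<close> is generated by the relative
  projectives of \<open>U\<close> lying in \<open>T\<close>, hence is covariantly finite. The torsion-free class \<open>rperp U\<close> is
  contravariantly finite whenever \<open>U\<close> is covariantly finite: the maps \<open>X \<rightarrow> M\<close> with \<open>X\<close> torsion-free
  whose kernel contains no nonzero \<open>V\<close> with \<open>X/V\<close> torsion-free have bounded length, and one of
  maximal length is an approximation.

  Conversely, a covariantly finite torsion class has only finitely many lower covers. If all torsion
  classes are covariantly finite and there are infinitely many of them, Koenig's lemma yields a
  strictly descending chain \<open>U n\<close>. The union of the classes \<open>rperp (U n)\<close> is IE-closed, but a module
  \<open>Y\<close> receiving a nonzero map from every nonzero module has no right approximation in it: such an
  approximation lies in some \<open>rperp (U n)\<close>, so it cannot factor the nonzero maps to \<open>Y\<close> from a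
  nonzero module in \<open>U n \<inter> rperp (U (n + 1))\<close>.
\<close>

section \<open>Submodules, quotients and homomorphisms\<close>

text \<open>Two steps named above are not formal. That relative projectives generate a lower cover
  \<open>T\<close> does not yet make \<open>T\<close> covariantly finite, because one module has to
  reach all of \<open>T\<close> at once. The finiteness assumption enters here a second time: each
  relative projective of \<open>U\<close> in \<open>T\<close>, together with an element, reaches a
  torsion class, and among the finitely many classes obtained in this way there is a largest one.
  The bound on the maps to \<open>M\<close> rests on a connecting homomorphism. If \<open>K\<close>
  is the kernel of \<open>X -> M\<close> and \<open>P\<close> carries a universal element of
  \<open>U\<close>, the vanishing of Hom(P, X) embeds Hom(P, X/K) into Ext^1(P, K). The length of
  this piece is bounded in terms of \<open>P\<close> and \<open>M\<close>, and the length of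
  \<open>R\<close> limits how long \<open>K\<close> can be before it contains a part that the piece
  does not detect; such a part could be divided out. Lengths are taken over \<open>R\<close>
  throughout the second half, since Hom-groups and sets of values of maps are in general only
  \<open>R\<close>-submodules.\<close>

definition sub :: "('a, 'm) rmodule \<Rightarrow> 'm set \<Rightarrow> ('a, 'm) rmodule"
  where "sub M U = M\<lparr>carrier := U\<rparr>"

lemma sub_simps [simp]:
  "carrier (sub M U) = U" "\<zero>\<^bsub>sub M U\<^esub> = \<zero>\<^bsub>M\<^esub>" "x \<oplus>\<^bsub>sub M U\<^esub> y = x \<oplus>\<^bsub>M\<^esub> y" "x \<triangleleft>\<^bsub>sub M U\<^esub> a = x \<triangleleft>\<^bsub>M\<^esub> a"
  by (simp_all add: sub_def)

text \<open>Only the carrier is changed, so a submodule of a submodule is literally a submodule of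
  \<open>M\<close> and every inclusion is the identity function. Submodules can thus be compared
  inside one ambient module without transport along isomorphisms.\<close>

lemma sub_sub [simp]: "sub (sub M U) V = sub M V"
  by (simp add: sub_def)

lemma sub_carrier [simp]: "sub M (carrier M) = M"
  by (simp add: sub_def)

lemma im_mod_eq: "im_mod M N f = sub N (f ` carrier M)"
  by (simp add: im_mod_def sub_def)

context right_module
begin

lemma zero_ract [simp]: "a \<in> carrier \<Lambda> \<Longrightarrow> \<zero>\<^bsub>M\<^esub> \<triangleleft>\<^bsub>M\<^esub> a = \<zero>\<^bsub>M\<^esub>"
  using ract_l_distr[of "\<zero>\<^bsub>M\<^esub>" "\<zero>\<^bsub>M\<^esub>" a] M.add.l_cancel_one[of "\<zero>\<^bsub>M\<^esub> \<triangleleft>\<^bsub>M\<^esub> a" "\<zero>\<^bsub>M\<^esub> \<triangleleft>\<^bsub>M\<^esub> a"] by simp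

lemma ract_zero [simp]: "x \<in> carrier M \<Longrightarrow> x \<triangleleft>\<^bsub>M\<^esub> \<zero>\<^bsub>\<Lambda>\<^esub> = \<zero>\<^bsub>M\<^esub>"
  using ract_r_distr[of x "\<zero>\<^bsub>\<Lambda>\<^esub>" "\<zero>\<^bsub>\<Lambda>\<^esub>"] M.add.l_cancel_one[of "x \<triangleleft>\<^bsub>M\<^esub> \<zero>\<^bsub>\<Lambda>\<^esub>" "x \<triangleleft>\<^bsub>M\<^esub> \<zero>\<^bsub>\<Lambda>\<^esub>"] by simp

lemma neg_zero: "\<ominus>\<^bsub>M\<^esub> \<zero>\<^bsub>M\<^esub> = \<zero>\<^bsub>M\<^esub>"
  by (rule M.minus_equality) simp_all

lemma neg_ract: "x \<in> carrier M \<Longrightarrow> a \<in> carrier \<Lambda> \<Longrightarrow> (\<ominus>\<^bsub>M\<^esub> x) \<triangleleft>\<^bsub>M\<^esub> a = \<ominus>\<^bsub>M\<^esub> (x \<triangleleft>\<^bsub>M\<^esub> a)"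
  by (rule M.minus_equality[symmetric]) (simp_all add: ract_l_distr[symmetric] M.l_neg)

lemma minus_ract: "x \<in> carrier M \<Longrightarrow> y \<in> carrier M \<Longrightarrow> a \<in> carrier \<Lambda> \<Longrightarrow>
    (x \<ominus>\<^bsub>M\<^esub> y) \<triangleleft>\<^bsub>M\<^esub> a = x \<triangleleft>\<^bsub>M\<^esub> a \<ominus>\<^bsub>M\<^esub> y \<triangleleft>\<^bsub>M\<^esub> a"
  by (simp add: a_minus_def ract_l_distr neg_ract)

lemma minus_zero_iff: "x \<in> carrier M \<Longrightarrow> y \<in> carrier M \<Longrightarrow> x \<ominus>\<^bsub>M\<^esub> y = \<zero>\<^bsub>M\<^esub> \<longleftrightarrow> x = y"
  by (metis M.add.inv_closed M.minus_equality M.minus_minus M.r_neg a_minus_def)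

lemma minus_add_cancel: "x \<in> carrier M \<Longrightarrow> y \<in> carrier M \<Longrightarrow> (x \<ominus>\<^bsub>M\<^esub> y) \<oplus>\<^bsub>M\<^esub> y = x"
  by (simp add: a_minus_def M.a_assoc M.l_neg)

lemma add_minus_cancel: "x \<in> carrier M \<Longrightarrow> y \<in> carrier M \<Longrightarrow> (x \<oplus>\<^bsub>M\<^esub> y) \<ominus>\<^bsub>M\<^esub> y = x"
  by (simp add: a_minus_def M.a_assoc M.r_neg)

lemma neg_diff: "x \<in> carrier M \<Longrightarrow> y \<in> carrier M \<Longrightarrow> \<ominus>\<^bsub>M\<^esub> (x \<ominus>\<^bsub>M\<^esub> y) = y \<ominus>\<^bsub>M\<^esub> x"
  by (simp add: a_minus_def M.minus_add M.a_comm)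

lemma diff_add_diff: "x \<in> carrier M \<Longrightarrow> y \<in> carrier M \<Longrightarrow> z \<in> carrier M \<Longrightarrow>
    (x \<ominus>\<^bsub>M\<^esub> y) \<oplus>\<^bsub>M\<^esub> (y \<ominus>\<^bsub>M\<^esub> z) = x \<ominus>\<^bsub>M\<^esub> z"
  by (simp add: a_minus_def M.a_assoc M.r_neg1)

lemma diff_diff_diff: "x \<in> carrier M \<Longrightarrow> y \<in> carrier M \<Longrightarrow> z \<in> carrier M \<Longrightarrow>
    (x \<ominus>\<^bsub>M\<^esub> z) \<ominus>\<^bsub>M\<^esub> (y \<ominus>\<^bsub>M\<^esub> z) = x \<ominus>\<^bsub>M\<^esub> y"
  using diff_add_diff[of x z y] by (simp add: a_minus_def[of M "x \<ominus>\<^bsub>M\<^esub> z"] neg_diff)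

lemma add_diff_add:
  assumes "x \<in> carrier M" "y \<in> carrier M" "z \<in> carrier M" "w \<in> carrier M"
  shows "(x \<oplus>\<^bsub>M\<^esub> y) \<ominus>\<^bsub>M\<^esub> (z \<oplus>\<^bsub>M\<^esub> w) = (x \<ominus>\<^bsub>M\<^esub> z) \<oplus>\<^bsub>M\<^esub> (y \<ominus>\<^bsub>M\<^esub> w)"
  using assms by (simp add: a_minus_def M.minus_add M.a_ac)

lemma rsubD:
  assumes "rsubmodule \<Lambda> M U"
  shows "U \<subseteq> carrier M" "x \<in> U \<Longrightarrow> x \<in> carrier M" "\<zero>\<^bsub>M\<^esub> \<in> U"
    "x \<in> U \<Longrightarrow> y \<in> U \<Longrightarrow> x \<oplus>\<^bsub>M\<^esub> y \<in> U" "x \<in> U \<Longrightarrow> \<ominus>\<^bsub>M\<^esub> x \<in> U"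
    "x \<in> U \<Longrightarrow> y \<in> U \<Longrightarrow> x \<ominus>\<^bsub>M\<^esub> y \<in> U" "x \<in> U \<Longrightarrow> a \<in> carrier \<Lambda> \<Longrightarrow> x \<triangleleft>\<^bsub>M\<^esub> a \<in> U"
proof -
  have s: "subgroup U (add_monoid M)" using assms by (simp add: rsubmodule_def)
  show 1: "U \<subseteq> carrier M" using subgroup.subset[OF s] by simp
  show "x \<in> U \<Longrightarrow> x \<in> carrier M" using 1 by auto
  show "\<zero>\<^bsub>M\<^esub> \<in> U" using subgroup.one_closed[OF s] by simp
  show 2: "x \<in> U \<Longrightarrow> y \<in> U \<Longrightarrow> x \<oplus>\<^bsub>M\<^esub> y \<in> U" for x y using subgroup.m_closed[OF s] by simp
  show 3: "x \<in> U \<Longrightarrow> \<ominus>\<^bsub>M\<^esub> x \<in> U" for x using subgroup.m_inv_closed[OF s] by (simp add: a_inv_def)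
  show "x \<in> U \<Longrightarrow> y \<in> U \<Longrightarrow> x \<ominus>\<^bsub>M\<^esub> y \<in> U" using 2 3 by (simp add: a_minus_def)
  show "x \<in> U \<Longrightarrow> a \<in> carrier \<Lambda> \<Longrightarrow> x \<triangleleft>\<^bsub>M\<^esub> a \<in> U" using assms by (simp add: rsubmodule_def)
qed

lemma rsubI:
  assumes "U \<subseteq> carrier M" "\<zero>\<^bsub>M\<^esub> \<in> U" "\<And>x y. x \<in> U \<Longrightarrow> y \<in> U \<Longrightarrow> x \<oplus>\<^bsub>M\<^esub> y \<in> U"
    "\<And>x a. x \<in> U \<Longrightarrow> a \<in> carrier \<Lambda> \<Longrightarrow> x \<triangleleft>\<^bsub>M\<^esub> a \<in> U"
  shows "rsubmodule \<Lambda> M U"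
  by (rule rsubmoduleI[OF right_module_axioms assms])

lemma rsub_carrier: "rsubmodule \<Lambda> M (carrier M)"
  by (rule rsubI) auto

lemma rsub_zero: "rsubmodule \<Lambda> M {\<zero>\<^bsub>M\<^esub>}"
  by (rule rsubI) auto

lemma rsub_Int: "rsubmodule \<Lambda> M U \<Longrightarrow> rsubmodule \<Lambda> M V \<Longrightarrow> rsubmodule \<Lambda> M (U \<inter> V)"
  by (rule rsubI) (auto simp: rsubD)

lemma rsub_Inter: "(\<And>U. U \<in> \<U> \<Longrightarrow> rsubmodule \<Lambda> M U) \<Longrightarrow> \<U> \<noteq> {} \<Longrightarrow> rsubmodule \<Lambda> M (\<Inter>\<U>)"
  by (rule rsubI) (auto dest: rsubD)

lemma rsub_cyclic: "x \<in> carrier M \<Longrightarrow> rsubmodule \<Lambda> M ((\<lambda>a. x \<triangleleft>\<^bsub>M\<^esub> a) ` carrier \<Lambda>)"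
proof (rule rsubI)
  assume x: "x \<in> carrier M"
  show "\<zero>\<^bsub>M\<^esub> \<in> (\<lambda>a. x \<triangleleft>\<^bsub>M\<^esub> a) ` carrier \<Lambda>" using x by (force simp: image_iff)
qed (auto simp: ract_r_distr[symmetric] ract_assoc[symmetric])

definition msum :: "'m set \<Rightarrow> 'm set \<Rightarrow> 'm set"
  where "msum U V = {u \<oplus>\<^bsub>M\<^esub> v | u v. u \<in> U \<and> v \<in> V}"

lemma rsub_msum:
  assumes "rsubmodule \<Lambda> M U" "rsubmodule \<Lambda> M V"
  shows "rsubmodule \<Lambda> M (msum U V)" "U \<subseteq> msum U V" "V \<subseteq> msum U V"
proof -
  note [simp] = rsubD[OF assms(1)] rsubD[OF assms(2)]
  show "rsubmodule \<Lambda> M (msum U V)"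
  proof (rule rsubI)
    show "\<zero>\<^bsub>M\<^esub> \<in> msum U V" by (auto simp: msum_def intro!: exI[of _ "\<zero>\<^bsub>M\<^esub>"])
    fix x y assume "x \<in> msum U V" "y \<in> msum U V"
    then obtain u v u' v' where uv: "x = u \<oplus>\<^bsub>M\<^esub> v" "y = u' \<oplus>\<^bsub>M\<^esub> v'" "u \<in> U" "v \<in> V" "u' \<in> U" "v' \<in> V"
      by (auto simp: msum_def)
    then have "x \<oplus>\<^bsub>M\<^esub> y = (u \<oplus>\<^bsub>M\<^esub> u') \<oplus>\<^bsub>M\<^esub> (v \<oplus>\<^bsub>M\<^esub> v')"
      by (simp add: M.a_ac)
    moreover have "u \<oplus>\<^bsub>M\<^esub> u' \<in> U" "v \<oplus>\<^bsub>M\<^esub> v' \<in> V" using uv by auto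
    ultimately show "x \<oplus>\<^bsub>M\<^esub> y \<in> msum U V" unfolding msum_def by blast
  next
    fix x a assume "x \<in> msum U V" and a: "a \<in> carrier \<Lambda>"
    then obtain u v where uv: "x = u \<oplus>\<^bsub>M\<^esub> v" "u \<in> U" "v \<in> V" by (auto simp: msum_def)
    then have "x \<triangleleft>\<^bsub>M\<^esub> a = u \<triangleleft>\<^bsub>M\<^esub> a \<oplus>\<^bsub>M\<^esub> v \<triangleleft>\<^bsub>M\<^esub> a" using a by (simp add: ract_l_distr)
    moreover have "u \<triangleleft>\<^bsub>M\<^esub> a \<in> U" "v \<triangleleft>\<^bsub>M\<^esub> a \<in> V" using uv a by auto
    ultimately show "x \<triangleleft>\<^bsub>M\<^esub> a \<in> msum U V" unfolding msum_def by blast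
  qed (auto simp: msum_def)
  show "U \<subseteq> msum U V"
  proof
    fix u assume "u \<in> U"
    then have "u = u \<oplus>\<^bsub>M\<^esub> \<zero>\<^bsub>M\<^esub>" "u \<in> U" "\<zero>\<^bsub>M\<^esub> \<in> V" by auto
    then show "u \<in> msum U V" unfolding msum_def by blast
  qed
  show "V \<subseteq> msum U V"
  proof
    fix v assume "v \<in> V"
    then have "v = \<zero>\<^bsub>M\<^esub> \<oplus>\<^bsub>M\<^esub> v" "v \<in> V" "\<zero>\<^bsub>M\<^esub> \<in> U" by auto
    then show "v \<in> msum U V" unfolding msum_def by blast
  qed
qed

lemma right_module_sub:
  assumes "rsubmodule \<Lambda> M U"
  shows "right_module \<Lambda> (sub M U)"
proof -
  note [simp] = rsubD[OF assms]
  have "abelian_group (sub M U)"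
  proof (rule abelian_groupI)
    fix x assume "x \<in> carrier (sub M U)"
    then show "\<exists>y\<in>carrier (sub M U). y \<oplus>\<^bsub>sub M U\<^esub> x = \<zero>\<^bsub>sub M U\<^esub>"
      by (intro bexI[of _ "\<ominus>\<^bsub>M\<^esub> x"]) (auto simp: M.l_neg)
  qed (auto simp: M.a_ac)
  then show ?thesis
    by (intro right_module.intro right_module_axioms.intro \<Lambda>.ring_axioms)
      (auto simp: ract_l_distr ract_r_distr ract_assoc)
qed

lemma rsub_sub:
  assumes "rsubmodule \<Lambda> M U"
  shows "rsubmodule \<Lambda> (sub M U) V \<longleftrightarrow> rsubmodule \<Lambda> M V \<and> V \<subseteq> U"
proof -
  interpret S: right_module \<Lambda> "sub M U" by (rule right_module_sub[OF assms(1)])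
  show ?thesis
  proof safe
    assume V: "rsubmodule \<Lambda> (sub M U) V"
    show "rsubmodule \<Lambda> M V"
      by (rule rsubI) (use S.rsubD[OF V] rsubD(1)[OF assms] in auto)
    show "x \<in> V \<Longrightarrow> x \<in> U" for x using S.rsubD[OF V] by auto
  next
    assume V: "rsubmodule \<Lambda> M V" "V \<subseteq> U"
    show "rsubmodule \<Lambda> (sub M U) V"
      by (rule S.rsubI) (use rsubD[OF V(1)] V in auto)
  qed
qed

end

section \<open>Homomorphisms, kernels and factorization through surjections\<close>

lemma rhomI:
  assumes "\<And>x. x \<in> carrier M \<Longrightarrow> f x \<in> carrier N"
    "\<And>x y. x \<in> carrier M \<Longrightarrow> y \<in> carrier M \<Longrightarrow> f (x \<oplus>\<^bsub>M\<^esub> y) = f x \<oplus>\<^bsub>N\<^esub> f y"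
    "\<And>x a. x \<in> carrier M \<Longrightarrow> a \<in> carrier \<Lambda> \<Longrightarrow> f (x \<triangleleft>\<^bsub>M\<^esub> a) = f x \<triangleleft>\<^bsub>N\<^esub> a"
  shows "f \<in> rhom \<Lambda> M N"
  using assms by (auto simp: rhom_def)

lemma rhomD:
  assumes "f \<in> rhom \<Lambda> M N" "x \<in> carrier M"
  shows "f x \<in> carrier N" "y \<in> carrier M \<Longrightarrow> f (x \<oplus>\<^bsub>M\<^esub> y) = f x \<oplus>\<^bsub>N\<^esub> f y"
    "a \<in> carrier \<Lambda> \<Longrightarrow> f (x \<triangleleft>\<^bsub>M\<^esub> a) = f x \<triangleleft>\<^bsub>N\<^esub> a"
  using assms by (auto simp: rhom_def)

lemma rhom_comp: "f \<in> rhom \<Lambda> M N \<Longrightarrow> g \<in> rhom \<Lambda> N L \<Longrightarrow> (\<lambda>x. g (f x)) \<in> rhom \<Lambda> M L"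
  by (rule rhomI) (auto simp: rhomD)

lemma rhom_id [simp]: "(\<lambda>x. x) \<in> rhom \<Lambda> M M"
  by (rule rhomI) auto

lemma rhom_incl: "V \<subseteq> U \<Longrightarrow> (\<lambda>x. x) \<in> rhom \<Lambda> (sub M V) (sub M U)"
  by (rule rhomI) auto

lemma rhom_incl': "V \<subseteq> carrier M \<Longrightarrow> (\<lambda>x. x) \<in> rhom \<Lambda> (sub M V) M"
  by (rule rhomI) auto

lemma rhom_restrict: "f \<in> rhom \<Lambda> M N \<Longrightarrow> U \<subseteq> carrier M \<Longrightarrow> f \<in> rhom \<Lambda> (sub M U) N"
  by (rule rhomI) (auto simp: rhomD subset_iff)

lemma rhom_corestrict: "f \<in> rhom \<Lambda> M N \<Longrightarrow> f ` carrier M \<subseteq> V \<Longrightarrow> f \<in> rhom \<Lambda> M (sub N V)"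
  by (rule rhomI) (auto simp: rhomD subset_iff)

lemma rhom_into_sub: "f \<in> rhom \<Lambda> M (sub N V) \<Longrightarrow> V \<subseteq> carrier N \<Longrightarrow> f \<in> rhom \<Lambda> M N"
  using rhomD[of f \<Lambda> M "sub N V"] by (intro rhomI) auto

lemma rhom_zero:
  assumes "right_module \<Lambda> M" "right_module \<Lambda> N" "f \<in> rhom \<Lambda> M N"
  shows "f \<zero>\<^bsub>M\<^esub> = \<zero>\<^bsub>N\<^esub>"
proof -
  interpret M: right_module \<Lambda> M by fact
  interpret N: right_module \<Lambda> N by fact
  show ?thesis
    using rhomD(2)[OF assms(3), of "\<zero>\<^bsub>M\<^esub>" "\<zero>\<^bsub>M\<^esub>"] rhomD(1)[OF assms(3), of "\<zero>\<^bsub>M\<^esub>"]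
      N.M.add.l_cancel_one[of "f \<zero>\<^bsub>M\<^esub>" "f \<zero>\<^bsub>M\<^esub>"] by simp
qed

lemma rhom_minus:
  assumes "right_module \<Lambda> M" "right_module \<Lambda> N" "f \<in> rhom \<Lambda> M N" "x \<in> carrier M"
  shows "f (\<ominus>\<^bsub>M\<^esub> x) = \<ominus>\<^bsub>N\<^esub> f x" "y \<in> carrier M \<Longrightarrow> f (y \<ominus>\<^bsub>M\<^esub> x) = f y \<ominus>\<^bsub>N\<^esub> f x"
proof -
  interpret M: right_module \<Lambda> M by fact
  interpret N: right_module \<Lambda> N by fact
  show 1: "f (\<ominus>\<^bsub>M\<^esub> x) = \<ominus>\<^bsub>N\<^esub> f x"
    using rhomD(2)[OF assms(3), of "\<ominus>\<^bsub>M\<^esub> x" x] rhomD(1)[OF assms(3)] assms(4) rhom_zero[OF assms(1-3)]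
    by (intro N.M.minus_equality[symmetric]) (simp_all add: M.M.l_neg)
  show "y \<in> carrier M \<Longrightarrow> f (y \<ominus>\<^bsub>M\<^esub> x) = f y \<ominus>\<^bsub>N\<^esub> f x"
    using assms(4) by (simp add: a_minus_def 1 rhomD(2)[OF assms(3)])
qed

definition hker :: "('a, 'm) rmodule \<Rightarrow> ('a, 'n) rmodule \<Rightarrow> ('m \<Rightarrow> 'n) \<Rightarrow> 'm set"
  where "hker M N f = {x \<in> carrier M. f x = \<zero>\<^bsub>N\<^esub>}"

lemma hker_sub [simp]: "hker M (sub N V) f = hker M N f"
  and hker_restrict: "hker (sub M U) N f = {x \<in> U. f x = \<zero>\<^bsub>N\<^esub>}"
  by (simp_all add: hker_def)

lemma rsub_vimage:
  assumes "right_module \<Lambda> M" "right_module \<Lambda> N" "f \<in> rhom \<Lambda> M N" "rsubmodule \<Lambda> N V"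
  shows "rsubmodule \<Lambda> M {x \<in> carrier M. f x \<in> V}"
proof -
  interpret M: right_module \<Lambda> M by fact
  interpret N: right_module \<Lambda> N by fact
  show ?thesis
    by (rule M.rsubI) (auto simp: rhom_zero[OF assms(1-3)] rhomD[OF assms(3)] N.rsubD[OF assms(4)])
qed

lemma rsub_hker:
  assumes "right_module \<Lambda> M" "right_module \<Lambda> N" "f \<in> rhom \<Lambda> M N"
  shows "rsubmodule \<Lambda> M (hker M N f)"
  using rsub_vimage[OF assms right_module.rsub_zero[OF assms(2)]] by (simp add: hker_def)

lemma rsub_image:
  assumes "right_module \<Lambda> M" "right_module \<Lambda> N" "f \<in> rhom \<Lambda> M N" "rsubmodule \<Lambda> M U"
  shows "rsubmodule \<Lambda> N (f ` U)"
proof -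
  interpret M: right_module \<Lambda> M by fact
  interpret N: right_module \<Lambda> N by fact
  note [simp] = M.rsubD[OF assms(4)] rhomD[OF assms(3)]
  have "f x \<oplus>\<^bsub>N\<^esub> f y \<in> f ` U" if "x \<in> U" "y \<in> U" for x y
    using that by (intro image_eqI[of _ _ "x \<oplus>\<^bsub>M\<^esub> y"]) auto
  moreover have "f x \<triangleleft>\<^bsub>N\<^esub> a \<in> f ` U" if "x \<in> U" "a \<in> carrier \<Lambda>" for x a
    using that by (intro image_eqI[of _ _ "x \<triangleleft>\<^bsub>M\<^esub> a"]) auto
  ultimately show ?thesis
    by (intro N.rsubI) (auto simp: rhom_zero[OF assms(1-3), symmetric])
qed

lemma rsub_range:
  assumes "right_module \<Lambda> M" "right_module \<Lambda> N" "f \<in> rhom \<Lambda> M N"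
  shows "rsubmodule \<Lambda> N (f ` carrier M)"
  by (rule rsub_image[OF assms right_module.rsub_carrier[OF assms(1)]])

lemma rhom_inj_iff:
  assumes "right_module \<Lambda> M" "right_module \<Lambda> N" "f \<in> rhom \<Lambda> M N"
  shows "inj_on f (carrier M) \<longleftrightarrow> hker M N f = {\<zero>\<^bsub>M\<^esub>}"
proof -
  interpret M: right_module \<Lambda> M by fact
  interpret N: right_module \<Lambda> N by fact
  note [simp] = rhomD[OF assms(3)]
  show ?thesis
  proof
    assume inj: "inj_on f (carrier M)"
    have "x = \<zero>\<^bsub>M\<^esub>" if "x \<in> carrier M" "f x = \<zero>\<^bsub>N\<^esub>" for x
      by (rule inj_onD[OF inj]) (use that in \<open>simp_all add: rhom_zero[OF assms]\<close>)
    then show "hker M N f = {\<zero>\<^bsub>M\<^esub>}" by (auto simp: hker_def rhom_zero[OF assms])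
  next
    assume k: "hker M N f = {\<zero>\<^bsub>M\<^esub>}"
    show "inj_on f (carrier M)"
    proof (rule inj_onI)
      fix x y assume xy: "x \<in> carrier M" "y \<in> carrier M" "f x = f y"
      then have "x \<ominus>\<^bsub>M\<^esub> y \<in> hker M N f"
        by (auto simp: hker_def rhom_minus[OF assms] N.minus_zero_iff)
      then show "x = y" using k xy by (simp add: M.minus_zero_iff)
    qed
  qed
qed

lemma rhom_const_zero: "right_module \<Lambda> N \<Longrightarrow> (\<lambda>_. \<zero>\<^bsub>N\<^esub>) \<in> rhom \<Lambda> M N"
proof -
  assume "right_module \<Lambda> N"
  then interpret N: right_module \<Lambda> N .
  show ?thesis by (rule rhomI) auto
qed

lemma rhom_add_fun:
  assumes "right_module \<Lambda> N" "f \<in> rhom \<Lambda> M N" "g \<in> rhom \<Lambda> M N"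
  shows "(\<lambda>x. f x \<oplus>\<^bsub>N\<^esub> g x) \<in> rhom \<Lambda> M N"
proof -
  interpret N: right_module \<Lambda> N by fact
  show ?thesis
    by (rule rhomI) (auto simp: rhomD[OF assms(2)] rhomD[OF assms(3)] N.M.a_ac N.ract_l_distr)
qed

lemma rhom_minus_fun:
  assumes "right_module \<Lambda> N" "f \<in> rhom \<Lambda> M N" "g \<in> rhom \<Lambda> M N"
  shows "(\<lambda>x. f x \<ominus>\<^bsub>N\<^esub> g x) \<in> rhom \<Lambda> M N"
proof -
  interpret N: right_module \<Lambda> N by fact
  show ?thesis
    by (rule rhomI)
      (auto simp: rhomD[OF assms(2)] rhomD[OF assms(3)] N.minus_ract N.add_diff_add)
qed

lemma rhom_inv:
  assumes "right_module \<Lambda> M" "f \<in> rhom \<Lambda> M N" "bij_betw f (carrier M) (carrier N)"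
  shows "inv_into (carrier M) f \<in> rhom \<Lambda> N M"
proof -
  interpret M: right_module \<Lambda> M by fact
  let ?g = "inv_into (carrier M) f"
  have inj: "inj_on f (carrier M)" and surj: "f ` carrier M = carrier N"
    using assms(3) by (auto simp: bij_betw_def)
  have g: "?g y \<in> carrier M" "f (?g y) = y" if "y \<in> carrier N" for y
    using that surj by (metis inv_into_into f_inv_into_f)+
  show ?thesis
  proof (rule rhomI)
    fix x y assume xy: "x \<in> carrier N" "y \<in> carrier N"
    have "f (?g x \<oplus>\<^bsub>M\<^esub> ?g y) = x \<oplus>\<^bsub>N\<^esub> y" using g xy by (simp add: rhomD[OF assms(2)])
    then show "?g (x \<oplus>\<^bsub>N\<^esub> y) = ?g x \<oplus>\<^bsub>M\<^esub> ?g y"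
      using inv_into_f_f[OF inj, of "?g x \<oplus>\<^bsub>M\<^esub> ?g y"] g xy by simp
  next
    fix x a assume xy: "x \<in> carrier N" "a \<in> carrier \<Lambda>"
    have "f (?g x \<triangleleft>\<^bsub>M\<^esub> a) = x \<triangleleft>\<^bsub>N\<^esub> a" using g xy by (simp add: rhomD[OF assms(2)])
    then show "?g (x \<triangleleft>\<^bsub>N\<^esub> a) = ?g x \<triangleleft>\<^bsub>M\<^esub> a"
      using inv_into_f_f[OF inj, of "?g x \<triangleleft>\<^bsub>M\<^esub> a"] g xy by simp
  qed (auto simp: g)
qed

text \<open>Composing \<open>g\<close> with a set-theoretic section \<open>s\<close> of
  \<open>p\<close> gives the factor: the kernel condition makes \<open>g\<close> constant on the
  fibres of \<open>p\<close>, so it does not matter that \<open>s\<close> fails to be linear. Maps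
  out of quotients are constructed in this way below.\<close>

lemma rhom_factor:
  assumes "right_module \<Lambda> M" "right_module \<Lambda> N" "right_module \<Lambda> L"
    and p: "p \<in> rhom \<Lambda> M N" "p ` carrier M = carrier N" and g: "g \<in> rhom \<Lambda> M L"
    and ker: "\<And>x. x \<in> carrier M \<Longrightarrow> p x = \<zero>\<^bsub>N\<^esub> \<Longrightarrow> g x = \<zero>\<^bsub>L\<^esub>"
  obtains h where "h \<in> rhom \<Lambda> N L" "\<And>x. x \<in> carrier M \<Longrightarrow> h (p x) = g x"
proof -
  interpret M: right_module \<Lambda> M by fact
  interpret N: right_module \<Lambda> N by fact
  interpret L: right_module \<Lambda> L by fact
  note [simp] = rhomD[OF p(1)] rhomD[OF g]
  define s where "s = inv_into (carrier M) p"
  have s: "s y \<in> carrier M" "p (s y) = y" if "y \<in> carrier N" for y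
    using that p(2) unfolding s_def by (metis inv_into_into f_inv_into_f)+
  have eq: "g x = g y" if "x \<in> carrier M" "y \<in> carrier M" "p x = p y" for x y
  proof -
    have "p (x \<ominus>\<^bsub>M\<^esub> y) = \<zero>\<^bsub>N\<^esub>" using that by (simp add: rhom_minus[OF assms(1,2) p(1)] N.minus_zero_iff)
    then have "g (x \<ominus>\<^bsub>M\<^esub> y) = \<zero>\<^bsub>L\<^esub>" using that ker by simp
    then show ?thesis using that by (simp add: rhom_minus[OF assms(1,3) g] L.minus_zero_iff)
  qed
  have "(\<lambda>y. g (s y)) \<in> rhom \<Lambda> N L"
  proof (rule rhomI)
    fix x y assume "x \<in> carrier N" "y \<in> carrier N"
    then show "g (s (x \<oplus>\<^bsub>N\<^esub> y)) = g (s x) \<oplus>\<^bsub>L\<^esub> g (s y)"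
      using eq[of "s (x \<oplus>\<^bsub>N\<^esub> y)" "s x \<oplus>\<^bsub>M\<^esub> s y"] by (simp add: s)
  next
    fix x a assume "x \<in> carrier N" "a \<in> carrier \<Lambda>"
    then show "g (s (x \<triangleleft>\<^bsub>N\<^esub> a)) = g (s x) \<triangleleft>\<^bsub>L\<^esub> a"
      using eq[of "s (x \<triangleleft>\<^bsub>N\<^esub> a)" "s x \<triangleleft>\<^bsub>M\<^esub> a"] by (simp add: s)
  qed (simp add: s)
  moreover have "g (s (p x)) = g x" if "x \<in> carrier M" for x
    using that by (intro eq) (auto simp: s)
  ultimately show ?thesis by (rule that)
qed

text \<open>Quotients are built on chosen representatives of the cosets, which keeps the type of the elements.\<close>

definition crep :: "('a, 'm) rmodule \<Rightarrow> 'm set \<Rightarrow> 'm \<Rightarrow> 'm"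
  where "crep M U x = (SOME y. y \<in> carrier M \<and> x \<ominus>\<^bsub>M\<^esub> y \<in> U)"

definition quot :: "('a, 'm) rmodule \<Rightarrow> 'm set \<Rightarrow> ('a, 'm) rmodule"
  where "quot M U = \<lparr>carrier = crep M U ` carrier M, mult = undefined, one = undefined,
    zero = crep M U \<zero>\<^bsub>M\<^esub>, add = (\<lambda>x y. crep M U (x \<oplus>\<^bsub>M\<^esub> y)), ract = (\<lambda>x a. crep M U (x \<triangleleft>\<^bsub>M\<^esub> a))\<rparr>"

context right_module
begin

context
  fixes U assumes U: "rsubmodule \<Lambda> M U"
begin

lemma crep:
  assumes "x \<in> carrier M"
  shows "crep M U x \<in> carrier M" "x \<ominus>\<^bsub>M\<^esub> crep M U x \<in> U"
proof -
  have "crep M U x \<in> carrier M \<and> x \<ominus>\<^bsub>M\<^esub> crep M U x \<in> U"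
    unfolding crep_def
    by (rule someI[of _ x]) (use assms in \<open>simp add: rsubD[OF U] a_minus_def M.r_neg\<close>)
  then show "crep M U x \<in> carrier M" "x \<ominus>\<^bsub>M\<^esub> crep M U x \<in> U" by auto
qed

text \<open>The representative depends only on the predicate given to \<open>SOME\<close>. Elements
  that differ by an element of \<open>U\<close> satisfy the same coset predicate, so their
  representatives are equal.\<close>

lemma crep_eq_iff:
  assumes "x \<in> carrier M" "y \<in> carrier M"
  shows "crep M U x = crep M U y \<longleftrightarrow> x \<ominus>\<^bsub>M\<^esub> y \<in> U"
proof
  assume eq: "crep M U x = crep M U y"
  have "x \<ominus>\<^bsub>M\<^esub> y = (x \<ominus>\<^bsub>M\<^esub> crep M U x) \<ominus>\<^bsub>M\<^esub> (y \<ominus>\<^bsub>M\<^esub> crep M U x)"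
    using assms by (simp add: diff_diff_diff crep)
  then show "x \<ominus>\<^bsub>M\<^esub> y \<in> U"
    using crep[OF assms(1)] crep[OF assms(2)] eq by (simp add: rsubD[OF U])
next
  assume d: "x \<ominus>\<^bsub>M\<^esub> y \<in> U"
  have "x \<ominus>\<^bsub>M\<^esub> z \<in> U \<longleftrightarrow> y \<ominus>\<^bsub>M\<^esub> z \<in> U" if "z \<in> carrier M" for z
  proof -
    have "x \<ominus>\<^bsub>M\<^esub> z = (x \<ominus>\<^bsub>M\<^esub> y) \<oplus>\<^bsub>M\<^esub> (y \<ominus>\<^bsub>M\<^esub> z)"
      using assms that by (simp add: diff_add_diff)
    moreover have "y \<ominus>\<^bsub>M\<^esub> z = (y \<ominus>\<^bsub>M\<^esub> x) \<oplus>\<^bsub>M\<^esub> (x \<ominus>\<^bsub>M\<^esub> z)"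
      using assms that by (simp add: diff_add_diff)
    moreover have "y \<ominus>\<^bsub>M\<^esub> x \<in> U" using rsubD(5)[OF U d] assms by (simp add: neg_diff)
    ultimately show ?thesis using d rsubD(4)[OF U] by metis
  qed
  then have "(\<lambda>z. z \<in> carrier M \<and> x \<ominus>\<^bsub>M\<^esub> z \<in> U) = (\<lambda>z. z \<in> carrier M \<and> y \<ominus>\<^bsub>M\<^esub> z \<in> U)" by blast
  then show "crep M U x = crep M U y" by (simp only: crep_def)
qed

lemma crep_idem: "x \<in> carrier M \<Longrightarrow> crep M U (crep M U x) = crep M U x"
  using crep crep_eq_iff by metis

lemma crep_add: "x \<in> carrier M \<Longrightarrow> y \<in> carrier M \<Longrightarrow>
    crep M U (crep M U x \<oplus>\<^bsub>M\<^esub> crep M U y) = crep M U (x \<oplus>\<^bsub>M\<^esub> y)"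
proof -
  assume xy: "x \<in> carrier M" "y \<in> carrier M"
  have "(x \<oplus>\<^bsub>M\<^esub> y) \<ominus>\<^bsub>M\<^esub> (crep M U x \<oplus>\<^bsub>M\<^esub> crep M U y) = (x \<ominus>\<^bsub>M\<^esub> crep M U x) \<oplus>\<^bsub>M\<^esub> (y \<ominus>\<^bsub>M\<^esub> crep M U y)"
    using xy crep(1) by (simp add: add_diff_add)
  then have "(x \<oplus>\<^bsub>M\<^esub> y) \<ominus>\<^bsub>M\<^esub> (crep M U x \<oplus>\<^bsub>M\<^esub> crep M U y) \<in> U"
    using xy crep(2) rsubD(4)[OF U] by simp
  then show ?thesis using xy crep(1)
    by (intro crep_eq_iff[THEN iffD2, symmetric]) auto
qed

lemma crep_act: "x \<in> carrier M \<Longrightarrow> a \<in> carrier \<Lambda> \<Longrightarrow>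
    crep M U (crep M U x \<triangleleft>\<^bsub>M\<^esub> a) = crep M U (x \<triangleleft>\<^bsub>M\<^esub> a)"
  using crep rsubD(7)[OF U]
  by (intro crep_eq_iff[THEN iffD2, symmetric]) (auto simp: minus_ract[symmetric])

lemma right_module_quot: "right_module \<Lambda> (quot M U)"
proof -
  have "abelian_group (quot M U)"
  proof (rule abelian_groupI)
    fix x y z assume "x \<in> carrier (quot M U)" "y \<in> carrier (quot M U)" "z \<in> carrier (quot M U)"
    then obtain x' y' z' where c: "x' \<in> carrier M" "y' \<in> carrier M" "z' \<in> carrier M"
      "x = crep M U x'" "y = crep M U y'" "z = crep M U z'" by (auto simp: quot_def)
    show "x \<oplus>\<^bsub>quot M U\<^esub> y \<in> carrier (quot M U)" using c crep(1) by (auto simp: quot_def)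
    show "x \<oplus>\<^bsub>quot M U\<^esub> y \<oplus>\<^bsub>quot M U\<^esub> z = x \<oplus>\<^bsub>quot M U\<^esub> (y \<oplus>\<^bsub>quot M U\<^esub> z)"
      using c crep(1) by (simp add: quot_def crep_add M.a_assoc)
    show "x \<oplus>\<^bsub>quot M U\<^esub> y = y \<oplus>\<^bsub>quot M U\<^esub> x"
      using c crep(1) by (simp add: quot_def M.a_comm)
    show "\<zero>\<^bsub>quot M U\<^esub> \<oplus>\<^bsub>quot M U\<^esub> x = x" using c by (simp add: quot_def crep_add)
    show "\<exists>y\<in>carrier (quot M U). y \<oplus>\<^bsub>quot M U\<^esub> x = \<zero>\<^bsub>quot M U\<^esub>"
      using c by (intro bexI[of _ "crep M U (\<ominus>\<^bsub>M\<^esub> x')"]) (auto simp: quot_def crep_add M.l_neg)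
  qed (auto simp: quot_def)
  moreover have "right_module_axioms \<Lambda> (quot M U)"
  proof
    fix x y a b assume "x \<in> carrier (quot M U)" "y \<in> carrier (quot M U)" and ab: "a \<in> carrier \<Lambda>" "b \<in> carrier \<Lambda>"
    then obtain x' y' where c: "x' \<in> carrier M" "y' \<in> carrier M"
      "x = crep M U x'" "y = crep M U y'" by (auto simp: quot_def)
    show "x \<triangleleft>\<^bsub>quot M U\<^esub> a \<in> carrier (quot M U)" using c ab crep(1) by (auto simp: quot_def)
    show "x \<triangleleft>\<^bsub>quot M U\<^esub> (a \<oplus>\<^bsub>\<Lambda>\<^esub> b) = x \<triangleleft>\<^bsub>quot M U\<^esub> a \<oplus>\<^bsub>quot M U\<^esub> x \<triangleleft>\<^bsub>quot M U\<^esub> b"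
      using c ab by (simp add: quot_def crep_act crep_add ract_r_distr)
    show "(x \<oplus>\<^bsub>quot M U\<^esub> y) \<triangleleft>\<^bsub>quot M U\<^esub> a = x \<triangleleft>\<^bsub>quot M U\<^esub> a \<oplus>\<^bsub>quot M U\<^esub> y \<triangleleft>\<^bsub>quot M U\<^esub> a"
      using c ab by (simp add: quot_def crep_act crep_add ract_l_distr)
    show "x \<triangleleft>\<^bsub>quot M U\<^esub> (a \<otimes>\<^bsub>\<Lambda>\<^esub> b) = (x \<triangleleft>\<^bsub>quot M U\<^esub> a) \<triangleleft>\<^bsub>quot M U\<^esub> b"
      using c ab by (simp add: quot_def crep_act ract_assoc)
  next
    show "x \<triangleleft>\<^bsub>quot M U\<^esub> \<one>\<^bsub>\<Lambda>\<^esub> = x" if "x \<in> carrier (quot M U)" for x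
      using that crep(1) by (auto simp: quot_def crep_idem)
  qed
  ultimately show ?thesis by (intro right_module.intro \<Lambda>.ring_axioms)
qed

lemma crep_hom: "crep M U \<in> rhom \<Lambda> M (quot M U)"
  by (rule rhomI) (auto simp: quot_def crep_add crep_act)

lemma crep_surj: "crep M U ` carrier M = carrier (quot M U)"
  by (simp add: quot_def)

lemma crep_zero_iff: "x \<in> carrier M \<Longrightarrow> crep M U x = \<zero>\<^bsub>quot M U\<^esub> \<longleftrightarrow> x \<in> U"
proof -
  assume x: "x \<in> carrier M"
  have "x \<ominus>\<^bsub>M\<^esub> \<zero>\<^bsub>M\<^esub> = x" using add_minus_cancel[OF x M.zero_closed] x by simp
  then show ?thesis
    using crep_eq_iff[OF x M.zero_closed] by (simp add: quot_def)
qed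

lemma hker_crep: "hker M (quot M U) (crep M U) = U"
  using crep_zero_iff rsubD(1)[OF U] by (auto simp: hker_def)

end
end

section \<open>Length\<close>

text \<open>Counts the strict inclusions in a chain of submodules that ends at \<open>A\<close> and
  may start anywhere. Finite length means that these numbers are bounded; \<open>len\<close> is
  their maximum and is meaningful only together with \<open>fin_len\<close>.\<close>

inductive chain_len :: "('a, 'k) ring_scheme \<Rightarrow> ('a, 'm) rmodule \<Rightarrow> 'm set \<Rightarrow> nat \<Rightarrow> bool" for \<Lambda> M where
  zero: "rsubmodule \<Lambda> M A \<Longrightarrow> chain_len \<Lambda> M A 0"
| Suc: "chain_len \<Lambda> M B n \<Longrightarrow> rsubmodule \<Lambda> M A \<Longrightarrow> B \<subset> A \<Longrightarrow> chain_len \<Lambda> M A (Suc n)"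

definition fin_len :: "('a, 'k) ring_scheme \<Rightarrow> ('a, 'm) rmodule \<Rightarrow> 'm set \<Rightarrow> bool"
  where "fin_len \<Lambda> M A \<longleftrightarrow> rsubmodule \<Lambda> M A \<and> (\<exists>b. \<forall>n. chain_len \<Lambda> M A n \<longrightarrow> n \<le> b)"

definition len :: "('a, 'k) ring_scheme \<Rightarrow> ('a, 'm) rmodule \<Rightarrow> 'm set \<Rightarrow> nat"
  where "len \<Lambda> M A = (GREATEST n. chain_len \<Lambda> M A n)"

lemma chain_len_rsub: "chain_len \<Lambda> M A n \<Longrightarrow> rsubmodule \<Lambda> M A"
  by (cases rule: chain_len.cases) auto

lemma fin_len_rsub: "fin_len \<Lambda> M A \<Longrightarrow> rsubmodule \<Lambda> M A"
  by (simp add: fin_len_def)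

lemma fin_lenI: "rsubmodule \<Lambda> M A \<Longrightarrow> (\<And>n. chain_len \<Lambda> M A n \<Longrightarrow> n \<le> b) \<Longrightarrow> fin_len \<Lambda> M A"
  by (auto simp: fin_len_def)

lemma len_chain:
  assumes "fin_len \<Lambda> M A"
  shows "chain_len \<Lambda> M A (len \<Lambda> M A)" "chain_len \<Lambda> M A n \<Longrightarrow> n \<le> len \<Lambda> M A"
proof -
  obtain b where b: "\<And>n. chain_len \<Lambda> M A n \<Longrightarrow> n \<le> b" using assms by (auto simp: fin_len_def)
  have "chain_len \<Lambda> M A 0" by (rule chain_len.zero[OF fin_len_rsub[OF assms]])
  then show "chain_len \<Lambda> M A (len \<Lambda> M A)" unfolding len_def by (rule GreatestI_nat) (use b in auto)
  show "chain_len \<Lambda> M A n \<Longrightarrow> n \<le> len \<Lambda> M A" unfolding len_def by (rule Greatest_le_nat) (use b in auto)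
qed

lemma len_le: "fin_len \<Lambda> M A \<Longrightarrow> (\<And>n. chain_len \<Lambda> M A n \<Longrightarrow> n \<le> b) \<Longrightarrow> len \<Lambda> M A \<le> b"
  using len_chain(1) by blast

lemma chain_len_mono:
  assumes "chain_len \<Lambda> M A n" "rsubmodule \<Lambda> M B" "A \<subseteq> B"
  shows "chain_len \<Lambda> M B n"
  using assms(1)
proof (cases rule: chain_len.cases)
  case (Suc C m)
  then show ?thesis using assms(2,3) chain_len.Suc[OF Suc(2) assms(2)] by auto
qed (use assms in \<open>auto intro: chain_len.zero\<close>)

lemma chain_len_sub:
  assumes "right_module \<Lambda> M" "rsubmodule \<Lambda> M U" "B \<subseteq> U"
  shows "chain_len \<Lambda> (sub M U) B n \<longleftrightarrow> chain_len \<Lambda> M B n"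
proof
  interpret right_module \<Lambda> M by fact
  show "chain_len \<Lambda> (sub M U) B n \<Longrightarrow> chain_len \<Lambda> M B n"
    by (induction rule: chain_len.induct) (auto simp: rsub_sub[OF assms(2)] intro: chain_len.intros)
  have "B \<subseteq> U \<Longrightarrow> chain_len \<Lambda> (sub M U) B n" if "chain_len \<Lambda> M B n" for B n
    using that
  proof (induction rule: chain_len.induct)
    case (Suc B n A)
    then show ?case by (auto simp: rsub_sub[OF assms(2)] intro!: chain_len.Suc[of _ _ B])
  qed (auto simp: rsub_sub[OF assms(2)] intro: chain_len.zero)
  then show "chain_len \<Lambda> M B n \<Longrightarrow> chain_len \<Lambda> (sub M U) B n" using assms(3) by blast
qed

lemma fin_len_sub:
  assumes "right_module \<Lambda> M" "rsubmodule \<Lambda> M U" "B \<subseteq> U"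
  shows "fin_len \<Lambda> (sub M U) B \<longleftrightarrow> fin_len \<Lambda> M B" "len \<Lambda> (sub M U) B = len \<Lambda> M B"
  using assms(3) chain_len_sub[OF assms] right_module.rsub_sub[OF assms(1,2)]
  by (auto simp: fin_len_def len_def)

lemma fin_len_mono:
  assumes "fin_len \<Lambda> M A" "rsubmodule \<Lambda> M B" "B \<subseteq> A"
  shows "fin_len \<Lambda> M B" "len \<Lambda> M B \<le> len \<Lambda> M A" "B \<noteq> A \<Longrightarrow> len \<Lambda> M B < len \<Lambda> M A"
proof -
  show f: "fin_len \<Lambda> M B"
    using assms len_chain(2)[OF assms(1)] chain_len_mono[OF _ fin_len_rsub[OF assms(1)]]
    by (auto intro!: fin_lenI[of _ _ _ "len \<Lambda> M A"])
  show "len \<Lambda> M B \<le> len \<Lambda> M A"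
    by (rule len_chain(2)[OF assms(1)], rule chain_len_mono[OF len_chain(1)[OF f]])
      (use assms fin_len_rsub in auto)
  show "B \<noteq> A \<Longrightarrow> len \<Lambda> M B < len \<Lambda> M A"
    using len_chain(2)[OF assms(1) chain_len.Suc[OF len_chain(1)[OF f] fin_len_rsub[OF assms(1)]]] assms(3)
    by (simp add: psubset_eq)
qed

lemma len_zero:
  assumes "right_module \<Lambda> M"
  shows "fin_len \<Lambda> M {\<zero>\<^bsub>M\<^esub>}" "len \<Lambda> M {\<zero>\<^bsub>M\<^esub>} = 0"
proof -
  interpret right_module \<Lambda> M by fact
  have *: "n \<le> 0" if "chain_len \<Lambda> M {\<zero>\<^bsub>M\<^esub>} n" for n
    using that
  proof (cases rule: chain_len.cases)
    case (Suc B m)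
    then have "B = {}" by auto
    then show ?thesis using rsubD(3)[OF chain_len_rsub[OF Suc(2)]] by simp
  qed auto
  then show f: "fin_len \<Lambda> M {\<zero>\<^bsub>M\<^esub>}" by (rule fin_lenI[OF rsub_zero])
  show "len \<Lambda> M {\<zero>\<^bsub>M\<^esub>} = 0" using len_le[OF f *] by simp
qed

lemma len_eq_zero:
  assumes "right_module \<Lambda> M" "fin_len \<Lambda> M A" "len \<Lambda> M A = 0"
  shows "A = {\<zero>\<^bsub>M\<^esub>}"
proof -
  interpret right_module \<Lambda> M by fact
  show ?thesis
    using fin_len_mono(3)[OF assms(2) rsub_zero] assms(3) rsubD(3)[OF fin_len_rsub[OF assms(2)]] by auto
qed

context
  fixes \<Lambda> :: "('a, 'k) ring_scheme" and M :: "('a, 'm) rmodule" and N :: "('a, 'n) rmodule" and f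
  assumes M: "right_module \<Lambda> M" and N: "right_module \<Lambda> N" and f: "f \<in> rhom \<Lambda> M N"
begin

interpretation M: right_module \<Lambda> M by (rule M)
interpretation N: right_module \<Lambda> N by (rule N)

text \<open>By the modular law, a submodule \<open>B\<close> of \<open>A\<close> with the same
  intersection with the kernel and the same image is equal to \<open>A\<close>. Each strict step is
  therefore strict in the kernel or in the image and is charged to one of the two chains.\<close>

lemma chain_len_split:
  assumes "chain_len \<Lambda> M A n"
  shows "\<exists>p q. n \<le> p + q \<and> chain_len \<Lambda> M (A \<inter> hker M N f) p \<and> chain_len \<Lambda> N (f ` A) q"
  using assms
proof (induction rule: chain_len.induct)
  case (zero A)
  then show ?case
    by (auto intro!: exI chain_len.zero M.rsub_Int rsub_image[OF M N f] rsub_hker[OF M N f])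
next
  case (Suc B n A)
  then obtain p q where pq: "n \<le> p + q" "chain_len \<Lambda> M (B \<inter> hker M N f) p" "chain_len \<Lambda> N (f ` B) q"
    by auto
  have B: "rsubmodule \<Lambda> M B" using Suc chain_len_rsub by auto
  have rs: "rsubmodule \<Lambda> M (A \<inter> hker M N f)" "rsubmodule \<Lambda> N (f ` A)"
    using Suc by (auto intro!: M.rsub_Int rsub_image[OF M N f] rsub_hker[OF M N f])
  consider "B \<inter> hker M N f \<subset> A \<inter> hker M N f" | "f ` B \<subset> f ` A"
  proof (rule ccontr)
    assume "\<not> thesis"
    then have eq: "B \<inter> hker M N f = A \<inter> hker M N f" "f ` B = f ` A"
      using that Suc.hyps(3) by blast+
    have "x \<in> B" if x: "x \<in> A" for x
    proof -
      obtain y where y: "y \<in> B" "f x = f y" using x eq(2) by (metis imageE imageI)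
      have c: "x \<in> carrier M" "y \<in> carrier M" "y \<in> A"
        using x y M.rsubD(2)[OF Suc.hyps(2)] M.rsubD(2)[OF B] Suc.hyps(3) by auto
      have "x \<ominus>\<^bsub>M\<^esub> y \<in> A \<inter> hker M N f"
        using x c y M.rsubD(6)[OF Suc.hyps(2)] rhom_minus[OF M N f] rhomD(1)[OF f]
        by (auto simp: hker_def N.minus_zero_iff)
      then have "x \<ominus>\<^bsub>M\<^esub> y \<in> B" using eq by auto
      then have "(x \<ominus>\<^bsub>M\<^esub> y) \<oplus>\<^bsub>M\<^esub> y \<in> B" using y M.rsubD(4)[OF B] by blast
      then show ?thesis using c by (simp add: M.minus_add_cancel)
    qed
    then show False using Suc by auto
  qed
  then show ?case
  proof cases
    case 1
    have "chain_len \<Lambda> M (A \<inter> hker M N f) (Suc p)" by (rule chain_len.Suc[OF pq(2) rs(1) 1])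
    moreover have "chain_len \<Lambda> N (f ` A) q" by (rule chain_len_mono[OF pq(3) rs(2)]) (use Suc in auto)
    ultimately show ?thesis using pq(1) by (intro exI[of _ "Suc p"] exI[of _ q]) auto
  next
    case 2
    have "chain_len \<Lambda> N (f ` A) (Suc q)" by (rule chain_len.Suc[OF pq(3) rs(2) 2])
    moreover have "chain_len \<Lambda> M (A \<inter> hker M N f) p" by (rule chain_len_mono[OF pq(2) rs(1)]) (use Suc in auto)
    ultimately show ?thesis using pq(1) by (intro exI[of _ p] exI[of _ "Suc q"]) auto
  qed
qed

text \<open>A chain below the kernel is continued by the preimages of a chain in \<open>N\<close>.
  These stay distinct because the chain lies in the image of \<open>f\<close>.\<close>

lemma chain_len_join:
  assumes "chain_len \<Lambda> N C q" "chain_len \<Lambda> M (hker M N f) p" "C \<subseteq> f ` carrier M"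
  shows "chain_len \<Lambda> M {x \<in> carrier M. f x \<in> C} (p + q)"
  using assms
proof (induction rule: chain_len.induct)
  case (zero C)
  have "hker M N f \<subseteq> {x \<in> carrier M. f x \<in> C}" using N.rsubD(3)[OF zero(1)] by (auto simp: hker_def)
  then show ?case using chain_len_mono[OF zero(2) rsub_vimage[OF M N f zero(1)]] by simp
next
  case (Suc B n A)
  have "{x \<in> carrier M. f x \<in> B} \<subset> {x \<in> carrier M. f x \<in> A}"
    using Suc.hyps(3) Suc.prems(2) by blast
  then show ?case
    using chain_len.Suc[OF Suc.IH rsub_vimage[OF M N f Suc.hyps(2)]] Suc by auto
qed

lemma fin_len_additive:
  shows "fin_len \<Lambda> M (carrier M) \<longleftrightarrow> fin_len \<Lambda> M (hker M N f) \<and> fin_len \<Lambda> N (f ` carrier M)" (is "?A \<longleftrightarrow> ?K \<and> ?I")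
    and "fin_len \<Lambda> M (carrier M) \<Longrightarrow>
      len \<Lambda> M (carrier M) = len \<Lambda> M (hker M N f) + len \<Lambda> N (f ` carrier M)"
proof -
  have k: "carrier M \<inter> hker M N f = hker M N f" "{x \<in> carrier M. f x \<in> f ` carrier M} = carrier M"
    by (auto simp: hker_def)
  have join: "chain_len \<Lambda> M (carrier M) (p + q)"
    if "chain_len \<Lambda> M (hker M N f) p" "chain_len \<Lambda> N (f ` carrier M) q" for p q
    using chain_len_join[OF that(2,1)] by (simp add: k)
  have rs: "rsubmodule \<Lambda> M (hker M N f)" "rsubmodule \<Lambda> N (f ` carrier M)"
    by (auto intro: rsub_range[OF M N f] rsub_hker[OF M N f])
  have up: "n \<le> len \<Lambda> M (hker M N f) + len \<Lambda> N (f ` carrier M)"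
    if K: ?K and I: ?I and "chain_len \<Lambda> M (carrier M) n" for n
  proof -
    obtain p q where pq: "n \<le> p + q" "chain_len \<Lambda> M (hker M N f) p" "chain_len \<Lambda> N (f ` carrier M) q"
      using chain_len_split[OF \<open>chain_len \<Lambda> M (carrier M) n\<close>] by (auto simp: k)
    show ?thesis using len_chain(2)[OF K pq(2)] len_chain(2)[OF I pq(3)] pq(1) by linarith
  qed
  show iff: "?A \<longleftrightarrow> ?K \<and> ?I"
  proof
    assume A: ?A
    show "?K \<and> ?I"
    proof
      show ?K by (rule fin_len_mono(1)[OF A rs(1)]) (auto simp: hker_def)
      show ?I
      proof (rule fin_lenI[OF rs(2), where b = "len \<Lambda> M (carrier M)"])
        fix n assume "chain_len \<Lambda> N (f ` carrier M) n"
        from len_chain(2)[OF A join[OF chain_len.zero[OF rs(1)] this]]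
        show "n \<le> len \<Lambda> M (carrier M)" by simp
      qed
    qed
  next
    assume "?K \<and> ?I"
    then show ?A using up by (auto intro!: fin_lenI[OF M.rsub_carrier])
  qed
  show "len \<Lambda> M (carrier M) = len \<Lambda> M (hker M N f) + len \<Lambda> N (f ` carrier M)" if A: ?A
  proof (rule antisym)
    have KI: ?K ?I using iff A by auto
    show "len \<Lambda> M (carrier M) \<le> len \<Lambda> M (hker M N f) + len \<Lambda> N (f ` carrier M)"
      using up[OF KI len_chain(1)[OF A]] .
    show "len \<Lambda> M (hker M N f) + len \<Lambda> N (f ` carrier M) \<le> len \<Lambda> M (carrier M)"
      using len_chain(2)[OF A join[OF len_chain(1)[OF KI(1)] len_chain(1)[OF KI(2)]]] .
  qed
qed

end

lemma fin_len_quot: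
  assumes M: "right_module \<Lambda> M" and fin: "fin_len \<Lambda> M (carrier M)" and U: "rsubmodule \<Lambda> M U"
  shows "fin_len \<Lambda> (quot M U) (carrier (quot M U))"
    "len \<Lambda> M (carrier M) = len \<Lambda> M U + len \<Lambda> (quot M U) (carrier (quot M U))"
proof -
  interpret right_module \<Lambda> M by fact
  note * = fin_len_additive[OF M right_module_quot[OF U] crep_hom[OF U]]
  show "fin_len \<Lambda> (quot M U) (carrier (quot M U))"
    "len \<Lambda> M (carrier M) = len \<Lambda> M U + len \<Lambda> (quot M U) (carrier (quot M U))"
    using * fin by (auto simp: hker_crep[OF U] crep_surj[OF U])
qed

text \<open>\<open>M\<close> modulo the preimage of \<open>D\<close> embeds into \<open>N/D\<close>.
  The inequality of lengths is written additively so that no subtraction occurs; it says that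
  imposing \<open>f x \<in> D\<close> costs at most the length of \<open>N/D\<close>.\<close>

lemma len_vimage:
  assumes M: "right_module \<Lambda> M" and N: "right_module \<Lambda> N" and f: "f \<in> rhom \<Lambda> M N"
    and fM: "fin_len \<Lambda> M (carrier M)" and fN: "fin_len \<Lambda> N (carrier N)" and D: "rsubmodule \<Lambda> N D"
  shows "len \<Lambda> M (carrier M) + len \<Lambda> N D \<le> len \<Lambda> M {x \<in> carrier M. f x \<in> D} + len \<Lambda> N (carrier N)"
proof -
  interpret N: right_module \<Lambda> N by fact
  let ?g = "\<lambda>x. crep N D (f x)"
  have g: "?g \<in> rhom \<Lambda> M (quot N D)" by (rule rhom_comp[OF f N.crep_hom[OF D]])
  have k: "hker M (quot N D) ?g = {x \<in> carrier M. f x \<in> D}"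
    by (auto simp: hker_def N.crep_zero_iff[OF D] rhomD[OF f])
  have "len \<Lambda> M (carrier M) = len \<Lambda> M {x \<in> carrier M. f x \<in> D} + len \<Lambda> (quot N D) (?g ` carrier M)"
    using fin_len_additive(2)[OF M N.right_module_quot[OF D] g fM] by (simp add: k)
  moreover have "len \<Lambda> (quot N D) (?g ` carrier M) \<le> len \<Lambda> (quot N D) (carrier (quot N D))"
    using rsub_range[OF M N.right_module_quot[OF D] g]
    by (intro fin_len_mono(2) fin_len_quot(1)[OF N fN D]) (auto simp: rhomD[OF g])
  ultimately show ?thesis using fin_len_quot(2)[OF N fN D] by simp
qed

text \<open>Second isomorphism theorem: \<open>A\<close> and \<open>A + B\<close> have the same
  image in \<open>(A + B)/B\<close>, with kernels \<open>A \<inter> B\<close> and \<open>B\<close>.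
  Additivity of length for both maps gives the formula.\<close>

lemma fin_len_msum:
  assumes M: "right_module \<Lambda> M" and A: "fin_len \<Lambda> M A" and B: "fin_len \<Lambda> M B"
  shows "fin_len \<Lambda> M (right_module.msum M A B)"
    "len \<Lambda> M (right_module.msum M A B) + len \<Lambda> M (A \<inter> B) = len \<Lambda> M A + len \<Lambda> M B"
proof -
  interpret right_module \<Lambda> M by fact
  note rA = fin_len_rsub[OF A] and rB = fin_len_rsub[OF B]
  note rS = rsub_msum[OF rA rB]
  let ?S = "msum A B"
  interpret S: right_module \<Lambda> "sub M ?S" by (rule right_module_sub[OF rS(1)])
  have BS: "rsubmodule \<Lambda> (sub M ?S) B" using rB rS by (simp add: rsub_sub[OF rS(1)])
  let ?Q = "quot (sub M ?S) B"
  interpret Q: right_module \<Lambda> ?Q by (rule S.right_module_quot[OF BS])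
  let ?c = "crep (sub M ?S) B"
  have c: "?c \<in> rhom \<Lambda> (sub M ?S) ?Q" by (rule S.crep_hom[OF BS])
  have cA: "?c \<in> rhom \<Lambda> (sub M A) ?Q"
    using rhom_restrict[OF c, of A] rS(2) by simp
  have surj: "?c ` A = carrier ?Q"
  proof -
    have "?c x \<in> ?c ` A" if x: "x \<in> ?S" for x
    proof -
      obtain a b where ab: "a \<in> A" "b \<in> B" "x = a \<oplus>\<^bsub>M\<^esub> b" using x by (auto simp: msum_def)
      have m: "a \<in> ?S" "b \<in> ?S" using ab rS by auto
      then have "?c x = ?c a \<oplus>\<^bsub>?Q\<^esub> ?c b" using rhomD(2)[OF c, of a b] ab by simp
      moreover have "?c b = \<zero>\<^bsub>?Q\<^esub>" using S.crep_zero_iff[OF BS, of b] m ab by simp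
      moreover have "?c a \<in> carrier ?Q" using m S.crep_surj[OF BS] by auto
      ultimately have "?c x = ?c a" by (simp add: Q.M.r_zero)
      then show ?thesis using ab by auto
    qed
    then have "?c ` ?S \<subseteq> ?c ` A" by auto
    moreover have "?c ` ?S = carrier ?Q" using S.crep_surj[OF BS] by simp
    moreover have "?c ` A \<subseteq> ?c ` ?S" using rS(2) by auto
    ultimately show ?thesis by auto
  qed
  have kA: "hker (sub M A) ?Q ?c = A \<inter> B" "hker (sub M ?S) ?Q ?c = B"
    using S.crep_zero_iff[OF BS] S.hker_crep[OF BS] rS by (auto simp: hker_restrict)
  note addA = fin_len_additive[OF right_module_sub[OF rA] S.right_module_quot[OF BS] cA]
  note addS = fin_len_additive[OF S.right_module_axioms S.right_module_quot[OF BS] c]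
  have im: "?c ` ?S = carrier ?Q" using S.crep_surj[OF BS] by simp
  have fA: "fin_len \<Lambda> (sub M A) A" using A by (simp add: fin_len_sub[OF M rA])
  have fQ: "fin_len \<Lambda> ?Q (carrier ?Q)" using addA(1) fA by (simp add: surj)
  have fS: "fin_len \<Lambda> (sub M ?S) ?S"
    using addS(1) fQ B kA im fin_len_sub[OF M rS(1), of B] rS(3) by simp
  then show f: "fin_len \<Lambda> M ?S" by (simp add: fin_len_sub[OF M rS(1)])
  have "len \<Lambda> M ?S = len \<Lambda> M B + len \<Lambda> ?Q (carrier ?Q)"
    using addS(2) fS fin_len_sub(2)[OF M rS(1)] rS(3) by (simp add: kA im)
  moreover have "len \<Lambda> M A = len \<Lambda> M (A \<inter> B) + len \<Lambda> ?Q (carrier ?Q)"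
    using addA(2) fA fin_len_sub(2)[OF M rA] by (simp add: kA surj)
  ultimately show "len \<Lambda> M ?S + len \<Lambda> M (A \<inter> B) = len \<Lambda> M A + len \<Lambda> M B" by simp
qed

text \<open>The predicate \<open>P\<close> carries along a property that is stable under sums but
  not expressed by length. It serves to keep track of \<open>\<Lambda>\<close>-submodules while
  their length is measured over \<open>R\<close>.\<close>

lemma fin_len_generated:
  assumes M: "right_module \<Lambda> M"
    and cyc: "\<And>x. x \<in> S \<Longrightarrow> \<exists>A. fin_len \<Lambda> M A \<and> P A \<and> x \<in> A"
    and P0: "P {\<zero>\<^bsub>M\<^esub>}" and Psum: "\<And>A B. P A \<Longrightarrow> P B \<Longrightarrow> P (right_module.msum M A B)"
    and "finite S"
  shows "\<exists>A. fin_len \<Lambda> M A \<and> P A \<and> S \<subseteq> A"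
  using assms(5,2)
proof (induction S rule: finite_induct)
  case empty
  show ?case
    by (rule exI[of _ "{\<zero>\<^bsub>M\<^esub>}"]) (simp add: len_zero(1)[OF M] P0)
next
  case (insert x F)
  have "\<exists>A. fin_len \<Lambda> M A \<and> P A \<and> x \<in> A" by (rule insert.prems) simp
  then obtain A where A: "fin_len \<Lambda> M A" "P A" "x \<in> A" by (elim exE conjE)
  have "\<exists>B. fin_len \<Lambda> M B \<and> P B \<and> F \<subseteq> B" by (rule insert.IH, rule insert.prems) simp
  then obtain B where B: "fin_len \<Lambda> M B" "P B" "F \<subseteq> B" by (elim exE conjE)
  note S = right_module.rsub_msum[OF M fin_len_rsub[OF A(1)] fin_len_rsub[OF B(1)]]
  have "insert x F \<subseteq> right_module.msum M A B" using S(2,3) A(3) B(3) by auto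
  then show ?case
    by (intro exI[of _ "right_module.msum M A B"] conjI fin_len_msum(1)[OF M A(1) B(1)] Psum[OF A(2) B(2)])
qed

section \<open>Artinian commutative rings have finite length\<close>

locale comm_artinian = cring R for R :: "('r, 'q) ring_scheme" (structure) +
  assumes artinian: "artinian_ring R"
begin

lemma r_idealI:
  assumes "I \<subseteq> carrier R" "\<zero> \<in> I" "\<And>x y. x \<in> I \<Longrightarrow> y \<in> I \<Longrightarrow> x \<oplus> y \<in> I"
    "\<And>x s. x \<in> I \<Longrightarrow> s \<in> carrier R \<Longrightarrow> s \<otimes> x \<in> I"
  shows "ideal I R"
proof (rule idealI)
  show "ring R" by (rule ring_axioms)
  show "subgroup I (add_monoid R)"
  proof (rule add.subgroupI)
    fix a assume a: "a \<in> I"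
    then have "\<ominus> a = (\<ominus> \<one>) \<otimes> a" using assms(1) by (auto simp: l_minus)
    then show "\<ominus> a \<in> I" using assms(4)[OF a, of "\<ominus> \<one>"] by simp
  qed (use assms in auto)
  show "x \<otimes> a \<in> I" "a \<otimes> x \<in> I" if "a \<in> I" "x \<in> carrier R" for a x
    using assms(1,4) that m_comm[of a x] by auto
qed

lemma idealD:
  assumes "ideal I R"
  shows "I \<subseteq> carrier R" "x \<in> I \<Longrightarrow> x \<in> carrier R" "\<zero> \<in> I" "x \<in> I \<Longrightarrow> y \<in> I \<Longrightarrow> x \<oplus> y \<in> I"
    "x \<in> I \<Longrightarrow> y \<in> I \<Longrightarrow> x \<ominus> y \<in> I" "x \<in> I \<Longrightarrow> s \<in> carrier R \<Longrightarrow> s \<otimes> x \<in> I"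
proof -
  interpret ideal I R by fact
  show "I \<subseteq> carrier R" "x \<in> I \<Longrightarrow> x \<in> carrier R" "\<zero> \<in> I" "x \<in> I \<Longrightarrow> y \<in> I \<Longrightarrow> x \<oplus> y \<in> I"
    "x \<in> I \<Longrightarrow> y \<in> I \<Longrightarrow> x \<ominus> y \<in> I" "x \<in> I \<Longrightarrow> s \<in> carrier R \<Longrightarrow> s \<otimes> x \<in> I"
    using I_l_closed by (auto simp: a_minus_def)
qed

lemma dcc_minimal:
  assumes "\<I> \<noteq> {}" "\<And>I. I \<in> \<I> \<Longrightarrow> ideal I R"
  obtains (min) I where "I \<in> \<I>" "\<And>J. J \<in> \<I> \<Longrightarrow> J \<subseteq> I \<Longrightarrow> J = I"
proof (rule ccontr)
  assume no: "\<not> thesis"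
  have *: "\<exists>J. J \<in> \<I> \<and> J \<subset> I" if I: "I \<in> \<I>" for I
  proof (rule ccontr)
    assume "\<nexists>J. J \<in> \<I> \<and> J \<subset> I"
    then have "J = I" if "J \<in> \<I>" "J \<subseteq> I" for J using that by blast
    then show False using no min[OF I] by blast
  qed
  obtain I0 where "I0 \<in> \<I>" using assms(1) by auto
  then have "\<exists>f. \<forall>n. f n \<in> \<I> \<and> f (Suc n) \<subset> f n"
    using * by (intro dependent_nat_choice) auto
  then obtain f where f: "\<And>n. f n \<in> \<I>" "\<And>n. f (Suc n) \<subset> f n" by blast
  then have "\<forall>n. ideal (f n) R" "\<forall>n. f (Suc n) \<subseteq> f n" using assms(2) by auto
  then obtain k where "\<forall>n\<ge>k. f n = f k" using artinian unfolding artinian_ring_def by blast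
  then have "f (Suc k) = f k" using le_SucI[OF order_refl[of k]] by blast
  then show False using f(2)[of k] by simp
qed

text \<open>The ideals whose quotient ring is a field, together with the whole ring.\<close>

definition field_ideal :: "'r set \<Rightarrow> bool"
  where "field_ideal m \<longleftrightarrow> ideal m R \<and> (\<forall>s\<in>carrier R. s \<in> m \<or> (\<exists>t\<in>carrier R. \<one> \<ominus> t \<otimes> s \<in> m))"

text \<open>\<open>comp_series I n\<close>: there is a chain of \<open>n\<close> ideals from \<open>I\<close> up to \<open>R\<close> whose factors are zero or simple.\<close>

inductive comp_series :: "'r set \<Rightarrow> nat \<Rightarrow> bool" where
  base: "comp_series (carrier R) 0"
| step: "comp_series I n \<Longrightarrow> ideal J R \<Longrightarrow> J \<subseteq> I \<Longrightarrow> r \<in> I \<Longrightarrow>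
    (\<And>i. i \<in> I \<Longrightarrow> \<exists>j\<in>J. \<exists>s\<in>carrier R. i = j \<oplus> s \<otimes> r) \<Longrightarrow>
    (\<And>s. s \<in> carrier R \<Longrightarrow> s \<otimes> r \<in> J \<or> (\<exists>t\<in>carrier R. (\<one> \<ominus> t \<otimes> s) \<otimes> r \<in> J)) \<Longrightarrow> comp_series J (Suc n)"

lemma comp_series_ideal: "comp_series I n \<Longrightarrow> ideal I R"
  by (induction rule: comp_series.induct) (auto intro: r_idealI)

text \<open>Equivalent to \<open>m I = I\<close> for all maximal ideals \<open>m\<close>, that is,
  to \<open>I\<close> having no simple quotient module. Quantifying over the ideals \<open>J\<close>
  that contain all products \<open>\<mu> \<otimes> i\<close> expresses this without products of
  ideals.\<close>

definition no_simple_factor :: "'r set \<Rightarrow> bool"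
  where "no_simple_factor I \<longleftrightarrow> (\<forall>m J. field_ideal m \<longrightarrow> ideal J R \<longrightarrow> J \<subseteq> I \<longrightarrow>
    (\<forall>\<mu>\<in>m. \<forall>i\<in>I. \<mu> \<otimes> i \<in> J) \<longrightarrow> J = I)"

text \<open>\<open>I/K\<close> is a nonzero vector space over the field \<open>R/m\<close>. Zorn's
  lemma supplies an ideal \<open>J\<close> that is maximal among those between \<open>K\<close> and
  \<open>I\<close> omitting \<open>x\<close>; modulo \<open>K\<close> it is a hyperplane
  complementary to the line through \<open>x\<close>.\<close>

lemma hyperplane:
  assumes I: "ideal I R" and K: "ideal K R" "K \<subset> I" and m: "field_ideal m"
    and mI: "\<And>\<mu> i. \<mu> \<in> m \<Longrightarrow> i \<in> I \<Longrightarrow> \<mu> \<otimes> i \<in> K"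
  obtains J x where "ideal J R" "J \<subset> I" "x \<in> I" "\<And>i. i \<in> I \<Longrightarrow> \<exists>j\<in>J. \<exists>s\<in>carrier R. i = j \<oplus> s \<otimes> x"
    "\<And>s. s \<in> carrier R \<Longrightarrow> s \<otimes> x \<in> J \<or> (\<exists>t\<in>carrier R. (\<one> \<ominus> t \<otimes> s) \<otimes> x \<in> J)"
proof -
  note [simp] = idealD(2)[OF I]
  obtain x where x: "x \<in> I" "x \<notin> K" using K by auto
  define \<A> where "\<A> = {J. ideal J R \<and> K \<subseteq> J \<and> J \<subseteq> I \<and> x \<notin> J}"
  have "\<exists>J\<in>\<A>. \<forall>X\<in>\<A>. J \<subseteq> X \<longrightarrow> X = J"
  proof (rule subset_Zorn_nonempty)
    show "\<A> \<noteq> {}" using K x by (auto simp: \<A>_def)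
    fix \<C> assume C: "\<C> \<noteq> {}" "subset.chain \<A> \<C>"
    then have CA: "\<C> \<subseteq> \<A>" and lin: "\<And>A B. A \<in> \<C> \<Longrightarrow> B \<in> \<C> \<Longrightarrow> A \<subseteq> B \<or> B \<subseteq> A"
      by (auto simp: subset.chain_def)
    have id: "ideal A R" if "A \<in> \<C>" for A using that CA by (auto simp: \<A>_def)
    have "ideal (\<Union>\<C>) R"
    proof (rule r_idealI)
      show "\<Union>\<C> \<subseteq> carrier R" using id idealD(1) by blast
      show "\<zero> \<in> \<Union>\<C>" using id idealD(3) C(1) by blast
      show "s \<otimes> y \<in> \<Union>\<C>" if "y \<in> \<Union>\<C>" "s \<in> carrier R" for y s using id idealD(6) that by blast
      fix y z assume "y \<in> \<Union>\<C>" "z \<in> \<Union>\<C>"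
      then obtain A B where "A \<in> \<C>" "B \<in> \<C>" "y \<in> A" "z \<in> B" by auto
      then show "y \<oplus> z \<in> \<Union>\<C>" using lin[of A B] id idealD(4) by blast
    qed
    then show "\<Union>\<C> \<in> \<A>" using CA C(1) by (auto simp: \<A>_def)
  qed
  then obtain J where J: "J \<in> \<A>" and max: "\<And>X. X \<in> \<A> \<Longrightarrow> J \<subseteq> X \<Longrightarrow> X = J" by blast
  have Jp: "ideal J R" "K \<subseteq> J" "J \<subseteq> I" "x \<notin> J" using J by (auto simp: \<A>_def)
  note [simp] = idealD(2)[OF Jp(1)]
  have xc: "x \<in> carrier R" using x by simp
  have gen: "\<exists>j\<in>J. \<exists>s\<in>carrier R. i = j \<oplus> s \<otimes> x" if i: "i \<in> I" for i
  proof (cases "i \<in> J")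
    case True
    then show ?thesis using xc by (intro bexI[of _ i] bexI[of _ \<zero>]) auto
  next
    case False
    have ic: "i \<in> carrier R" using i by simp
    define X where "X = {j \<oplus> s \<otimes> i | j s. j \<in> J \<and> s \<in> carrier R}"
    have X: "ideal X R"
    proof (rule r_idealI)
      show "X \<subseteq> carrier R" using ic by (auto simp: X_def)
      show "\<zero> \<in> X" unfolding X_def using ic idealD(3)[OF Jp(1)]
        by (auto intro!: exI[of _ \<zero>])
      fix y assume "y \<in> X"
      then obtain j s where y: "y = j \<oplus> s \<otimes> i" "j \<in> J" "s \<in> carrier R" by (auto simp: X_def)
      show "t \<otimes> y \<in> X" if t: "t \<in> carrier R" for t
      proof -
        have "t \<otimes> y = t \<otimes> j \<oplus> (t \<otimes> s) \<otimes> i" using y t ic by (simp add: r_distr m_assoc)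
        then show ?thesis unfolding X_def using idealD(6)[OF Jp(1) y(2) t] y t by blast
      qed
      fix z assume "z \<in> X"
      then obtain k t where z: "z = k \<oplus> t \<otimes> i" "k \<in> J" "t \<in> carrier R" by (auto simp: X_def)
      have "y \<oplus> z = (j \<oplus> k) \<oplus> (s \<oplus> t) \<otimes> i" using y z ic by (simp add: l_distr a_ac)
      then show "y \<oplus> z \<in> X" unfolding X_def using idealD(4)[OF Jp(1) y(2) z(2)] y z by blast
    qed
    have JX: "J \<subseteq> X"
    proof
      fix j assume j: "j \<in> J"
      then have "j = j \<oplus> \<zero> \<otimes> i" using ic by simp
      then show "j \<in> X" unfolding X_def using j by blast
    qed
    have "i = \<zero> \<oplus> \<one> \<otimes> i" using ic by simp
    then have iX: "i \<in> X" unfolding X_def using idealD(3)[OF Jp(1)] by blast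
    have "X \<subseteq> I" unfolding X_def using idealD(4,6)[OF I] Jp(3) i by blast
    then have "x \<in> X" using max[of X] JX iX False X Jp by (auto simp: \<A>_def)
    then obtain j s where js: "x = j \<oplus> s \<otimes> i" "j \<in> J" "s \<in> carrier R" by (auto simp: X_def)
    \<comment> \<open>Maximality of \<open>J\<close> has put \<open>x\<close> into
      \<open>J + R i\<close>. The coefficient \<open>s\<close> of \<open>i\<close> is invertible
      modulo \<open>m\<close>, so the equation can be solved for \<open>i\<close>.\<close>
    have "s \<notin> m"
    proof
      assume "s \<in> m"
      then have "s \<otimes> i \<in> J" using mI i Jp by auto
      then show False using js Jp idealD(4)[OF Jp(1)] by blast
    qed
    then obtain t where t: "t \<in> carrier R" "\<one> \<ominus> t \<otimes> s \<in> m"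
      using m js by (auto simp: field_ideal_def)
    have "(\<one> \<ominus> t \<otimes> s) \<otimes> i \<in> J" using mI[OF t(2) i] Jp by auto
    then have "(\<one> \<ominus> t \<otimes> s) \<otimes> i \<ominus> t \<otimes> j \<in> J"
      using idealD(5,6)[OF Jp(1)] js t by blast
    moreover have "i = ((\<one> \<ominus> t \<otimes> s) \<otimes> i \<ominus> t \<otimes> j) \<oplus> t \<otimes> x"
    proof -
      have "j \<in> carrier R" using js by simp
      then show ?thesis using js(3) t(1) ic unfolding js(1) by algebra
    qed
    ultimately show ?thesis using t by blast
  qed
  show ?thesis
  proof (rule that[OF Jp(1) _ x(1) gen])
    show "J \<subset> I" using Jp x by auto
    fix s assume s: "s \<in> carrier R"
    show "s \<otimes> x \<in> J \<or> (\<exists>t\<in>carrier R. (\<one> \<ominus> t \<otimes> s) \<otimes> x \<in> J)"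
      using m s mI[OF _ x(1)] Jp(2) unfolding field_ideal_def by blast
  qed
qed

text \<open>A minimal nonzero ideal \<open>A\<close> without simple factors is mapped onto itself by
  every element outside its annihilator \<open>p\<close>, so \<open>p\<close> is prime. An artinian
  domain is a field, hence \<open>p\<close> is one of the ideals tested by
  \<open>no_simple_factor\<close>; since it kills \<open>A\<close>, the test forces \<open>A\<close>
  to be zero.\<close>

lemma no_simple_factor_zero:
  assumes "ideal I R" "no_simple_factor I"
  shows "I = {\<zero>}"
proof (rule ccontr)
  assume "I \<noteq> {\<zero>}"
  then have "{A. ideal A R \<and> no_simple_factor A \<and> A \<noteq> {\<zero>}} \<noteq> {}" using assms by auto
  then obtain A where A: "ideal A R" "no_simple_factor A" "A \<noteq> {\<zero>}"
    and min: "\<And>B. ideal B R \<Longrightarrow> no_simple_factor B \<Longrightarrow> B \<noteq> {\<zero>} \<Longrightarrow> B \<subseteq> A \<Longrightarrow> B = A"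
    by (rule dcc_minimal) auto
  note Ac [simp] = idealD(2)[OF A(1)]
  define p where "p = {a \<in> carrier R. \<forall>x\<in>A. a \<otimes> x = \<zero>}"
  have p: "ideal p R"
    by (rule r_idealI) (auto simp: p_def l_distr m_assoc)
  note pD = idealD[OF p]
  have aA: "\<exists>y\<in>A. x = a \<otimes> y" if a: "a \<in> carrier R" "a \<notin> p" and x: "x \<in> A" for a x
  proof -
    \<comment> \<open>The ideal \<open>a A\<close> has no simple factor either, because an ideal
      below it pulls back along multiplication by \<open>a\<close> to an ideal below
      \<open>A\<close>. Minimality of \<open>A\<close> then gives \<open>a A = A\<close>.\<close>
    let ?B = "(\<lambda>y. a \<otimes> y) ` A"
    have "ideal ?B R"
    proof (rule r_idealI)
      show "\<zero> \<in> ?B" using idealD(3)[OF A(1)] a by (auto simp: image_iff intro!: bexI[of _ \<zero>])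
      fix u assume "u \<in> ?B"
      then obtain y where y: "y \<in> A" "u = a \<otimes> y" by auto
      show "s \<otimes> u \<in> ?B" if "s \<in> carrier R" for s
        using y that a idealD(6)[OF A(1)] by (intro image_eqI[of _ _ "s \<otimes> y"]) (auto simp: m_lcomm)
      fix v assume "v \<in> ?B"
      then obtain z where z: "z \<in> A" "v = a \<otimes> z" by auto
      show "u \<oplus> v \<in> ?B"
        using y z a idealD(4)[OF A(1)] by (intro image_eqI[of _ _ "y \<oplus> z"]) (auto simp: r_distr)
    qed (use a in auto)
    moreover have "no_simple_factor ?B"
      unfolding no_simple_factor_def
    proof (intro allI impI)
      fix m J assume m: "field_ideal m" and J: "ideal J R" "J \<subseteq> ?B" "\<forall>\<mu>\<in>m. \<forall>i\<in>?B. \<mu> \<otimes> i \<in> J"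
      have mc: "\<mu> \<in> carrier R" if "\<mu> \<in> m" for \<mu> using m that idealD(2) by (auto simp: field_ideal_def)
      let ?J = "{y \<in> A. a \<otimes> y \<in> J}"
      have "ideal ?J R"
        by (rule r_idealI) (use a idealD[OF A(1)] idealD[OF J(1)] in \<open>auto simp: r_distr m_lcomm\<close>)
      moreover have "\<mu> \<otimes> y \<in> ?J" if "\<mu> \<in> m" "y \<in> A" for \<mu> y
        using that mc a J(3) idealD(6)[OF A(1)] by (auto simp: m_lcomm[of a])
      ultimately have "?J = A" using A(2) m unfolding no_simple_factor_def by blast
      then show "J = ?B" using J(2) by auto
    qed
    moreover have "?B \<noteq> {\<zero>}" using a by (auto simp: p_def)
    moreover have "?B \<subseteq> A" using a idealD(6)[OF A(1)] by auto
    ultimately have "?B = A" by (rule min)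
    then show ?thesis using x by auto
  qed
  have mult: "a \<otimes> b \<notin> p" if "a \<in> carrier R" "a \<notin> p" "b \<in> carrier R" "b \<notin> p" for a b
  proof
    assume ab: "a \<otimes> b \<in> p"
    have "a \<otimes> x = \<zero>" if x: "x \<in> A" for x
    proof -
      obtain y where "y \<in> A" "x = b \<otimes> y" using aA[of b x] \<open>b \<in> _\<close> \<open>b \<notin> _\<close> x by auto
      then show ?thesis using ab \<open>a \<in> _\<close> \<open>b \<in> _\<close> by (simp add: p_def m_assoc[symmetric])
    qed
    then show False using that by (auto simp: p_def)
  qed
  have pR: "\<not> carrier R \<subseteq> p"
  proof
    assume "carrier R \<subseteq> p"
    then have "\<one> \<in> p" by auto
    then have "\<forall>x\<in>A. x = \<zero>" by (auto simp: p_def)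
    then show False using A(3) idealD(3)[OF A(1)] by blast
  qed
  \<comment> \<open>The chain condition is now applied modulo \<open>p\<close>: a minimal ideal
    \<open>J\<close> not contained in \<open>p\<close> is mapped onto itself by every element
    outside \<open>p\<close>.\<close>
  have "{J. ideal J R \<and> \<not> J \<subseteq> p} \<noteq> {}"
    using pR r_idealI[of "carrier R"] by auto
  then obtain J where J: "ideal J R" "\<not> J \<subseteq> p"
    and minJ: "\<And>B. ideal B R \<Longrightarrow> \<not> B \<subseteq> p \<Longrightarrow> B \<subseteq> J \<Longrightarrow> B = J"
    by (rule dcc_minimal) auto
  note Jc [simp] = idealD(2)[OF J(1)]
  have aJ: "\<exists>j\<in>J. i = a \<otimes> j" if a: "a \<in> carrier R" "a \<notin> p" and i: "i \<in> J" for a i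
  proof -
    let ?B = "(\<lambda>y. a \<otimes> y) ` J"
    have "ideal ?B R"
    proof (rule r_idealI)
      show "\<zero> \<in> ?B" using idealD(3)[OF J(1)] a by (auto simp: image_iff intro!: bexI[of _ \<zero>])
      fix u assume "u \<in> ?B"
      then obtain y where y: "y \<in> J" "u = a \<otimes> y" by auto
      show "s \<otimes> u \<in> ?B" if "s \<in> carrier R" for s
        using y that a idealD(6)[OF J(1)] by (intro image_eqI[of _ _ "s \<otimes> y"]) (auto simp: m_lcomm)
      fix v assume "v \<in> ?B"
      then obtain z where z: "z \<in> J" "v = a \<otimes> z" by auto
      show "u \<oplus> v \<in> ?B"
        using y z a idealD(4)[OF J(1)] by (intro image_eqI[of _ _ "y \<oplus> z"]) (auto simp: r_distr)
    qed (use a in auto)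
    moreover have "\<not> ?B \<subseteq> p"
    proof -
      obtain b where "b \<in> J" "b \<notin> p" using J(2) by auto
      then show ?thesis using mult[OF a, of b] by auto
    qed
    moreover have "?B \<subseteq> J" using a idealD(6)[OF J(1)] by auto
    ultimately have "?B = J" by (rule minJ)
    then show ?thesis using i by auto
  qed
  obtain b where b: "b \<in> J" "b \<notin> p" using J(2) by auto
  \<comment> \<open>Since \<open>b = b \<otimes> e\<close> and \<open>p\<close> is prime,
    \<open>e\<close> is congruent to \<open>\<one>\<close> modulo \<open>p\<close>. Writing
    \<open>e\<close> as a multiple of \<open>s\<close> then inverts \<open>s\<close> modulo
    \<open>p\<close>.\<close>
  obtain e where e: "e \<in> J" "b = b \<otimes> e" using aJ[of b b] b by auto
  have e1: "\<one> \<ominus> e \<in> p"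
  proof (rule ccontr)
    assume "\<one> \<ominus> e \<notin> p"
    then have "b \<otimes> (\<one> \<ominus> e) \<notin> p" using mult[of b "\<one> \<ominus> e"] b e by auto
    moreover have "b \<otimes> (\<one> \<ominus> e) = b \<ominus> b \<otimes> e" using b(1) e(1)
    proof -
      have "b \<in> carrier R" "e \<in> carrier R" using b e by auto
      then show ?thesis by algebra
    qed
    ultimately show False using e(2) pD(3) b(1) by (simp add: a_minus_def r_neg)
  qed
  have "field_ideal p"
    unfolding field_ideal_def
  proof (intro conjI p ballI)
    fix s assume s: "s \<in> carrier R"
    show "s \<in> p \<or> (\<exists>t\<in>carrier R. \<one> \<ominus> t \<otimes> s \<in> p)"
    proof (cases "s \<in> p")
      case False
      then obtain j where "j \<in> J" "e = s \<otimes> j" using aJ[OF s False e(1)] by auto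
      then show ?thesis using e1 s by (intro disjI2 bexI[of _ j]) (auto simp: m_comm)
    qed simp
  qed
  moreover have "ideal {\<zero>} R" by (rule r_idealI) auto
  moreover have "{\<zero>} \<subseteq> A" using idealD(3)[OF A(1)] by auto
  moreover have "\<forall>\<mu>\<in>p. \<forall>i\<in>A. \<mu> \<otimes> i \<in> {\<zero>}" by (auto simp: p_def)
  ultimately have "{\<zero>} = A" using A(2) unfolding no_simple_factor_def by blast
  then show False using A(3) by simp
qed

text \<open>A minimal ideal reached by such a series has no simple factor, since
  \<open>hyperplane\<close> would extend the series; so it is zero. In other words, a commutative
  artinian ring has finite length.\<close>

lemma comp_series_zero: "\<exists>n. comp_series {\<zero>} n"
proof -
  have "{I. \<exists>n. comp_series I n} \<noteq> {}" using comp_series.base by auto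
  then obtain I where I': "I \<in> {I. \<exists>n. comp_series I n}"
    and min': "\<And>J. J \<in> {I. \<exists>n. comp_series I n} \<Longrightarrow> J \<subseteq> I \<Longrightarrow> J = I"
    by (rule dcc_minimal) (auto intro: comp_series_ideal)
  then obtain n where I: "comp_series I n" by auto
  have min: "J = I" if "comp_series J m" "J \<subseteq> I" for J m using min'[of J] that by auto
  note id = comp_series_ideal[OF I]
  have "no_simple_factor I"
    unfolding no_simple_factor_def
  proof (intro allI impI, rule ccontr)
    fix m K assume m: "field_ideal m" "ideal K R" "K \<subseteq> I" "\<forall>\<mu>\<in>m. \<forall>i\<in>I. \<mu> \<otimes> i \<in> K" and "K \<noteq> I"
    then have "K \<subset> I" by auto
    from hyperplane[OF id m(2) this m(1)] m(4) obtain J x where J: "ideal J R" "J \<subset> I" "x \<in> I"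
      "\<And>i. i \<in> I \<Longrightarrow> \<exists>j\<in>J. \<exists>s\<in>carrier R. i = j \<oplus> s \<otimes> x"
      "\<And>s. s \<in> carrier R \<Longrightarrow> s \<otimes> x \<in> J \<or> (\<exists>t\<in>carrier R. (\<one> \<ominus> t \<otimes> s) \<otimes> x \<in> J)"
      by metis
    have "comp_series J (Suc n)" by (rule comp_series.step[OF I J(1) _ J(3-5)]) (use J in auto)
    then show False using min[of J] J(2) by auto
  qed
  then show ?thesis using no_simple_factor_zero[OF id] I by auto
qed

text \<open>\<open>U\<close> modulo \<open>U \<inter> V\<close> is zero or simple, so intersecting a
  chain with \<open>V\<close> loses at most one strict step. The loss is charged to the step at
  which the chain first leaves \<open>V\<close>; after that, equal intersections with
  \<open>V\<close> force equal members of the chain.\<close>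

lemma chain_len_simple_step:
  assumes N: "right_module R N" and U: "rsubmodule R N U" and V: "rsubmodule R N V"
    and y: "y \<in> U" and gen: "\<And>u. u \<in> U \<Longrightarrow> \<exists>v\<in>V. \<exists>s\<in>carrier R. u = v \<oplus>\<^bsub>N\<^esub> y \<triangleleft>\<^bsub>N\<^esub> s"
    and simple: "\<And>s. s \<in> carrier R \<Longrightarrow> y \<triangleleft>\<^bsub>N\<^esub> s \<in> V \<or> (\<exists>t\<in>carrier R. y \<triangleleft>\<^bsub>N\<^esub> (\<one> \<ominus> t \<otimes> s) \<in> V)"
    and "chain_len R N A n" "A \<subseteq> U"
  shows "\<exists>p. chain_len R N (A \<inter> V) p \<and> n \<le> p + (if A \<subseteq> V then 0 else 1)"
  using assms(7,8)
proof (induction rule: chain_len.induct)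
  interpret N: right_module R N by fact
  case (zero A)
  then show ?case using chain_len.zero N.rsub_Int[OF zero(1) V] by fastforce
next
  interpret N: right_module R N by fact
  case (Suc B n A)
  then obtain p where p: "chain_len R N (B \<inter> V) p" "n \<le> p + (if B \<subseteq> V then 0 else 1)" by auto
  note rA = Suc.hyps(2) and rB = chain_len_rsub[OF Suc.hyps(1)]
  have rAV: "rsubmodule R N (A \<inter> V)" by (rule N.rsub_Int[OF rA V])
  have up: "chain_len R N (A \<inter> V) p"
    by (rule chain_len_mono[OF p(1) rAV]) (use Suc in auto)
  show ?case
  proof (cases "B \<subseteq> V")
    case B: True
    show ?thesis
    proof (cases "A \<subseteq> V")
      case True
      then have "chain_len R N (A \<inter> V) (Suc p)"
        by (intro chain_len.Suc[OF p(1) rAV]) (use B Suc in auto)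
      then show ?thesis using p B True by (intro exI[of _ "Suc p"]) auto
    next
      case False
      then show ?thesis using p B up by (intro exI[of _ p]) auto
    qed
  next
    case False
    then obtain b where b: "b \<in> B" "b \<notin> V" by auto
    have "B \<inter> V \<subset> A \<inter> V"
    proof (rule ccontr)
      assume "\<not> B \<inter> V \<subset> A \<inter> V"
      then have eq: "B \<inter> V = A \<inter> V" using Suc.hyps(3) by auto
      have yc: "y \<in> carrier N" using y N.rsubD(2)[OF U] by auto
      obtain v s where vs: "v \<in> V" "s \<in> carrier R" "b = v \<oplus>\<^bsub>N\<^esub> y \<triangleleft>\<^bsub>N\<^esub> s"
        using gen[of b] b Suc.hyps(3) Suc.prems by auto
      have "y \<triangleleft>\<^bsub>N\<^esub> s \<notin> V" using vs b N.rsubD(4)[OF V] by auto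
      then obtain t where t: "t \<in> carrier R" "y \<triangleleft>\<^bsub>N\<^esub> (\<one> \<ominus> t \<otimes> s) \<in> V" using simple vs(2) by auto
      have "a \<in> B" if a: "a \<in> A" for a
      proof -
        obtain w r where wr: "w \<in> V" "r \<in> carrier R" "a = w \<oplus>\<^bsub>N\<^esub> y \<triangleleft>\<^bsub>N\<^esub> r"
          using gen[of a] a Suc.prems by auto
        have c: "w \<in> carrier N" "v \<in> carrier N" using wr vs N.rsubD(2)[OF V] by auto
        \<comment> \<open>Because \<open>y (1 - t s)\<close> lies in \<open>V\<close>, this identity
          expresses \<open>y r\<close> modulo \<open>V\<close> through \<open>y s\<close>, and hence
          through the element \<open>b\<close> of \<open>B\<close>.\<close>
        have "r = (\<one> \<ominus> t \<otimes> s) \<otimes> r \<oplus> s \<otimes> (t \<otimes> r)"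
          using t(1) vs(2) wr(2) by algebra
        then have "y \<triangleleft>\<^bsub>N\<^esub> r = (y \<triangleleft>\<^bsub>N\<^esub> (\<one> \<ominus> t \<otimes> s)) \<triangleleft>\<^bsub>N\<^esub> r \<oplus>\<^bsub>N\<^esub> (y \<triangleleft>\<^bsub>N\<^esub> s) \<triangleleft>\<^bsub>N\<^esub> (t \<otimes> r)"
          using t(1) vs(2) wr(2) yc by (metis N.ract_assoc N.ract_r_distr m_closed minus_closed one_closed)
        moreover have "y \<triangleleft>\<^bsub>N\<^esub> s = b \<ominus>\<^bsub>N\<^esub> v"
          using vs c yc N.add_minus_cancel[of "y \<triangleleft>\<^bsub>N\<^esub> s" v] by (simp add: N.M.a_comm)
        ultimately have a2: "a = w \<oplus>\<^bsub>N\<^esub> ((y \<triangleleft>\<^bsub>N\<^esub> (\<one> \<ominus> t \<otimes> s)) \<triangleleft>\<^bsub>N\<^esub> r \<oplus>\<^bsub>N\<^esub> (b \<ominus>\<^bsub>N\<^esub> v) \<triangleleft>\<^bsub>N\<^esub> (t \<otimes> r))"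
          using wr by simp
        define d where "d = b \<triangleleft>\<^bsub>N\<^esub> (t \<otimes> r)"
        define z where "z = w \<oplus>\<^bsub>N\<^esub> ((y \<triangleleft>\<^bsub>N\<^esub> (\<one> \<ominus> t \<otimes> s)) \<triangleleft>\<^bsub>N\<^esub> r \<ominus>\<^bsub>N\<^esub> v \<triangleleft>\<^bsub>N\<^esub> (t \<otimes> r))"
        have dB: "d \<in> B" unfolding d_def using N.rsubD(7)[OF rB b(1)] t wr by auto
        have zV: "z \<in> V" unfolding z_def using t vs wr N.rsubD(4,6,7)[OF V] by auto
        have bc: "b \<in> carrier N" "d \<in> carrier N" "z \<in> carrier N"
          using b N.rsubD(2)[OF rB] dB N.rsubD(2)[OF V] zV by auto
        have "a = z \<oplus>\<^bsub>N\<^esub> d"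
        proof -
          define e where "e = (y \<triangleleft>\<^bsub>N\<^esub> (\<one> \<ominus> t \<otimes> s)) \<triangleleft>\<^bsub>N\<^esub> r"
          define f where "f = v \<triangleleft>\<^bsub>N\<^esub> (t \<otimes> r)"
          have ef: "e \<in> carrier N" "f \<in> carrier N" using t vs(2) wr c yc by (auto simp: e_def f_def)
          have "(b \<ominus>\<^bsub>N\<^esub> v) \<triangleleft>\<^bsub>N\<^esub> (t \<otimes> r) = d \<ominus>\<^bsub>N\<^esub> f"
            using N.minus_ract[OF bc(1) c(2), of "t \<otimes> r"] t wr by (simp add: d_def f_def)
          then have "a = w \<oplus>\<^bsub>N\<^esub> (e \<oplus>\<^bsub>N\<^esub> (d \<ominus>\<^bsub>N\<^esub> f))" "z = w \<oplus>\<^bsub>N\<^esub> (e \<ominus>\<^bsub>N\<^esub> f)"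
            by (simp_all add: a2 z_def e_def f_def)
          then show ?thesis using ef c(1) bc(2) by (simp add: a_minus_def N.M.a_ac)
        qed
        then have "z = a \<ominus>\<^bsub>N\<^esub> d" using bc by (simp add: N.add_minus_cancel)
        then have "z \<in> A" using a dB Suc.hyps(3) N.rsubD(6)[OF rA] by auto
        then have "z \<in> B" using zV eq by auto
        then show "a \<in> B" using \<open>a = z \<oplus>\<^bsub>N\<^esub> d\<close> dB N.rsubD(4)[OF rB] by auto
      qed
      then show False using Suc.hyps(3) by auto
    qed
    then have "chain_len R N (A \<inter> V) (Suc p)" by (intro chain_len.Suc[OF p(1) rAV])
    moreover have "\<not> A \<subseteq> V" using False Suc.hyps(3) by auto
    ultimately show ?thesis using p False by (intro exI[of _ "Suc p"]) auto
  qed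
qed

text \<open>Acting on \<open>x\<close> maps a composition series of \<open>R\<close> to a series of
  the cyclic module, and each factor adds at most one to the length.\<close>

lemma fin_len_cyclic:
  assumes N: "right_module R N" and x: "x \<in> carrier N"
  shows "fin_len R N ((\<lambda>r. x \<triangleleft>\<^bsub>N\<^esub> r) ` carrier R)"
proof -
  interpret N: right_module R N by fact
  let ?c = "\<lambda>I. (\<lambda>r. x \<triangleleft>\<^bsub>N\<^esub> r) ` I"
  have rs: "rsubmodule R N (?c I)" if I: "ideal I R" for I
  proof (rule N.rsubI)
    show "?c I \<subseteq> carrier N" using idealD(2)[OF I] x by auto
    show "\<zero>\<^bsub>N\<^esub> \<in> ?c I" using idealD(3)[OF I] x by (auto simp: image_iff intro!: bexI[of _ \<zero>])
    fix u assume "u \<in> ?c I"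
    then obtain i where i: "i \<in> I" "u = x \<triangleleft>\<^bsub>N\<^esub> i" by auto
    note ic = idealD(2)[OF I i(1)]
    show "u \<triangleleft>\<^bsub>N\<^esub> s \<in> ?c I" if "s \<in> carrier R" for s
      using i ic that x idealD(6)[OF I i(1) that]
      by (intro image_eqI[of _ _ "s \<otimes> i"]) (auto simp: N.ract_assoc[symmetric] m_comm)
    fix v assume "v \<in> ?c I"
    then obtain j where j: "j \<in> I" "v = x \<triangleleft>\<^bsub>N\<^esub> j" by auto
    then show "u \<oplus>\<^bsub>N\<^esub> v \<in> ?c I"
      using i ic x idealD(2)[OF I j(1)] idealD(4)[OF I i(1) j(1)]
      by (intro image_eqI[of _ _ "i \<oplus> j"]) (auto simp: N.ract_r_distr)
  qed
  obtain n where n: "comp_series {\<zero>} n" using comp_series_zero by auto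
  \<comment> \<open>\<open>comp_series\<close> is built from \<open>R\<close> downwards, whereas
    finiteness spreads from the zero ideal upwards. The induction statement is therefore an
    implication that leads back to \<open>R\<close>.\<close>
  have "fin_len R N (?c I) \<Longrightarrow> fin_len R N (?c (carrier R))" if "comp_series I n" for I n
    using that
  proof (induction rule: comp_series.induct)
    case (step I n J r)
    note I = comp_series_ideal[OF step.hyps(1)]
    have rc: "r \<in> carrier R" using step.hyps(4) idealD(2)[OF I] by auto
    have "fin_len R N (?c I)"
    proof (rule fin_lenI[OF rs[OF I]])
      fix n assume c: "chain_len R N (?c I) n"
      have "\<exists>p. chain_len R N (?c I \<inter> ?c J) p \<and> n \<le> p + (if ?c I \<subseteq> ?c J then 0 else 1)"
      proof (rule chain_len_simple_step[OF N rs[OF I] rs[OF step.hyps(2)] _ _ _ c])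
        show "x \<triangleleft>\<^bsub>N\<^esub> r \<in> ?c I" using step.hyps(4) by auto
        fix u assume "u \<in> ?c I"
        then obtain i where i: "i \<in> I" "u = x \<triangleleft>\<^bsub>N\<^esub> i" by auto
        obtain j s where js: "j \<in> J" "s \<in> carrier R" "i = j \<oplus> s \<otimes> r" using step.hyps(5)[OF i(1)] by auto
        have "u = x \<triangleleft>\<^bsub>N\<^esub> j \<oplus>\<^bsub>N\<^esub> (x \<triangleleft>\<^bsub>N\<^esub> r) \<triangleleft>\<^bsub>N\<^esub> s"
          using i js x rc idealD(2)[OF step.hyps(2) js(1)]
          by (simp add: N.ract_r_distr N.ract_assoc[symmetric] m_comm)
        then show "\<exists>v\<in>?c J. \<exists>s\<in>carrier R. u = v \<oplus>\<^bsub>N\<^esub> (x \<triangleleft>\<^bsub>N\<^esub> r) \<triangleleft>\<^bsub>N\<^esub> s"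
          using js by blast
      next
        fix s assume s: "s \<in> carrier R"
        have eq: "(x \<triangleleft>\<^bsub>N\<^esub> r) \<triangleleft>\<^bsub>N\<^esub> t = x \<triangleleft>\<^bsub>N\<^esub> (t \<otimes> r)" if "t \<in> carrier R" for t
          using that rc x by (simp add: N.ract_assoc[symmetric] m_comm)
        from step.hyps(6)[OF s]
        show "(x \<triangleleft>\<^bsub>N\<^esub> r) \<triangleleft>\<^bsub>N\<^esub> s \<in> ?c J \<or> (\<exists>t\<in>carrier R. (x \<triangleleft>\<^bsub>N\<^esub> r) \<triangleleft>\<^bsub>N\<^esub> (\<one> \<ominus> t \<otimes> s) \<in> ?c J)"
        proof
          assume "s \<otimes> r \<in> J"
          then show ?thesis using eq[OF s] by auto
        next
          assume "\<exists>t\<in>carrier R. (\<one> \<ominus> t \<otimes> s) \<otimes> r \<in> J"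
          then obtain t where t: "t \<in> carrier R" "(\<one> \<ominus> t \<otimes> s) \<otimes> r \<in> J" by auto
          then have "(x \<triangleleft>\<^bsub>N\<^esub> r) \<triangleleft>\<^bsub>N\<^esub> (\<one> \<ominus> t \<otimes> s) \<in> ?c J"
            using eq[of "\<one> \<ominus> t \<otimes> s"] s by auto
          then show ?thesis using t by auto
        qed
      qed simp
      then obtain p where p: "chain_len R N (?c I \<inter> ?c J) p" "n \<le> p + 1"
        by (auto split: if_splits)
      have "chain_len R N (?c J) p" by (rule chain_len_mono[OF p(1) rs[OF step.hyps(2)]]) auto
      then show "n \<le> len R N (?c J) + 1" using len_chain(2)[OF step.prems, of p] p(2) by simp
    qed
    then show ?case by (rule step.IH)
  qed auto
  moreover have "?c {\<zero>} = {\<zero>\<^bsub>N\<^esub>}" using x by auto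
  ultimately show ?thesis using n len_zero(1)[OF N] by metis
qed

lemma fin_len_fin_gen:
  assumes N: "right_module R N" and fg: "fin_gen R N"
  shows "fin_len R N (carrier N)"
proof -
  interpret N: right_module R N by fact
  obtain S where S: "finite S" "S \<subseteq> carrier N" "\<And>U. rsubmodule R N U \<Longrightarrow> S \<subseteq> U \<Longrightarrow> U = carrier N"
    using fg by (auto simp: fin_gen_def)
  have "\<exists>A. fin_len R N A \<and> True \<and> S \<subseteq> A"
  proof (rule fin_len_generated[OF N])
    fix x assume "x \<in> S"
    then have "x \<in> carrier N" using S by auto
    then show "\<exists>A. fin_len R N A \<and> True \<and> x \<in> A"
      using fin_len_cyclic[OF N, of x]
      by (intro exI[of _ "(\<lambda>r. x \<triangleleft>\<^bsub>N\<^esub> r) ` carrier R"]) (auto simp: image_iff intro!: bexI[of _ \<one>])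
  qed (use S in auto)
  then obtain A where "fin_len R N A" "S \<subseteq> A" by auto
  then show ?thesis using S(3)[OF fin_len_rsub] by metis
qed

end

section \<open>Finitely generated modules over an artin algebra\<close>

sublocale artin_algebra \<subseteq> comm_artinian R
  by unfold_locales (rule artinian)

context artin_algebra
begin

text \<open>Restriction of scalars along the structure map from \<open>R\<close> to
  \<open>\<Lambda>\<close>. The result is again a right module, so the theory of length applies to
  it over \<open>R\<close>.\<close>

definition res :: "('a, 'm) rmodule \<Rightarrow> ('r, 'm) rmodule"
  where "res M = \<lparr>carrier = carrier M, mult = undefined, one = undefined, zero = \<zero>\<^bsub>M\<^esub>, add = add M,
    ract = (\<lambda>x r. x \<triangleleft>\<^bsub>M\<^esub> (r \<odot>\<^bsub>\<Lambda>\<^esub> \<one>\<^bsub>\<Lambda>\<^esub>))\<rparr>"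

lemma res_simps [simp]:
  "carrier (res M) = carrier M" "\<zero>\<^bsub>res M\<^esub> = \<zero>\<^bsub>M\<^esub>" "x \<oplus>\<^bsub>res M\<^esub> y = x \<oplus>\<^bsub>M\<^esub> y"
  "x \<triangleleft>\<^bsub>res M\<^esub> r = x \<triangleleft>\<^bsub>M\<^esub> (r \<odot>\<^bsub>\<Lambda>\<^esub> \<one>\<^bsub>\<Lambda>\<^esub>)"
  by (simp_all add: res_def)

lemma res_minus [simp]: "\<ominus>\<^bsub>res M\<^esub> x = \<ominus>\<^bsub>M\<^esub> x" "x \<ominus>\<^bsub>res M\<^esub> y = x \<ominus>\<^bsub>M\<^esub> y"
proof -
  have *: "\<ominus>\<^bsub>res M\<^esub> x = \<ominus>\<^bsub>M\<^esub> x" for x by (simp add: a_inv_def m_inv_def res_def)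
  show "\<ominus>\<^bsub>res M\<^esub> x = \<ominus>\<^bsub>M\<^esub> x" "x \<ominus>\<^bsub>res M\<^esub> y = x \<ominus>\<^bsub>M\<^esub> y"
    by (simp_all add: a_minus_def *)
qed

lemma res_sub: "res (sub M U) = sub (res M) U"
  by (simp add: res_def sub_def)

lemma res_hker [simp]: "hker (res M) (res N) f = hker M N f"
  by (simp add: hker_def)

lemma smult_one_mult: "r \<in> carrier R \<Longrightarrow> a \<in> carrier \<Lambda> \<Longrightarrow> (r \<odot>\<^bsub>\<Lambda>\<^esub> \<one>\<^bsub>\<Lambda>\<^esub>) \<otimes>\<^bsub>\<Lambda>\<^esub> a = r \<odot>\<^bsub>\<Lambda>\<^esub> a"
  and mult_smult_one: "r \<in> carrier R \<Longrightarrow> a \<in> carrier \<Lambda> \<Longrightarrow> a \<otimes>\<^bsub>\<Lambda>\<^esub> (r \<odot>\<^bsub>\<Lambda>\<^esub> \<one>\<^bsub>\<Lambda>\<^esub>) = r \<odot>\<^bsub>\<Lambda>\<^esub> a"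
  by (simp_all add: smult_mult_left smult_mult_right)

lemma right_module_res:
  assumes "right_module \<Lambda> M"
  shows "right_module R (res M)"
proof -
  interpret M: right_module \<Lambda> M by fact
  have "abelian_group (res M)"
  proof (rule abelian_groupI)
    fix x assume "x \<in> carrier (res M)"
    then show "\<exists>y\<in>carrier (res M). y \<oplus>\<^bsub>res M\<^esub> x = \<zero>\<^bsub>res M\<^esub>"
      by (intro bexI[of _ "\<ominus>\<^bsub>M\<^esub> x"]) (auto simp: M.M.l_neg)
  qed (auto simp: M.M.a_ac)
  moreover have "right_module_axioms R (res M)"
  proof
    fix x a b assume x: "x \<in> carrier (res M)" and a: "a \<in> carrier R" and b: "b \<in> carrier R"
    have "(a \<otimes>\<^bsub>R\<^esub> b) \<odot>\<^bsub>\<Lambda>\<^esub> \<one>\<^bsub>\<Lambda>\<^esub> = (a \<odot>\<^bsub>\<Lambda>\<^esub> \<one>\<^bsub>\<Lambda>\<^esub>) \<otimes>\<^bsub>\<Lambda>\<^esub> (b \<odot>\<^bsub>\<Lambda>\<^esub> \<one>\<^bsub>\<Lambda>\<^esub>)"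
      using a b by (simp add: smult_one_mult smult_assoc1)
    then show "x \<triangleleft>\<^bsub>res M\<^esub> (a \<otimes>\<^bsub>R\<^esub> b) = (x \<triangleleft>\<^bsub>res M\<^esub> a) \<triangleleft>\<^bsub>res M\<^esub> b"
      using x a b by (simp add: M.ract_assoc)
  qed (auto simp: M.ract_l_distr M.ract_r_distr smult_l_distr)
  ultimately show ?thesis by (intro right_module.intro R.ring_axioms)
qed

lemma rhom_res: "f \<in> rhom \<Lambda> M N \<Longrightarrow> f \<in> rhom R (res M) (res N)"
  by (auto simp: rhom_def)

lemma rsub_res:
  assumes "right_module \<Lambda> M" "rsubmodule \<Lambda> M U"
  shows "rsubmodule R (res M) U"
proof -
  interpret M: right_module \<Lambda> M by fact
  interpret r: right_module R "res M" by (rule right_module_res[OF assms(1)])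
  show ?thesis by (rule r.rsubI) (use M.rsubD[OF assms(2)] in auto)
qed

lemma msum_res:
  assumes "right_module \<Lambda> M"
  shows "right_module.msum (res M) A B = right_module.msum M A B"
  using right_module.msum_def[OF assms] right_module.msum_def[OF right_module_res[OF assms]] by simp

definition regular :: "('a, 'a) rmodule"
  where "regular = \<lparr>carrier = carrier \<Lambda>, mult = undefined, one = undefined, zero = \<zero>\<^bsub>\<Lambda>\<^esub>,
    add = add \<Lambda>, ract = mult \<Lambda>\<rparr>"

lemma regular_simps [simp]:
  "carrier regular = carrier \<Lambda>" "\<zero>\<^bsub>regular\<^esub> = \<zero>\<^bsub>\<Lambda>\<^esub>" "x \<oplus>\<^bsub>regular\<^esub> y = x \<oplus>\<^bsub>\<Lambda>\<^esub> y" "x \<triangleleft>\<^bsub>regular\<^esub> a = x \<otimes>\<^bsub>\<Lambda>\<^esub> a"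
  by (simp_all add: regular_def)

lemma regular_minus: "\<ominus>\<^bsub>regular\<^esub> x = \<ominus>\<^bsub>\<Lambda>\<^esub> x"
  by (simp add: a_inv_def m_inv_def)

lemma right_module_regular: "right_module \<Lambda> regular"
proof -
  have "abelian_group regular"
  proof (rule abelian_groupI)
    fix x assume "x \<in> carrier regular"
    then show "\<exists>y\<in>carrier regular. y \<oplus>\<^bsub>regular\<^esub> x = \<zero>\<^bsub>regular\<^esub>"
      by (intro bexI[of _ "\<ominus>\<^bsub>\<Lambda>\<^esub> x"]) (auto simp: M.l_neg)
  qed (auto simp: M.a_ac)
  moreover have "right_module_axioms \<Lambda> regular"
    by unfold_locales (auto simp: \<Lambda>.l_distr \<Lambda>.r_distr \<Lambda>.m_assoc)
  ultimately show ?thesis by (intro right_module.intro \<Lambda>.ring_axioms)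
qed

lemma fin_len_regular: "fin_len R (res regular) (carrier \<Lambda>)"
proof -
  obtain S where S: "finite S" "S \<subseteq> carrier \<Lambda>" "\<And>U. submodule U R \<Lambda> \<Longrightarrow> S \<subseteq> U \<Longrightarrow> U = carrier \<Lambda>"
    using fin_gen_over_base by auto
  have "U = carrier \<Lambda>" if U: "rsubmodule R (res regular) U" "S \<subseteq> U" for U
  proof (rule S(3)[OF _ U(2)])
    note rs = right_module.rsubD[OF right_module_res[OF right_module_regular] U(1)]
    have sg: "subgroup U (add_monoid \<Lambda>)"
      using rs by (intro M.add.subgroupI) (auto simp: regular_minus)
    show "submodule U R \<Lambda>"
    proof (rule submodule.intro[OF sg], unfold_locales)
      fix a x assume a: "a \<in> carrier R" "x \<in> U"
      then have "x \<in> carrier \<Lambda>" using subgroup.subset[OF sg] by auto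
      then show "a \<odot>\<^bsub>\<Lambda>\<^esub> x \<in> U" using U(1) a by (auto simp: rsubmodule_def mult_smult_one)
    qed
  qed
  then have "fin_gen R (res regular)" using S(1,2) by (auto simp: fin_gen_def)
  then show ?thesis using fin_len_fin_gen[OF right_module_res[OF right_module_regular]] by simp
qed

text \<open>Finite length passes to submodules, which is what finite generation is replaced for.
  Forwards, a cyclic submodule is an image of the regular module, which has finite length over
  \<open>R\<close>. Backwards, a finite set whose generated submodule has maximal length generates
  everything.\<close>

lemma fin_gen_iff_fin_len:
  fixes M :: "('a, 'm) rmodule"
  assumes M: "right_module \<Lambda> M"
  shows "fin_gen \<Lambda> M \<longleftrightarrow> fin_len R (res M) (carrier M)"
proof -
  interpret M: right_module \<Lambda> M by fact
  note rM = right_module_res[OF M]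
  show ?thesis
  proof
    assume "fin_gen \<Lambda> M"
    then obtain S where S: "finite S" "S \<subseteq> carrier M" "\<And>U. rsubmodule \<Lambda> M U \<Longrightarrow> S \<subseteq> U \<Longrightarrow> U = carrier M"
      by (auto simp: fin_gen_def)
    have "\<exists>A. fin_len R (res M) A \<and> rsubmodule \<Lambda> M A \<and> S \<subseteq> A"
    proof (rule fin_len_generated[OF rM])
      fix x assume "x \<in> S"
      then have x: "x \<in> carrier M" using S by auto
      let ?f = "\<lambda>a. x \<triangleleft>\<^bsub>M\<^esub> a"
      have f: "?f \<in> rhom \<Lambda> regular M"
        using x by (intro rhomI) (auto simp: M.ract_r_distr M.ract_assoc)
      have "fin_len R (res M) (?f ` carrier \<Lambda>)"
        using fin_len_additive(1)[OF right_module_res[OF right_module_regular] rM rhom_res[OF f]] fin_len_regular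
        by simp
      moreover have "x \<in> ?f ` carrier \<Lambda>" by (rule image_eqI[of _ _ "\<one>\<^bsub>\<Lambda>\<^esub>"]) (simp_all add: x)
      ultimately show "\<exists>A. fin_len R (res M) A \<and> rsubmodule \<Lambda> M A \<and> x \<in> A"
        using M.rsub_cyclic[OF x] by (intro exI[of _ "?f ` carrier \<Lambda>"] conjI)
    next
      show "rsubmodule \<Lambda> M {\<zero>\<^bsub>res M\<^esub>}" using M.rsub_zero by simp
      fix A B assume "rsubmodule \<Lambda> M A" "rsubmodule \<Lambda> M B"
      then show "rsubmodule \<Lambda> M (right_module.msum (res M) A B)" by (simp add: msum_res[OF M] M.rsub_msum)
    qed (rule S(1))
    then obtain A where A: "fin_len R (res M) A" "rsubmodule \<Lambda> M A" "S \<subseteq> A" by blast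
    then show "fin_len R (res M) (carrier M)" using S(3)[OF A(2,3)] by simp
  next
    assume fl: "fin_len R (res M) (carrier M)"
    define G where "G S = \<Inter>{U. rsubmodule \<Lambda> M U \<and> S \<subseteq> U}" for S
    have G: "rsubmodule \<Lambda> M (G S)" "S \<subseteq> G S" if "S \<subseteq> carrier M" for S
    proof -
      show "rsubmodule \<Lambda> M (G S)" unfolding G_def
        by (rule M.rsub_Inter) (use that M.rsub_carrier in auto)
      show "S \<subseteq> G S" by (auto simp: G_def)
    qed
    have Gmin: "G S \<subseteq> U" if "rsubmodule \<Lambda> M U" "S \<subseteq> U" for S U using that by (auto simp: G_def)
    have Gfl: "len R (res M) (G S) < Suc (len R (res M) (carrier M))" if "S \<subseteq> carrier M" for S
      using fin_len_mono(2)[OF fl rsub_res[OF M G(1)[OF that]]] M.rsubD(1)[OF G(1)[OF that]] by simp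
    have "\<exists>S. (finite S \<and> S \<subseteq> carrier M) \<and>
        (\<forall>S'. finite S' \<and> S' \<subseteq> carrier M \<longrightarrow> len R (res M) (G S') \<le> len R (res M) (G S))"
    proof (rule ex_has_greatest_nat[of _ "{}" _ "Suc (len R (res M) (carrier M))"])
      show "finite {} \<and> {} \<subseteq> carrier M" by simp
      show "\<forall>S. finite S \<and> S \<subseteq> carrier M \<longrightarrow> len R (res M) (G S) < Suc (len R (res M) (carrier M))"
        using Gfl by simp
    qed
    then obtain S where S: "finite S" "S \<subseteq> carrier M"
      and Smax: "\<forall>S'. finite S' \<and> S' \<subseteq> carrier M \<longrightarrow> len R (res M) (G S') \<le> len R (res M) (G S)"
      by (elim exE conjE)
    have "G S = carrier M"
    proof (rule ccontr)
      assume "G S \<noteq> carrier M"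
      then obtain x where x: "x \<in> carrier M" "x \<notin> G S" using M.rsubD(1)[OF G(1)[OF S(2)]] by auto
      have xS: "insert x S \<subseteq> carrier M" using x S by auto
      have "G S \<subseteq> G (insert x S)" by (auto simp: G_def)
      moreover have "x \<in> G (insert x S)" using G(2)[OF xS] by auto
      moreover have "fin_len R (res M) (G (insert x S))"
        using fin_len_mono(1)[OF fl rsub_res[OF M G(1)[OF xS]]] M.rsubD(1)[OF G(1)[OF xS]] by simp
      ultimately have "len R (res M) (G S) < len R (res M) (G (insert x S))"
        using fin_len_mono(3)[OF _ rsub_res[OF M G(1)[OF S(2)]]] x by blast
      then show False using Smax[rule_format, of "insert x S"] S(1) xS by simp
    qed
    then have "U = carrier M" if "rsubmodule \<Lambda> M U" "S \<subseteq> U" for U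
      using Gmin[OF that] M.rsubD(1)[OF that(1)] by auto
    then show "fin_gen \<Lambda> M" using S(1,2) by (auto simp: fin_gen_def)
  qed
qed

text \<open>Length over \<open>R\<close> instead of over \<open>\<Lambda>\<close>, so that it also
  bounds \<open>R\<close>-submodules that are not stable under \<open>\<Lambda>\<close>.\<close>

definition lg :: "('a, 'm) rmodule \<Rightarrow> nat"
  where "lg M = len R (res M) (carrier M)"

lemma modsD: "M \<in> fg_mods \<Lambda> \<Longrightarrow> right_module \<Lambda> M" "M \<in> fg_mods \<Lambda> \<Longrightarrow> fin_len R (res M) (carrier M)"
  using fin_gen_iff_fin_len[of M] by (auto simp: fg_mods_def)

lemma modsI: "right_module \<Lambda> M \<Longrightarrow> fin_len R (res M) (carrier M) \<Longrightarrow> M \<in> fg_mods \<Lambda>"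
  using fin_gen_iff_fin_len[of M] by (auto simp: fg_mods_def)

lemma sub_mods:
  assumes M: "M \<in> fg_mods \<Lambda>" and U: "rsubmodule \<Lambda> M U"
  shows "sub M U \<in> fg_mods \<Lambda>" "lg (sub M U) \<le> lg M" "U \<noteq> carrier M \<Longrightarrow> lg (sub M U) < lg M"
    "lg (sub M U) = len R (res M) U"
proof -
  interpret M: right_module \<Lambda> M by (rule modsD[OF M])
  note rU = rsub_res[OF modsD(1)[OF M] U]
  have UM: "U \<subseteq> carrier M" using M.rsubD[OF U] by simp
  note fs = fin_len_sub[OF right_module_res[OF modsD(1)[OF M]] rU order_refl]
  note fm = fin_len_mono[OF modsD(2)[OF M] rU UM]
  show "sub M U \<in> fg_mods \<Lambda>"
    by (rule modsI[OF M.right_module_sub[OF U]]) (simp add: res_sub fs fm)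
  show eq: "lg (sub M U) = len R (res M) U" by (simp add: lg_def res_sub fs)
  show "lg (sub M U) \<le> lg M" "U \<noteq> carrier M \<Longrightarrow> lg (sub M U) < lg M"
    using fm(2,3) by (simp_all only: eq) (simp_all add: lg_def)
qed

lemma lg_eq_zero:
  assumes M: "M \<in> fg_mods \<Lambda>" "lg M = 0"
  shows "carrier M = {\<zero>\<^bsub>M\<^esub>}"
  using len_eq_zero[OF right_module_res[OF modsD(1)] modsD(2)] M by (simp add: lg_def)

lemma lg_hom:
  assumes M: "M \<in> fg_mods \<Lambda>" and N: "right_module \<Lambda> N" and f: "f \<in> rhom \<Lambda> M N"
  shows "sub N (f ` carrier M) \<in> fg_mods \<Lambda>" "lg M = lg (sub M (hker M N f)) + lg (sub N (f ` carrier M))"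
proof -
  note add = fin_len_additive[OF right_module_res[OF modsD(1)[OF M]] right_module_res[OF N] rhom_res[OF f]]
  note I = rsub_range[OF modsD(1)[OF M] N f]
  note fs = fin_len_sub[OF right_module_res[OF N] rsub_res[OF N I] order_refl]
  show "sub N (f ` carrier M) \<in> fg_mods \<Lambda>"
    by (rule modsI[OF right_module.right_module_sub[OF N I]])
      (use fs add modsD(2)[OF M] in \<open>simp add: res_sub\<close>)
  show "lg M = lg (sub M (hker M N f)) + lg (sub N (f ` carrier M))"
    using add(2) modsD(2)[OF M] sub_mods(4)[OF M rsub_hker[OF modsD(1)[OF M] N f]]
    by (simp add: lg_def[of M] lg_def[of "sub N _"] res_sub fs)
qed

lemma ext_mods:
  assumes M: "right_module \<Lambda> M" and N: "N \<in> fg_mods \<Lambda>" and f: "f \<in> rhom \<Lambda> M N"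
    and K: "sub M (hker M N f) \<in> fg_mods \<Lambda>"
  shows "M \<in> fg_mods \<Lambda>"
proof -
  note Nm = modsD(1)[OF N]
  note add = fin_len_additive(1)[OF right_module_res[OF M] right_module_res[OF Nm] rhom_res[OF f]]
  note k = rsub_hker[OF M Nm f]
  have I: "rsubmodule R (res N) (f ` carrier M)" by (rule rsub_res[OF Nm rsub_range[OF M Nm f]])
  have "fin_len R (res M) (hker M N f)"
    using modsD(2)[OF K] fin_len_sub(1)[OF right_module_res[OF M] rsub_res[OF M k] order_refl]
    by (simp add: res_sub)
  moreover have "fin_len R (res N) (f ` carrier M)"
    by (rule fin_len_mono(1)[OF modsD(2)[OF N] I]) (auto simp: rhomD[OF f])
  ultimately show ?thesis using add by (intro modsI[OF M]) simp
qed

lemma quot_mods: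
  assumes M: "M \<in> fg_mods \<Lambda>" and U: "rsubmodule \<Lambda> M U"
  shows "quot M U \<in> fg_mods \<Lambda>" "lg M = lg (sub M U) + lg (quot M U)"
proof -
  interpret M: right_module \<Lambda> M by (rule modsD[OF M])
  note h = lg_hom[OF M M.right_module_quot[OF U] M.crep_hom[OF U]]
  show "quot M U \<in> fg_mods \<Lambda>" "lg M = lg (sub M U) + lg (quot M U)"
    using h by (simp_all add: M.crep_surj[OF U] M.hker_crep[OF U])
qed

lemma lg_surj:
  assumes M: "M \<in> fg_mods \<Lambda>" and N: "right_module \<Lambda> N" and f: "f \<in> rhom \<Lambda> M N" "f ` carrier M = carrier N"
  shows "N \<in> fg_mods \<Lambda>" "lg N \<le> lg M" "lg M \<le> lg N \<Longrightarrow> bij_betw f (carrier M) (carrier N)"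
proof -
  note h = lg_hom[OF M N f(1)]
  note k = rsub_hker[OF modsD(1)[OF M] N f(1)]
  show "N \<in> fg_mods \<Lambda>" "lg N \<le> lg M" using h by (simp_all add: f(2))
  show "bij_betw f (carrier M) (carrier N)" if "lg M \<le> lg N"
  proof -
    have "lg (sub M (hker M N f)) = 0" using h that by (simp add: f(2))
    then have "hker M N f = {\<zero>\<^bsub>M\<^esub>}" using lg_eq_zero[OF sub_mods(1)[OF M k]] by simp
    then show ?thesis using rhom_inj_iff[OF modsD(1)[OF M] N f(1)] f(2) by (simp add: bij_betw_def)
  qed
qed

lemma lg_inj:
  assumes M: "M \<in> fg_mods \<Lambda>" and N: "N \<in> fg_mods \<Lambda>" and f: "f \<in> rhom \<Lambda> M N" "inj_on f (carrier M)"
  shows "lg M \<le> lg N" "lg N \<le> lg M \<Longrightarrow> bij_betw f (carrier M) (carrier N)"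
proof -
  note Mm = modsD(1)[OF M] and Nm = modsD(1)[OF N]
  note h = lg_hom[OF M Nm f(1)]
  note I = sub_mods[OF N rsub_range[OF Mm Nm f(1)]]
  interpret M: right_module \<Lambda> M by (rule Mm)
  have "hker M N f = {\<zero>\<^bsub>M\<^esub>}" using rhom_inj_iff[OF Mm Nm f(1)] f(2) by simp
  moreover have "lg (sub M {\<zero>\<^bsub>M\<^esub>}) = 0"
    using sub_mods(4)[OF M M.rsub_zero] len_zero(2)[OF right_module_res[OF Mm]] by simp
  ultimately have eq: "lg M = lg (sub N (f ` carrier M))" using h by simp
  then show "lg M \<le> lg N" using I(2) by simp
  show "bij_betw f (carrier M) (carrier N)" if "lg N \<le> lg M"
    using that eq I(3) f(2) by (auto simp: bij_betw_def)
qed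

lemma riso_mods: "M \<in> fg_mods \<Lambda> \<Longrightarrow> right_module \<Lambda> N \<Longrightarrow> riso \<Lambda> M N \<Longrightarrow> N \<in> fg_mods \<Lambda>"
  using lg_surj(1) by (auto simp: riso_def bij_betw_def)

section \<open>Direct sums and the regular module inside the universe\<close>

lemma dsum_simps [simp]:
  "carrier (dsum M N) = carrier M \<times> carrier N" "\<zero>\<^bsub>dsum M N\<^esub> = (\<zero>\<^bsub>M\<^esub>, \<zero>\<^bsub>N\<^esub>)"
  "(x, y) \<oplus>\<^bsub>dsum M N\<^esub> (x', y') = (x \<oplus>\<^bsub>M\<^esub> x', y \<oplus>\<^bsub>N\<^esub> y')" "(x, y) \<triangleleft>\<^bsub>dsum M N\<^esub> a = (x \<triangleleft>\<^bsub>M\<^esub> a, y \<triangleleft>\<^bsub>N\<^esub> a)"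
  by (simp_all add: dsum_def)

lemma right_module_dsum:
  assumes "right_module \<Lambda> M" "right_module \<Lambda> N"
  shows "right_module \<Lambda> (dsum M N)"
proof -
  interpret M: right_module \<Lambda> M by fact
  interpret N: right_module \<Lambda> N by fact
  have "abelian_group (dsum M N)"
  proof (rule abelian_groupI)
    fix z assume "z \<in> carrier (dsum M N)"
    then show "\<exists>w\<in>carrier (dsum M N). w \<oplus>\<^bsub>dsum M N\<^esub> z = \<zero>\<^bsub>dsum M N\<^esub>"
      by (intro bexI[of _ "(\<ominus>\<^bsub>M\<^esub> fst z, \<ominus>\<^bsub>N\<^esub> snd z)"]) (auto simp: M.M.l_neg N.M.l_neg)
  qed (auto simp: M.M.a_ac N.M.a_ac)
  moreover have "right_module_axioms \<Lambda> (dsum M N)"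
    by unfold_locales (auto simp: M.ract_l_distr N.ract_l_distr M.ract_r_distr N.ract_r_distr M.ract_assoc N.ract_assoc)
  ultimately show ?thesis by (intro right_module.intro \<Lambda>.ring_axioms)
qed

lemma dsum_mods:
  assumes "M \<in> fg_mods \<Lambda>" "N \<in> fg_mods \<Lambda>"
  shows "dsum M N \<in> fg_mods \<Lambda>"
proof -
  note m = modsD(1)[OF assms(1)] modsD(1)[OF assms(2)]
  interpret M: right_module \<Lambda> M by (rule m)
  interpret N: right_module \<Lambda> N by (rule m)
  note D = right_module_dsum[OF m]
  have p: "snd \<in> rhom \<Lambda> (dsum M N) N" by (rule rhomI) auto
  have i: "(\<lambda>x. (x, \<zero>\<^bsub>N\<^esub>)) \<in> rhom \<Lambda> M (dsum M N)" by (rule rhomI) auto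
  have "(\<lambda>x. (x, \<zero>\<^bsub>N\<^esub>)) ` carrier M = hker (dsum M N) N snd" by (auto simp: hker_def)
  then have "sub (dsum M N) (hker (dsum M N) N snd) \<in> fg_mods \<Lambda>"
    using lg_hom(1)[OF assms(1) D i] by simp
  then show ?thesis by (rule ext_mods[OF D assms(2) p])
qed

text \<open>The elements of \<open>dsum M N\<close> are pairs, so it is not of type
  \<open>'a fgmod\<close>. \<open>D\<close> is a copy inside the universe, and the injections and
  projections carry the structure of the direct sum over to it.\<close>

definition biprod :: "'a fgmod \<Rightarrow> 'a fgmod \<Rightarrow> 'a fgmod \<Rightarrow> ((nat \<Rightarrow> 'a) set \<Rightarrow> (nat \<Rightarrow> 'a) set) \<Rightarrow>
    ((nat \<Rightarrow> 'a) set \<Rightarrow> (nat \<Rightarrow> 'a) set) \<Rightarrow> ((nat \<Rightarrow> 'a) set \<Rightarrow> (nat \<Rightarrow> 'a) set) \<Rightarrow>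
    ((nat \<Rightarrow> 'a) set \<Rightarrow> (nat \<Rightarrow> 'a) set) \<Rightarrow> bool"
  where "biprod M N D i j p q \<longleftrightarrow> D \<in> fg_mods \<Lambda> \<and> riso \<Lambda> (dsum M N) D \<and>
    i \<in> rhom \<Lambda> M D \<and> j \<in> rhom \<Lambda> N D \<and> p \<in> rhom \<Lambda> D M \<and> q \<in> rhom \<Lambda> D N \<and>
    (\<forall>x\<in>carrier M. p (i x) = x \<and> q (i x) = \<zero>\<^bsub>N\<^esub>) \<and> (\<forall>y\<in>carrier N. q (j y) = y \<and> p (j y) = \<zero>\<^bsub>M\<^esub>) \<and>
    (\<forall>d\<in>carrier D. d = i (p d) \<oplus>\<^bsub>D\<^esub> j (q d))"

lemma biprod_exists:
  fixes M N :: "'a fgmod"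
  assumes "M \<in> fg_mods \<Lambda>" "N \<in> fg_mods \<Lambda>"
  obtains D :: "'a fgmod" and i j p q where "biprod M N D i j p q"
proof -
  note m = modsD(1)[OF assms(1)] modsD(1)[OF assms(2)]
  interpret M: right_module \<Lambda> M by (rule m)
  interpret N: right_module \<Lambda> N by (rule m)
  note Dm = right_module_dsum[OF m]
  obtain D :: "'a fgmod" where D: "D \<in> fg_mods \<Lambda>" "riso \<Lambda> (dsum M N) D"
    using fg_mods_universe[OF dsum_mods[OF assms]] by auto
  then obtain f where f: "f \<in> rhom \<Lambda> (dsum M N) D" "bij_betw f (carrier (dsum M N)) (carrier D)"
    by (auto simp: riso_def)
  let ?g = "inv_into (carrier (dsum M N)) f"
  note g = rhom_inv[OF Dm f]
  have gf: "?g (f z) = z" if "z \<in> carrier (dsum M N)" for z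
    using f(2) that bij_betw_inv_into_left by metis
  have fg: "f (?g d) = d" if "d \<in> carrier D" for d
    using f(2) that bij_betw_inv_into_right by metis
  have h: "(\<lambda>x. (x, \<zero>\<^bsub>N\<^esub>)) \<in> rhom \<Lambda> M (dsum M N)" "(\<lambda>y. (\<zero>\<^bsub>M\<^esub>, y)) \<in> rhom \<Lambda> N (dsum M N)"
    "fst \<in> rhom \<Lambda> (dsum M N) M" "snd \<in> rhom \<Lambda> (dsum M N) N"
    by (auto intro!: rhomI)
  have "d = f (fst (?g d), \<zero>\<^bsub>N\<^esub>) \<oplus>\<^bsub>D\<^esub> f (\<zero>\<^bsub>M\<^esub>, snd (?g d))" if d: "d \<in> carrier D" for d
  proof -
    have gd: "?g d \<in> carrier M \<times> carrier N" using rhomD(1)[OF g d] by simp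
    then obtain x y where xy: "?g d = (x, y)" "x \<in> carrier M" "y \<in> carrier N" by auto
    have "f ((x, \<zero>\<^bsub>N\<^esub>) \<oplus>\<^bsub>dsum M N\<^esub> (\<zero>\<^bsub>M\<^esub>, y)) = f (x, \<zero>\<^bsub>N\<^esub>) \<oplus>\<^bsub>D\<^esub> f (\<zero>\<^bsub>M\<^esub>, y)"
      by (rule rhomD(2)[OF f(1)]) (use xy in auto)
    moreover have "f (x, y) = d" using fg[OF d] by (simp only: xy(1))
    ultimately show ?thesis unfolding xy(1) using xy(2,3) by simp
  qed
  then have "biprod M N D (\<lambda>x. f (x, \<zero>\<^bsub>N\<^esub>)) (\<lambda>y. f (\<zero>\<^bsub>M\<^esub>, y)) (\<lambda>d. fst (?g d)) (\<lambda>d. snd (?g d))"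
    using D rhom_comp[OF h(1) f(1)] rhom_comp[OF h(2) f(1)] rhom_comp[OF g h(3)] rhom_comp[OF g h(4)]
    unfolding biprod_def by (simp add: gf[simplified])
  then show ?thesis by (rule that)
qed

lemma biprodD:
  assumes "biprod M N D i j p q"
  shows "D \<in> fg_mods \<Lambda>" "riso \<Lambda> (dsum M N) D"
    "i \<in> rhom \<Lambda> M D" "j \<in> rhom \<Lambda> N D" "p \<in> rhom \<Lambda> D M" "q \<in> rhom \<Lambda> D N"
    "\<And>x. x \<in> carrier M \<Longrightarrow> p (i x) = x" "\<And>x. x \<in> carrier M \<Longrightarrow> q (i x) = \<zero>\<^bsub>N\<^esub>"
    "\<And>y. y \<in> carrier N \<Longrightarrow> q (j y) = y" "\<And>y. y \<in> carrier N \<Longrightarrow> p (j y) = \<zero>\<^bsub>M\<^esub>"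
    "\<And>d. d \<in> carrier D \<Longrightarrow> i (p d) \<oplus>\<^bsub>D\<^esub> j (q d) = d"
  using assms by (auto simp: biprod_def)

lemma biprod_elem:
  assumes M: "right_module \<Lambda> M" and N: "right_module \<Lambda> N" and b: "biprod M N D i j p q"
    and x: "x \<in> carrier M" and y: "y \<in> carrier N"
  shows "i x \<oplus>\<^bsub>D\<^esub> j y \<in> carrier D" "p (i x \<oplus>\<^bsub>D\<^esub> j y) = x" "q (i x \<oplus>\<^bsub>D\<^esub> j y) = y"
proof -
  interpret M: right_module \<Lambda> M by fact
  interpret N: right_module \<Lambda> N by fact
  interpret D: right_module \<Lambda> D by (rule modsD(1)[OF biprodD(1)[OF b]])
  note B = biprodD[OF b]
  show "i x \<oplus>\<^bsub>D\<^esub> j y \<in> carrier D" using rhomD(1)[OF B(3) x] rhomD(1)[OF B(4) y] by simp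
  show "p (i x \<oplus>\<^bsub>D\<^esub> j y) = x" "q (i x \<oplus>\<^bsub>D\<^esub> j y) = y"
    using rhomD(1)[OF B(3) x] rhomD(1)[OF B(4) y] x y B(7-10)
    by (simp_all add: rhomD(2)[OF B(5)] rhomD(2)[OF B(6)])
qed

text \<open>A free module of rank one on \<open>u\<close> with carrier in the universe. Maps out of
  it correspond to elements of the target, which later turns its approximations into universal
  elements.\<close>

lemma regular_copy:
  obtains L :: "'a fgmod" and u where "L \<in> fg_mods \<Lambda>" "u \<in> carrier L"
    "\<And>x. x \<in> carrier L \<Longrightarrow> \<exists>a\<in>carrier \<Lambda>. x = u \<triangleleft>\<^bsub>L\<^esub> a"
    "\<And>(M :: 'a fgmod) m. right_module \<Lambda> M \<Longrightarrow> m \<in> carrier M \<Longrightarrow> \<exists>h\<in>rhom \<Lambda> L M. h u = m"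
proof -
  have "regular \<in> fg_mods \<Lambda>"
    by (rule modsI[OF right_module_regular]) (simp add: fin_len_regular)
  then obtain L :: "'a fgmod" where L: "L \<in> fg_mods \<Lambda>" "riso \<Lambda> regular L"
    using fg_mods_universe by blast
  then obtain f where f: "f \<in> rhom \<Lambda> regular L" "bij_betw f (carrier regular) (carrier L)"
    by (auto simp: riso_def)
  note g = rhom_inv[OF right_module_regular f]
  have 1: "\<exists>a\<in>carrier \<Lambda>. x = f \<one>\<^bsub>\<Lambda>\<^esub> \<triangleleft>\<^bsub>L\<^esub> a" if x: "x \<in> carrier L" for x
  proof -
    obtain a where a: "a \<in> carrier \<Lambda>" "x = f a" using f(2) x by (auto simp: bij_betw_def)
    then show ?thesis using rhomD(3)[OF f(1), of "\<one>\<^bsub>\<Lambda>\<^esub>" a] by auto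
  qed
  have 2: "\<exists>h\<in>rhom \<Lambda> L M. h (f \<one>\<^bsub>\<Lambda>\<^esub>) = m" if M: "right_module \<Lambda> M" "m \<in> carrier M" for M :: "'a fgmod" and m
  proof -
    interpret M: right_module \<Lambda> M by fact
    have k: "(\<lambda>a. m \<triangleleft>\<^bsub>M\<^esub> a) \<in> rhom \<Lambda> regular M"
      using M(2) by (intro rhomI) (auto simp: M.ract_r_distr M.ract_assoc)
    have "inv_into (carrier regular) f (f \<one>\<^bsub>\<Lambda>\<^esub>) = \<one>\<^bsub>\<Lambda>\<^esub>"
      using bij_betw_inv_into_left[OF f(2), of "\<one>\<^bsub>\<Lambda>\<^esub>"] by simp
    then show ?thesis using rhom_comp[OF g k] M(2)
      by (intro bexI[of _ "\<lambda>x. m \<triangleleft>\<^bsub>M\<^esub> inv_into (carrier regular) f x"]) auto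
  qed
  have "f \<one>\<^bsub>\<Lambda>\<^esub> \<in> carrier L" using rhomD(1)[OF f(1), of "\<one>\<^bsub>\<Lambda>\<^esub>"] by simp
  then show ?thesis by (rule that[OF L(1) _ 1 2])
qed

section \<open>Torsion classes and IE-closed subcategories\<close>

abbreviation mods :: "'a fgmod set" where "mods \<equiv> fg_mods \<Lambda>"

definition hom0 :: "('a, 'm) rmodule \<Rightarrow> ('a, 'n) rmodule \<Rightarrow> bool"
  where "hom0 X Y \<longleftrightarrow> (\<forall>f\<in>rhom \<Lambda> X Y. \<forall>x\<in>carrier X. f x = \<zero>\<^bsub>Y\<^esub>)"

lemma hom0D: "hom0 X Y \<Longrightarrow> f \<in> rhom \<Lambda> X Y \<Longrightarrow> x \<in> carrier X \<Longrightarrow> f x = \<zero>\<^bsub>Y\<^esub>"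
  by (auto simp: hom0_def)

lemma hom0I: "(\<And>f x. f \<in> rhom \<Lambda> X Y \<Longrightarrow> x \<in> carrier X \<Longrightarrow> f x = \<zero>\<^bsub>Y\<^esub>) \<Longrightarrow> hom0 X Y"
  by (auto simp: hom0_def)

lemma hom0_zero_dom: "right_module \<Lambda> X \<Longrightarrow> right_module \<Lambda> Y \<Longrightarrow> carrier X = {\<zero>\<^bsub>X\<^esub>} \<Longrightarrow> hom0 X Y"
  by (rule hom0I) (simp add: rhom_zero)

lemma hom0_zero_cod: "carrier Y = {\<zero>\<^bsub>Y\<^esub>} \<Longrightarrow> hom0 X Y"
  by (auto intro!: hom0I dest: rhomD(1))

lemma hom0_surj: "hom0 X Y \<Longrightarrow> p \<in> rhom \<Lambda> X X' \<Longrightarrow> p ` carrier X = carrier X' \<Longrightarrow> hom0 X' Y"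
proof (rule hom0I)
  fix f x assume h: "hom0 X Y" and p: "p \<in> rhom \<Lambda> X X'" "p ` carrier X = carrier X'"
    and f: "f \<in> rhom \<Lambda> X' Y" and "x \<in> carrier X'"
  then obtain z where "z \<in> carrier X" "x = p z" by auto
  then show "f x = \<zero>\<^bsub>Y\<^esub>" using hom0D[OF h rhom_comp[OF p(1) f]] by simp
qed

lemma hom0_inj:
  assumes "hom0 X Y" "right_module \<Lambda> Y'" "right_module \<Lambda> Y" "f \<in> rhom \<Lambda> Y' Y" "inj_on f (carrier Y')"
  shows "hom0 X Y'"
proof (rule hom0I)
  interpret Y': right_module \<Lambda> Y' by fact
  fix g x assume g: "g \<in> rhom \<Lambda> X Y'" and x: "x \<in> carrier X"
  have "f (g x) = f \<zero>\<^bsub>Y'\<^esub>" using hom0D[OF assms(1) rhom_comp[OF g assms(4)] x] rhom_zero[OF assms(2-4)] by simp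
  then show "g x = \<zero>\<^bsub>Y'\<^esub>" using inj_onD[OF assms(5)] rhomD(1)[OF g x] by simp
qed

lemma hom0_sub: "hom0 X Y \<Longrightarrow> V \<subseteq> carrier Y \<Longrightarrow> hom0 X (sub Y V)"
  by (auto intro!: hom0I dest: hom0D rhom_into_sub)

lemma hom0_ext_dom:
  assumes "right_module \<Lambda> M" "right_module \<Lambda> N" "right_module \<Lambda> Y"
    and g: "g \<in> rhom \<Lambda> M N" "g ` carrier M = carrier N" and "hom0 (sub M (hker M N g)) Y" "hom0 N Y"
  shows "hom0 M Y"
proof (rule hom0I)
  fix f x assume f: "f \<in> rhom \<Lambda> M Y" and x: "x \<in> carrier M"
  have f0: "f x = \<zero>\<^bsub>Y\<^esub>" if "x \<in> carrier M" "g x = \<zero>\<^bsub>N\<^esub>" for x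
    using hom0D[OF assms(6) rhom_restrict[OF f], of x] that by (auto simp: hker_def)
  obtain h where h: "h \<in> rhom \<Lambda> N Y" "\<And>x. x \<in> carrier M \<Longrightarrow> h (g x) = f x"
    using rhom_factor[OF assms(1-3) g f f0] by metis
  show "f x = \<zero>\<^bsub>Y\<^esub>" using hom0D[OF assms(7) h(1)] h(2)[OF x] rhomD(1)[OF g(1) x] by metis
qed

lemma hom0_ext_cod:
  assumes "g \<in> rhom \<Lambda> M N" "hom0 X (sub M (hker M N g))" "hom0 X N"
  shows "hom0 X M"
proof (rule hom0I)
  fix f x assume f: "f \<in> rhom \<Lambda> X M" and x: "x \<in> carrier X"
  have "f ` carrier X \<subseteq> hker M N g"
    using hom0D[OF assms(3) rhom_comp[OF f assms(1)]] by (auto simp: hker_def rhomD[OF f])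
  from hom0D[OF assms(2) rhom_corestrict[OF f this] x] show "f x = \<zero>\<^bsub>M\<^esub>" by simp
qed

definition lperp :: "'a fgmod set \<Rightarrow> 'a fgmod set"
  where "lperp \<X> = {M \<in> mods. \<forall>X\<in>\<X>. hom0 M X}"

definition rperp :: "'a fgmod set \<Rightarrow> 'a fgmod set"
  where "rperp \<X> = {M \<in> mods. \<forall>X\<in>\<X>. hom0 X M}"

lemma hom0_self: "hom0 M M \<Longrightarrow> right_module \<Lambda> M \<Longrightarrow> carrier M = {\<zero>\<^bsub>M\<^esub>}"
proof -
  assume h: "hom0 M M" and "right_module \<Lambda> M"
  then interpret M: right_module \<Lambda> M by simp
  show ?thesis using hom0D[OF h rhom_id] by auto
qed

lemma biprod_of_riso:
  assumes M: "M \<in> mods" and N: "N \<in> mods" and D: "D \<in> mods" "riso \<Lambda> (dsum M N) D"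
  obtains i j p q where "biprod M N D i j p q"
proof -
  note Dm = right_module_dsum[OF modsD(1)[OF M] modsD(1)[OF N]]
  obtain D' i j p q where b: "biprod M N D' i j p q" by (rule biprod_exists[OF M N])
  note B = biprodD[OF b]
  have D'm: "right_module \<Lambda> D'" by (rule modsD(1)[OF B(1)])
  obtain f where f: "f \<in> rhom \<Lambda> (dsum M N) D'" "bij_betw f (carrier (dsum M N)) (carrier D')"
    using B(2) by (auto simp: riso_def)
  obtain g where g: "g \<in> rhom \<Lambda> (dsum M N) D" "bij_betw g (carrier (dsum M N)) (carrier D)"
    using D(2) by (auto simp: riso_def)
  define k where "k = (\<lambda>d. g (inv_into (carrier (dsum M N)) f d))"
  have k: "k \<in> rhom \<Lambda> D' D" unfolding k_def by (rule rhom_comp[OF rhom_inv[OF Dm f] g(1)])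
  have kb: "bij_betw k (carrier D') (carrier D)"
    unfolding k_def using bij_betw_trans[OF bij_betw_inv_into[OF f(2)] g(2)] by (simp add: comp_def)
  define l where "l = inv_into (carrier D') k"
  have l: "l \<in> rhom \<Lambda> D D'" unfolding l_def by (rule rhom_inv[OF D'm k kb])
  have lk: "l (k d) = d" if "d \<in> carrier D'" for d
    using that kb unfolding l_def by (rule bij_betw_inv_into_left[rotated])
  have kl: "k (l d) = d" if "d \<in> carrier D" for d
    using that kb unfolding l_def by (rule bij_betw_inv_into_right[rotated])
  have "k (i (p (l d))) \<oplus>\<^bsub>D\<^esub> k (j (q (l d))) = d" if d: "d \<in> carrier D" for d
  proof -
    have ld: "l d \<in> carrier D'" using rhomD(1)[OF l d] .
    have "k (i (p (l d)) \<oplus>\<^bsub>D'\<^esub> j (q (l d))) = k (i (p (l d))) \<oplus>\<^bsub>D\<^esub> k (j (q (l d)))"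
      by (rule rhomD(2)[OF k]) (use ld rhomD(1)[OF B(3)] rhomD(1)[OF B(4)] rhomD(1)[OF B(5)] rhomD(1)[OF B(6)] in auto)
    then show ?thesis using B(11)[OF ld] kl[OF d] by simp
  qed
  then have "biprod M N D (\<lambda>x. k (i x)) (\<lambda>y. k (j y)) (\<lambda>d. p (l d)) (\<lambda>d. q (l d))"
    unfolding biprod_def
    using D rhom_comp[OF B(3) k] rhom_comp[OF B(4) k] rhom_comp[OF l B(5)] rhom_comp[OF l B(6)]
    by (simp add: lk rhomD(1)[OF B(3)] rhomD(1)[OF B(4)] B(7-10))
  then show ?thesis by (rule that)
qed

section \<open>Maps out of direct sums, pullbacks, surjections from a class\<close>

lemma copair:
  assumes b: "biprod M N D i j p q" and L: "right_module \<Lambda> L"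
    and f: "f \<in> rhom \<Lambda> M L" and g: "g \<in> rhom \<Lambda> N L"
  shows "(\<lambda>d. f (p d) \<oplus>\<^bsub>L\<^esub> g (q d)) \<in> rhom \<Lambda> D L"
  by (rule rhom_add_fun[OF L rhom_comp[OF biprodD(5)[OF b] f] rhom_comp[OF biprodD(6)[OF b] g]])

lemma copair_image:
  assumes M: "right_module \<Lambda> M" and N: "right_module \<Lambda> N" and b: "biprod M N D i j p q"
    and L: "right_module \<Lambda> L" and f: "f \<in> rhom \<Lambda> M L" and g: "g \<in> rhom \<Lambda> N L"
  shows "(\<lambda>d. f (p d) \<oplus>\<^bsub>L\<^esub> g (q d)) ` carrier D = right_module.msum L (f ` carrier M) (g ` carrier N)"
proof -
  interpret L: right_module \<Lambda> L by fact
  note B = biprodD[OF b]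
  have "f x \<oplus>\<^bsub>L\<^esub> g y \<in> (\<lambda>d. f (p d) \<oplus>\<^bsub>L\<^esub> g (q d)) ` carrier D" if "x \<in> carrier M" "y \<in> carrier N" for x y
    using biprod_elem[OF M N b that] by (intro image_eqI[of _ _ "i x \<oplus>\<^bsub>D\<^esub> j y"]) auto
  moreover have "p d \<in> carrier M" "q d \<in> carrier N" if "d \<in> carrier D" for d
    using rhomD(1)[OF B(5) that] rhomD(1)[OF B(6) that] by auto
  ultimately show ?thesis unfolding L.msum_def by blast
qed

text \<open>The pullback is the submodule \<open>W\<close> of the direct sum on which the two maps
  to \<open>B\<close> agree. The first projection identifies the kernel of the second with the
  kernel of \<open>g\<close>, so \<open>E\<close> is an extension of the image of \<open>b\<close>
  by a copy of the kernel of \<open>g\<close>.\<close>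

lemma pullback_exists:
  assumes A: "A \<in> mods" and P: "P \<in> mods" and B: "right_module \<Lambda> B"
    and g: "g \<in> rhom \<Lambda> A B" and h: "h \<in> rhom \<Lambda> P B"
  obtains E a b where "E \<in> mods" "a \<in> rhom \<Lambda> E A" "b \<in> rhom \<Lambda> E P"
    "\<forall>e\<in>carrier E. g (a e) = h (b e)"
    "\<forall>x\<in>carrier A. \<forall>y\<in>carrier P. g x = h y \<longrightarrow> (\<exists>e\<in>carrier E. a e = x \<and> b e = y)"
    "bij_betw a (hker E P b) (hker A B g)"
proof -
  note Am = modsD(1)[OF A] and Pm = modsD(1)[OF P]
  interpret A: right_module \<Lambda> A by fact
  interpret P: right_module \<Lambda> P by fact
  interpret B: right_module \<Lambda> B by fact
  obtain D i j p q where bp: "biprod A P D i j p q" by (rule biprod_exists[OF A P])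
  note bD = biprodD[OF bp]
  note Dm = modsD(1)[OF bD(1)]
  interpret D: right_module \<Lambda> D by fact
  define W where "W = {d \<in> carrier D. g (p d) = h (q d)}"
  have k: "(\<lambda>d. g (p d) \<ominus>\<^bsub>B\<^esub> h (q d)) \<in> rhom \<Lambda> D B"
    by (rule rhom_minus_fun[OF B rhom_comp[OF bD(5) g] rhom_comp[OF bD(6) h]])
  have W: "W = hker D B (\<lambda>d. g (p d) \<ominus>\<^bsub>B\<^esub> h (q d))"
    by (auto simp: W_def hker_def B.minus_zero_iff rhomD(1)[OF rhom_comp[OF bD(5) g]] rhomD(1)[OF rhom_comp[OF bD(6) h]])
  have rW: "rsubmodule \<Lambda> D W" unfolding W by (rule rsub_hker[OF Dm B k])
  have WD: "W \<subseteq> carrier D" by (auto simp: W_def)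
  show ?thesis
  proof (rule that[of "sub D W" p q])
    show "sub D W \<in> mods" by (rule sub_mods(1)[OF bD(1) rW])
    show "p \<in> rhom \<Lambda> (sub D W) A" "q \<in> rhom \<Lambda> (sub D W) P"
      by (rule rhom_restrict[OF _ WD], rule bD)+
    show "\<forall>e\<in>carrier (sub D W). g (p e) = h (q e)" by (simp add: W_def)
    have ex: "\<exists>e\<in>carrier (sub D W). p e = x \<and> q e = y" if "x \<in> carrier A" "y \<in> carrier P" "g x = h y" for x y
      using biprod_elem[OF Am Pm bp that(1,2)] that(3)
      by (intro bexI[of _ "i x \<oplus>\<^bsub>D\<^esub> j y"]) (auto simp: W_def)
    then show "\<forall>x\<in>carrier A. \<forall>y\<in>carrier P. g x = h y \<longrightarrow> (\<exists>e\<in>carrier (sub D W). p e = x \<and> q e = y)"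
      by blast
    show "bij_betw p (hker (sub D W) P q) (hker A B g)"
    proof (rule bij_betwI')
      fix x y assume "x \<in> hker (sub D W) P q" "y \<in> hker (sub D W) P q"
      then have x: "x \<in> carrier D" "q x = \<zero>\<^bsub>P\<^esub>" and y: "y \<in> carrier D" "q y = \<zero>\<^bsub>P\<^esub>"
        by (auto simp: hker_restrict W_def)
      have "x = y" if "p x = p y"
        using bD(11)[OF x(1)] bD(11)[OF y(1)] x y that by simp
      then show "(p x = p y) = (x = y)" by auto
    next
      fix x assume "x \<in> hker (sub D W) P q"
      then have x: "x \<in> carrier D" "q x = \<zero>\<^bsub>P\<^esub>" "g (p x) = h (q x)"
        by (auto simp: hker_restrict W_def)
      then show "p x \<in> hker A B g" by (simp add: hker_def rhomD(1)[OF bD(5)] rhom_zero[OF Pm B h])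
    next
      fix y assume "y \<in> hker A B g"
      then have y: "y \<in> carrier A" "g y = h \<zero>\<^bsub>P\<^esub>" by (auto simp: hker_def rhom_zero[OF Pm B h])
      then show "\<exists>x\<in>hker (sub D W) P q. y = p x"
        using ex[OF y(1) P.M.zero_closed y(2)] by (auto simp: hker_restrict)
    qed
  qed
qed

text \<open>Among the maps from the class to \<open>Y\<close>, one whose image has maximal length is
  surjective: a missed element is reached by a second map, and the two together, on the direct sum,
  have a longer image.\<close>

lemma epi_from_class:
  assumes PM: "\<P> \<subseteq> mods" and sum: "\<And>P Q D i j p q. P \<in> \<P> \<Longrightarrow> Q \<in> \<P> \<Longrightarrow> biprod P Q D i j p q \<Longrightarrow> D \<in> \<P>"
    and Y: "Y \<in> mods" and gen: "\<And>y. y \<in> carrier Y \<Longrightarrow> \<exists>P\<in>\<P>. \<exists>h\<in>rhom \<Lambda> P Y. y \<in> h ` carrier P"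
  shows "\<exists>P\<in>\<P>. \<exists>h\<in>rhom \<Lambda> P Y. h ` carrier P = carrier Y"
proof -
  note Ym = modsD(1)[OF Y]
  interpret Y: right_module \<Lambda> Y by fact
  let ?ok = "\<lambda>(P, h). P \<in> \<P> \<and> h \<in> rhom \<Lambda> P Y"
  let ?l = "\<lambda>(P, h). lg (sub Y (h ` carrier P))"
  obtain P0 h0 where P0: "P0 \<in> \<P>" "h0 \<in> rhom \<Lambda> P0 Y" using gen[OF Y.M.zero_closed] by blast
  have rs: "rsubmodule \<Lambda> Y (h ` carrier P)" if "P \<in> \<P>" "h \<in> rhom \<Lambda> P Y" for P h
    using rsub_range[OF modsD(1) Ym that(2)] that PM by auto
  have "?l z < Suc (lg Y)" if "?ok z" for z
    using that sub_mods(2)[OF Y rs] by (auto simp: less_Suc_eq_le)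
  then obtain z where z: "?ok z" and zmax: "\<And>w. ?ok w \<Longrightarrow> ?l w \<le> ?l z"
    using ex_has_greatest_nat[of ?ok "(P0, h0)" ?l "Suc (lg Y)"] P0 by auto
  obtain P h where Ph: "z = (P, h)" "P \<in> \<P>" "h \<in> rhom \<Lambda> P Y" using z by (cases z) auto
  note rh = rs[OF Ph(2,3)]
  have "h ` carrier P = carrier Y"
  proof (rule ccontr)
    assume "h ` carrier P \<noteq> carrier Y"
    then obtain y where y: "y \<in> carrier Y" "y \<notin> h ` carrier P" using Y.rsubD(1)[OF rh] by auto
    obtain Q k where Q: "Q \<in> \<P>" "k \<in> rhom \<Lambda> Q Y" "y \<in> k ` carrier Q" using gen[OF y(1)] by blast
    have PQ: "P \<in> mods" "Q \<in> mods" using Ph Q PM by auto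
    obtain D i j p q where b: "biprod P Q D i j p q" by (rule biprod_exists[OF PQ])
    let ?c = "\<lambda>d. h (p d) \<oplus>\<^bsub>Y\<^esub> k (q d)"
    note c = copair[OF b Ym Ph(3) Q(2)]
    have im: "?c ` carrier D = Y.msum (h ` carrier P) (k ` carrier Q)"
      by (rule copair_image[OF modsD(1)[OF PQ(1)] modsD(1)[OF PQ(2)] b Ym Ph(3) Q(2)])
    note ms = Y.rsub_msum[OF rh rs[OF Q(1,2)]]
    have Dok: "?ok (D, ?c)" using sum[OF Ph(2) Q(1) b] c by simp
    have "lg (sub (sub Y (?c ` carrier D)) (h ` carrier P)) < lg (sub Y (?c ` carrier D))"
    proof (rule sub_mods(3))
      show "sub Y (?c ` carrier D) \<in> mods" unfolding im by (rule sub_mods(1)[OF Y ms(1)])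
      show "rsubmodule \<Lambda> (sub Y (?c ` carrier D)) (h ` carrier P)"
        unfolding im using ms(2) rh by (simp add: Y.rsub_sub[OF ms(1)])
      show "h ` carrier P \<noteq> carrier (sub Y (?c ` carrier D))"
        using ms(3) Q(3) y(2) by (auto simp: im)
    qed
    then show False using zmax[OF Dok] by (simp add: Ph(1))
  qed
  then show ?thesis using Ph by blast
qed

section \<open>Criteria for torsion classes and for IE-closed subcategories\<close>

lemma subcategoryD:
  assumes "subcategory \<Lambda> C"
  shows "C \<subseteq> mods" "M \<in> C \<Longrightarrow> right_module \<Lambda> N \<Longrightarrow> f \<in> rhom \<Lambda> M N \<Longrightarrow> bij_betw f (carrier M) (carrier N) \<Longrightarrow> N \<in> C"
    "Z \<in> mods \<Longrightarrow> carrier Z = {\<zero>\<^bsub>Z\<^esub>} \<Longrightarrow> Z \<in> C"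
    "M \<in> C \<Longrightarrow> N \<in> C \<Longrightarrow> biprod M N D i j p q \<Longrightarrow> D \<in> C"
proof -
  note s = assms[unfolded subcategory_def]
  note s1 = s[THEN conjunct1] and s2 = s[THEN conjunct2, THEN conjunct1, rule_format]
    and s3 = s[THEN conjunct2, THEN conjunct2, THEN conjunct1, rule_format]
    and s4 = s[THEN conjunct2, THEN conjunct2, THEN conjunct2, rule_format]
  show "C \<subseteq> mods" by (rule s1)
  show "M \<in> C \<Longrightarrow> right_module \<Lambda> N \<Longrightarrow> f \<in> rhom \<Lambda> M N \<Longrightarrow> bij_betw f (carrier M) (carrier N) \<Longrightarrow> N \<in> C"
  proof -
    assume a: "M \<in> C" "right_module \<Lambda> N" "f \<in> rhom \<Lambda> M N" "bij_betw f (carrier M) (carrier N)"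
    have r: "riso \<Lambda> M N" unfolding riso_def using a(3,4) by blast
    show "N \<in> C" by (rule s2[OF a(1) riso_mods[OF subsetD[OF s1 a(1)] a(2) r] r])
  qed
  show "Z \<in> mods \<Longrightarrow> carrier Z = {\<zero>\<^bsub>Z\<^esub>} \<Longrightarrow> Z \<in> C" by (rule s3)
  show "M \<in> C \<Longrightarrow> N \<in> C \<Longrightarrow> biprod M N D i j p q \<Longrightarrow> D \<in> C"
    by (rule s4[OF _ _ biprodD(1,2)])
qed

lemma ext_closedD:
  assumes "ext_closed \<Lambda> C" "M \<in> mods" "N \<in> C" "g \<in> rhom \<Lambda> M N" "g ` carrier M = carrier N"
    "sub M (hker M N g) \<in> C"
  shows "M \<in> C"
proof -
  have "short_exact \<Lambda> (sub M (hker M N g)) (\<lambda>x. x) M g N"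
    using assms rhom_incl'[of "hker M N g" M] by (auto simp: short_exact_def hker_def)
  then show ?thesis using assms unfolding ext_closed_def by blast
qed

text \<open>A direct sum is an extension of its summands. In this form, additivity follows from
  closure under extensions in the two criteria below.\<close>

lemma riso_dsum_ext:
  assumes M: "M \<in> mods" and N: "N \<in> mods" and D: "D \<in> mods" "riso \<Lambda> (dsum M N) D"
  shows "\<exists>q i. q \<in> rhom \<Lambda> D N \<and> q ` carrier D = carrier N \<and> i \<in> rhom \<Lambda> M (sub D (hker D N q)) \<and>
    bij_betw i (carrier M) (hker D N q)"
proof -
  obtain i j p q where b: "biprod M N D i j p q" by (rule biprod_of_riso[OF M N D])
  note B = biprodD[OF b]
  note Dm = modsD(1)[OF B(1)] and Nm = modsD(1)[OF N]
  interpret D: right_module \<Lambda> D by fact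
  interpret N: right_module \<Lambda> N by fact
  have i: "i ` carrier M \<subseteq> hker D N q" using rhomD(1)[OF B(3)] B(8) by (auto simp: hker_def)
  have "q ` carrier D = carrier N"
  proof
    show "q ` carrier D \<subseteq> carrier N" using rhomD(1)[OF B(6)] by auto
    show "carrier N \<subseteq> q ` carrier D"
    proof
      fix y assume y: "y \<in> carrier N"
      show "y \<in> q ` carrier D" by (rule image_eqI[where x = "j y"]) (simp_all add: B(9)[OF y] rhomD(1)[OF B(4) y])
    qed
  qed
  moreover have "bij_betw i (carrier M) (hker D N q)"
  proof (rule bij_betwI[where g = p])
    show "i \<in> carrier M \<rightarrow> hker D N q" using i by auto
    show "p \<in> hker D N q \<rightarrow> carrier M" using rhomD(1)[OF B(5)] by (auto simp: hker_def)
    show "p (i x) = x" if "x \<in> carrier M" for x using B(7)[OF that] .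
    show "i (p y) = y" if "y \<in> hker D N q" for y
    proof -
      have y: "y \<in> carrier D" "q y = \<zero>\<^bsub>N\<^esub>" using that by (auto simp: hker_def)
      have "i (p y) \<in> carrier D" using rhomD(1)[OF B(3) rhomD(1)[OF B(5) y(1)]] .
      then show ?thesis using B(11)[OF y(1)] y(2) rhom_zero[OF Nm Dm B(4)] by simp
    qed
  qed
  ultimately show ?thesis using B(6) rhom_corestrict[OF B(3) i] by blast
qed

lemma torsionI:
  assumes T: "T \<subseteq> mods" and zero: "\<And>Z. Z \<in> mods \<Longrightarrow> carrier Z = {\<zero>\<^bsub>Z\<^esub>} \<Longrightarrow> Z \<in> T"
    and quo: "\<And>M N f. M \<in> T \<Longrightarrow> N \<in> mods \<Longrightarrow> f \<in> rhom \<Lambda> M N \<Longrightarrow> f ` carrier M = carrier N \<Longrightarrow> N \<in> T"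
    and ext: "\<And>M N g. M \<in> mods \<Longrightarrow> N \<in> T \<Longrightarrow> g \<in> rhom \<Lambda> M N \<Longrightarrow> g ` carrier M = carrier N \<Longrightarrow>
      sub M (hker M N g) \<in> T \<Longrightarrow> M \<in> T"
  shows "torsion_class \<Lambda> T"
proof -
  have rk: "rsubmodule \<Lambda> M (hker M N g)" if "M \<in> mods" "N \<in> T" "g \<in> rhom \<Lambda> M N" for M N g
    using rsub_hker[OF modsD(1) modsD(1) that(3)] that T by auto
  have "subcategory \<Lambda> T"
    unfolding subcategory_def
  proof (intro conjI ballI impI T)
    show "N \<in> T" if "M \<in> T" "N \<in> mods" "riso \<Lambda> M N" for M N
      using that quo by (auto simp: riso_def bij_betw_def)
    fix M N D assume MN: "M \<in> T" "N \<in> T" and D: "D \<in> mods" "riso \<Lambda> (dsum M N) D"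
    then obtain q i where q: "q \<in> rhom \<Lambda> D N" "q ` carrier D = carrier N"
      "i \<in> rhom \<Lambda> M (sub D (hker D N q))" "bij_betw i (carrier M) (hker D N q)"
      using riso_dsum_ext[of M N D] T by blast
    have "sub D (hker D N q) \<in> T"
      using quo[OF MN(1) sub_mods(1)[OF D(1) rk[OF D(1) MN(2) q(1)]] q(3)] q(4) by (simp add: bij_betw_def)
    then show "D \<in> T" by (rule ext[OF D(1) MN(2) q(1,2)])
  qed (use zero in auto)
  moreover have "ext_closed \<Lambda> T"
    unfolding ext_closed_def
  proof (intro ballI allI impI)
    fix L N M f g assume LN: "L \<in> T" "N \<in> T" and M: "M \<in> mods" and se: "short_exact \<Lambda> L f M g N"
    then have g: "g \<in> rhom \<Lambda> M N" "g ` carrier M = carrier N" "f \<in> rhom \<Lambda> L M" "f ` carrier L = hker M N g"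
      by (auto simp: short_exact_def hker_def)
    have "sub M (hker M N g) \<in> T"
      by (rule quo[OF LN(1) sub_mods(1)[OF M rk[OF M LN(2) g(1)]] rhom_corestrict[OF g(3)]])
        (use g in auto)
    then show "M \<in> T" by (rule ext[OF M LN(2) g(1,2)])
  qed
  moreover have "quotient_closed \<Lambda> T" using quo unfolding quotient_closed_def by blast
  ultimately show ?thesis by (simp add: torsion_class_def)
qed

text \<open>An image is a submodule of its target, so closure under submodules gives closure under
  images. Closure under isomorphisms follows since the inverse of an isomorphism is
  injective.\<close>

lemma torsionfree_IE:
  assumes F: "F \<subseteq> mods" and zero: "\<And>Z. Z \<in> mods \<Longrightarrow> carrier Z = {\<zero>\<^bsub>Z\<^esub>} \<Longrightarrow> Z \<in> F"
    and sb: "\<And>M N f. N \<in> F \<Longrightarrow> M \<in> mods \<Longrightarrow> f \<in> rhom \<Lambda> M N \<Longrightarrow> inj_on f (carrier M) \<Longrightarrow> M \<in> F"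
    and ext: "\<And>M N g. M \<in> mods \<Longrightarrow> N \<in> F \<Longrightarrow> g \<in> rhom \<Lambda> M N \<Longrightarrow> g ` carrier M = carrier N \<Longrightarrow>
      sub M (hker M N g) \<in> F \<Longrightarrow> M \<in> F"
  shows "IE_closed \<Lambda> F"
proof -
  have iso: "N \<in> F" if MN: "M \<in> F" "N \<in> mods" and f: "f \<in> rhom \<Lambda> M N" "bij_betw f (carrier M) (carrier N)" for M N f
  proof (rule sb[OF MN(1,2) rhom_inv[OF modsD(1) f]])
    show "inj_on (inv_into (carrier M) f) (carrier N)"
      using bij_betw_inv_into[OF f(2)] by (simp add: bij_betw_def)
  qed (use MN F in auto)
  have rk: "rsubmodule \<Lambda> M (hker M N g)" if "M \<in> mods" "N \<in> F" "g \<in> rhom \<Lambda> M N" for M N g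
    using rsub_hker[OF modsD(1) modsD(1) that(3)] that F by auto
  have "subcategory \<Lambda> F"
    unfolding subcategory_def
  proof (intro conjI ballI impI F)
    show "N \<in> F" if "M \<in> F" "N \<in> mods" "riso \<Lambda> M N" for M N
      using that iso by (auto simp: riso_def)
    fix M N D assume MN: "M \<in> F" "N \<in> F" and D: "D \<in> mods" "riso \<Lambda> (dsum M N) D"
    then obtain q i where q: "q \<in> rhom \<Lambda> D N" "q ` carrier D = carrier N"
      "i \<in> rhom \<Lambda> M (sub D (hker D N q))" "bij_betw i (carrier M) (hker D N q)"
      using riso_dsum_ext[of M N D] F by blast
    have "sub D (hker D N q) \<in> F"
      by (rule iso[OF MN(1) sub_mods(1)[OF D(1) rk[OF D(1) MN(2) q(1)]] q(3)]) (use q(4) in simp)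
    then show "D \<in> F" by (rule ext[OF D(1) MN(2) q(1,2)])
  qed (use zero in auto)
  moreover have "ext_closed \<Lambda> F"
    unfolding ext_closed_def
  proof (intro ballI allI impI)
    fix L N M f g assume LN: "L \<in> F" "N \<in> F" and M: "M \<in> mods" and se: "short_exact \<Lambda> L f M g N"
    then have g: "g \<in> rhom \<Lambda> M N" "g ` carrier M = carrier N" "f \<in> rhom \<Lambda> L M" "f ` carrier L = hker M N g"
      "inj_on f (carrier L)"
      by (auto simp: short_exact_def hker_def)
    have "sub M (hker M N g) \<in> F"
      by (rule iso[OF LN(1) sub_mods(1)[OF M rk[OF M LN(2) g(1)]] rhom_corestrict[OF g(3)]])
        (use g in \<open>auto simp: bij_betw_def\<close>)
    then show "M \<in> F" by (rule ext[OF M LN(2) g(1,2)])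
  qed
  moreover have "image_closed \<Lambda> F"
    unfolding image_closed_def im_mod_eq
  proof (intro ballI)
    fix M N f assume MN: "M \<in> F" "N \<in> F" and f: "f \<in> rhom \<Lambda> M N"
    have m: "M \<in> mods" "N \<in> mods" using MN F by auto
    have r: "rsubmodule \<Lambda> N (f ` carrier M)" by (rule rsub_range[OF modsD(1)[OF m(1)] modsD(1)[OF m(2)] f])
    then have "f ` carrier M \<subseteq> carrier N" using rhomD(1)[OF f] by auto
    then show "sub N (f ` carrier M) \<in> F"
      by (intro sb[OF MN(2) sub_mods(1)[OF m(2) r] rhom_incl']) auto
  qed
  ultimately show ?thesis by (simp add: IE_closed_def)
qed

text \<open>Dually to the torsion-free case, an image is a quotient of its source.\<close>

lemma torsion_IE:
  assumes "torsion_class \<Lambda> T" shows "IE_closed \<Lambda> T"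
proof -
  have T: "subcategory \<Lambda> T" "ext_closed \<Lambda> T" "quotient_closed \<Lambda> T" using assms by (auto simp: torsion_class_def)
  have "image_closed \<Lambda> T"
    unfolding image_closed_def im_mod_eq
  proof (intro ballI)
    fix M N f assume MN: "M \<in> T" "N \<in> T" and f: "f \<in> rhom \<Lambda> M N"
    have m: "M \<in> mods" "N \<in> mods" using MN subcategoryD(1)[OF T(1)] by auto
    have r: "rsubmodule \<Lambda> N (f ` carrier M)" by (rule rsub_range[OF modsD(1)[OF m(1)] modsD(1)[OF m(2)] f])
    have "f \<in> rhom \<Lambda> M (sub N (f ` carrier M))" by (rule rhom_corestrict[OF f]) simp
    then show "sub N (f ` carrier M) \<in> T"
      using T(3)[unfolded quotient_closed_def, rule_format, OF MN(1) sub_mods(1)[OF m(2) r]] by simp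
  qed
  then show ?thesis using T by (simp add: IE_closed_def)
qed

lemma lperp_torsion:
  assumes X: "\<X> \<subseteq> mods" shows "torsion_class \<Lambda> (lperp \<X>)"
proof (rule torsionI)
  have Xm: "right_module \<Lambda> X" if "X \<in> \<X>" for X using that X modsD(1) by auto
  show "lperp \<X> \<subseteq> mods" by (auto simp: lperp_def)
  show "Z \<in> lperp \<X>" if "Z \<in> mods" "carrier Z = {\<zero>\<^bsub>Z\<^esub>}" for Z
    using that hom0_zero_dom[OF modsD(1) Xm] by (auto simp: lperp_def)
  show "N \<in> lperp \<X>" if "M \<in> lperp \<X>" "N \<in> mods" "f \<in> rhom \<Lambda> M N" "f ` carrier M = carrier N" for M N f
    using that hom0_surj[OF _ that(3,4)] by (auto simp: lperp_def)
  show "M \<in> lperp \<X>" if "M \<in> mods" "N \<in> lperp \<X>" "g \<in> rhom \<Lambda> M N" "g ` carrier M = carrier N"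
      "sub M (hker M N g) \<in> lperp \<X>" for M N g
    using that hom0_ext_dom[OF modsD(1) modsD(1) Xm that(3,4)] by (auto simp: lperp_def)
qed

lemma rperp_sub_closed:
  assumes X: "\<X> \<subseteq> mods" and "N \<in> rperp \<X>" "M \<in> mods" "f \<in> rhom \<Lambda> M N" "inj_on f (carrier M)"
  shows "M \<in> rperp \<X>"
  using assms hom0_inj[OF _ modsD(1) modsD(1), of _ N M f] by (auto simp: rperp_def)

lemma rperp_sub: "N \<in> rperp \<X> \<Longrightarrow> rsubmodule \<Lambda> N V \<Longrightarrow> sub N V \<in> rperp \<X>"
proof -
  assume N: "N \<in> rperp \<X>" and V: "rsubmodule \<Lambda> N V"
  then have Nm: "N \<in> mods" by (simp add: rperp_def)
  show ?thesis
    using N sub_mods(1)[OF Nm V] hom0_sub[OF _ right_module.rsubD(1)[OF modsD(1)[OF Nm] V]]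
    by (auto simp: rperp_def)
qed

lemma rperp_ext:
  assumes "M \<in> mods" "N \<in> rperp \<X>" "g \<in> rhom \<Lambda> M N" "sub M (hker M N g) \<in> rperp \<X>"
  shows "M \<in> rperp \<X>"
  using assms hom0_ext_cod[OF assms(3)] by (auto simp: rperp_def)

lemma rperp_zero: "Z \<in> mods \<Longrightarrow> carrier Z = {\<zero>\<^bsub>Z\<^esub>} \<Longrightarrow> Z \<in> rperp \<X>"
  using hom0_zero_cod by (auto simp: rperp_def)

lemma rperp_IE:
  assumes X: "\<X> \<subseteq> mods" shows "IE_closed \<Lambda> (rperp \<X>)"
proof (rule torsionfree_IE)
  show "rperp \<X> \<subseteq> mods" by (auto simp: rperp_def)
  show "Z \<in> rperp \<X>" if "Z \<in> mods" "carrier Z = {\<zero>\<^bsub>Z\<^esub>}" for Z by (rule rperp_zero[OF that])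
  show "M \<in> rperp \<X>" if "N \<in> rperp \<X>" "M \<in> mods" "f \<in> rhom \<Lambda> M N" "inj_on f (carrier M)" for M N f
    by (rule rperp_sub_closed[OF X that])
  show "M \<in> rperp \<X>" if "M \<in> mods" "N \<in> rperp \<X>" "g \<in> rhom \<Lambda> M N" "g ` carrier M = carrier N"
      "sub M (hker M N g) \<in> rperp \<X>" for M N g
    by (rule rperp_ext[OF that(1-3,5)])
qed

section \<open>The torsion radical\<close>

context
  fixes T assumes tors: "torsion_class \<Lambda> T"
begin

lemma torsD:
  shows "T \<subseteq> mods" "M \<in> T \<Longrightarrow> M \<in> mods"
    "Z \<in> mods \<Longrightarrow> carrier Z = {\<zero>\<^bsub>Z\<^esub>} \<Longrightarrow> Z \<in> T"
    "M \<in> T \<Longrightarrow> N \<in> T \<Longrightarrow> biprod M N D i j p q \<Longrightarrow> D \<in> T"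
proof -
  have s: "subcategory \<Lambda> T" using tors by (simp add: torsion_class_def)
  show "T \<subseteq> mods" by (rule subcategoryD(1)[OF s])
  then show "M \<in> T \<Longrightarrow> M \<in> mods" by (rule subsetD)
  show "Z \<in> mods \<Longrightarrow> carrier Z = {\<zero>\<^bsub>Z\<^esub>} \<Longrightarrow> Z \<in> T" by (rule subcategoryD(3)[OF s])
  show "M \<in> T \<Longrightarrow> N \<in> T \<Longrightarrow> biprod M N D i j p q \<Longrightarrow> D \<in> T" by (rule subcategoryD(4)[OF s])
qed

lemma tors_quot:
  assumes "M \<in> T" "right_module \<Lambda> N" "f \<in> rhom \<Lambda> M N" "f ` carrier M = carrier N" shows "N \<in> T"
proof -
  have "N \<in> mods" by (rule lg_surj(1)[OF torsD(2)[OF assms(1)] assms(2-4)])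
  moreover have "quotient_closed \<Lambda> T" using tors by (simp add: torsion_class_def)
  ultimately show ?thesis using assms(1,3,4) unfolding quotient_closed_def by blast
qed

lemma tors_image:
  assumes "M \<in> T" "right_module \<Lambda> N" "f \<in> rhom \<Lambda> M N" shows "sub N (f ` carrier M) \<in> T"
proof (rule tors_quot[OF assms(1)])
  show "right_module \<Lambda> (sub N (f ` carrier M))"
    by (rule right_module.right_module_sub[OF assms(2) rsub_range[OF modsD(1)[OF torsD(2)[OF assms(1)]] assms(2,3)]])
  show "f \<in> rhom \<Lambda> M (sub N (f ` carrier M))" by (rule rhom_corestrict[OF assms(3)]) simp
qed simp

lemma tors_ext:
  assumes "M \<in> mods" "N \<in> T" "g \<in> rhom \<Lambda> M N" "g ` carrier M = carrier N" "sub M (hker M N g) \<in> T"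
  shows "M \<in> T"
proof -
  have "ext_closed \<Lambda> T" using tors by (simp add: torsion_class_def)
  then show ?thesis by (rule ext_closedD[OF _ assms])
qed

lemma tors_msum:
  assumes M: "M \<in> mods" and U: "rsubmodule \<Lambda> M U" "sub M U \<in> T" and V: "rsubmodule \<Lambda> M V" "sub M V \<in> T"
  shows "sub M (right_module.msum M U V) \<in> T"
proof -
  note Mm = modsD(1)[OF M]
  interpret M: right_module \<Lambda> M by fact
  note m = torsD(2)[OF U(2)] torsD(2)[OF V(2)]
  obtain D i j p q where b: "biprod (sub M U) (sub M V) D i j p q" by (rule biprod_exists[OF m])
  have i: "(\<lambda>x. x) \<in> rhom \<Lambda> (sub M U) M" "(\<lambda>x. x) \<in> rhom \<Lambda> (sub M V) M"
    using M.rsubD(1) U V by (auto intro!: rhom_incl')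
  show ?thesis
    using tors_image[OF torsD(4)[OF U(2) V(2) b] Mm copair[OF b Mm i]]
      copair_image[OF modsD(1)[OF m(1)] modsD(1)[OF m(2)] b Mm i] by simp
qed

text \<open>Sums of torsion submodules are torsion, so a torsion submodule \<open>U\<close> of
  maximal length is the largest one. The image of a map from a torsion module to \<open>M/U\<close>
  has a torsion preimage, by closure under extensions, and that preimage has to lie in
  \<open>U\<close>.\<close>

lemma torsion_radical_exists:
  assumes M: "M \<in> mods"
  shows "\<exists>U. rsubmodule \<Lambda> M U \<and> sub M U \<in> T \<and> quot M U \<in> rperp T"
proof -
  note Mm = modsD(1)[OF M]
  interpret M: right_module \<Lambda> M by fact
  let ?ok = "\<lambda>U. rsubmodule \<Lambda> M U \<and> sub M U \<in> T"
  have "?ok {\<zero>\<^bsub>M\<^esub>}" using torsD(3)[OF sub_mods(1)[OF M M.rsub_zero]] M.rsub_zero by simp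
  moreover have "\<forall>U. ?ok U \<longrightarrow> lg (sub M U) < Suc (lg M)" using sub_mods(2)[OF M] by (auto simp: less_Suc_eq_le)
  ultimately obtain U where U: "?ok U" and max: "\<And>V. ?ok V \<Longrightarrow> lg (sub M V) \<le> lg (sub M U)"
    using ex_has_greatest_nat[of ?ok _ "\<lambda>U. lg (sub M U)" "Suc (lg M)"] by blast
  have rU: "rsubmodule \<Lambda> M U" using U by simp
  have big: "V \<subseteq> U" if V: "?ok V" for V
  proof -
    note ms = M.rsub_msum[OF conjunct1[OF U] conjunct1[OF V]]
    have ok: "?ok (M.msum U V)" using tors_msum[OF M] U V ms(1) by blast
    have "U = M.msum U V"
    proof (rule ccontr)
      assume "U \<noteq> M.msum U V"
      then have "lg (sub (sub M (M.msum U V)) U) < lg (sub M (M.msum U V))"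
        using sub_mods(1)[OF M ms(1)] U ms(2) by (intro sub_mods(3)) (auto simp: M.rsub_sub[OF ms(1)])
      then show False using max[OF ok] by simp
    qed
    then show ?thesis using ms(3) by simp
  qed
  note Qm = M.right_module_quot[OF rU]
  have "hom0 X (quot M U)" if X: "X \<in> T" for X
  proof (rule hom0I)
    fix f x assume f: "f \<in> rhom \<Lambda> X (quot M U)" and x: "x \<in> carrier X"
    note fi = rsub_range[OF modsD(1)[OF torsD(2)[OF X]] Qm f]
    let ?V = "{m \<in> carrier M. crep M U m \<in> f ` carrier X}"
    have rV: "rsubmodule \<Lambda> M ?V" by (rule rsub_vimage[OF Mm Qm M.crep_hom[OF rU] fi])
    have UV: "U \<subseteq> ?V"
    proof
      fix u assume u: "u \<in> U"
      then have uc: "u \<in> carrier M" using M.rsubD(2)[OF rU] by simp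
      then have "crep M U u = \<zero>\<^bsub>quot M U\<^esub>" using M.crep_zero_iff[OF rU] u by simp
      then show "u \<in> ?V" using uc right_module.rsubD(3)[OF Qm fi] by simp
    qed
    have c: "crep M U \<in> rhom \<Lambda> (sub M ?V) (sub (quot M U) (f ` carrier X))"
      by (rule rhom_corestrict[OF rhom_restrict[OF M.crep_hom[OF rU]]]) auto
    have "sub M ?V \<in> T"
    proof (rule tors_ext[OF sub_mods(1)[OF M rV] tors_image[OF X Qm f] c])
      show "crep M U ` carrier (sub M ?V) = carrier (sub (quot M U) (f ` carrier X))"
      proof -
        have "y \<in> crep M U ` ?V" if y: "y \<in> f ` carrier X" for y
        proof -
          have "y \<in> carrier (quot M U)" using y rhomD(1)[OF f] by auto
          then obtain m where "m \<in> carrier M" "y = crep M U m" using M.crep_surj[OF rU] by auto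
          then show ?thesis using y by auto
        qed
        then show ?thesis by auto
      qed
      have "hker (sub M ?V) (sub (quot M U) (f ` carrier X)) (crep M U) = U"
        using UV M.crep_zero_iff[OF rU] by (auto simp: hker_restrict)
      then show "sub (sub M ?V) (hker (sub M ?V) (sub (quot M U) (f ` carrier X)) (crep M U)) \<in> T"
        using U by simp
    qed
    then have VU: "?V \<subseteq> U" using big rV by simp
    have "f x \<in> carrier (quot M U)" using rhomD(1)[OF f x] .
    then obtain m where m: "m \<in> carrier M" "f x = crep M U m" using M.crep_surj[OF rU] by auto
    then have "m \<in> U" using VU x by auto
    then show "f x = \<zero>\<^bsub>quot M U\<^esub>" using m M.crep_zero_iff[OF rU] by simp
  qed
  then show ?thesis using U quot_mods(1)[OF M rU] by (auto simp: rperp_def)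
qed

definition trad :: "'a fgmod \<Rightarrow> (nat \<Rightarrow> 'a) set set"
  where "trad M = (SOME U. rsubmodule \<Lambda> M U \<and> sub M U \<in> T \<and> quot M U \<in> rperp T)"

lemma trad:
  assumes M: "M \<in> mods"
  shows "rsubmodule \<Lambda> M (trad M)" "sub M (trad M) \<in> T" "quot M (trad M) \<in> rperp T"
  using someI_ex[OF torsion_radical_exists[OF M]] by (auto simp: trad_def)

lemma trad_image:
  assumes M: "M \<in> mods" and X: "X \<in> T" and f: "f \<in> rhom \<Lambda> X M"
  shows "f ` carrier X \<subseteq> trad M"
proof -
  interpret M: right_module \<Lambda> M by (rule modsD(1)[OF M])
  have h: "hom0 X (quot M (trad M))" using trad(3)[OF M] X by (auto simp: rperp_def)
  show ?thesis
    using hom0D[OF h rhom_comp[OF f M.crep_hom[OF trad(1)[OF M]]]] M.crep_zero_iff[OF trad(1)[OF M]] rhomD(1)[OF f]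
    by auto
qed

lemma tors_rperp_zero: "M \<in> T \<Longrightarrow> M \<in> rperp T \<Longrightarrow> carrier M = {\<zero>\<^bsub>M\<^esub>}"
  using hom0_self[of M] modsD(1)[OF torsD(2)[of M]] by (auto simp: rperp_def)

end


lemma tors_vimage:
  assumes tors: "torsion_class \<Lambda> T" and M: "M \<in> mods" and U: "rsubmodule \<Lambda> M U" "sub M U \<in> T"
    and V: "rsubmodule \<Lambda> (quot M U) V" "sub (quot M U) V \<in> T"
  shows "rsubmodule \<Lambda> M {m \<in> carrier M. crep M U m \<in> V}" "U \<subseteq> {m \<in> carrier M. crep M U m \<in> V}"
    "crep M U ` {m \<in> carrier M. crep M U m \<in> V} = V" "sub M {m \<in> carrier M. crep M U m \<in> V} \<in> T"
proof -
  note Mm = modsD(1)[OF M]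
  interpret M: right_module \<Lambda> M by fact
  note Qm = M.right_module_quot[OF U(1)]
  let ?V = "{m \<in> carrier M. crep M U m \<in> V}"
  show rV: "rsubmodule \<Lambda> M ?V" by (rule rsub_vimage[OF Mm Qm M.crep_hom[OF U(1)] V(1)])
  show UV: "U \<subseteq> ?V"
  proof
    fix u assume u: "u \<in> U"
    then have uc: "u \<in> carrier M" using M.rsubD(2)[OF U(1)] by simp
    then have "crep M U u = \<zero>\<^bsub>quot M U\<^esub>" using M.crep_zero_iff[OF U(1)] u by simp
    then show "u \<in> ?V" using uc right_module.rsubD(3)[OF Qm V(1)] by simp
  qed
  show im: "crep M U ` ?V = V"
  proof
    show "V \<subseteq> crep M U ` ?V"
    proof
      fix y assume y: "y \<in> V"
      then have "y \<in> carrier (quot M U)" using right_module.rsubD(2)[OF Qm V(1)] by simp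
      then obtain m where "m \<in> carrier M" "y = crep M U m" using M.crep_surj[OF U(1)] by auto
      then show "y \<in> crep M U ` ?V" using y by auto
    qed
  qed auto
  have c: "crep M U \<in> rhom \<Lambda> (sub M ?V) (sub (quot M U) V)"
    by (rule rhom_corestrict[OF rhom_restrict[OF M.crep_hom[OF U(1)]]]) auto
  have k: "hker (sub M ?V) (sub (quot M U) V) (crep M U) = U"
    using UV M.crep_zero_iff[OF U(1)] by (auto simp: hker_restrict)
  show "sub M ?V \<in> T"
    by (rule tors_ext[OF tors sub_mods(1)[OF M rV] V(2) c]) (simp_all add: im k[simplified] U(2))
qed

section \<open>IE-closed subcategories as intersections of a torsion and a torsion-free
  class\<close>

lemma IE_D:
  assumes "IE_closed \<Lambda> C"
  shows "subcategory \<Lambda> C" "ext_closed \<Lambda> C" "C \<subseteq> mods"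
    "M \<in> C \<Longrightarrow> N \<in> C \<Longrightarrow> f \<in> rhom \<Lambda> M N \<Longrightarrow> sub N (f ` carrier M) \<in> C"
proof -
  have IE: "subcategory \<Lambda> C" "image_closed \<Lambda> C" "ext_closed \<Lambda> C" using assms by (auto simp: IE_closed_def)
  show "subcategory \<Lambda> C" "ext_closed \<Lambda> C" by fact+
  show "C \<subseteq> mods" by (rule subcategoryD(1)[OF IE(1)])
  show "M \<in> C \<Longrightarrow> N \<in> C \<Longrightarrow> f \<in> rhom \<Lambda> M N \<Longrightarrow> sub N (f ` carrier M) \<in> C"
    using IE(2) unfolding image_closed_def im_mod_eq by blast
qed

lemma iso_closed_inv:
  assumes "subcategory \<Lambda> C" "N \<in> C" "right_module \<Lambda> M" "f \<in> rhom \<Lambda> M N" "bij_betw f (carrier M) (carrier N)"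
  shows "M \<in> C"
  by (rule subcategoryD(2)[OF assms(1,2,3) rhom_inv[OF assms(3-5)] bij_betw_inv_into[OF assms(5)]])

lemma quot_carrier_zero:
  assumes "right_module \<Lambda> M"
  shows "carrier (quot M (carrier M)) = {\<zero>\<^bsub>quot M (carrier M)\<^esub>}"
proof -
  interpret M: right_module \<Lambda> M by fact
  have "crep M (carrier M) ` carrier M = {\<zero>\<^bsub>quot M (carrier M)\<^esub>}"
    using M.crep_zero_iff[OF M.rsub_carrier] M.M.zero_closed by auto
  then show ?thesis by (simp add: M.crep_surj[OF M.rsub_carrier])
qed

lemma quot_zero_imp:
  assumes "right_module \<Lambda> M" "rsubmodule \<Lambda> M U" "carrier (quot M U) = {\<zero>\<^bsub>quot M U\<^esub>}"
  shows "U = carrier M"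
proof -
  interpret M: right_module \<Lambda> M by fact
  have "x \<in> U" if "x \<in> carrier M" for x
  proof -
    have "crep M U x \<in> carrier (quot M U)" using that M.crep_surj[OF assms(2)] by auto
    then show ?thesis using assms(3) M.crep_zero_iff[OF assms(2) that] by simp
  qed
  then show ?thesis using M.rsubD(1)[OF assms(2)] by auto
qed

text \<open>The kernel of the quotient map being embedded in \<open>C0\<close>, pushing out along this embedding
  gives an extension \<open>E\<close> in \<open>C\<close> that contains \<open>M\<close>, so that \<open>M\<close> is the image of a map \<open>P \<rightarrow> E\<close>.\<close>

lemma IE_pushout:
  assumes C: "IE_closed \<Lambda> C" and M: "M \<in> mods" and A: "rsubmodule \<Lambda> M A" and C0: "C0 \<in> C"
    and f: "f \<in> rhom \<Lambda> (sub M A) C0" "inj_on f A" and Q: "quot M A \<in> C"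
    and P: "P \<in> C" and h: "h \<in> rhom \<Lambda> P M" "h ` carrier P = carrier M"
  shows "M \<in> C"
proof -
  note CD = IE_D[OF C] and sc = subcategoryD[OF IE_D(1)[OF C]]
  have C0m: "C0 \<in> mods" using C0 CD(3) by auto
  note mm = modsD(1)[OF M] modsD(1)[OF C0m]
  interpret M: right_module \<Lambda> M by (rule mm)
  interpret C: right_module \<Lambda> C0 by (rule mm)
  note AM = M.right_module_sub[OF A]
  obtain D i j p q where b: "biprod C0 M D i j p q" by (rule biprod_exists[OF C0m M])
  note B = biprodD[OF b]
  note Dm = modsD(1)[OF B(1)]
  interpret D: right_module \<Lambda> D by fact
  have AC: "a \<in> carrier M" if "a \<in> A" for a using that M.rsubD(2)[OF A] by simp
  have fc: "f a \<in> carrier C0" if "a \<in> A" for a using rhomD(1)[OF f(1)] that by simp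
  \<comment> \<open>The antidiagonal image \<open>W\<close> of \<open>A\<close> in the sum of
    \<open>C0\<close> and \<open>M\<close> is divided out; the quotient \<open>E\<close> is the
    pushout.\<close>
  define w where "w = (\<lambda>a. i (f a) \<ominus>\<^bsub>D\<^esub> j a)"
  have w: "w \<in> rhom \<Lambda> (sub M A) D"
    unfolding w_def
    by (rule rhom_minus_fun[OF Dm rhom_comp[OF f(1) B(3)] rhom_restrict[OF B(4) M.rsubD(1)[OF A]]])
  have pw: "p (w a) = f a" and qw: "q (w a) = \<ominus>\<^bsub>M\<^esub> a" if "a \<in> A" for a
  proof -
    note c = fc[OF that] AC[OF that]
    note d = rhomD(1)[OF B(3) c(1)] rhomD(1)[OF B(4) c(2)]
    show "p (w a) = f a" "q (w a) = \<ominus>\<^bsub>M\<^esub> a"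
      unfolding w_def using c d
      by (simp_all add: rhom_minus(2)[OF Dm mm(2) B(5)] rhom_minus(2)[OF Dm mm(1) B(6)] B(7-10))
        (simp_all add: a_minus_def)
  qed
  define W where "W = w ` A"
  have rW: "rsubmodule \<Lambda> D W" unfolding W_def using rsub_range[OF AM Dm w] by simp
  define E where "E = quot D W"
  define e where "e = crep D W"
  have e: "e \<in> rhom \<Lambda> D E" "e ` carrier D = carrier E" unfolding e_def E_def by (rule D.crep_hom[OF rW], rule D.crep_surj[OF rW])
  have e0: "e d = \<zero>\<^bsub>E\<^esub> \<longleftrightarrow> d \<in> W" if "d \<in> carrier D" for d
    using D.crep_zero_iff[OF rW that] by (simp add: e_def E_def)
  have E: "E \<in> mods" unfolding E_def by (rule quot_mods(1)[OF B(1) rW])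
  note Em = modsD(1)[OF E]
  interpret E: right_module \<Lambda> E by fact
  note Qm = M.right_module_quot[OF A]
  have cq: "(\<lambda>d. crep M A (q d)) \<in> rhom \<Lambda> D (quot M A)" by (rule rhom_comp[OF B(6) M.crep_hom[OF A]])
  have "crep M A (q d) = \<zero>\<^bsub>quot M A\<^esub>" if d: "d \<in> carrier D" "e d = \<zero>\<^bsub>E\<^esub>" for d
  proof -
    obtain a where a: "a \<in> A" "d = w a" using e0[OF d(1)] d(2) by (auto simp: W_def)
    then have "q d \<in> A" using qw[OF a(1)] M.rsubD(5)[OF A] by simp
    then show ?thesis using M.crep_zero_iff[OF A] AC by simp
  qed
  then obtain \<gamma> where \<gamma>: "\<gamma> \<in> rhom \<Lambda> E (quot M A)" "\<And>d. d \<in> carrier D \<Longrightarrow> \<gamma> (e d) = crep M A (q d)"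
    using rhom_factor[OF Dm Em Qm e cq] by metis
  have \<alpha>: "(\<lambda>x. e (i x)) \<in> rhom \<Lambda> C0 E" by (rule rhom_comp[OF B(3) e(1)])
  have \<beta>: "(\<lambda>x. e (j x)) \<in> rhom \<Lambda> M E" by (rule rhom_comp[OF B(4) e(1)])
  have \<alpha>inj: "inj_on (\<lambda>x. e (i x)) (carrier C0)"
    unfolding rhom_inj_iff[OF mm(2) Em \<alpha>]
  proof
    show "hker C0 E (\<lambda>x. e (i x)) \<subseteq> {\<zero>\<^bsub>C0\<^esub>}"
    proof
      fix x assume "x \<in> hker C0 E (\<lambda>x. e (i x))"
      then have x: "x \<in> carrier C0" "e (i x) = \<zero>\<^bsub>E\<^esub>" by (auto simp: hker_def)
      then obtain a where a: "a \<in> A" "i x = w a" using e0[OF rhomD(1)[OF B(3) x(1)]] by (auto simp: W_def)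
      then have "\<ominus>\<^bsub>M\<^esub> a = \<zero>\<^bsub>M\<^esub>" using qw[OF a(1)] B(8)[OF x(1)] by simp
      then have "a = \<zero>\<^bsub>M\<^esub>" using AC[OF a(1)] M.M.minus_minus[of a] M.neg_zero by simp
      then have "x = f \<zero>\<^bsub>M\<^esub>" using pw[OF a(1)] a(2) B(7)[OF x(1)] by simp
      then show "x \<in> {\<zero>\<^bsub>C0\<^esub>}" using rhom_zero[OF AM mm(2) f(1)] by simp
    qed
    show "{\<zero>\<^bsub>C0\<^esub>} \<subseteq> hker C0 E (\<lambda>x. e (i x))" using rhom_zero[OF mm(2) Em \<alpha>] by (simp add: hker_def)
  qed
  have \<beta>inj: "inj_on (\<lambda>x. e (j x)) (carrier M)"
    unfolding rhom_inj_iff[OF mm(1) Em \<beta>]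
  proof
    show "hker M E (\<lambda>x. e (j x)) \<subseteq> {\<zero>\<^bsub>M\<^esub>}"
    proof
      fix x assume "x \<in> hker M E (\<lambda>x. e (j x))"
      then have x: "x \<in> carrier M" "e (j x) = \<zero>\<^bsub>E\<^esub>" by (auto simp: hker_def)
      then obtain a where a: "a \<in> A" "j x = w a" using e0[OF rhomD(1)[OF B(4) x(1)]] by (auto simp: W_def)
      then have "f a = f \<zero>\<^bsub>M\<^esub>" using pw[OF a(1)] B(10)[OF x(1)] rhom_zero[OF AM mm(2) f(1)] by simp
      then have "a = \<zero>\<^bsub>M\<^esub>" using inj_onD[OF f(2)] a(1) M.rsubD(3)[OF A] by simp
      then show "x \<in> {\<zero>\<^bsub>M\<^esub>}" using qw[OF a(1)] a(2) B(9)[OF x(1)] M.neg_zero by simp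
    qed
    show "{\<zero>\<^bsub>M\<^esub>} \<subseteq> hker M E (\<lambda>x. e (j x))" using rhom_zero[OF mm(1) Em \<beta>] by (simp add: hker_def)
  qed
  have \<gamma>surj: "\<gamma> ` carrier E = carrier (quot M A)"
  proof
    show "\<gamma> ` carrier E \<subseteq> carrier (quot M A)" using rhomD(1)[OF \<gamma>(1)] by auto
    show "carrier (quot M A) \<subseteq> \<gamma> ` carrier E"
    proof
      fix y assume "y \<in> carrier (quot M A)"
      then obtain m where m: "m \<in> carrier M" "y = crep M A m" using M.crep_surj[OF A] by auto
      note jm = rhomD(1)[OF B(4) m(1)]
      have "y = \<gamma> (e (j m))" using \<gamma>(2)[OF jm] B(9)[OF m(1)] m(2) by simp
      then show "y \<in> \<gamma> ` carrier E" using rhomD(1)[OF e(1) jm] by auto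
    qed
  qed
  have ker: "hker E (quot M A) \<gamma> = (\<lambda>x. e (i x)) ` carrier C0"
  proof
    show "(\<lambda>x. e (i x)) ` carrier C0 \<subseteq> hker E (quot M A) \<gamma>"
    proof
      fix y assume "y \<in> (\<lambda>x. e (i x)) ` carrier C0"
      then obtain x where x: "x \<in> carrier C0" "y = e (i x)" by auto
      note ix = rhomD(1)[OF B(3) x(1)]
      have "\<gamma> y = \<zero>\<^bsub>quot M A\<^esub>"
        using \<gamma>(2)[OF ix] B(8)[OF x(1)] x(2) rhom_zero[OF mm(1) Qm M.crep_hom[OF A]] by simp
      then show "y \<in> hker E (quot M A) \<gamma>" using x(2) rhomD(1)[OF e(1) ix] by (simp add: hker_def)
    qed
    show "hker E (quot M A) \<gamma> \<subseteq> (\<lambda>x. e (i x)) ` carrier C0"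
    proof
      fix y assume "y \<in> hker E (quot M A) \<gamma>"
      then have y: "y \<in> carrier E" "\<gamma> y = \<zero>\<^bsub>quot M A\<^esub>" by (auto simp: hker_def)
      have "y \<in> e ` carrier D" using y(1) by (simp only: e(2))
      then obtain d where d: "d \<in> carrier D" "y = e d" by blast
      have pd: "p d \<in> carrier C0" and qd: "q d \<in> carrier M" using rhomD(1)[OF B(5) d(1)] rhomD(1)[OF B(6) d(1)] .
      have a: "q d \<in> A" using \<gamma>(2)[OF d(1)] y(2) d(2) M.crep_zero_iff[OF A qd] by simp
      have fa: "f (q d) \<in> carrier C0" using fc[OF a] .
      note c = rhomD(1)[OF B(3) pd] rhomD(1)[OF B(3) fa] rhomD(1)[OF B(4) qd]
      have wc: "w (q d) \<in> carrier D" using rhomD(1)[OF w] a by simp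
      have "d \<oplus>\<^bsub>D\<^esub> w (q d) = (i (p d) \<oplus>\<^bsub>D\<^esub> j (q d)) \<oplus>\<^bsub>D\<^esub> (i (f (q d)) \<ominus>\<^bsub>D\<^esub> j (q d))"
        using B(11)[OF d(1)] by (simp add: w_def)
      also have "\<dots> = i (p d) \<oplus>\<^bsub>D\<^esub> i (f (q d))"
        using c D.M.r_neg2 by (simp add: a_minus_def D.M.a_ac D.M.r_neg1)
      also have "\<dots> = i (p d \<oplus>\<^bsub>C0\<^esub> f (q d))" using rhomD(2)[OF B(3) pd fa] by simp
      finally have "e (d \<oplus>\<^bsub>D\<^esub> w (q d)) = e (i (p d \<oplus>\<^bsub>C0\<^esub> f (q d)))" by simp
      moreover have "e (w (q d)) = \<zero>\<^bsub>E\<^esub>" using e0[OF wc] a by (simp add: W_def)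
      ultimately have "y = e (i (p d \<oplus>\<^bsub>C0\<^esub> f (q d)))"
        using rhomD(2)[OF e(1) d(1) wc] y(1) d(2) by simp
      then show "y \<in> (\<lambda>x. e (i x)) ` carrier C0" using pd fa by auto
    qed
  qed
  have kE: "rsubmodule \<Lambda> E (hker E (quot M A) \<gamma>)" by (rule rsub_hker[OF Em Qm \<gamma>(1)])
  have "sub E (hker E (quot M A) \<gamma>) \<in> C"
    by (rule sc(2)[OF C0 E.right_module_sub[OF kE] rhom_corestrict[OF \<alpha>]])
      (use \<alpha>inj in \<open>auto simp: ker bij_betw_def\<close>)
  then have EC: "E \<in> C" by (rule ext_closedD[OF CD(2) E Q \<gamma>(1) \<gamma>surj])
  have \<beta>h: "(\<lambda>x. e (j (h x))) \<in> rhom \<Lambda> P E" by (rule rhom_comp[OF h(1) \<beta>])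
  have im: "(\<lambda>x. e (j (h x))) ` carrier P = (\<lambda>x. e (j x)) ` carrier M"
    using h(2) by (metis (no_types, lifting) image_cong image_image)
  have "sub E ((\<lambda>x. e (j x)) ` carrier M) \<in> C" using CD(4)[OF P EC \<beta>h] by (simp only: im)
  then show "M \<in> C"
    by (rule iso_closed_inv[OF CD(1) _ mm(1) rhom_corestrict[OF \<beta>]]) (use \<beta>inj in \<open>auto simp: bij_betw_def\<close>)
qed

text \<open>Choose a nonzero \<open>A\<close> of least length such that \<open>M/A\<close> still
  belongs to \<open>rperp (lperp C)\<close>. As a nonzero module of that class, \<open>A\<close> has
  a nonzero map \<open>f\<close> to a module of \<open>C\<close>. Dividing \<open>M\<close> by the
  kernel of \<open>f\<close> stays in the class as well, so minimality makes \<open>f\<close>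
  injective. Induction puts \<open>M/A\<close> into \<open>C\<close>, and \<open>IE_pushout\<close>
  concludes.\<close>

lemma IE_fac:
  assumes C: "IE_closed \<Lambda> C"
  shows "M \<in> mods \<Longrightarrow> M \<in> rperp (lperp C) \<Longrightarrow> P \<in> C \<Longrightarrow> h \<in> rhom \<Lambda> P M \<Longrightarrow> h ` carrier P = carrier M \<Longrightarrow> M \<in> C"
proof (induction "lg M" arbitrary: M h rule: less_induct)
  case less
  note CD = IE_D[OF C] and sc = subcategoryD[OF IE_D(1)[OF C]]
  note M = less.prems(1) and Mm = modsD(1)[OF less.prems(1)]
  interpret M: right_module \<Lambda> M by (rule Mm)
  let ?F = "rperp (lperp C)"
  have L: "lperp C \<subseteq> mods" by (auto simp: lperp_def)
  show ?case
  proof (cases "carrier M = {\<zero>\<^bsub>M\<^esub>}")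
    case True
    then show ?thesis by (rule sc(3)[OF M])
  next
    case nz: False
    let ?ok = "\<lambda>A. rsubmodule \<Lambda> M A \<and> A \<noteq> {\<zero>\<^bsub>M\<^esub>} \<and> quot M A \<in> ?F"
    have "?ok (carrier M)"
      using nz M.rsub_carrier rperp_zero[OF quot_mods(1)[OF M M.rsub_carrier] quot_carrier_zero[OF Mm]] by simp
    then obtain A where A: "?ok A" and min: "\<And>A'. ?ok A' \<Longrightarrow> lg (sub M A) \<le> lg (sub M A')"
      using ex_has_least_nat[of ?ok "carrier M" "\<lambda>A. lg (sub M A)"] by blast
    then have rA: "rsubmodule \<Lambda> M A" and QF: "quot M A \<in> ?F" by auto
    note AM = M.right_module_sub[OF rA] and Qm = M.right_module_quot[OF rA]
    have Ac: "a \<in> carrier M" if "a \<in> A" for a using that M.rsubD(2)[OF rA] by simp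
    have Am: "sub M A \<in> mods" by (rule sub_mods(1)[OF M rA])
    have "sub M A \<in> ?F" by (rule rperp_sub[OF less.prems(2) rA])
    then have "sub M A \<notin> lperp C" using A hom0_self[OF _ AM] by (auto simp: rperp_def)
    then obtain C0 where C0: "C0 \<in> C" "\<not> hom0 (sub M A) C0" using Am by (auto simp: lperp_def)
    then obtain f a0 where f: "f \<in> rhom \<Lambda> (sub M A) C0" "a0 \<in> A" "f a0 \<noteq> \<zero>\<^bsub>C0\<^esub>"
      unfolding hom0_def by auto
    have C0m: "right_module \<Lambda> C0" using C0(1) CD(3) modsD(1) by auto
    define A' where "A' = hker (sub M A) C0 f"
    have "rsubmodule \<Lambda> (sub M A) A'" unfolding A'_def by (rule rsub_hker[OF AM C0m f(1)])
    then have rA': "rsubmodule \<Lambda> M A'" and A'A: "A' \<subseteq> A" using M.rsub_sub[OF rA] by auto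
    have A'k: "a \<in> A' \<longleftrightarrow> a \<in> A \<and> f a = \<zero>\<^bsub>C0\<^esub>" for a by (auto simp: A'_def hker_def)
    have ne: "A' \<noteq> A" using f A'k by auto
    note Q'm = M.right_module_quot[OF rA']
    let ?c = "crep M A" and ?c' = "crep M A'"
    \<comment> \<open>A map from \<open>X\<close> to \<open>M/A'\<close> lands in
      \<open>A/A'\<close>, because \<open>M/A\<close> receives no nonzero map from \<open>X\<close>.
      Now \<open>A/A'\<close> embeds into \<open>C0\<close> through \<open>f\<close>, and
      \<open>X\<close> has no nonzero map to \<open>C0\<close>.\<close>
    have "hom0 X (quot M A')" if X: "X \<in> lperp C" for X
    proof (rule hom0I)
      fix k x assume k: "k \<in> rhom \<Lambda> X (quot M A')" and x: "x \<in> carrier X"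
      have "?c m = \<zero>\<^bsub>quot M A\<^esub>" if "m \<in> carrier M" "?c' m = \<zero>\<^bsub>quot M A'\<^esub>" for m
        using that A'A M.crep_zero_iff[OF rA'] M.crep_zero_iff[OF rA] by auto
      then obtain g where g: "g \<in> rhom \<Lambda> (quot M A') (quot M A)" "\<And>m. m \<in> carrier M \<Longrightarrow> g (?c' m) = ?c m"
        using rhom_factor[OF Mm Q'm Qm M.crep_hom[OF rA'] M.crep_surj[OF rA'] M.crep_hom[OF rA]] by metis
      have hQ: "hom0 X (quot M A)" using QF X by (auto simp: rperp_def)
      have kA: "\<exists>a\<in>A. k z = ?c' a" if z: "z \<in> carrier X" for z
      proof -
        obtain m where m: "m \<in> carrier M" "k z = ?c' m" using rhomD(1)[OF k z] M.crep_surj[OF rA'] by auto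
        have "g (k z) = \<zero>\<^bsub>quot M A\<^esub>" by (rule hom0D[OF hQ rhom_comp[OF k g(1)] z])
        then have "m \<in> A" using g(2)[OF m(1)] m M.crep_zero_iff[OF rA m(1)] by simp
        then show ?thesis using m by auto
      qed
      let ?B = "?c' ` A"
      have cA: "?c' \<in> rhom \<Lambda> (sub M A) (sub (quot M A') ?B)"
        by (rule rhom_corestrict[OF rhom_restrict[OF M.crep_hom[OF rA'] M.rsubD(1)[OF rA]]]) simp
      have Bm: "right_module \<Lambda> (sub (quot M A') ?B)"
        by (rule right_module.right_module_sub[OF Q'm rsub_image[OF Mm Q'm M.crep_hom[OF rA'] rA]])
      have "f a = \<zero>\<^bsub>C0\<^esub>" if "a \<in> carrier (sub M A)" "?c' a = \<zero>\<^bsub>sub (quot M A') ?B\<^esub>" for a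
        using that M.crep_zero_iff[OF rA'] Ac A'k by simp
      then obtain fb where fb: "fb \<in> rhom \<Lambda> (sub (quot M A') ?B) C0" "\<And>a. a \<in> A \<Longrightarrow> fb (?c' a) = f a"
        using rhom_factor[OF AM Bm C0m cA _ f(1)] by (metis sub_simps(1))
      have kB: "k \<in> rhom \<Lambda> X (sub (quot M A') ?B)" by (rule rhom_corestrict[OF k]) (use kA in blast)
      have "hom0 X C0" using X C0(1) by (auto simp: lperp_def)
      then have z: "fb (k x) = \<zero>\<^bsub>C0\<^esub>" by (rule hom0D[OF _ rhom_comp[OF kB fb(1)] x])
      obtain a where a: "a \<in> A" "k x = ?c' a" using kA[OF x] by auto
      then have "a \<in> A'" using z fb(2)[OF a(1)] A'k by simp
      then show "k x = \<zero>\<^bsub>quot M A'\<^esub>" using a M.crep_zero_iff[OF rA' Ac[OF a(1)]] by simp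
    qed
    then have Q'F: "quot M A' \<in> ?F" using quot_mods(1)[OF M rA'] by (simp add: rperp_def)
    have "A' = {\<zero>\<^bsub>M\<^esub>}"
    proof (rule ccontr)
      assume "A' \<noteq> {\<zero>\<^bsub>M\<^esub>}"
      then have "lg (sub M A) \<le> lg (sub M A')" using min rA' Q'F by simp
      moreover have "lg (sub (sub M A) A') < lg (sub M A)"
        by (rule sub_mods(3)[OF Am]) (use M.rsub_sub[OF rA] rA' A'A ne in auto)
      ultimately show False by simp
    qed
    then have finj: "inj_on f A" using rhom_inj_iff[OF AM C0m f(1)] by (simp add: A'_def)
    have "lg (sub M A) \<noteq> 0"
    proof
      assume "lg (sub M A) = 0"
      then have "A = {\<zero>\<^bsub>M\<^esub>}" using lg_eq_zero[OF Am] by simp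
      then show False using A by simp
    qed
    then have "lg (quot M A) < lg M" using quot_mods(2)[OF M rA] by simp
    moreover have "(\<lambda>x. ?c (h x)) \<in> rhom \<Lambda> P (quot M A)" by (rule rhom_comp[OF less.prems(4) M.crep_hom[OF rA]])
    moreover have "(\<lambda>x. ?c (h x)) ` carrier P = carrier (quot M A)"
      using less.prems(5) M.crep_surj[OF rA] by (metis image_image)
    ultimately have QC: "quot M A \<in> C" using less.hyps quot_mods(1)[OF M rA] QF less.prems(3) by blast
    show ?thesis by (rule IE_pushout[OF C M rA C0(1) f(1) finj QC less.prems(3-5)])
  qed
qed

text \<open>For a proper submodule \<open>A\<close> of maximal length in the torsion class,
  \<open>A\<close> lies in \<open>C\<close> by induction and \<open>M/A\<close> is an image of some
  \<open>C2\<close> in \<open>C\<close>. The pullback of \<open>M\<close> and \<open>C2\<close> over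
  \<open>M/A\<close> is an extension of \<open>C2\<close> by \<open>A\<close>, hence in
  \<open>C\<close>, and it maps onto \<open>M\<close>, so that \<open>IE_fac\<close>
  applies.\<close>

lemma IE_inter:
  assumes C: "IE_closed \<Lambda> C"
  shows "M \<in> lperp (rperp C) \<Longrightarrow> M \<in> rperp (lperp C) \<Longrightarrow> M \<in> C"
proof (induction "lg M" arbitrary: M rule: less_induct)
  case less
  note CD = IE_D[OF C] and sc = subcategoryD[OF IE_D(1)[OF C]]
  let ?T = "lperp (rperp C)"
  have M: "M \<in> mods" using less.prems by (simp add: lperp_def)
  note Mm = modsD(1)[OF M]
  interpret M: right_module \<Lambda> M by (rule Mm)
  have T: "torsion_class \<Lambda> ?T" by (rule lperp_torsion) (auto simp: rperp_def)
  have CT: "C \<subseteq> ?T" using CD(3) by (auto simp: lperp_def rperp_def)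
  show ?case
  proof (cases "carrier M = {\<zero>\<^bsub>M\<^esub>}")
    case True
    then show ?thesis by (rule sc(3)[OF M])
  next
    case nz: False
    let ?ok = "\<lambda>A. rsubmodule \<Lambda> M A \<and> A \<noteq> carrier M \<and> sub M A \<in> ?T"
    have "?ok {\<zero>\<^bsub>M\<^esub>}" using nz M.rsub_zero torsD(3)[OF T sub_mods(1)[OF M M.rsub_zero]] by simp
    moreover have "\<forall>A. ?ok A \<longrightarrow> lg (sub M A) < Suc (lg M)" using sub_mods(2)[OF M] by (simp add: less_Suc_eq_le)
    ultimately obtain A where A: "?ok A" and max: "\<And>A'. ?ok A' \<Longrightarrow> lg (sub M A') \<le> lg (sub M A)"
      using ex_has_greatest_nat[of ?ok _ "\<lambda>U. lg (sub M U)" "Suc (lg M)"] by blast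
    then have rA: "rsubmodule \<Lambda> M A" and AT: "sub M A \<in> ?T" and AM: "A \<noteq> carrier M" by auto
    let ?Q = "quot M A" and ?c = "crep M A"
    note Qm = M.right_module_quot[OF rA]
    note c = M.crep_hom[OF rA] and cs = M.crep_surj[OF rA] and c0 = M.crep_zero_iff[OF rA]
    have QT: "?Q \<in> ?T" by (rule tors_quot[OF T less.prems(1) Qm c cs])
    have "carrier ?Q \<noteq> {\<zero>\<^bsub>?Q\<^esub>}" using quot_zero_imp[OF Mm rA] AM by auto
    then have "?Q \<notin> rperp C" using QT hom0_self[OF _ Qm] by (auto simp: lperp_def)
    then obtain C2 where C2: "C2 \<in> C" "\<not> hom0 C2 ?Q" using quot_mods(1)[OF M rA] by (auto simp: rperp_def)
    then obtain f x0 where f: "f \<in> rhom \<Lambda> C2 ?Q" "x0 \<in> carrier C2" "f x0 \<noteq> \<zero>\<^bsub>?Q\<^esub>"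
      unfolding hom0_def by auto
    have C2m: "C2 \<in> mods" using C2(1) CD(3) by auto
    note fi = rsub_range[OF modsD(1)[OF C2m] Qm f(1)]
    let ?I = "{m \<in> carrier M. ?c m \<in> f ` carrier C2}"
    have fT: "sub ?Q (f ` carrier C2) \<in> ?T" by (rule tors_image[OF T _ Qm f(1)]) (use C2 CT in auto)
    note v = tors_vimage[OF T M rA AT fi fT]
    \<comment> \<open>The preimage of the image of \<open>C2\<close> is torsion, being an extension,
      and properly contains \<open>A\<close>. Maximality therefore makes \<open>C2\<close> map onto
      \<open>M/A\<close>.\<close>
    have "?I = carrier M"
    proof (rule ccontr)
      assume "?I \<noteq> carrier M"
      then have le: "lg (sub M ?I) \<le> lg (sub M A)" using max v(1,4) by simp
      have "A \<noteq> ?I"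
      proof
        assume "A = ?I"
        obtain m where m: "m \<in> carrier M" "f x0 = ?c m" using rhomD(1)[OF f(1,2)] cs by auto
        then have "m \<in> A" using f(2) \<open>A = ?I\<close> by auto
        then show False using m f(3) c0[OF m(1)] by simp
      qed
      then have "lg (sub (sub M ?I) A) < lg (sub M ?I)"
        by (intro sub_mods(3)[OF sub_mods(1)[OF M v(1)]]) (use M.rsub_sub[OF v(1)] rA v(2) in auto)
      then show False using le by simp
    qed
    then have fs: "\<exists>y\<in>carrier C2. ?c m = f y" if "m \<in> carrier M" for m using that by blast
    have "lg (sub M A) < lg M" by (rule sub_mods(3)[OF M rA AM])
    then have AC: "sub M A \<in> C" by (rule less.hyps[OF _ AT rperp_sub[OF less.prems(2) rA]])
    obtain E a b where E: "E \<in> mods" "a \<in> rhom \<Lambda> E M" "b \<in> rhom \<Lambda> E C2"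
      "\<forall>e\<in>carrier E. ?c (a e) = f (b e)"
      "\<forall>x\<in>carrier M. \<forall>y\<in>carrier C2. ?c x = f y \<longrightarrow> (\<exists>e\<in>carrier E. a e = x \<and> b e = y)"
      "bij_betw a (hker E C2 b) (hker M ?Q ?c)"
      by (rule pullback_exists[OF M C2m Qm c f(1)])
    have kb: "rsubmodule \<Lambda> E (hker E C2 b)" by (rule rsub_hker[OF modsD(1)[OF E(1)] modsD(1)[OF C2m] E(3)])
    have bs: "b ` carrier E = carrier C2"
    proof
      show "b ` carrier E \<subseteq> carrier C2" using rhomD(1)[OF E(3)] by auto
      show "carrier C2 \<subseteq> b ` carrier E"
      proof
        fix y assume y: "y \<in> carrier C2"
        obtain m where m: "m \<in> carrier M" "f y = ?c m" using rhomD(1)[OF f(1) y] cs by auto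
        then have "\<exists>e\<in>carrier E. a e = m \<and> b e = y" using E(5) y by simp
        then show "y \<in> b ` carrier E" by blast
      qed
    qed
    have as: "a ` carrier E = carrier M"
    proof
      show "a ` carrier E \<subseteq> carrier M" using rhomD(1)[OF E(2)] by auto
      show "carrier M \<subseteq> a ` carrier E"
      proof
        fix m assume m: "m \<in> carrier M"
        obtain y where y: "y \<in> carrier C2" "?c m = f y" using fs[OF m] by auto
        then have "\<exists>e\<in>carrier E. a e = m \<and> b e = y" using E(5) m by simp
        then show "m \<in> a ` carrier E" by blast
      qed
    qed
    have ab: "bij_betw a (carrier (sub E (hker E C2 b))) (carrier (sub M A))"
      using E(6) by (simp add: M.hker_crep[OF rA])
    have kE: "hker E C2 b \<subseteq> carrier E" by (auto simp: hker_def)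
    have "a \<in> rhom \<Lambda> (sub E (hker E C2 b)) (sub M A)"
      by (rule rhom_corestrict[OF rhom_restrict[OF E(2) kE]]) (use ab in \<open>auto simp: bij_betw_def\<close>)
    then have "sub E (hker E C2 b) \<in> C"
      by (rule iso_closed_inv[OF CD(1) AC modsD(1)[OF sub_mods(1)[OF E(1) kb]] _ ab])
    then have "E \<in> C" by (rule ext_closedD[OF CD(2) E(1) C2(1) E(3) bs])
    then show ?thesis by (rule IE_fac[OF C M less.prems(2) _ E(2) as])
  qed
qed

lemma IE_eq:
  assumes C: "IE_closed \<Lambda> C"
  shows "C = lperp (rperp C) \<inter> rperp (lperp C)"
proof
  show "C \<subseteq> lperp (rperp C) \<inter> rperp (lperp C)"
  proof
    fix M assume M: "M \<in> C"
    then have Mm: "M \<in> mods" using IE_D(3)[OF C] by (rule rev_subsetD)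
    show "M \<in> lperp (rperp C) \<inter> rperp (lperp C)" using M Mm by (simp add: lperp_def rperp_def)
  qed
  show "lperp (rperp C) \<inter> rperp (lperp C) \<subseteq> C"
  proof
    fix M assume "M \<in> lperp (rperp C) \<inter> rperp (lperp C)"
    then show "M \<in> C" by (intro IE_inter[OF C]) simp_all
  qed
qed

text \<open>\<open>C\<close> is recovered from the two torsion classes
  \<open>lperp (rperp C)\<close> and \<open>lperp C\<close>, so the number of IE-closed
  subcategories is at most the square of the number of torsion classes.\<close>

lemma finite_IE:
  assumes "finite {T. torsion_class \<Lambda> T}"
  shows "finite {C. IE_closed \<Lambda> C}"
proof (rule inj_on_finite)
  show "inj_on (\<lambda>C. (lperp (rperp C), lperp C)) {C. IE_closed \<Lambda> C}"
  proof (rule inj_onI)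
    fix C D assume C: "C \<in> {C. IE_closed \<Lambda> C}" and D: "D \<in> {C. IE_closed \<Lambda> C}"
      and "(lperp (rperp C), lperp C) = (lperp (rperp D), lperp D)"
    then have eq: "lperp (rperp C) = lperp (rperp D)" "lperp C = lperp D" by simp_all
    have "C = lperp (rperp C) \<inter> rperp (lperp C)" using C by (intro IE_eq) simp
    also have "\<dots> = D" unfolding eq using D by (intro IE_eq[symmetric]) simp
    finally show "C = D" .
  qed
  show "(\<lambda>C. (lperp (rperp C), lperp C)) ` {C. IE_closed \<Lambda> C} \<subseteq> {T. torsion_class \<Lambda> T} \<times> {T. torsion_class \<Lambda> T}"
  proof -
    have "torsion_class \<Lambda> (lperp (rperp C))" for C by (rule lperp_torsion) (auto simp: rperp_def)
    then show ?thesis using lperp_torsion[OF IE_D(3)] by auto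
  qed
  show "finite ({T. torsion_class \<Lambda> T} \<times> {T. torsion_class \<Lambda> T})" using assms by simp
qed

section \<open>Universal elements and relatively projective modules\<close>

text \<open>An element of a module in \<open>U\<close> that reaches all elements of all modules in \<open>U\<close> is the same as a
  left \<open>U\<close>-approximation of the regular module.\<close>

definition univ_elem :: "'a fgmod set \<Rightarrow> 'a fgmod \<Rightarrow> (nat \<Rightarrow> 'a) set \<Rightarrow> bool"
  where "univ_elem U E e \<longleftrightarrow> E \<in> U \<and> e \<in> carrier E \<and> (\<forall>Y\<in>U. \<forall>y\<in>carrier Y. \<exists>h\<in>rhom \<Lambda> E Y. h e = y)"

lemma univ_elemD:
  assumes "univ_elem U E e"
  shows "E \<in> U" "e \<in> carrier E" "Y \<in> U \<Longrightarrow> y \<in> carrier Y \<Longrightarrow> \<exists>h\<in>rhom \<Lambda> E Y. h e = y"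
  using assms by (simp_all add: univ_elem_def)

lemma univ_elem_of_cov:
  assumes U: "U \<subseteq> mods" and cov: "covariantly_finite \<Lambda> U"
  shows "\<exists>E e. univ_elem U E e"
proof -
  obtain L u where L: "L \<in> mods" "u \<in> carrier L"
    and Lf: "\<And>(M :: 'a fgmod) m. right_module \<Lambda> M \<Longrightarrow> m \<in> carrier M \<Longrightarrow> \<exists>h\<in>rhom \<Lambda> L M. h u = m"
    by (rule regular_copy) blast
  obtain X f where Xf: "left_approx \<Lambda> U L X f" using cov L(1) unfolding covariantly_finite_def by blast
  then have X: "X \<in> U" "f \<in> rhom \<Lambda> L X"
    and fac: "\<And>Y g. Y \<in> U \<Longrightarrow> g \<in> rhom \<Lambda> L Y \<Longrightarrow> \<exists>h\<in>rhom \<Lambda> X Y. \<forall>x\<in>carrier L. g x = h (f x)"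
    by (simp_all add: left_approx_def)
  have "\<exists>h\<in>rhom \<Lambda> X Y. h (f u) = y" if Y: "Y \<in> U" "y \<in> carrier Y" for Y y
  proof -
    have "right_module \<Lambda> Y" using U Y(1) by (intro modsD(1)) (rule subsetD)
    then obtain g where g: "g \<in> rhom \<Lambda> L Y" "g u = y" using Lf[OF _ Y(2)] by blast
    obtain h where "h \<in> rhom \<Lambda> X Y" "\<forall>x\<in>carrier L. g x = h (f x)" using fac[OF Y(1) g(1)] by blast
    then show ?thesis using g(2) L(2) by (intro bexI[of _ h]) simp_all
  qed
  then have "univ_elem U X (f u)" using X(1) rhomD(1)[OF X(2) L(2)] by (simp add: univ_elem_def)
  then show ?thesis by blast
qed

lemma left_approx_biprod:
  assumes tors: "torsion_class \<Lambda> U"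
    and M: "M \<in> mods" and N: "N \<in> mods" and D: "biprod M N D i j p q"
    and f: "left_approx \<Lambda> U M X f" and g: "left_approx \<Lambda> U N Y g"
  shows "\<exists>Z k. left_approx \<Lambda> U D Z k"
proof -
  note U = torsD(1)[OF tors]
  have X: "X \<in> U" "f \<in> rhom \<Lambda> M X" "\<And>Z k. Z \<in> U \<Longrightarrow> k \<in> rhom \<Lambda> M Z \<Longrightarrow> \<exists>h\<in>rhom \<Lambda> X Z. \<forall>x\<in>carrier M. k x = h (f x)"
    using f by (simp_all add: left_approx_def)
  have Y: "Y \<in> U" "g \<in> rhom \<Lambda> N Y" "\<And>Z k. Z \<in> U \<Longrightarrow> k \<in> rhom \<Lambda> N Z \<Longrightarrow> \<exists>h\<in>rhom \<Lambda> Y Z. \<forall>x\<in>carrier N. k x = h (g x)"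
    using g by (simp_all add: left_approx_def)
  note m = subsetD[OF U X(1)] subsetD[OF U Y(1)]
  obtain Z i' j' p' q' where Z: "biprod X Y Z i' j' p' q'" by (rule biprod_exists[OF m])
  note B = biprodD[OF D] and B' = biprodD[OF Z]
  note Zm = modsD(1)[OF B'(1)]
  interpret Z: right_module \<Lambda> Z by (rule Zm)
  let ?k = "\<lambda>d. i' (f (p d)) \<oplus>\<^bsub>Z\<^esub> j' (g (q d))"
  have k: "?k \<in> rhom \<Lambda> D Z"
    by (rule rhom_add_fun[OF Zm rhom_comp[OF rhom_comp[OF B(5) X(2)] B'(3)] rhom_comp[OF rhom_comp[OF B(6) Y(2)] B'(4)]])
  have "\<exists>h\<in>rhom \<Lambda> Z V. \<forall>x\<in>carrier D. l x = h (?k x)" if V: "V \<in> U" and l: "l \<in> rhom \<Lambda> D V" for V l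
  proof -
    have Vm: "right_module \<Lambda> V" by (rule modsD(1)[OF subsetD[OF U V]])
    obtain h1 where h1: "h1 \<in> rhom \<Lambda> X V" "\<forall>x\<in>carrier M. l (i x) = h1 (f x)"
      using X(3)[OF V rhom_comp[OF B(3) l]] by blast
    obtain h2 where h2: "h2 \<in> rhom \<Lambda> Y V" "\<forall>x\<in>carrier N. l (j x) = h2 (g x)"
      using Y(3)[OF V rhom_comp[OF B(4) l]] by blast
    have "l d = h1 (p' (?k d)) \<oplus>\<^bsub>V\<^esub> h2 (q' (?k d))" if d: "d \<in> carrier D" for d
    proof -
      have pd: "p d \<in> carrier M" "q d \<in> carrier N" using rhomD(1)[OF B(5) d] rhomD(1)[OF B(6) d] .
      have fp: "f (p d) \<in> carrier X" "g (q d) \<in> carrier Y" using rhomD(1)[OF X(2) pd(1)] rhomD(1)[OF Y(2) pd(2)] .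
      have "l d = l (i (p d) \<oplus>\<^bsub>D\<^esub> j (q d))" using B(11)[OF d] by simp
      also have "\<dots> = l (i (p d)) \<oplus>\<^bsub>V\<^esub> l (j (q d))"
        by (rule rhomD(2)[OF l rhomD(1)[OF B(3) pd(1)] rhomD(1)[OF B(4) pd(2)]])
      also have "\<dots> = h1 (f (p d)) \<oplus>\<^bsub>V\<^esub> h2 (g (q d))" using h1(2) h2(2) pd by simp
      finally show ?thesis
        using biprod_elem(2,3)[OF modsD(1)[OF m(1)] modsD(1)[OF m(2)] Z fp] by simp
    qed
    then show ?thesis using copair[OF Z Vm h1(1) h2(1)] by (intro bexI[of _ "\<lambda>z. h1 (p' z) \<oplus>\<^bsub>V\<^esub> h2 (q' z)"]) simp_all
  qed
  moreover have "Z \<in> U" by (rule torsD(4)[OF tors X(1) Y(1) Z])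
  ultimately have "left_approx \<Lambda> U D Z ?k" using k by (simp add: left_approx_def)
  then show ?thesis by blast
qed

text \<open>A map out of \<open>M\<close> is a map out of \<open>G\<close> that kills the kernel of
  \<open>c\<close>. Dividing the approximation of \<open>G\<close> by the image of this kernel
  therefore gives one of \<open>M\<close>, and it stays in \<open>U\<close> because torsion classes
  are closed under quotients.\<close>

lemma left_approx_quot:
  assumes U: "torsion_class \<Lambda> U" and G: "G \<in> mods" and M: "M \<in> mods" and f: "left_approx \<Lambda> U G X f"
    and c: "c \<in> rhom \<Lambda> G M" "c ` carrier G = carrier M"
  shows "\<exists>Z k. left_approx \<Lambda> U M Z k"
proof -
  have X: "X \<in> U" "f \<in> rhom \<Lambda> G X" "\<And>Z k. Z \<in> U \<Longrightarrow> k \<in> rhom \<Lambda> G Z \<Longrightarrow> \<exists>h\<in>rhom \<Lambda> X Z. \<forall>x\<in>carrier G. k x = h (f x)"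
    using f by (simp_all add: left_approx_def)
  note Gm = modsD(1)[OF G] and Mm = modsD(1)[OF M] and Xm = modsD(1)[OF torsD(2)[OF U X(1)]]
  interpret X: right_module \<Lambda> X by (rule Xm)
  let ?W = "f ` hker G M c"
  have W: "rsubmodule \<Lambda> X ?W" by (rule rsub_image[OF Gm Xm X(2) rsub_hker[OF Gm Mm c(1)]])
  let ?Z = "quot X ?W"
  note Zm = X.right_module_quot[OF W]
  have ZU: "?Z \<in> U" by (rule tors_quot[OF U X(1) Zm X.crep_hom[OF W] X.crep_surj[OF W]])
  have "crep X ?W (f x) = \<zero>\<^bsub>?Z\<^esub>" if "x \<in> carrier G" "c x = \<zero>\<^bsub>M\<^esub>" for x
    using X.crep_zero_iff[OF W rhomD(1)[OF X(2) that(1)]] that by (simp add: hker_def)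
  then obtain k where k: "k \<in> rhom \<Lambda> M ?Z" "\<And>x. x \<in> carrier G \<Longrightarrow> k (c x) = crep X ?W (f x)"
    using rhom_factor[OF Gm Mm Zm c rhom_comp[OF X(2) X.crep_hom[OF W]]] by blast
  have "\<exists>h\<in>rhom \<Lambda> ?Z V. \<forall>x\<in>carrier M. l x = h (k x)" if V: "V \<in> U" and l: "l \<in> rhom \<Lambda> M V" for V l
  proof -
    have Vm: "right_module \<Lambda> V" by (rule modsD(1)[OF torsD(2)[OF U V]])
    obtain h where h: "h \<in> rhom \<Lambda> X V" "\<forall>x\<in>carrier G. l (c x) = h (f x)"
      using X(3)[OF V rhom_comp[OF c(1) l]] by blast
    have "h z = \<zero>\<^bsub>V\<^esub>" if z: "z \<in> carrier X" "crep X ?W z = \<zero>\<^bsub>?Z\<^esub>" for z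
    proof -
      have "z \<in> ?W" using X.crep_zero_iff[OF W z(1)] z(2) by simp
      then obtain x where x: "x \<in> carrier G" "c x = \<zero>\<^bsub>M\<^esub>" "z = f x" by (auto simp: hker_def)
      have "l (c x) = h (f x)" using h(2) x(1) by blast
      then show ?thesis using x rhom_zero[OF Mm Vm l] by simp
    qed
    then obtain h' where h': "h' \<in> rhom \<Lambda> ?Z V" "\<And>z. z \<in> carrier X \<Longrightarrow> h' (crep X ?W z) = h z"
      using rhom_factor[OF Xm Zm Vm X.crep_hom[OF W] X.crep_surj[OF W] h(1)] by blast
    have "l m = h' (k m)" if "m \<in> carrier M" for m
    proof -
      have "m \<in> c ` carrier G" using that by (simp only: c(2))
      then obtain x where x: "x \<in> carrier G" "m = c x" by blast
      have "h' (k m) = h (f x)" unfolding x(2) k(2)[OF x(1)] by (rule h'(2)[OF rhomD(1)[OF X(2) x(1)]])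
      moreover have "l (c x) = h (f x)" using h(2) x(1) by blast
      ultimately show ?thesis unfolding x(2) by (simp only:)
    qed
    then show ?thesis using h'(1) by blast
  qed
  then have "left_approx \<Lambda> U M ?Z k" using ZU k(1) by (simp add: left_approx_def)
  then show ?thesis by blast
qed

text \<open>A universal element yields an approximation of the regular module. The modules with an
  approximation are closed under direct sums and quotients, so they are all finitely generated
  modules.\<close>

lemma cov_of_univ_elem:
  assumes U: "torsion_class \<Lambda> U" and e: "univ_elem U E e"
  shows "covariantly_finite \<Lambda> U"
  unfolding covariantly_finite_def
proof
  fix M :: "'a fgmod" assume M: "M \<in> mods"
  obtain L u where L: "L \<in> mods" "u \<in> carrier L" "\<forall>x\<in>carrier L. \<exists>a\<in>carrier \<Lambda>. x = u \<triangleleft>\<^bsub>L\<^esub> a"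
    and Lf: "\<And>(M :: 'a fgmod) m. right_module \<Lambda> M \<Longrightarrow> m \<in> carrier M \<Longrightarrow> \<exists>h\<in>rhom \<Lambda> L M. h u = m"
    by (rule regular_copy) blast
  note E = univ_elemD[OF e]
  have Em: "right_module \<Lambda> E" by (rule modsD(1)[OF torsD(2)[OF U E(1)]])
  obtain f where f: "f \<in> rhom \<Lambda> L E" "f u = e" using Lf[OF Em E(2)] by blast
  have "left_approx \<Lambda> U L E f"
    unfolding left_approx_def
  proof (intro conjI E(1) f(1) ballI)
    fix Y g assume Y: "Y \<in> U" and g: "g \<in> rhom \<Lambda> L Y"
    obtain h where h: "h \<in> rhom \<Lambda> E Y" "h e = g u" using E(3)[OF Y rhomD(1)[OF g L(2)]] by blast
    have "g x = h (f x)" if x: "x \<in> carrier L" for x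
    proof -
      obtain a where a: "a \<in> carrier \<Lambda>" "x = u \<triangleleft>\<^bsub>L\<^esub> a" using L(3) x by blast
      then show ?thesis
        using rhomD(3)[OF g L(2) a(1)] rhomD(3)[OF f(1) L(2) a(1)] rhomD(3)[OF h(1) E(2) a(1)] f(2) h(2) by simp
    qed
    then show "\<exists>h\<in>rhom \<Lambda> E Y. \<forall>x\<in>carrier L. g x = h (f x)" using h(1) by blast
  qed
  then have LG: "L \<in> {G \<in> mods. \<exists>X f. left_approx \<Lambda> U G X f}" using L(1) by blast
  have "\<exists>G\<in>{G \<in> mods. \<exists>X f. left_approx \<Lambda> U G X f}. \<exists>h\<in>rhom \<Lambda> G M. h ` carrier G = carrier M"
  proof (rule epi_from_class[OF _ _ M])
    show "\<exists>P\<in>{G \<in> mods. \<exists>X f. left_approx \<Lambda> U G X f}. \<exists>h\<in>rhom \<Lambda> P M. y \<in> h ` carrier P" if y: "y \<in> carrier M" for y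
    proof -
      obtain h where "h \<in> rhom \<Lambda> L M" "h u = y" using Lf[OF modsD(1)[OF M] y] by blast
      then show ?thesis using LG L(2) by blast
    qed
    show "D \<in> {G \<in> mods. \<exists>X f. left_approx \<Lambda> U G X f}"
      if PQ: "P \<in> {G \<in> mods. \<exists>X f. left_approx \<Lambda> U G X f}" "Q \<in> {G \<in> mods. \<exists>X f. left_approx \<Lambda> U G X f}"
        and b: "biprod P Q D i j p q" for P Q D i j p q
    proof -
      have m: "P \<in> mods" "Q \<in> mods" using PQ by simp_all
      obtain X f Y g where "left_approx \<Lambda> U P X f" "left_approx \<Lambda> U Q Y g" using PQ by blast
      then have "\<exists>Z k. left_approx \<Lambda> U D Z k" by (rule left_approx_biprod[OF U m b])
      then show ?thesis using biprodD(1)[OF b] by simp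
    qed
  qed blast
  then obtain G h X f where "G \<in> mods" "left_approx \<Lambda> U G X f" "h \<in> rhom \<Lambda> G M" "h ` carrier G = carrier M" by blast
  then show "\<exists>X f. left_approx \<Lambda> U M X f" using left_approx_quot[OF U _ M] by blast
qed

text \<open>Expresses that Ext^1(P, K) vanishes for all \<open>K\<close> in \<open>U\<close>, by
  lifting along surjections with kernel in \<open>U\<close>. \<open>A\<close> and \<open>B\<close>
  range over all modules, a generality that \<open>undetected_zero\<close> exploits. For
  \<open>U = mods\<close> this is projectivity.\<close>

definition rel_proj :: "'a fgmod set \<Rightarrow> 'a fgmod \<Rightarrow> bool"
  where "rel_proj U P \<longleftrightarrow> P \<in> U \<and> (\<forall>A B g h. A \<in> mods \<longrightarrow> B \<in> mods \<longrightarrow> g \<in> rhom \<Lambda> A B \<longrightarrow>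
    g ` carrier A = carrier B \<longrightarrow> sub A (hker A B g) \<in> U \<longrightarrow> h \<in> rhom \<Lambda> P B \<longrightarrow>
    (\<exists>k\<in>rhom \<Lambda> P A. \<forall>x\<in>carrier P. g (k x) = h x))"

lemma rel_projD:
  assumes "rel_proj U P"
  shows "P \<in> U" "A \<in> mods \<Longrightarrow> B \<in> mods \<Longrightarrow> g \<in> rhom \<Lambda> A B \<Longrightarrow> g ` carrier A = carrier B \<Longrightarrow>
    sub A (hker A B g) \<in> U \<Longrightarrow> h \<in> rhom \<Lambda> P B \<Longrightarrow> \<exists>k\<in>rhom \<Lambda> P A. \<forall>x\<in>carrier P. g (k x) = h x"
  using assms unfolding rel_proj_def by simp_all

lemma rel_projI:
  assumes "P \<in> U" "\<And>A B g h. A \<in> mods \<Longrightarrow> B \<in> mods \<Longrightarrow> g \<in> rhom \<Lambda> A B \<Longrightarrow> g ` carrier A = carrier B \<Longrightarrow>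
    sub A (hker A B g) \<in> U \<Longrightarrow> h \<in> rhom \<Lambda> P B \<Longrightarrow> \<exists>k\<in>rhom \<Lambda> P A. \<forall>x\<in>carrier P. g (k x) = h x"
  shows "rel_proj U P"
  unfolding rel_proj_def using assms by simp

context
  fixes U assumes U: "torsion_class \<Lambda> U"
begin

lemma rel_proj_mods: "rel_proj U P \<Longrightarrow> P \<in> mods"
  by (rule torsD(2)[OF U rel_projD(1)])

lemma rel_proj_biprod:
  assumes P: "rel_proj U P" and Q: "rel_proj U Q" and b: "biprod P Q D i j p q"
  shows "rel_proj U D"
proof (rule rel_projI)
  note B = biprodD[OF b]
  show "D \<in> U" by (rule torsD(4)[OF U rel_projD(1)[OF P] rel_projD(1)[OF Q] b])
  fix X Y g h assume X: "X \<in> mods" "Y \<in> mods" and g: "g \<in> rhom \<Lambda> X Y" "g ` carrier X = carrier Y"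
    "sub X (hker X Y g) \<in> U" and h: "h \<in> rhom \<Lambda> D Y"
  note Xm = modsD(1)[OF X(1)]
  obtain k where k: "k \<in> rhom \<Lambda> P X" "\<forall>x\<in>carrier P. g (k x) = h (i x)"
    using rel_projD(2)[OF P X g rhom_comp[OF B(3) h]] by blast
  obtain l where l: "l \<in> rhom \<Lambda> Q X" "\<forall>x\<in>carrier Q. g (l x) = h (j x)"
    using rel_projD(2)[OF Q X g rhom_comp[OF B(4) h]] by blast
  have "g (k (p d) \<oplus>\<^bsub>X\<^esub> l (q d)) = h d" if d: "d \<in> carrier D" for d
  proof -
    have pd: "p d \<in> carrier P" "q d \<in> carrier Q" using rhomD(1)[OF B(5) d] rhomD(1)[OF B(6) d] .
    have "g (k (p d) \<oplus>\<^bsub>X\<^esub> l (q d)) = g (k (p d)) \<oplus>\<^bsub>Y\<^esub> g (l (q d))"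
      by (rule rhomD(2)[OF g(1) rhomD(1)[OF k(1) pd(1)] rhomD(1)[OF l(1) pd(2)]])
    also have "\<dots> = h (i (p d)) \<oplus>\<^bsub>Y\<^esub> h (j (q d))" using k(2) l(2) pd by simp
    also have "\<dots> = h (i (p d) \<oplus>\<^bsub>D\<^esub> j (q d))"
      by (rule rhomD(2)[OF h rhomD(1)[OF B(3) pd(1)] rhomD(1)[OF B(4) pd(2)], symmetric])
    finally show ?thesis using B(11)[OF d] by simp
  qed
  then show "\<exists>k\<in>rhom \<Lambda> D X. \<forall>x\<in>carrier D. g (k x) = h x" by (intro bexI[OF _ copair[OF b Xm k(1) l(1)]] ballI)
qed

lemma rel_proj_summand:
  assumes P: "rel_proj U P" and A: "A \<in> U" and s: "s \<in> rhom \<Lambda> A P" and r: "r \<in> rhom \<Lambda> P A"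
    and rs: "\<And>x. x \<in> carrier A \<Longrightarrow> r (s x) = x"
  shows "rel_proj U A"
proof (rule rel_projI[OF A])
  fix X Y g h assume X: "X \<in> mods" "Y \<in> mods" and g: "g \<in> rhom \<Lambda> X Y" "g ` carrier X = carrier Y"
    "sub X (hker X Y g) \<in> U" and h: "h \<in> rhom \<Lambda> A Y"
  obtain k where k: "k \<in> rhom \<Lambda> P X" "\<forall>x\<in>carrier P. g (k x) = h (r x)"
    using rel_projD(2)[OF P X g rhom_comp[OF r h]] by blast
  have "g (k (s x)) = h x" if "x \<in> carrier A" for x
    using k(2) rhomD(1)[OF s that] rs[OF that] by simp
  then show "\<exists>k\<in>rhom \<Lambda> A X. \<forall>x\<in>carrier A. g (k x) = h x" by (intro bexI[OF _ rhom_comp[OF s k(1)]] ballI)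
qed

lemma rel_proj_zero:
  assumes Z: "Z \<in> mods" "carrier Z = {\<zero>\<^bsub>Z\<^esub>}"
  shows "rel_proj U Z"
proof (rule rel_projI[OF torsD(3)[OF U Z]])
  fix X Y g h assume X: "X \<in> mods" "Y \<in> mods" and g: "g \<in> rhom \<Lambda> X Y" and h: "h \<in> rhom \<Lambda> Z Y"
  note m = modsD(1)[OF X(1)] modsD(1)[OF X(2)] modsD(1)[OF Z(1)]
  have "g \<zero>\<^bsub>X\<^esub> = h x" if "x \<in> carrier Z" for x
    using that Z(2) rhom_zero[OF m(1,2) g] rhom_zero[OF m(3,2) h] by simp
  then show "\<exists>k\<in>rhom \<Lambda> Z X. \<forall>x\<in>carrier Z. g (k x) = h x" by (intro bexI[OF _ rhom_const_zero[OF m(1)]] ballI)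
qed

text \<open>The length-minimal universal element corresponds to the minimal left approximation.\<close>

definition min_univ :: "'a fgmod \<Rightarrow> (nat \<Rightarrow> 'a) set \<Rightarrow> bool"
  where "min_univ P e \<longleftrightarrow> univ_elem U P e \<and> (\<forall>Q f. univ_elem U Q f \<longrightarrow> lg P \<le> lg Q)"

lemma min_univ_exists:
  assumes "univ_elem U E e" shows "\<exists>P f. min_univ P f"
proof -
  have "\<exists>P. (\<exists>f. univ_elem U P f) \<and> (\<forall>Q. (\<exists>f. univ_elem U Q f) \<longrightarrow> lg P \<le> lg Q)"
    by (rule ex_has_least_nat[of _ E]) (use assms in blast)
  then show ?thesis unfolding min_univ_def by blast
qed

context
  fixes P e assumes Pe: "min_univ P e"
begin

lemma uP: "univ_elem U P e" using Pe by (simp add: min_univ_def)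
lemma PU: "P \<in> U" by (rule univ_elemD(1)[OF uP])
lemma Pmods: "P \<in> mods" by (rule torsD(2)[OF U PU])

interpretation P: right_module \<Lambda> P by (rule modsD(1)[OF Pmods])

text \<open>The image of \<open>f\<close> still contains \<open>e\<close>, which is universal there
  too. Minimality of the length makes \<open>f\<close> surjective and hence bijective.\<close>

lemma min_univ_endo_bij:
  assumes f: "f \<in> rhom \<Lambda> P P" "f e = e"
  shows "bij_betw f (carrier P) (carrier P)"
proof -
  note ec = univ_elemD(2)[OF uP]
  let ?I = "f ` carrier P"
  have rI: "rsubmodule \<Lambda> P ?I" by (rule rsub_range[OF P.right_module_axioms P.right_module_axioms f(1)])
  have IU: "sub P ?I \<in> U" by (rule tors_image[OF U PU P.right_module_axioms f(1)])
  have eI: "e \<in> ?I" using f(2) ec by force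
  have "univ_elem U (sub P ?I) e"
    unfolding univ_elem_def
  proof (intro conjI ballI)
    fix Y y assume Y: "Y \<in> U" "y \<in> carrier Y"
    obtain h where "h \<in> rhom \<Lambda> P Y" "h e = y" using univ_elemD(3)[OF uP Y] by blast
    then show "\<exists>h\<in>rhom \<Lambda> (sub P ?I) Y. h e = y" using rhom_restrict[OF _ P.rsubD(1)[OF rI]] by blast
  qed (use IU eI in simp_all)
  then have "lg P \<le> lg (sub P ?I)" using Pe unfolding min_univ_def by blast
  then have s: "?I = carrier P" using sub_mods(3)[OF Pmods rI] by fastforce
  show ?thesis by (rule lg_surj(3)[OF Pmods P.right_module_axioms f(1) s]) simp
qed

text \<open>Pulling the surjection back along \<open>h\<close> gives an extension \<open>E\<close>
  of \<open>P\<close> by a module of \<open>U\<close>, so \<open>E\<close> is in \<open>U\<close>. A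
  preimage of \<open>e\<close> in \<open>E\<close> is the value at \<open>e\<close> of a map
  \<open>s\<close> from \<open>P\<close>. The composite endomorphism of \<open>P\<close> fixes
  \<open>e\<close>, so it is bijective and \<open>E\<close> splits over \<open>P\<close>; this is
  the argument of Wakamatsu's lemma.\<close>

lemma min_univ_rel_proj: "rel_proj U P"
proof (rule rel_projI[OF PU])
  note ec = univ_elemD(2)[OF uP]
  fix A B g h assume A: "A \<in> mods" "B \<in> mods" and g: "g \<in> rhom \<Lambda> A B" "g ` carrier A = carrier B"
    "sub A (hker A B g) \<in> U" and h: "h \<in> rhom \<Lambda> P B"
  note Am = modsD(1)[OF A(1)] and Bm = modsD(1)[OF A(2)]
  obtain E a b where E: "E \<in> mods" "a \<in> rhom \<Lambda> E A" "b \<in> rhom \<Lambda> E P"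
    "\<forall>e\<in>carrier E. g (a e) = h (b e)"
    "\<forall>x\<in>carrier A. \<forall>y\<in>carrier P. g x = h y \<longrightarrow> (\<exists>e\<in>carrier E. a e = x \<and> b e = y)"
    "bij_betw a (hker E P b) (hker A B g)"
    by (rule pullback_exists[OF A(1) Pmods Bm g(1) h])
  note Em = modsD(1)[OF E(1)]
  have pre: "\<exists>z\<in>carrier E. b z = y" if y: "y \<in> carrier P" for y
  proof -
    have "h y \<in> g ` carrier A" using rhomD(1)[OF h y] g(2) by simp
    then obtain x where "x \<in> carrier A" "g x = h y" by force
    then show ?thesis using E(5) y by blast
  qed
  have bs: "b ` carrier E = carrier P"
  proof
    show "b ` carrier E \<subseteq> carrier P" using rhomD(1)[OF E(3)] by blast
    show "carrier P \<subseteq> b ` carrier E" using pre by blast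
  qed
  have kb: "rsubmodule \<Lambda> E (hker E P b)" by (rule rsub_hker[OF Em P.right_module_axioms E(3)])
  have kE: "hker E P b \<subseteq> carrier E" by (auto simp: hker_def)
  have ab: "bij_betw a (carrier (sub E (hker E P b))) (carrier (sub A (hker A B g)))" using E(6) by simp
  have ar: "a \<in> rhom \<Lambda> (sub E (hker E P b)) (sub A (hker A B g))"
    by (rule rhom_corestrict[OF rhom_restrict[OF E(2) kE]]) (use E(6) in \<open>simp add: bij_betw_def\<close>)
  have km: "right_module \<Lambda> (sub E (hker E P b))" by (rule modsD(1)[OF sub_mods(1)[OF E(1) kb]])
  have "sub E (hker E P b) \<in> U"
    by (rule tors_quot[OF U g(3) km rhom_inv[OF km ar ab]])
      (use bij_betw_inv_into[OF ab] in \<open>simp add: bij_betw_def\<close>)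
  then have EU: "E \<in> U" by (rule tors_ext[OF U E(1) PU E(3) bs])
  obtain z where z: "z \<in> carrier E" "b z = e" using pre[OF ec] by blast
  obtain s where s: "s \<in> rhom \<Lambda> P E" "s e = z" using univ_elemD(3)[OF uP EU z(1)] by blast
  let ?f = "\<lambda>x. b (s x)"
  have f: "?f \<in> rhom \<Lambda> P P" by (rule rhom_comp[OF s(1) E(3)])
  have bij: "bij_betw ?f (carrier P) (carrier P)" by (rule min_univ_endo_bij[OF f]) (simp add: s(2) z(2))
  let ?i = "inv_into (carrier P) ?f"
  have i: "?i \<in> rhom \<Lambda> P P" by (rule rhom_inv[OF P.right_module_axioms f bij])
  have "g (a (s (?i x))) = h x" if x: "x \<in> carrier P" for x
  proof -
    have "s (?i x) \<in> carrier E" by (rule rhomD(1)[OF s(1) rhomD(1)[OF i x]])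
    then have "g (a (s (?i x))) = h (?f (?i x))" using E(4) by blast
    then show ?thesis using bij_betw_inv_into_right[OF bij x] by simp
  qed
  then show "\<exists>k\<in>rhom \<Lambda> P A. \<forall>x\<in>carrier P. g (k x) = h x"
    by (intro bexI[OF _ rhom_comp[OF rhom_comp[OF i s(1)] E(2)]] ballI)
qed

text \<open>The image of the regular module under the approximation that corresponds to
  \<open>e\<close>; \<open>quot P cyc\<close> is the cokernel of this approximation.\<close>

definition cyc :: "(nat \<Rightarrow> 'a) set set" where "cyc = (\<lambda>a. e \<triangleleft>\<^bsub>P\<^esub> a) ` carrier \<Lambda>"

lemma rsub_cyc: "rsubmodule \<Lambda> P cyc"
  unfolding cyc_def by (rule P.rsub_cyclic[OF univ_elemD(2)[OF uP]])

lemma e_cyc: "e \<in> cyc"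
  unfolding cyc_def by (rule image_eqI[of _ _ "\<one>\<^bsub>\<Lambda>\<^esub>"]) (simp_all add: univ_elemD(2)[OF uP])

lemma coker_factor:
  assumes A: "right_module \<Lambda> A" and l: "l \<in> rhom \<Lambda> P A" "l e = \<zero>\<^bsub>A\<^esub>"
  obtains k where "k \<in> rhom \<Lambda> (quot P cyc) A" "\<forall>x\<in>carrier P. k (crep P cyc x) = l x"
proof -
  interpret A: right_module \<Lambda> A by fact
  have "l x = \<zero>\<^bsub>A\<^esub>" if x: "x \<in> carrier P" "crep P cyc x = \<zero>\<^bsub>quot P cyc\<^esub>" for x
  proof -
    have "x \<in> cyc" using P.crep_zero_iff[OF rsub_cyc x(1)] x(2) by simp
    then obtain a where "a \<in> carrier \<Lambda>" "x = e \<triangleleft>\<^bsub>P\<^esub> a" by (auto simp: cyc_def)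
    then show ?thesis using rhomD(3)[OF l(1) univ_elemD(2)[OF uP]] l(2) by simp
  qed
  then obtain k where "k \<in> rhom \<Lambda> (quot P cyc) A" "\<And>x. x \<in> carrier P \<Longrightarrow> k (crep P cyc x) = l x"
    using rhom_factor[OF P.right_module_axioms P.right_module_quot[OF rsub_cyc] A P.crep_hom[OF rsub_cyc] P.crep_surj[OF rsub_cyc] l(1)]
    by blast
  then show ?thesis using that by blast
qed

lemma coker_mods: "quot P cyc \<in> U"
  by (rule tors_quot[OF U PU P.right_module_quot[OF rsub_cyc] P.crep_hom[OF rsub_cyc] P.crep_surj[OF rsub_cyc]])

text \<open>The map lifts to \<open>l\<close> on \<open>P\<close>, but \<open>l\<close> may fail to
  kill \<open>e\<close>. The value \<open>l e\<close> lies in the kernel of \<open>g\<close>, a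
  module of \<open>U\<close>, so universality provides a map \<open>m\<close> from \<open>P\<close>
  to this kernel with the same value at \<open>e\<close>. The difference \<open>l - m\<close> kills
  \<open>e\<close> and descends to the cokernel.\<close>

lemma coker_rel_proj: "rel_proj U (quot P cyc)"
proof (rule rel_projI[OF coker_mods])
  note ec = univ_elemD(2)[OF uP]
  let ?c = "crep P cyc"
  fix A B g h assume A: "A \<in> mods" "B \<in> mods" and g: "g \<in> rhom \<Lambda> A B" "g ` carrier A = carrier B"
    "sub A (hker A B g) \<in> U" and h: "h \<in> rhom \<Lambda> (quot P cyc) B"
  note Am = modsD(1)[OF A(1)] and Bm = modsD(1)[OF A(2)] and Qm = P.right_module_quot[OF rsub_cyc]
  interpret A: right_module \<Lambda> A by (rule Am)
  interpret B: right_module \<Lambda> B by (rule Bm)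
  obtain l where l: "l \<in> rhom \<Lambda> P A" "\<forall>x\<in>carrier P. g (l x) = h (?c x)"
    using rel_projD(2)[OF min_univ_rel_proj A g rhom_comp[OF P.crep_hom[OF rsub_cyc] h]] by blast
  have "?c e = \<zero>\<^bsub>quot P cyc\<^esub>" using P.crep_zero_iff[OF rsub_cyc ec] e_cyc by simp
  then have "l e \<in> hker A B g"
    using l(2) ec rhom_zero[OF Qm Bm h] rhomD(1)[OF l(1) ec] by (simp add: hker_def)
  then obtain m where m: "m \<in> rhom \<Lambda> P (sub A (hker A B g))" "m e = l e"
    using univ_elemD(3)[OF uP g(3), of "l e"] by auto
  have kA: "hker A B g \<subseteq> carrier A" by (auto simp: hker_def)
  note mA = rhom_into_sub[OF m(1) kA]
  have d: "(\<lambda>x. l x \<ominus>\<^bsub>A\<^esub> m x) \<in> rhom \<Lambda> P A" by (rule rhom_minus_fun[OF Am l(1) mA])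
  have d0: "l e \<ominus>\<^bsub>A\<^esub> m e = \<zero>\<^bsub>A\<^esub>" using A.minus_zero_iff[OF rhomD(1)[OF l(1) ec] rhomD(1)[OF mA ec]] m(2) by simp
  obtain k where k: "k \<in> rhom \<Lambda> (quot P cyc) A" "\<forall>x\<in>carrier P. k (?c x) = l x \<ominus>\<^bsub>A\<^esub> m x"
    by (rule coker_factor[OF Am d d0])
  have "g (k y) = h y" if y: "y \<in> carrier (quot P cyc)" for y
  proof -
    obtain x where x: "x \<in> carrier P" "y = ?c x" using y P.crep_surj[OF rsub_cyc] by auto
    have "g (m x) = \<zero>\<^bsub>B\<^esub>" using rhomD(1)[OF m(1) x(1)] by (simp add: hker_def)
    then have "g (k y) = h y \<ominus>\<^bsub>B\<^esub> \<zero>\<^bsub>B\<^esub>"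
      using k(2) l(2) x rhom_minus(2)[OF Am Bm g(1) rhomD(1)[OF mA x(1)] rhomD(1)[OF l(1) x(1)]] by simp
    then show ?thesis using rhomD(1)[OF h y] by (simp add: a_minus_def B.neg_zero)
  qed
  then show "\<exists>k\<in>rhom \<Lambda> (quot P cyc) A. \<forall>x\<in>carrier (quot P cyc). g (k x) = h x"
    by (intro bexI[OF _ k(1)] ballI)
qed

end

end

lemma rhom_funpow: "s \<in> rhom \<Lambda> M M \<Longrightarrow> (s ^^ n) \<in> rhom \<Lambda> M M"
proof (induction n)
  case 0
  have "s ^^ 0 = (\<lambda>x. x)" by (simp add: fun_eq_iff)
  then show ?case by (simp only: rhom_id)
next
  case (Suc n)
  have "s ^^ Suc n = (\<lambda>x. s ((s ^^ n) x))" by (simp add: fun_eq_iff)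
  then show ?case using rhom_comp[OF Suc.IH[OF Suc.prems] Suc.prems] by (simp only:)
qed

text \<open>A power of \<open>s\<close> with image of least length maps that image bijectively onto
  itself. Inverting it there gives a projection onto the image, and the complementary projection
  \<open>r\<close> retracts \<open>M\<close> onto the kernel.\<close>

lemma fitting:
  assumes M: "M \<in> mods" and s: "s \<in> rhom \<Lambda> M M"
  obtains n r where "n \<ge> 1" "(s ^^ n) \<in> rhom \<Lambda> M M" "r \<in> rhom \<Lambda> M (sub M (hker M M (s ^^ n)))"
    "\<forall>x\<in>hker M M (s ^^ n). r x = x" "\<forall>x\<in>carrier M. x \<ominus>\<^bsub>M\<^esub> r x \<in> (s ^^ n) ` carrier M"
proof -
  note Mm = modsD(1)[OF M]
  interpret M: right_module \<Lambda> M by (rule Mm)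
  note h = rhom_funpow[OF s]
  have rI: "rsubmodule \<Lambda> M ((s ^^ n) ` carrier M)" for n by (rule rsub_range[OF Mm Mm h])
  \<comment> \<open>A positive exponent is demanded because the application needs
    \<open>s ^^ n\<close> to take its values where \<open>s\<close> does.\<close>
  have "\<exists>n. n \<ge> 1 \<and> (\<forall>m. m \<ge> 1 \<longrightarrow> lg (sub M ((s ^^ n) ` carrier M)) \<le> lg (sub M ((s ^^ m) ` carrier M)))"
    by (rule ex_has_least_nat[of _ 1]) simp
  then obtain n where n: "n \<ge> 1"
    and min: "\<forall>m. m \<ge> 1 \<longrightarrow> lg (sub M ((s ^^ n) ` carrier M)) \<le> lg (sub M ((s ^^ m) ` carrier M))" by blast
  let ?f = "s ^^ n" and ?I = "(s ^^ n) ` carrier M"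
  have f: "?f \<in> rhom \<Lambda> M M" by (rule h)
  have IM: "sub M ?I \<in> mods" by (rule sub_mods(1)[OF M rI])
  note Im = modsD(1)[OF IM]
  have fI: "?f \<in> rhom \<Lambda> (sub M ?I) (sub M ?I)"
    by (rule rhom_corestrict[OF rhom_restrict[OF f M.rsubD(1)[OF rI]]]) (use rhomD(1)[OF f] in auto)
  have ff: "?f ` ?I = (s ^^ (n + n)) ` carrier M" by (simp add: funpow_add image_image)
  have fsub: "?f ` ?I \<subseteq> ?I" using rhomD(1)[OF f] by auto
  have le: "lg (sub M ?I) \<le> lg (sub M (?f ` ?I))" unfolding ff using min n by simp
  have rff: "rsubmodule \<Lambda> (sub M ?I) (?f ` ?I)" unfolding M.rsub_sub[OF rI] using rI[of "n + n"] ff fsub by simp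
  have fs: "?f ` ?I = ?I"
  proof (rule ccontr)
    assume "?f ` ?I \<noteq> ?I"
    then have "?f ` ?I \<noteq> carrier (sub M ?I)" by (simp only: sub_simps not_False_eq_True)
    from sub_mods(3)[OF IM rff this] le show False by (simp only: sub_sub)
  qed
  have bij: "bij_betw ?f (carrier (sub M ?I)) (carrier (sub M ?I))"
    by (rule lg_surj(3)[OF IM Im fI]) (simp_all add: fs)
  let ?t = "inv_into (carrier (sub M ?I)) ?f"
  have t: "?t \<in> rhom \<Lambda> (sub M ?I) (sub M ?I)" by (rule rhom_inv[OF Im fI bij])
  have tI: "?t y \<in> ?I" if "y \<in> ?I" for y using rhomD(1)[OF t, of y] that by simp
  have ft: "?f (?t y) = y" if "y \<in> ?I" for y using bij_betw_inv_into_right[OF bij, of y] that by simp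
  have fM: "?f \<in> rhom \<Lambda> M (sub M ?I)" by (rule rhom_corestrict[OF f]) simp
  have tf: "(\<lambda>x. ?t (?f x)) \<in> rhom \<Lambda> M M"
    by (rule rhom_into_sub[OF rhom_comp[OF fM t] M.rsubD(1)[OF rI]])
  let ?r = "\<lambda>x. x \<ominus>\<^bsub>M\<^esub> ?t (?f x)"
  have r: "?r \<in> rhom \<Lambda> M M" by (rule rhom_minus_fun[OF Mm rhom_id tf])
  have fz: "?f (?r x) = \<zero>\<^bsub>M\<^esub>" if x: "x \<in> carrier M" for x
  proof -
    have "?f (?r x) = ?f x \<ominus>\<^bsub>M\<^esub> ?f (?t (?f x))" by (rule rhom_minus(2)[OF Mm Mm f rhomD(1)[OF tf x] x])
    moreover have "?f (?t (?f x)) = ?f x" by (rule ft) (use x in simp)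
    ultimately show ?thesis using rhomD(1)[OF f x] by (simp add: M.minus_zero_iff)
  qed
  have r2: "?r \<in> rhom \<Lambda> M (sub M (hker M M ?f))"
    by (rule rhom_corestrict[OF r]) (use fz rhomD(1)[OF r] in \<open>auto simp: hker_def\<close>)
  have t0: "?t \<zero>\<^bsub>M\<^esub> = \<zero>\<^bsub>M\<^esub>" using rhom_zero[OF Im Im t] by simp
  show ?thesis
  proof (rule that[OF n f r2])
    show "\<forall>x\<in>hker M M ?f. ?r x = x"
    proof
      fix x assume "x \<in> hker M M ?f"
      then have "x \<in> carrier M" "?f x = \<zero>\<^bsub>M\<^esub>" by (simp_all add: hker_def)
      then show "?r x = x" using t0 by (simp add: a_minus_def M.neg_zero)
    qed
    show "\<forall>x\<in>carrier M. x \<ominus>\<^bsub>M\<^esub> ?r x \<in> ?I"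
    proof
      fix x assume x: "x \<in> carrier M"
      have tc: "?t (?f x) \<in> carrier M" by (rule rhomD(1)[OF tf x])
      have "?t (?f x) \<oplus>\<^bsub>M\<^esub> ?r x = x"
        using M.minus_add_cancel[OF x tc] M.M.a_comm[OF rhomD(1)[OF r x] tc] by simp
      then have "x \<ominus>\<^bsub>M\<^esub> ?r x = ?t (?f x)" using M.add_minus_cancel[OF tc rhomD(1)[OF r x]] by simp
      then show "x \<ominus>\<^bsub>M\<^esub> ?r x \<in> ?I" using tI[of "?f x"] x by simp
    qed
  qed
qed

section \<open>Lower covers of torsion classes\<close>

lemma torsion_Int:
  assumes S: "torsion_class \<Lambda> S" and T: "torsion_class \<Lambda> T"
  shows "torsion_class \<Lambda> (S \<inter> T)"
proof (rule torsionI)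
  show "S \<inter> T \<subseteq> mods" using torsD(1)[OF S] by blast
  show "Z \<in> S \<inter> T" if "Z \<in> mods" "carrier Z = {\<zero>\<^bsub>Z\<^esub>}" for Z
    using torsD(3)[OF S that] torsD(3)[OF T that] by blast
  show "N \<in> S \<inter> T" if "M \<in> S \<inter> T" "N \<in> mods" "f \<in> rhom \<Lambda> M N" "f ` carrier M = carrier N" for M N f
    using tors_quot[OF S _ modsD(1)[OF that(2)] that(3,4)] tors_quot[OF T _ modsD(1)[OF that(2)] that(3,4)] that(1)
    by blast
  show "M \<in> S \<inter> T" if "M \<in> mods" "N \<in> S \<inter> T" "g \<in> rhom \<Lambda> M N" "g ` carrier M = carrier N"
      "sub M (hker M N g) \<in> S \<inter> T" for M N g
    using tors_ext[OF S that(1) _ that(3,4)] tors_ext[OF T that(1) _ that(3,4)] that(2,5) by blast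
qed

lemma torsion_chain_Union:
  assumes ne: "\<C> \<noteq> {}" and tors: "\<And>T. T \<in> \<C> \<Longrightarrow> torsion_class \<Lambda> T"
    and chain: "\<And>S T. S \<in> \<C> \<Longrightarrow> T \<in> \<C> \<Longrightarrow> S \<subseteq> T \<or> T \<subseteq> S"
  shows "torsion_class \<Lambda> (\<Union>\<C>)"
proof (rule torsionI)
  show "\<Union>\<C> \<subseteq> mods" using torsD(1)[OF tors] by blast
  show "Z \<in> \<Union>\<C>" if "Z \<in> mods" "carrier Z = {\<zero>\<^bsub>Z\<^esub>}" for Z
    using torsD(3)[OF tors that] ne by blast
  show "N \<in> \<Union>\<C>" if "M \<in> \<Union>\<C>" "N \<in> mods" "f \<in> rhom \<Lambda> M N" "f ` carrier M = carrier N" for M N f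
    using tors_quot[OF tors _ modsD(1)[OF that(2)] that(3,4)] that(1) by blast
  show "M \<in> \<Union>\<C>" if M: "M \<in> mods" "N \<in> \<Union>\<C>" "g \<in> rhom \<Lambda> M N" "g ` carrier M = carrier N"
      "sub M (hker M N g) \<in> \<Union>\<C>" for M N g
  proof -
    obtain S T where ST: "S \<in> \<C>" "T \<in> \<C>" "N \<in> S" "sub M (hker M N g) \<in> T" using M(2,5) by blast
    obtain W where W: "W \<in> \<C>" "N \<in> W" "sub M (hker M N g) \<in> W" using chain[OF ST(1,2)] ST by blast
    have "M \<in> W" by (rule tors_ext[OF tors[OF W(1)] M(1) W(2) M(3,4) W(3)])
    then show ?thesis using W(1) by blast
  qed
qed

lemma univ_elem_generates:
  assumes T: "torsion_class \<Lambda> T" and U: "U \<subseteq> mods" and e: "univ_elem U E e" and E: "E \<in> T"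
  shows "U \<subseteq> T"
proof
  fix Y assume Y: "Y \<in> U"
  then have Ym: "Y \<in> mods" using U by blast
  have "\<exists>P\<in>T. \<exists>h\<in>rhom \<Lambda> P Y. h ` carrier P = carrier Y"
  proof (rule epi_from_class[OF torsD(1)[OF T] _ Ym])
    show "D \<in> T" if "P \<in> T" "Q \<in> T" "biprod P Q D i j p q" for P Q D i j p q by (rule torsD(4)[OF T that])
    show "\<exists>P\<in>T. \<exists>h\<in>rhom \<Lambda> P Y. y \<in> h ` carrier P" if "y \<in> carrier Y" for y
      using univ_elemD(3)[OF e Y that] univ_elemD(2)[OF e] E by blast
  qed
  then show "Y \<in> T" using tors_quot[OF T _ modsD(1)[OF Ym]] by blast
qed

section \<open>Lower covers and their labels\<close>

definition cover :: "'a fgmod set \<Rightarrow> 'a fgmod set \<Rightarrow> bool"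
  where "cover U T \<longleftrightarrow> torsion_class \<Lambda> T \<and> T \<subset> U \<and>
    (\<forall>T'. torsion_class \<Lambda> T' \<longrightarrow> T \<subseteq> T' \<longrightarrow> T' \<subset> U \<longrightarrow> T' = T)"

lemma coverD:
  assumes "cover U T"
  shows "torsion_class \<Lambda> T" "T \<subseteq> U" "T \<noteq> U" "torsion_class \<Lambda> T' \<Longrightarrow> T \<subseteq> T' \<Longrightarrow> T' \<subset> U \<Longrightarrow> T' = T"
  using assms unfolding cover_def by blast+

text \<open>The module \<open>E\<close> acts as a finite generator: a torsion class strictly below
  \<open>U\<close> misses \<open>E\<close>, a condition that survives unions of chains. Hence Zorn's
  lemma applies.\<close>

lemma cover_exists:
  assumes U: "torsion_class \<Lambda> U" and e: "univ_elem U E e" and T: "torsion_class \<Lambda> T" "T \<subset> U"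
  shows "\<exists>T'. cover U T' \<and> T \<subseteq> T'"
proof -
  have EU: "E \<in> U" by (rule univ_elemD(1)[OF e])
  have E: "E \<notin> T'" if "torsion_class \<Lambda> T'" "T' \<subset> U" for T'
    using univ_elem_generates[OF that(1) torsD(1)[OF U] e] that(2) by blast
  let ?A = "{T'. torsion_class \<Lambda> T' \<and> T \<subseteq> T' \<and> T' \<subset> U}"
  have "\<exists>M\<in>?A. \<forall>X\<in>?A. M \<subseteq> X \<longrightarrow> X = M"
  proof (rule subset_Zorn_nonempty)
    show "?A \<noteq> {}" using T by blast
    fix \<C> assume C: "\<C> \<noteq> {}" "subset.chain ?A \<C>"
    then have CA: "\<C> \<subseteq> ?A" and lin: "\<And>S T. S \<in> \<C> \<Longrightarrow> T \<in> \<C> \<Longrightarrow> S \<subseteq> T \<or> T \<subseteq> S"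
      unfolding subset.chain_def by blast+
    have "torsion_class \<Lambda> (\<Union>\<C>)" by (rule torsion_chain_Union[OF C(1)]) (use CA lin in blast)+
    moreover have "T \<subseteq> \<Union>\<C>" "\<Union>\<C> \<subseteq> U" using CA C(1) by blast+
    moreover have "E \<notin> \<Union>\<C>" using E CA by blast
    ultimately show "\<Union>\<C> \<in> ?A" using EU by blast
  qed
  then obtain M where M: "M \<in> ?A" "\<forall>X\<in>?A. M \<subseteq> X \<longrightarrow> X = M" by blast
  have "T' = M" if "torsion_class \<Lambda> T'" "M \<subseteq> T'" "T' \<subset> U" for T'
    using M that by (intro M(2)[rule_format]) auto
  then have "cover U M" using M(1) by (simp add: cover_def)
  then show ?thesis using M(1) by blast
qed

text \<open>The torsion radical \<open>u\<close> of \<open>K\<close> is divided out of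
  \<open>Y\<close>, so that \<open>K/u\<close> appears as a submodule of \<open>Y/u\<close> and not
  as a quotient of \<open>K\<close>. It is torsion-free because the torsion part of
  \<open>K/u\<close> has a torsion preimage inside \<open>K\<close>, which lies in
  \<open>u\<close>.\<close>

lemma tors_top:
  assumes U: "torsion_class \<Lambda> U" and Y: "Y \<in> mods" and K: "rsubmodule \<Lambda> Y K"
  obtains u where "rsubmodule \<Lambda> Y u" "u \<subseteq> K" "sub Y u \<in> U"
    "rsubmodule \<Lambda> (quot Y u) (crep Y u ` K)" "sub (quot Y u) (crep Y u ` K) \<in> rperp U"
proof -
  note Ym = modsD(1)[OF Y]
  interpret Y: right_module \<Lambda> Y by (rule Ym)
  have SK: "sub Y K \<in> mods" by (rule sub_mods(1)[OF Y K])
  define u where "u = trad U (sub Y K)"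
  note t = trad[OF U SK, folded u_def]
  have ru: "rsubmodule \<Lambda> Y u" and uK: "u \<subseteq> K" using t(1) unfolding Y.rsub_sub[OF K] by blast+
  have uU: "sub Y u \<in> U" using t(2) by simp
  note Qm = Y.right_module_quot[OF ru]
  interpret Q: right_module \<Lambda> "quot Y u" by (rule Qm)
  have rZ: "rsubmodule \<Lambda> (quot Y u) (crep Y u ` K)" by (rule rsub_image[OF Ym Qm Y.crep_hom[OF ru] K])
  let ?N = "sub (quot Y u) (crep Y u ` K)"
  have N: "?N \<in> mods" by (rule sub_mods(1)[OF quot_mods(1)[OF Y ru] rZ])
  define V where "V = trad U ?N"
  note s = trad[OF U N, folded V_def]
  have rV: "rsubmodule \<Lambda> (quot Y u) V" and VZ: "V \<subseteq> crep Y u ` K" using s(1) unfolding Q.rsub_sub[OF rZ] by blast+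
  have VU: "sub (quot Y u) V \<in> U" using s(2) by simp
  let ?I = "{y \<in> carrier Y. crep Y u y \<in> V}"
  note v = tors_vimage[OF U Y ru uU rV VU]
  have "y \<in> K" if y: "y \<in> ?I" for y
  proof -
    have yc: "y \<in> carrier Y" using y by blast
    obtain k where k: "k \<in> K" "crep Y u y = crep Y u k" using y VZ by blast
    have kc: "k \<in> carrier Y" by (rule Y.rsubD(2)[OF K k(1)])
    have "y \<ominus>\<^bsub>Y\<^esub> k \<in> K" using Y.crep_eq_iff[OF ru yc kc] k(2) uK by blast
    then have "(y \<ominus>\<^bsub>Y\<^esub> k) \<oplus>\<^bsub>Y\<^esub> k \<in> K" by (rule Y.rsubD(4)[OF K _ k(1)])
    then show ?thesis by (simp only: Y.minus_add_cancel[OF yc kc])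
  qed
  then have "?I \<subseteq> K" by blast
  from trad_image[OF U SK v(4) rhom_incl[OF this]] have Iu: "?I \<subseteq> u" by (simp add: u_def)
  have V0: "v = \<zero>\<^bsub>quot Y u\<^esub>" if "v \<in> V" for v
  proof -
    have "v \<in> crep Y u ` ?I" using that by (simp only: v(3))
    then obtain y where y: "y \<in> ?I" "v = crep Y u y" by blast
    then have "y \<in> carrier Y" "y \<in> u" using Iu by blast+
    then show ?thesis using Y.crep_zero_iff[OF ru] y(2) by simp
  qed
  have "hom0 X ?N" if X: "X \<in> U" for X
  proof (rule hom0I)
    fix f x assume "f \<in> rhom \<Lambda> X ?N" and x: "x \<in> carrier X"
    from trad_image[OF U N X this(1)] x have "f x \<in> V" unfolding V_def by blast
    then show "f x = \<zero>\<^bsub>?N\<^esub>" using V0 by simp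
  qed
  then have "?N \<in> rperp U" using N by (simp add: rperp_def)
  then show ?thesis by (rule that[OF ru uK uU rZ])
qed

text \<open>A label of \<open>T\<close> in \<open>U\<close> behaves like a simple object of \<open>U\<close>: nonzero maps to it are surjective
  with kernel in \<open>U\<close>.\<close>

definition label :: "'a fgmod set \<Rightarrow> 'a fgmod set \<Rightarrow> 'a fgmod \<Rightarrow> bool"
  where "label U T B \<longleftrightarrow> B \<in> U \<and> T = {Y \<in> U. hom0 Y B} \<and>
    (\<forall>Y\<in>U. \<forall>g\<in>rhom \<Lambda> Y B. (\<exists>y\<in>carrier Y. g y \<noteq> \<zero>\<^bsub>B\<^esub>) \<longrightarrow>
      g ` carrier Y = carrier B \<and> sub Y (hker Y B g) \<in> U)"

lemma labelD:
  assumes "label U T B"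
  shows "B \<in> U" "T = {Y \<in> U. hom0 Y B}"
    "Y \<in> U \<Longrightarrow> g \<in> rhom \<Lambda> Y B \<Longrightarrow> y \<in> carrier Y \<Longrightarrow> g y \<noteq> \<zero>\<^bsub>B\<^esub> \<Longrightarrow> g ` carrier Y = carrier B"
    "Y \<in> U \<Longrightarrow> g \<in> rhom \<Lambda> Y B \<Longrightarrow> y \<in> carrier Y \<Longrightarrow> g y \<noteq> \<zero>\<^bsub>B\<^esub> \<Longrightarrow> sub Y (hker Y B g) \<in> U"
  using assms unfolding label_def by blast+

lemma torsion_gap:
  assumes U: "torsion_class \<Lambda> U" and T: "torsion_class \<Lambda> T" and X: "X \<in> U" "X \<notin> T"
  shows "\<exists>B. B \<in> U \<and> B \<in> rperp T \<and> carrier B \<noteq> {\<zero>\<^bsub>B\<^esub>}"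
proof -
  have Xm: "X \<in> mods" by (rule torsD(2)[OF U X(1)])
  note tX = trad[OF T Xm]
  interpret X: right_module \<Lambda> X by (rule modsD(1)[OF Xm])
  have QU: "quot X (trad T X) \<in> U"
    by (rule tors_quot[OF U X(1) X.right_module_quot[OF tX(1)] X.crep_hom[OF tX(1)] X.crep_surj[OF tX(1)]])
  have "carrier (quot X (trad T X)) \<noteq> {\<zero>\<^bsub>quot X (trad T X)\<^esub>}"
  proof
    assume "carrier (quot X (trad T X)) = {\<zero>\<^bsub>quot X (trad T X)\<^esub>}"
    then have "trad T X = carrier X" by (rule quot_zero_imp[OF X.right_module_axioms tX(1)])
    then show False using tX(2) X(2) by simp
  qed
  then show ?thesis using QU tX(3) by blast
qed

text \<open>Take \<open>B\<close> of least length among the nonzero modules of \<open>U\<close> that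
  are torsion-free for \<open>T\<close>. Minimality makes nonzero maps from \<open>U\<close> to
  \<open>B\<close> surjective. As \<open>T\<close> is a lower cover, \<open>U\<close> is the
  smallest torsion class containing \<open>T\<close> and \<open>B\<close>, and this controls the
  kernels.\<close>

lemma cover_label:
  assumes U: "torsion_class \<Lambda> U" and cov: "cover U T"
  shows "\<exists>B. label U T B"
proof -
  note C = coverD[OF cov] and T = coverD(1)[OF cov]
  let ?ok = "\<lambda>B. B \<in> U \<and> B \<in> rperp T \<and> carrier B \<noteq> {\<zero>\<^bsub>B\<^esub>}"
  obtain X where X: "X \<in> U" "X \<notin> T" using C(2,3) by blast
  have "\<exists>B. ?ok B" by (rule torsion_gap[OF U T X])
  then obtain B0 where "?ok B0" by (rule exE)
  then have "\<exists>B. ?ok B \<and> (\<forall>B'. ?ok B' \<longrightarrow> lg B \<le> lg B')" by (rule ex_has_least_nat)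
  then obtain B where B: "?ok B" and min: "\<forall>B'. ?ok B' \<longrightarrow> lg B \<le> lg B'" by blast
  then have BU: "B \<in> U" and BF: "B \<in> rperp T" and Bnz: "carrier B \<noteq> {\<zero>\<^bsub>B\<^esub>}" by blast+
  have Bmods: "B \<in> mods" by (rule torsD(2)[OF U BU])
  note Bm = modsD(1)[OF Bmods]
  interpret B: right_module \<Lambda> B by (rule Bm)
  have Bself: "\<not> hom0 B B" using hom0_self[OF _ Bm] Bnz by blast
  have BT: "B \<notin> T" using BF Bself unfolding rperp_def by blast
  have L: "torsion_class \<Lambda> (lperp {B})" by (rule lperp_torsion) (use Bmods in blast)
  have "T \<subseteq> lperp {B}" using BF torsD(1)[OF T] unfolding rperp_def lperp_def by blast
  moreover have "B \<notin> lperp {B}" using Bself unfolding lperp_def by blast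
  ultimately have "lperp {B} \<inter> U = T" using C(4)[OF torsion_Int[OF L U]] C(2) BU by blast
  then have Teq: "T = {Y \<in> U. hom0 Y B}" using torsD(1)[OF U] unfolding lperp_def by blast
  have epi: "g ` carrier Y = carrier B"
    if Y: "Y \<in> U" and g: "g \<in> rhom \<Lambda> Y B" and y: "y \<in> carrier Y" "g y \<noteq> \<zero>\<^bsub>B\<^esub>" for Y g y
  proof (rule ccontr)
    assume ne: "g ` carrier Y \<noteq> carrier B"
    have r: "rsubmodule \<Lambda> B (g ` carrier Y)" by (rule rsub_range[OF modsD(1)[OF torsD(2)[OF U Y]] Bm g])
    have "sub B (g ` carrier Y) \<in> U" by (rule tors_image[OF U Y Bm g])
    moreover have "sub B (g ` carrier Y) \<in> rperp T" by (rule rperp_sub[OF BF r])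
    moreover have "carrier (sub B (g ` carrier Y)) \<noteq> {\<zero>\<^bsub>sub B (g ` carrier Y)\<^esub>}" using y by auto
    ultimately have "lg B \<le> lg (sub B (g ` carrier Y))" using min by blast
    then show False using sub_mods(3)[OF Bmods r ne] by simp
  qed
  have W: "torsion_class \<Lambda> (lperp (rperp (insert B T)) \<inter> U)"
    by (rule torsion_Int[OF lperp_torsion U]) (simp add: rperp_def)
  have "T \<subseteq> lperp (rperp (insert B T))" "B \<in> lperp (rperp (insert B T))"
    using torsD(1)[OF T] Bmods unfolding lperp_def rperp_def by blast+
  then have Ueq: "U \<subseteq> lperp (rperp (insert B T))" using C(4)[OF W] C(2) BT BU by blast
  have ker: "sub Y (hker Y B g) \<in> U"
    if Y: "Y \<in> U" and g: "g \<in> rhom \<Lambda> Y B" and y: "y \<in> carrier Y" "g y \<noteq> \<zero>\<^bsub>B\<^esub>" for Y g y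
  proof -
    have Ymods: "Y \<in> mods" by (rule torsD(2)[OF U Y])
    note Ym = modsD(1)[OF Ymods]
    interpret Y: right_module \<Lambda> Y by (rule Ym)
    let ?K = "hker Y B g"
    have rK: "rsubmodule \<Lambda> Y ?K" by (rule rsub_hker[OF Ym Bm g])
    obtain u where u: "rsubmodule \<Lambda> Y u" "u \<subseteq> ?K" "sub Y u \<in> U"
      "rsubmodule \<Lambda> (quot Y u) (crep Y u ` ?K)" "sub (quot Y u) (crep Y u ` ?K) \<in> rperp U"
      by (rule tors_top[OF U Ymods rK])
    let ?Q = "quot Y u" and ?c = "crep Y u" and ?Z = "crep Y u ` ?K"
    note c = Y.crep_hom[OF u(1)] and cs = Y.crep_surj[OF u(1)] and c0 = Y.crep_zero_iff[OF u(1)]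
    note Qm = Y.right_module_quot[OF u(1)]
    interpret Q: right_module \<Lambda> ?Q by (rule Qm)
    have QU: "?Q \<in> U" by (rule tors_quot[OF U Y Qm c cs])
    have Qmods: "?Q \<in> mods" by (rule torsD(2)[OF U QU])
    have "g x = \<zero>\<^bsub>B\<^esub>" if "x \<in> carrier Y" "?c x = \<zero>\<^bsub>?Q\<^esub>" for x
      using that c0[OF that(1)] u(2) unfolding hker_def by blast
    then obtain gb where gb: "gb \<in> rhom \<Lambda> ?Q B" "\<And>x. x \<in> carrier Y \<Longrightarrow> gb (?c x) = g x"
      using rhom_factor[OF Ym Qm Bm c cs g] by blast
    have kZ: "z \<in> ?Z" if z: "z \<in> carrier ?Q" "gb z = \<zero>\<^bsub>B\<^esub>" for z
    proof -
      have "z \<in> ?c ` carrier Y" using z(1) by (simp only: cs)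
      then obtain x where x: "x \<in> carrier Y" "z = ?c x" by blast
      then have "x \<in> ?K" using gb(2)[OF x(1)] z(2) by (simp add: hker_def)
      then show ?thesis using x(2) by blast
    qed
    have Zk: "gb z = \<zero>\<^bsub>B\<^esub>" if z: "z \<in> ?Z" for z
    proof -
      obtain x where x: "x \<in> carrier Y" "g x = \<zero>\<^bsub>B\<^esub>" "z = ?c x" using z unfolding hker_def by blast
      then show ?thesis using gb(2)[OF x(1)] by simp
    qed
    have hk: "hker ?Q B gb = ?Z" using kZ Zk Q.rsubD(1)[OF u(4)] unfolding hker_def by blast
    have "sub ?Q ?Z \<in> rperp T" using u(5) C(2) unfolding rperp_def by blast
    then have QF: "?Q \<in> rperp T" by (intro rperp_ext[OF Qmods BF gb(1)]) (simp only: hk)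
    have "?c y \<in> carrier ?Q" by (rule rhomD(1)[OF c y(1)])
    moreover have "gb (?c y) \<noteq> \<zero>\<^bsub>B\<^esub>" using gb(2)[OF y(1)] y(2) by simp
    ultimately have Qnz: "\<not> hom0 ?Q ?Q"
      using hom0_self[OF _ Qm] rhom_zero[OF Qm Bm gb(1)] by (metis singletonD)
    \<comment> \<open>\<open>?Q\<close> is nonzero and torsion-free for \<open>T\<close>, so the
      description of \<open>U\<close> by \<open>T\<close> and \<open>B\<close> forces a nonzero map
      from \<open>B\<close> to \<open>?Q\<close>.\<close>
    have "?Q \<in> lperp (rperp (insert B T))" using Ueq QU by blast
    then have "?Q \<notin> rperp (insert B T)" using Qnz unfolding lperp_def by blast
    then have "\<not> hom0 B ?Q" using QF unfolding rperp_def by blast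
    then obtain b x0 where b: "b \<in> rhom \<Lambda> B ?Q" "x0 \<in> carrier B" "b x0 \<noteq> \<zero>\<^bsub>?Q\<^esub>" unfolding hom0_def by blast
    have BZ: "hom0 B (sub ?Q ?Z)" using u(5) BU unfolding rperp_def by blast
    have gbb: "(\<lambda>x. gb (b x)) \<in> rhom \<Lambda> B B" by (rule rhom_comp[OF b(1) gb(1)])
    \<comment> \<open>The nonzero map \<open>b\<close> cannot stay inside \<open>?Z\<close>, which
      is torsion-free for \<open>U\<close>. Followed by \<open>gb\<close> it is a nonzero and hence
      bijective endomorphism of \<open>B\<close>, so \<open>B\<close> splits off from
      \<open>?Q\<close>.\<close>
    have "\<exists>x\<in>carrier B. gb (b x) \<noteq> \<zero>\<^bsub>B\<^esub>"
    proof (rule ccontr)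
      assume "\<not> (\<exists>x\<in>carrier B. gb (b x) \<noteq> \<zero>\<^bsub>B\<^esub>)"
      then have "b ` carrier B \<subseteq> ?Z" using kZ rhomD(1)[OF b(1)] by blast
      from hom0D[OF BZ rhom_corestrict[OF b(1) this] b(2)] b(3) show False by simp
    qed
    then obtain x1 where x1: "x1 \<in> carrier B" "gb (b x1) \<noteq> \<zero>\<^bsub>B\<^esub>" by blast
    have "bij_betw (\<lambda>x. gb (b x)) (carrier B) (carrier B)"
      by (rule lg_surj(3)[OF Bmods Bm gbb epi[OF BU gbb x1]]) simp
    note bij = this
    let ?i = "inv_into (carrier B) (\<lambda>x. gb (b x))"
    have i: "?i \<in> rhom \<Lambda> B B" by (rule rhom_inv[OF Bm gbb bij])
    have ri: "(\<lambda>z. b (?i (gb z))) \<in> rhom \<Lambda> ?Q ?Q" by (rule rhom_comp[OF rhom_comp[OF gb(1) i] b(1)])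
    let ?r = "\<lambda>z. z \<ominus>\<^bsub>?Q\<^esub> b (?i (gb z))"
    have r: "?r \<in> rhom \<Lambda> ?Q ?Q" by (rule rhom_minus_fun[OF Qm rhom_id ri])
    have rZ: "?r z \<in> ?Z" if z: "z \<in> carrier ?Q" for z
    proof (rule kZ[OF rhomD(1)[OF r z]])
      have "gb (?r z) = gb z \<ominus>\<^bsub>B\<^esub> gb (b (?i (gb z)))" by (rule rhom_minus(2)[OF Qm Bm gb(1) rhomD(1)[OF ri z] z])
      moreover have "gb (b (?i (gb z))) = gb z" by (rule bij_betw_inv_into_right[OF bij rhomD(1)[OF gb(1) z]])
      ultimately show "gb (?r z) = \<zero>\<^bsub>B\<^esub>" using rhomD(1)[OF gb(1) z] by (simp add: B.minus_zero_iff)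
    qed
    \<comment> \<open>The complementary projection maps \<open>?Q\<close>, a module of
      \<open>U\<close>, into the torsion-free \<open>?Z\<close>. It vanishes, so \<open>?Z\<close>
      is zero and the kernel of \<open>g\<close> coincides with its torsion part
      \<open>u\<close>.\<close>
    have QZ: "hom0 ?Q (sub ?Q ?Z)" using u(5) QU unfolding rperp_def by blast
    have "?r \<in> rhom \<Lambda> ?Q (sub ?Q ?Z)" by (rule rhom_corestrict[OF r]) (use rZ in blast)
    note r0 = hom0D[OF QZ this]
    have "z = \<zero>\<^bsub>?Q\<^esub>" if z: "z \<in> ?Z" for z
    proof -
      have zc: "z \<in> carrier ?Q" by (rule Q.rsubD(2)[OF u(4) z])
      have "?i \<zero>\<^bsub>B\<^esub> = \<zero>\<^bsub>B\<^esub>" by (rule rhom_zero[OF Bm Bm i])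
      then have "?r z = z" using Zk[OF z] rhom_zero[OF Bm Qm b(1)] zc by (simp add: a_minus_def Q.neg_zero)
      then show ?thesis using r0[OF zc] by simp
    qed
    then have "?K \<subseteq> u" using c0 Y.rsubD(1)[OF rK] by blast
    then have "?K = u" using u(2) by blast
    then show ?thesis using u(3) by simp
  qed
  have "label U T B"
    unfolding label_def
  proof (intro conjI ballI impI BU Teq)
    fix Y g assume Y: "Y \<in> U" "g \<in> rhom \<Lambda> Y B" and "\<exists>y\<in>carrier Y. g y \<noteq> \<zero>\<^bsub>B\<^esub>"
    then obtain y where y: "y \<in> carrier Y" "g y \<noteq> \<zero>\<^bsub>B\<^esub>" by blast
    show "g ` carrier Y = carrier B" "sub Y (hker Y B g) \<in> U" by (rule epi[OF Y y], rule ker[OF Y y])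
  qed
  then show ?thesis by (rule exI)
qed

section \<open>Generation of a lower cover by relative projectives\<close>

definition proj_gen :: "'a fgmod set \<Rightarrow> 'a fgmod set \<Rightarrow> 'a fgmod set"
  where "proj_gen U T = {Y \<in> mods. \<exists>Q p. rel_proj U Q \<and> Q \<in> T \<and> p \<in> rhom \<Lambda> Q Y \<and> p ` carrier Q = carrier Y}"

lemma proj_genI: "Y \<in> mods \<Longrightarrow> rel_proj U Q \<Longrightarrow> Q \<in> T \<Longrightarrow> p \<in> rhom \<Lambda> Q Y \<Longrightarrow> p ` carrier Q = carrier Y \<Longrightarrow> Y \<in> proj_gen U T"
  unfolding proj_gen_def by blast

text \<open>Closure under extensions is the horseshoe argument: the surjection onto \<open>N\<close>
  lifts to \<open>M\<close> because the kernel lies in \<open>U\<close>, and together with the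
  surjection onto the kernel it covers \<open>M\<close>.\<close>

lemma proj_gen_torsion:
  assumes U: "torsion_class \<Lambda> U" and T: "torsion_class \<Lambda> T" "T \<subseteq> U"
  shows "torsion_class \<Lambda> (proj_gen U T)" "proj_gen U T \<subseteq> T"
proof -
  show sT: "proj_gen U T \<subseteq> T"
    using tors_quot[OF T(1)] modsD(1) unfolding proj_gen_def by blast
  show "torsion_class \<Lambda> (proj_gen U T)"
  proof (rule torsionI)
    show "proj_gen U T \<subseteq> mods" unfolding proj_gen_def by blast
    show "Z \<in> proj_gen U T" if Z: "Z \<in> mods" "carrier Z = {\<zero>\<^bsub>Z\<^esub>}" for Z
      by (rule proj_genI[OF Z(1) rel_proj_zero[OF U Z] torsD(3)[OF T(1) Z] rhom_id]) simp
    show "N \<in> proj_gen U T" if M: "M \<in> proj_gen U T" and N: "N \<in> mods" "f \<in> rhom \<Lambda> M N" "f ` carrier M = carrier N" for M N f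
    proof -
      obtain Q p where Q: "rel_proj U Q" "Q \<in> T" "p \<in> rhom \<Lambda> Q M" "p ` carrier Q = carrier M"
        using M unfolding proj_gen_def by blast
      have "(\<lambda>x. f (p x)) ` carrier Q = f ` p ` carrier Q" by (rule image_image[symmetric])
      then have "(\<lambda>x. f (p x)) ` carrier Q = carrier N" by (simp only: Q(4) N(3))
      then show ?thesis by (rule proj_genI[OF N(1) Q(1,2) rhom_comp[OF Q(3) N(2)]])
    qed
    fix M N g assume M: "M \<in> mods" and N: "N \<in> proj_gen U T" and g: "g \<in> rhom \<Lambda> M N" "g ` carrier M = carrier N"
      and K: "sub M (hker M N g) \<in> proj_gen U T"
    note Mm = modsD(1)[OF M]
    interpret M: right_module \<Lambda> M by (rule Mm)
    let ?K = "hker M N g"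
    obtain Q p where Q: "rel_proj U Q" "Q \<in> T" "p \<in> rhom \<Lambda> Q N" "p ` carrier Q = carrier N" and Nmods: "N \<in> mods"
      using N unfolding proj_gen_def by blast
    obtain S q where S: "rel_proj U S" "S \<in> T" "q \<in> rhom \<Lambda> S (sub M ?K)" "q ` carrier S = carrier (sub M ?K)"
      using K unfolding proj_gen_def by blast
    note Nm = modsD(1)[OF Nmods]
    interpret N: right_module \<Lambda> N by (rule Nm)
    have KU: "sub M ?K \<in> U" using K sT T(2) by blast
    obtain k where k: "k \<in> rhom \<Lambda> Q M" "\<forall>x\<in>carrier Q. g (k x) = p x"
      using rel_projD(2)[OF Q(1) M Nmods g KU Q(3)] by blast
    have kM: "?K \<subseteq> carrier M" by (auto simp: hker_def)
    note qM = rhom_into_sub[OF S(3) kM]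
    note mm = rel_proj_mods[OF U S(1)] rel_proj_mods[OF U Q(1)]
    obtain D i j p' q' where b: "biprod S Q D i j p' q'" by (rule biprod_exists[OF mm])
    have im: "(\<lambda>d. q (p' d) \<oplus>\<^bsub>M\<^esub> k (q' d)) ` carrier D = M.msum (q ` carrier S) (k ` carrier Q)"
      by (rule copair_image[OF modsD(1)[OF mm(1)] modsD(1)[OF mm(2)] b Mm qM k(1)])
    have "carrier M \<subseteq> M.msum (q ` carrier S) (k ` carrier Q)"
    proof
      fix m assume m: "m \<in> carrier M"
      have "g m \<in> p ` carrier Q" using rhomD(1)[OF g(1) m] by (simp only: Q(4))
      then obtain x where x: "x \<in> carrier Q" "g m = p x" by blast
      have kx: "k x \<in> carrier M" by (rule rhomD(1)[OF k(1) x(1)])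
      have gk: "g (k x) = g m" using k(2) x by simp
      have "g (m \<ominus>\<^bsub>M\<^esub> k x) = g m \<ominus>\<^bsub>N\<^esub> g (k x)" by (rule rhom_minus(2)[OF Mm Nm g(1) kx m])
      then have "g (m \<ominus>\<^bsub>M\<^esub> k x) = \<zero>\<^bsub>N\<^esub>" using rhomD(1)[OF g(1) m] gk by (simp add: N.minus_zero_iff)
      then have "m \<ominus>\<^bsub>M\<^esub> k x \<in> q ` carrier S" using m kx S(4) by (simp add: hker_def)
      moreover have "k x \<in> k ` carrier Q" using x(1) by blast
      moreover have "m = (m \<ominus>\<^bsub>M\<^esub> k x) \<oplus>\<^bsub>M\<^esub> k x" by (rule M.minus_add_cancel[OF m kx, symmetric])
      ultimately show "m \<in> M.msum (q ` carrier S) (k ` carrier Q)" unfolding M.msum_def by blast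
    qed
    moreover have "M.msum (q ` carrier S) (k ` carrier Q) \<subseteq> carrier M"
      unfolding im[symmetric] using rhomD(1)[OF copair[OF b Mm qM k(1)]] by blast
    ultimately have "(\<lambda>d. q (p' d) \<oplus>\<^bsub>M\<^esub> k (q' d)) ` carrier D = carrier M" using im by blast
    then show "M \<in> proj_gen U T"
      by (rule proj_genI[OF M rel_proj_biprod[OF U S(1) Q(1) b] torsD(4)[OF T(1) S(2) Q(2) b] copair[OF b Mm qM k(1)]])
  qed
qed

text \<open>The key is that a length-minimal relative projective \<open>P0\<close> mapping onto \<open>Y\<close> has its kernel
  in \<open>U\<close> as soon as the cokernel of the minimal left approximation has no maps to \<open>Y\<close>.\<close>

lemma cover_proj_gen:
  assumes U: "torsion_class \<Lambda> U" and T: "torsion_class \<Lambda> T" "T \<subseteq> U" and lab: "label U T B"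
    and Pe: "min_univ U P e"
  shows "T = proj_gen U T"
proof -
  note PG = proj_gen_torsion[OF U T]
  note L = labelD[OF lab]
  have Bmods: "B \<in> mods" by (rule torsD(2)[OF U L(1)])
  note Bm = modsD(1)[OF Bmods]
  interpret B: right_module \<Lambda> B by (rule Bm)
  note uPe = uP[OF U Pe] and PUe = PU[OF U Pe] and Pmo = Pmods[OF U Pe]
  note Pm = modsD(1)[OF Pmo] and ec = univ_elemD(2)[OF uP[OF U Pe]]
  interpret P: right_module \<Lambda> P by (rule Pm)
  let ?cy = "cyc P e"
  let ?P1 = "quot P ?cy"
  note rc = rsub_cyc[OF U Pe]
  have P1U: "?P1 \<in> U" by (rule coker_mods[OF U Pe])
  have P1m: "right_module \<Lambda> ?P1" by (rule P.right_module_quot[OF rc])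
  have ce0: "crep P ?cy e = \<zero>\<^bsub>?P1\<^esub>" using P.crep_zero_iff[OF rc ec] e_cyc[OF U Pe] by simp
  \<comment> \<open>A nonzero map from the cokernel to \<open>B\<close> gives a map on
    \<open>P\<close> whose kernel is in \<open>U\<close> and contains \<open>e\<close>. Universality
    yields an endomorphism of \<open>P\<close> that fixes \<open>e\<close> and has values in this
    kernel. It is bijective, so the kernel is all of \<open>P\<close>.\<close>
  have "hom0 ?P1 B"
  proof (rule ccontr)
    assume "\<not> hom0 ?P1 B"
    then obtain \<gamma> z where \<gamma>: "\<gamma> \<in> rhom \<Lambda> ?P1 B" "z \<in> carrier ?P1" "\<gamma> z \<noteq> \<zero>\<^bsub>B\<^esub>" unfolding hom0_def by blast
    have "z \<in> crep P ?cy ` carrier P" using \<gamma>(2) by (simp only: P.crep_surj[OF rc])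
    then obtain x where x: "x \<in> carrier P" "z = crep P ?cy x" by blast
    let ?g = "\<lambda>x. \<gamma> (crep P ?cy x)"
    have g: "?g \<in> rhom \<Lambda> P B" by (rule rhom_comp[OF P.crep_hom[OF rc] \<gamma>(1)])
    have gx: "?g x \<noteq> \<zero>\<^bsub>B\<^esub>" using \<gamma>(3) x(2) by simp
    have K: "sub P (hker P B ?g) \<in> U" by (rule L(4)[OF PUe g x(1) gx])
    have eK: "e \<in> carrier (sub P (hker P B ?g))" using ec ce0 rhom_zero[OF P1m Bm \<gamma>(1)] by (simp add: hker_def)
    obtain s where s: "s \<in> rhom \<Lambda> P (sub P (hker P B ?g))" "s e = e" using univ_elemD(3)[OF uPe K eK] by blast
    have kP: "hker P B ?g \<subseteq> carrier P" by (auto simp: hker_def)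
    have "bij_betw s (carrier P) (carrier P)" by (rule min_univ_endo_bij[OF U Pe rhom_into_sub[OF s(1) kP] s(2)])
    then have "x \<in> s ` carrier P" using x(1) by (simp add: bij_betw_def)
    then have "x \<in> hker P B ?g" using rhomD(1)[OF s(1)] by auto
    then show False using gx by (simp add: hker_def)
  qed
  then have P1T: "?P1 \<in> T" unfolding L(2) using P1U by blast
  have P1mods: "?P1 \<in> mods" by (rule torsD(2)[OF U P1U])
  have P1G: "?P1 \<in> proj_gen U T"
    by (rule proj_genI[OF P1mods coker_rel_proj[OF U Pe] P1T rhom_id]) simp
  \<comment> \<open>This suffices, because a module of \<open>T\<close> modulo its torsion radical
    for \<open>proj_gen U T\<close> satisfies both conditions.\<close>
  have zero: "carrier Y = {\<zero>\<^bsub>Y\<^esub>}" if YT: "Y \<in> T" and YF: "Y \<in> rperp (proj_gen U T)" for Y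
  proof -
    have YU: "Y \<in> U" using YT T(2) by blast
    have Ymods: "Y \<in> mods" by (rule torsD(2)[OF U YU])
    note Ym = modsD(1)[OF Ymods]
    interpret Y: right_module \<Lambda> Y by (rule Ym)
    have h1: "hom0 ?P1 Y" using YF P1G unfolding rperp_def by blast
    let ?ok = "\<lambda>Q. rel_proj U Q \<and> (\<exists>p\<in>rhom \<Lambda> Q Y. p ` carrier Q = carrier Y)"
    have "\<exists>Q\<in>{Q. rel_proj U Q}. \<exists>p\<in>rhom \<Lambda> Q Y. p ` carrier Q = carrier Y"
    proof (rule epi_from_class[OF _ _ Ymods])
      show "{Q. rel_proj U Q} \<subseteq> mods" using rel_proj_mods[OF U] by blast
      show "D \<in> {Q. rel_proj U Q}" if "P \<in> {Q. rel_proj U Q}" "Q \<in> {Q. rel_proj U Q}" "biprod P Q D i j p q" for P Q D i j p q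
        using rel_proj_biprod[OF U _ _ that(3)] that(1,2) by blast
      show "\<exists>P\<in>{Q. rel_proj U Q}. \<exists>h\<in>rhom \<Lambda> P Y. y \<in> h ` carrier P" if "y \<in> carrier Y" for y
        using univ_elemD(3)[OF uPe YU that] min_univ_rel_proj[OF U Pe] ec by blast
    qed
    then obtain Q0 where "?ok Q0" by blast
    then have "\<exists>Q. ?ok Q \<and> (\<forall>Q'. ?ok Q' \<longrightarrow> lg Q \<le> lg Q')" by (rule ex_has_least_nat)
    then obtain P0 where P0: "?ok P0" and min: "\<forall>Q. ?ok Q \<longrightarrow> lg P0 \<le> lg Q" by blast
    then obtain p where pr: "rel_proj U P0" and p: "p \<in> rhom \<Lambda> P0 Y" "p ` carrier P0 = carrier Y" by blast
    have P0U: "P0 \<in> U" by (rule rel_projD(1)[OF pr])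
    have P0mods: "P0 \<in> mods" by (rule torsD(2)[OF U P0U])
    note P0m = modsD(1)[OF P0mods]
    interpret P0: right_module \<Lambda> P0 by (rule P0m)
    let ?K = "hker P0 Y p"
    have rK: "rsubmodule \<Lambda> P0 ?K" by (rule rsub_hker[OF P0m Ym p(1)])
    have KP0: "?K \<subseteq> carrier P0" by (auto simp: hker_def)
    obtain u where u: "rsubmodule \<Lambda> P0 u" "u \<subseteq> ?K" "sub P0 u \<in> U"
      "rsubmodule \<Lambda> (quot P0 u) (crep P0 u ` ?K)" "sub (quot P0 u) (crep P0 u ` ?K) \<in> rperp U"
      by (rule tors_top[OF U P0mods rK])
    let ?Q = "quot P0 u" and ?c = "crep P0 u" and ?Z = "crep P0 u ` ?K"
    note c = P0.crep_hom[OF u(1)] and cs = P0.crep_surj[OF u(1)] and c0 = P0.crep_zero_iff[OF u(1)]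
    note Qm = P0.right_module_quot[OF u(1)]
    have QU: "?Q \<in> U" by (rule tors_quot[OF U P0U Qm c cs])
    have "p x = \<zero>\<^bsub>Y\<^esub>" if "x \<in> carrier P0" "?c x = \<zero>\<^bsub>?Q\<^esub>" for x
      using that c0[OF that(1)] u(2) unfolding hker_def by blast
    then obtain pb where pb: "pb \<in> rhom \<Lambda> ?Q Y" "\<And>x. x \<in> carrier P0 \<Longrightarrow> pb (?c x) = p x"
      using rhom_factor[OF P0m Qm Ym c cs p(1)] by blast
    \<comment> \<open>\<open>?c k\<close> is the value at \<open>e\<close> of a map \<open>h\<close>
      from \<open>P\<close> to \<open>?Q\<close>. Followed by \<open>pb\<close> it kills
      \<open>e\<close>, so it factors through \<open>?P1\<close>, which has no nonzero map to
      \<open>Y\<close>. Thus \<open>h\<close> has values in the torsion-free \<open>?Z\<close> and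
      is zero.\<close>
    have "k \<in> u" if k: "k \<in> ?K" for k
    proof -
      have kc: "k \<in> carrier P0" "p k = \<zero>\<^bsub>Y\<^esub>" using k by (simp_all add: hker_def)
      obtain h where h: "h \<in> rhom \<Lambda> P ?Q" "h e = ?c k" using univ_elemD(3)[OF uPe QU rhomD(1)[OF c kc(1)]] by blast
      have hp: "(\<lambda>x. pb (h x)) \<in> rhom \<Lambda> P Y" by (rule rhom_comp[OF h(1) pb(1)])
      have "pb (h e) = \<zero>\<^bsub>Y\<^esub>" using h(2) pb(2)[OF kc(1)] kc(2) by simp
      then obtain l where l: "l \<in> rhom \<Lambda> ?P1 Y" "\<forall>x\<in>carrier P. l (crep P ?cy x) = pb (h x)"
        by (rule coker_factor[OF U Pe Ym hp])
      have "h x \<in> ?Z" if x: "x \<in> carrier P" for x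
      proof -
        have "pb (h x) = \<zero>\<^bsub>Y\<^esub>" using l(2) x hom0D[OF h1 l(1) rhomD(1)[OF P.crep_hom[OF rc] x]] by simp
        moreover have "h x \<in> ?c ` carrier P0" using rhomD(1)[OF h(1) x] by (simp only: cs)
        then obtain w where "w \<in> carrier P0" "h x = ?c w" by blast
        ultimately show ?thesis using pb(2) by (auto simp: hker_def)
      qed
      then have "h ` carrier P \<subseteq> ?Z" by blast
      note hZ = rhom_corestrict[OF h(1) this]
      have "hom0 P (sub ?Q ?Z)" using u(5) PUe unfolding rperp_def by blast
      from hom0D[OF this hZ ec] have "h e = \<zero>\<^bsub>?Q\<^esub>" by simp
      then show "k \<in> u" using h(2) c0[OF kc(1)] by simp
    qed
    then have "?K = u" using u(2) by blast
    then have KU: "sub P0 ?K \<in> U" using u(3) by simp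
    \<comment> \<open>If \<open>\<gamma>\<close> were nonzero on \<open>?K\<close>, its restriction
      would be a surjection onto \<open>B\<close> with kernel in \<open>U\<close>. Relative
      projectivity of \<open>P0\<close> then gives \<open>s\<close> from \<open>P0\<close> to
      \<open>?K\<close> with \<open>\<gamma> s = \<gamma>\<close>, to which Fitting's lemma is
      applied.\<close>
    have \<gamma>K: "\<gamma> k = \<zero>\<^bsub>B\<^esub>" if \<gamma>: "\<gamma> \<in> rhom \<Lambda> P0 B" and k: "k \<in> ?K" for \<gamma> k
    proof (rule ccontr)
      assume nz: "\<gamma> k \<noteq> \<zero>\<^bsub>B\<^esub>"
      let ?S = "sub P0 ?K"
      have Smods: "?S \<in> mods" by (rule torsD(2)[OF U KU])
      have \<gamma>S: "\<gamma> \<in> rhom \<Lambda> ?S B" by (rule rhom_restrict[OF \<gamma> KP0])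
      have kS: "k \<in> carrier ?S" using k by simp
      obtain s where s: "s \<in> rhom \<Lambda> P0 ?S" "\<forall>x\<in>carrier P0. \<gamma> (s x) = \<gamma> x"
        using rel_projD(2)[OF pr Smods Bmods \<gamma>S L(3)[OF KU \<gamma>S kS nz] L(4)[OF KU \<gamma>S kS nz] \<gamma>] by blast
      have s0: "s \<in> rhom \<Lambda> P0 P0" by (rule rhom_into_sub[OF s(1) KP0])
      obtain n r where n: "n \<ge> 1" "(s ^^ n) \<in> rhom \<Lambda> P0 P0" "r \<in> rhom \<Lambda> P0 (sub P0 (hker P0 P0 (s ^^ n)))"
        "\<forall>x\<in>hker P0 P0 (s ^^ n). r x = x" "\<forall>x\<in>carrier P0. x \<ominus>\<^bsub>P0\<^esub> r x \<in> (s ^^ n) ` carrier P0"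
        by (rule fitting[OF P0mods s0])
      let ?f = "s ^^ n" and ?A = "hker P0 P0 (s ^^ n)"
      have AP: "?A \<subseteq> carrier P0" by (auto simp: hker_def)
      have rA: "rsubmodule \<Lambda> P0 ?A" by (rule rsub_hker[OF P0m P0m n(2)])
      have \<gamma>f: "\<gamma> ((s ^^ m) x) = \<gamma> x" if "x \<in> carrier P0" for m x
      proof (induction m)
        case (Suc m)
        have "\<gamma> (s ((s ^^ m) x)) = \<gamma> ((s ^^ m) x)" using s(2) rhomD(1)[OF rhom_funpow[OF s0] that] by blast
        then show ?case using Suc.IH by simp
      qed simp
      have fK: "?f x \<in> ?K" if x: "x \<in> carrier P0" for x
      proof -
        obtain m where m: "n = Suc m" using n(1) by (cases n) simp_all
        have "s ((s ^^ m) x) \<in> ?K" using rhomD(1)[OF s(1) rhomD(1)[OF rhom_funpow[OF s0] x]] by simp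
        then show ?thesis by (simp add: m)
      qed
      have rP: "r \<in> rhom \<Lambda> P0 P0" by (rule rhom_into_sub[OF n(3) AP])
      have rr: "r ` carrier P0 = ?A"
      proof
        show "r ` carrier P0 \<subseteq> ?A" using rhomD(1)[OF n(3)] by auto
        show "?A \<subseteq> r ` carrier P0"
        proof
          fix x assume x: "x \<in> ?A"
          then have "x = r x" using n(4) by simp
          then show "x \<in> r ` carrier P0" using x AP by blast
        qed
      qed
      have AU: "sub P0 ?A \<in> U" using tors_image[OF U P0U P0m rP] by (simp only: rr)
      have Ap: "rel_proj U (sub P0 ?A)"
        by (rule rel_proj_summand[OF U pr AU rhom_incl'[OF AP] n(3)]) (use n(4) in simp)
      have pA: "p \<in> rhom \<Lambda> (sub P0 ?A) Y" by (rule rhom_restrict[OF p(1) AP])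
      \<comment> \<open>The image of \<open>?f\<close> is killed by \<open>p\<close>, so the other
        Fitting summand \<open>?A\<close> already maps onto \<open>Y\<close>. Minimality of
        \<open>P0\<close> leaves only \<open>?A = P0\<close>, which means \<open>?f = 0\<close>,
        although \<open>\<gamma>\<close> is unchanged by composition with powers of
        \<open>s\<close>.\<close>
      have pr2: "p x \<in> p ` ?A" if x: "x \<in> carrier P0" for x
      proof -
        note rx = rhomD(1)[OF rP x]
        have "x \<ominus>\<^bsub>P0\<^esub> r x \<in> ?f ` carrier P0" by (rule n(5)[rule_format, OF x])
        moreover have "?f ` carrier P0 \<subseteq> ?K" by (rule image_subsetI[OF fK])
        ultimately have "x \<ominus>\<^bsub>P0\<^esub> r x \<in> ?K" by (rule rev_subsetD)
        then have "p (x \<ominus>\<^bsub>P0\<^esub> r x) = \<zero>\<^bsub>Y\<^esub>" by (simp add: hker_def)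
        then have "p x \<ominus>\<^bsub>Y\<^esub> p (r x) = \<zero>\<^bsub>Y\<^esub>" using rhom_minus(2)[OF P0m Ym p(1) rx x] by simp
        then have eq: "p x = p (r x)" using Y.minus_zero_iff[OF rhomD(1)[OF p(1) x] rhomD(1)[OF p(1) rx]] by simp
        have "r x \<in> ?A" using rhomD(1)[OF n(3) x] by simp
        then show ?thesis unfolding eq by (rule imageI)
      qed
      have "p ` carrier P0 \<subseteq> p ` ?A" by (rule image_subsetI[OF pr2])
      then have "p ` carrier (sub P0 ?A) = carrier Y" using image_mono[OF AP, of p] p(2) by simp
      then have "?ok (sub P0 ?A)" using Ap pA by blast
      then have "lg P0 \<le> lg (sub P0 ?A)" using min by blast
      then have "?A = carrier P0" using sub_mods(3)[OF P0mods rA] by (cases "?A = carrier P0") simp_all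
      then have "?f k = \<zero>\<^bsub>P0\<^esub>" using k KP0 by (auto simp: hker_def)
      then have "\<gamma> k = \<gamma> \<zero>\<^bsub>P0\<^esub>" using \<gamma>f[of k n] k KP0 by auto
      then show False using nz rhom_zero[OF P0m Bm \<gamma>] by simp
    qed
    have "hom0 P0 B"
    proof (rule hom0I)
      fix \<gamma> x assume \<gamma>: "\<gamma> \<in> rhom \<Lambda> P0 B" and x: "x \<in> carrier P0"
      have "\<gamma> z = \<zero>\<^bsub>B\<^esub>" if "z \<in> carrier P0" "p z = \<zero>\<^bsub>Y\<^esub>" for z
        by (rule \<gamma>K[OF \<gamma>]) (simp add: hker_def that)
      then obtain \<delta> where \<delta>: "\<delta> \<in> rhom \<Lambda> Y B" "\<And>x. x \<in> carrier P0 \<Longrightarrow> \<delta> (p x) = \<gamma> x"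
        using rhom_factor[OF P0m Ym Bm p \<gamma>] by blast
      have "hom0 Y B" using YT L(2) by blast
      from hom0D[OF this \<delta>(1) rhomD(1)[OF p(1) x]] show "\<gamma> x = \<zero>\<^bsub>B\<^esub>" by (simp only: \<delta>(2)[OF x])
    qed
    then have "P0 \<in> T" unfolding L(2) using P0U by blast
    then have "Y \<in> proj_gen U T" by (rule proj_genI[OF Ymods pr _ p])
    then show ?thesis by (rule tors_rperp_zero[OF PG(1) _ YF])
  qed
  have "Y \<in> proj_gen U T" if Y: "Y \<in> T" for Y
  proof -
    have Ymods: "Y \<in> mods" by (rule torsD(2)[OF T(1) Y])
    interpret Y: right_module \<Lambda> Y by (rule modsD(1)[OF Ymods])
    note t = trad[OF PG(1) Ymods]
    have "quot Y (trad (proj_gen U T) Y) \<in> T"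
      by (rule tors_quot[OF T(1) Y Y.right_module_quot[OF t(1)] Y.crep_hom[OF t(1)] Y.crep_surj[OF t(1)]])
    from quot_zero_imp[OF Y.right_module_axioms t(1) zero[OF this t(3)]] t(2) show ?thesis by simp
  qed
  then show ?thesis using PG(2) by blast
qed


section \<open>Universal elements of lower covers\<close>

definition reach :: "'a fgmod set \<Rightarrow> 'a fgmod \<Rightarrow> (nat \<Rightarrow> 'a) set \<Rightarrow> 'a fgmod set"
  where "reach U E e = {Y \<in> U. \<forall>y\<in>carrier Y. \<exists>h\<in>rhom \<Lambda> E Y. h e = y}"

text \<open>In the extension case a map to \<open>N\<close> with value \<open>g m\<close> lifts to
  \<open>M\<close> by relative projectivity. The lift may miss \<open>m\<close> by an element of the
  kernel, and this is corrected by a map to the kernel.\<close>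

lemma reach_torsion:
  assumes U: "torsion_class \<Lambda> U" and E: "rel_proj U E" and e: "e \<in> carrier E"
  shows "torsion_class \<Lambda> (reach U E e)"
proof (rule torsionI)
  show "reach U E e \<subseteq> mods" using torsD(1)[OF U] unfolding reach_def by blast
  show "Z \<in> reach U E e" if Z: "Z \<in> mods" "carrier Z = {\<zero>\<^bsub>Z\<^esub>}" for Z
  proof -
    have "\<exists>h\<in>rhom \<Lambda> E Z. h e = y" if "y \<in> carrier Z" for y
      using that Z(2) by (intro bexI[OF _ rhom_const_zero[OF modsD(1)[OF Z(1)]]]) simp
    then show ?thesis using torsD(3)[OF U Z] by (simp add: reach_def)
  qed
  show "N \<in> reach U E e" if M: "M \<in> reach U E e" and N: "N \<in> mods" "f \<in> rhom \<Lambda> M N" "f ` carrier M = carrier N" for M N f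
  proof -
    have MU: "M \<in> U" and Mr: "\<forall>y\<in>carrier M. \<exists>h\<in>rhom \<Lambda> E M. h e = y" using M unfolding reach_def by blast+
    have "\<exists>h\<in>rhom \<Lambda> E N. h e = y" if "y \<in> carrier N" for y
    proof -
      have "y \<in> f ` carrier M" using that by (simp only: N(3))
      then obtain x where x: "x \<in> carrier M" "y = f x" by blast
      obtain h where h: "h \<in> rhom \<Lambda> E M" "h e = x" using Mr x(1) by blast
      show ?thesis using x(2) h(2) by (intro bexI[OF _ rhom_comp[OF h(1) N(2)]]) simp
    qed
    then show ?thesis using tors_quot[OF U MU modsD(1)[OF N(1)] N(2,3)] by (simp add: reach_def)
  qed
  fix M N g assume M: "M \<in> mods" and N: "N \<in> reach U E e" and g: "g \<in> rhom \<Lambda> M N" "g ` carrier M = carrier N"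
    and K: "sub M (hker M N g) \<in> reach U E e"
  have NU: "N \<in> U" and Nr: "\<forall>y\<in>carrier N. \<exists>h\<in>rhom \<Lambda> E N. h e = y" using N unfolding reach_def by blast+
  have KU: "sub M (hker M N g) \<in> U"
    and Kr: "\<forall>y\<in>carrier (sub M (hker M N g)). \<exists>h\<in>rhom \<Lambda> E (sub M (hker M N g)). h e = y"
    using K unfolding reach_def by blast+
  have Nmods: "N \<in> mods" by (rule torsD(2)[OF U NU])
  note Mm = modsD(1)[OF M] and Nm = modsD(1)[OF Nmods]
  interpret M: right_module \<Lambda> M by (rule Mm)
  interpret N: right_module \<Lambda> N by (rule Nm)
  have "\<exists>h\<in>rhom \<Lambda> E M. h e = m" if m: "m \<in> carrier M" for m
  proof -
    obtain h where h: "h \<in> rhom \<Lambda> E N" "h e = g m" using Nr rhomD(1)[OF g(1) m] by blast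
    obtain k where k: "k \<in> rhom \<Lambda> E M" "\<forall>x\<in>carrier E. g (k x) = h x"
      using rel_projD(2)[OF E M Nmods g KU h(1)] by blast
    have ke: "k e \<in> carrier M" by (rule rhomD(1)[OF k(1) e])
    have gk: "g (k e) = g m" using k(2) e h(2) by simp
    have "g (m \<ominus>\<^bsub>M\<^esub> k e) = g m \<ominus>\<^bsub>N\<^esub> g (k e)" by (rule rhom_minus(2)[OF Mm Nm g(1) ke m])
    then have "g (m \<ominus>\<^bsub>M\<^esub> k e) = \<zero>\<^bsub>N\<^esub>" using gk rhomD(1)[OF g(1) m] by (simp add: N.minus_zero_iff)
    then have "m \<ominus>\<^bsub>M\<^esub> k e \<in> hker M N g" using m ke by (simp add: hker_def)
    then obtain l where l: "l \<in> rhom \<Lambda> E (sub M (hker M N g))" "l e = m \<ominus>\<^bsub>M\<^esub> k e" using Kr by auto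
    have kM: "hker M N g \<subseteq> carrier M" by (auto simp: hker_def)
    have "l e \<oplus>\<^bsub>M\<^esub> k e = m" using l(2) M.minus_add_cancel[OF m ke] by simp
    then show ?thesis by (intro bexI[OF _ rhom_add_fun[OF Mm rhom_into_sub[OF l(1) kM] k(1)]])
  qed
  then show "M \<in> reach U E e" using tors_ext[OF U M NU g KU] by (simp add: reach_def)
qed

lemma rhom_scalar:
  assumes N: "right_module \<Lambda> N" and h: "h \<in> rhom \<Lambda> M N" and r: "r \<in> carrier R"
  shows "(\<lambda>x. h x \<triangleleft>\<^bsub>N\<^esub> (r \<odot>\<^bsub>\<Lambda>\<^esub> \<one>\<^bsub>\<Lambda>\<^esub>)) \<in> rhom \<Lambda> M N"
proof -
  interpret N: right_module \<Lambda> N by fact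
  have c: "r \<odot>\<^bsub>\<Lambda>\<^esub> \<one>\<^bsub>\<Lambda>\<^esub> \<in> carrier \<Lambda>" using r by simp
  show ?thesis
  proof (rule rhomI)
    fix x a assume x: "x \<in> carrier M" and a: "a \<in> carrier \<Lambda>"
    have hx: "h x \<in> carrier N" by (rule rhomD(1)[OF h x])
    have "h (x \<triangleleft>\<^bsub>M\<^esub> a) \<triangleleft>\<^bsub>N\<^esub> (r \<odot>\<^bsub>\<Lambda>\<^esub> \<one>\<^bsub>\<Lambda>\<^esub>) = h x \<triangleleft>\<^bsub>N\<^esub> (a \<otimes>\<^bsub>\<Lambda>\<^esub> (r \<odot>\<^bsub>\<Lambda>\<^esub> \<one>\<^bsub>\<Lambda>\<^esub>))"
      using rhomD(3)[OF h x a] N.ract_assoc[OF hx a c] by simp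
    also have "a \<otimes>\<^bsub>\<Lambda>\<^esub> (r \<odot>\<^bsub>\<Lambda>\<^esub> \<one>\<^bsub>\<Lambda>\<^esub>) = (r \<odot>\<^bsub>\<Lambda>\<^esub> \<one>\<^bsub>\<Lambda>\<^esub>) \<otimes>\<^bsub>\<Lambda>\<^esub> a"
      by (simp only: mult_smult_one[OF r a] smult_one_mult[OF r a])
    finally show "h (x \<triangleleft>\<^bsub>M\<^esub> a) \<triangleleft>\<^bsub>N\<^esub> (r \<odot>\<^bsub>\<Lambda>\<^esub> \<one>\<^bsub>\<Lambda>\<^esub>) = h x \<triangleleft>\<^bsub>N\<^esub> (r \<odot>\<^bsub>\<Lambda>\<^esub> \<one>\<^bsub>\<Lambda>\<^esub>) \<triangleleft>\<^bsub>N\<^esub> a"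
      using N.ract_assoc[OF hx c a] by simp
  qed (simp_all add: rhomD[OF h] c N.ract_l_distr)
qed

text \<open>The values at \<open>e\<close> of maps from \<open>E\<close> to \<open>Q\<close> form an
  \<open>R\<close>-submodule \<open>S (E, e)\<close> of \<open>Q\<close>. When its length is maximal
  it contains every \<open>q\<close>, since adjoining to \<open>E\<close> the summand
  \<open>Q\<close> with the element \<open>q\<close> would enlarge it by \<open>q\<close>.\<close>

lemma rel_proj_reached:
  assumes U: "torsion_class \<Lambda> U" and T: "torsion_class \<Lambda> T" and Q: "rel_proj U Q" "Q \<in> T"
  shows "\<exists>E e. rel_proj U E \<and> E \<in> T \<and> e \<in> carrier E \<and> Q \<in> reach U E e"
proof -
  have Qmods: "Q \<in> mods" by (rule rel_proj_mods[OF U Q(1)])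
  note Qm = modsD(1)[OF Qmods] and fQ = modsD(2)[OF Qmods]
  interpret Q: right_module \<Lambda> Q by (rule Qm)
  interpret rQ: right_module R "res Q" by (rule right_module_res[OF Qm])
  define ok where "ok = (\<lambda>(E, e). rel_proj U E \<and> E \<in> T \<and> e \<in> carrier E)"
  define S :: "'a fgmod \<times> (nat \<Rightarrow> 'a) set \<Rightarrow> (nat \<Rightarrow> 'a) set set"
    where "S = (\<lambda>(E, e). (\<lambda>h. h e) ` rhom \<Lambda> E Q)"
  have rS: "rsubmodule R (res Q) (S (E, e))" if e: "e \<in> carrier E" for E :: "'a fgmod" and e
  proof (rule rQ.rsubI)
    show "S (E, e) \<subseteq> carrier (res Q)" using rhomD(1)[OF _ e] unfolding S_def by auto
    have "(\<lambda>_. \<zero>\<^bsub>Q\<^esub>) \<in> rhom \<Lambda> E Q" by (rule rhom_const_zero[OF Qm])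
    then show "\<zero>\<^bsub>res Q\<^esub> \<in> S (E, e)" unfolding S_def prod.case by (rule image_eqI[rotated]) simp
    show "x \<oplus>\<^bsub>res Q\<^esub> y \<in> S (E, e)" if xy: "x \<in> S (E, e)" "y \<in> S (E, e)" for x y
    proof -
      obtain h k where h: "h \<in> rhom \<Lambda> E Q" "x = h e" and k: "k \<in> rhom \<Lambda> E Q" "y = k e" using xy unfolding S_def by auto
      show ?thesis unfolding S_def prod.case using h(2) k(2)
        by (intro image_eqI[OF _ rhom_add_fun[OF Qm h(1) k(1)]]) simp
    qed
    show "x \<triangleleft>\<^bsub>res Q\<^esub> r \<in> S (E, e)" if x: "x \<in> S (E, e)" and r: "r \<in> carrier R" for x r
    proof -
      obtain h where h: "h \<in> rhom \<Lambda> E Q" "x = h e" using x unfolding S_def by auto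
      show ?thesis unfolding S_def prod.case using h(2)
        by (intro image_eqI[OF _ rhom_scalar[OF Qm h(1) r]]) simp
    qed
  qed
  have SQ: "S (E, e) \<subseteq> carrier (res Q)" if "e \<in> carrier E" for E :: "'a fgmod" and e
    by (rule rQ.rsubD(1)[OF rS[OF that]])
  have fS: "fin_len R (res Q) (S (E, e))" "len R (res Q) (S (E, e)) \<le> len R (res Q) (carrier Q)"
    if "e \<in> carrier E" for E :: "'a fgmod" and e
    using fin_len_mono(1,2)[OF fQ rS[OF that]] SQ[OF that] by simp_all
  have "ok (Q, \<zero>\<^bsub>Q\<^esub>)" using Q by (simp add: ok_def)
  moreover have "\<forall>z. ok z \<longrightarrow> len R (res Q) (S z) < Suc (len R (res Q) (carrier Q))"
    using fS(2) unfolding ok_def by (auto simp: less_Suc_eq_le)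
  ultimately have "\<exists>z. ok z \<and> (\<forall>w. ok w \<longrightarrow> len R (res Q) (S w) \<le> len R (res Q) (S z))"
    by (rule ex_has_greatest_nat)
  then obtain z where z: "ok z" "\<forall>w. ok w \<longrightarrow> len R (res Q) (S w) \<le> len R (res Q) (S z)" by blast
  obtain E e where "z = (E, e)" by (rule prod.exhaust)
  then have Ee: "ok (E, e)" and max: "\<forall>w. ok w \<longrightarrow> len R (res Q) (S w) \<le> len R (res Q) (S (E, e))"
    using z by simp_all
  then have E: "rel_proj U E" "E \<in> T" "e \<in> carrier E" by (simp_all add: ok_def)
  have Emods: "E \<in> mods" by (rule rel_proj_mods[OF U E(1)])
  note Em = modsD(1)[OF Emods]
  have "q \<in> S (E, e)" if q: "q \<in> carrier Q" for q
  proof (rule ccontr)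
    assume nq: "q \<notin> S (E, e)"
    obtain D i j p q' where b: "biprod E Q D i j p q'" by (rule biprod_exists[OF Emods Qmods])
    note B = biprodD[OF b]
    let ?d = "i e \<oplus>\<^bsub>D\<^esub> j q"
    note d = biprod_elem[OF Em Qm b E(3) q]
    have okD: "ok (D, ?d)"
      using rel_proj_biprod[OF U E(1) Q(1) b] torsD(4)[OF T E(2) Q(2) b] d(1) by (simp add: ok_def)
    have sub: "S (E, e) \<subseteq> S (D, ?d)"
    proof
      fix x assume "x \<in> S (E, e)"
      then obtain h where h: "h \<in> rhom \<Lambda> E Q" "x = h e" unfolding S_def by auto
      show "x \<in> S (D, ?d)" unfolding S_def prod.case using d(2) h(2)
        by (intro image_eqI[OF _ rhom_comp[OF B(5) h(1)]]) simp
    qed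
    have "q \<in> S (D, ?d)" unfolding S_def prod.case using d(3) by (intro image_eqI[OF _ B(6)]) simp
    then have "S (E, e) \<noteq> S (D, ?d)" using nq by blast
    then have "len R (res Q) (S (E, e)) < len R (res Q) (S (D, ?d))"
      by (rule fin_len_mono(3)[OF fS(1)[OF d(1)] rS[OF E(3)] sub])
    moreover have "len R (res Q) (S (D, ?d)) \<le> len R (res Q) (S (E, e))" by (rule max[rule_format, OF okD])
    ultimately show False by simp
  qed
  then have "\<forall>y\<in>carrier Q. \<exists>h\<in>rhom \<Lambda> E Q. h e = y" unfolding S_def by blast
  then have "Q \<in> reach U E e" using rel_projD(1)[OF Q(1)] by (simp add: reach_def)
  then show ?thesis using E by blast
qed

text \<open>Two classes \<open>reach U E e\<close> lie in the one belonging to the direct sum, so a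
  maximal one among the finitely many is the largest. It contains every relative projective of
  \<open>U\<close> in \<open>T\<close>, and being a torsion class it contains
  \<open>T = proj_gen U T\<close>.\<close>

lemma cover_univ_elem:
  assumes fin: "finite {T. torsion_class \<Lambda> T}" and U: "torsion_class \<Lambda> U" and e: "univ_elem U E0 e0"
    and cov: "cover U T"
  shows "\<exists>E e. univ_elem T E e"
proof -
  note C = coverD[OF cov] and T = coverD(1)[OF cov]
  obtain B where lab: "label U T B" using cover_label[OF U cov] by blast
  obtain P f where Pf: "min_univ U P f" using min_univ_exists[OF U e] by blast
  have Teq: "T = proj_gen U T" by (rule cover_proj_gen[OF U T C(2) lab Pf])
  let ?D = "{reach U E e | E e. rel_proj U E \<and> E \<in> T \<and> e \<in> carrier E}"
  have "?D \<subseteq> {T. torsion_class \<Lambda> T}" using reach_torsion[OF U] by blast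
  then have finD: "finite ?D" using fin by (rule finite_subset)
  obtain L u where L: "L \<in> mods" "u \<in> carrier L" by (rule regular_copy) blast
  interpret L: right_module \<Lambda> L by (rule modsD(1)[OF L(1)])
  let ?Z = "sub L {\<zero>\<^bsub>L\<^esub>}"
  have Z: "?Z \<in> mods" "carrier ?Z = {\<zero>\<^bsub>?Z\<^esub>}" using sub_mods(1)[OF L(1) L.rsub_zero] by simp_all
  have "\<zero>\<^bsub>L\<^esub> \<in> carrier ?Z" by simp
  then have "reach U ?Z \<zero>\<^bsub>L\<^esub> \<in> ?D" using rel_proj_zero[OF U Z] torsD(3)[OF T Z] by blast
  then have "?D \<noteq> {}" by blast
  then obtain D where D: "D \<in> ?D" "\<forall>b\<in>?D. D \<subseteq> b \<longrightarrow> D = b" using finite_has_maximal[OF finD] by blast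
  then obtain E e where E: "D = reach U E e" "rel_proj U E" "E \<in> T" "e \<in> carrier E" by blast
  have Emods: "E \<in> mods" by (rule rel_proj_mods[OF U E(2)])
  note Em = modsD(1)[OF Emods]
  have big: "reach U E' e' \<subseteq> D" if E': "rel_proj U E'" "E' \<in> T" "e' \<in> carrier E'" for E' e'
  proof -
    have E'mods: "E' \<in> mods" by (rule rel_proj_mods[OF U E'(1)])
    obtain F i j p q where b: "biprod E E' F i j p q" by (rule biprod_exists[OF Emods E'mods])
    note B = biprodD[OF b]
    let ?d = "i e \<oplus>\<^bsub>F\<^esub> j e'"
    note d = biprod_elem[OF Em modsD(1)[OF E'mods] b E(4) E'(3)]
    have in1: "D \<subseteq> reach U F ?d"
    proof
      fix Y assume Y: "Y \<in> D"
      have "\<exists>h\<in>rhom \<Lambda> F Y. h ?d = y" if y: "y \<in> carrier Y" for y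
      proof -
        obtain h where h: "h \<in> rhom \<Lambda> E Y" "h e = y" using Y y unfolding E(1) reach_def by blast
        show ?thesis using d(2) h(2) by (intro bexI[OF _ rhom_comp[OF B(5) h(1)]]) simp
      qed
      then show "Y \<in> reach U F ?d" using Y unfolding E(1) by (simp add: reach_def)
    qed
    have in2: "reach U E' e' \<subseteq> reach U F ?d"
    proof
      fix Y assume Y: "Y \<in> reach U E' e'"
      have "\<exists>h\<in>rhom \<Lambda> F Y. h ?d = y" if y: "y \<in> carrier Y" for y
      proof -
        obtain h where h: "h \<in> rhom \<Lambda> E' Y" "h e' = y" using Y y unfolding reach_def by blast
        show ?thesis using d(3) h(2) by (intro bexI[OF _ rhom_comp[OF B(6) h(1)]]) simp
      qed
      then show "Y \<in> reach U F ?d" using Y by (simp add: reach_def)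
    qed
    have "reach U F ?d \<in> ?D" using rel_proj_biprod[OF U E(2) E'(1) b] torsD(4)[OF T E(3) E'(2) b] d(1) by blast
    then have "D = reach U F ?d" using D(2) in1 by blast
    then show ?thesis using in2 by simp
  qed
  have Dt: "torsion_class \<Lambda> D" unfolding E(1) by (rule reach_torsion[OF U E(2,4)])
  have "Y \<in> D" if Y: "Y \<in> T" for Y
  proof -
    have "Y \<in> proj_gen U T" using Y Teq by simp
    then obtain Q p where Q: "rel_proj U Q" "Q \<in> T" "p \<in> rhom \<Lambda> Q Y" "p ` carrier Q = carrier Y" and Ym: "Y \<in> mods"
      unfolding proj_gen_def by blast
    obtain E' e' where "rel_proj U E'" "E' \<in> T" "e' \<in> carrier E'" "Q \<in> reach U E' e'"
      using rel_proj_reached[OF U T Q(1,2)] by blast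
    then have "Q \<in> D" using big by blast
    then show ?thesis by (rule tors_quot[OF Dt _ modsD(1)[OF Ym] Q(3,4)])
  qed
  then have "univ_elem T E e" using E(3,4) unfolding univ_elem_def E(1) reach_def by blast
  then show ?thesis by blast
qed

section \<open>Universal elements of all torsion classes, and the number of lower covers\<close>

lemma mods_torsion: "torsion_class \<Lambda> mods"
  by (rule torsionI) simp_all

lemma mods_univ_elem: "\<exists>L u. univ_elem mods L u"
proof -
  obtain L u where L: "L \<in> mods" "u \<in> carrier L"
    and Lf: "\<And>(M :: 'a fgmod) m. right_module \<Lambda> M \<Longrightarrow> m \<in> carrier M \<Longrightarrow> \<exists>h\<in>rhom \<Lambda> L M. h u = m"
    by (rule regular_copy) blast
  have "univ_elem mods L u" unfolding univ_elem_def using L Lf[OF modsD(1)] by simp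
  then show ?thesis by blast
qed

lemma finite_univ_elem:
  assumes fin: "finite {T. torsion_class \<Lambda> T}" and T: "torsion_class \<Lambda> T"
  shows "\<exists>E e. univ_elem T E e"
proof -
  let ?U = "{U. torsion_class \<Lambda> U \<and> T \<subseteq> U \<and> (\<exists>E e. univ_elem U E e)}"
  have "finite ?U" using fin by (rule rev_finite_subset) blast
  moreover have "mods \<in> ?U" using mods_torsion mods_univ_elem torsD(1)[OF T] by simp
  then have "?U \<noteq> {}" by blast
  ultimately obtain U where U: "U \<in> ?U" "\<forall>b\<in>?U. b \<subseteq> U \<longrightarrow> U = b" using finite_has_minimal[of ?U] by blast
  then obtain E e where Ue: "torsion_class \<Lambda> U" "T \<subseteq> U" "univ_elem U E e" by blast
  have "U = T"
  proof (rule ccontr)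
    assume "U \<noteq> T"
    then have "T \<subset> U" using Ue(2) by blast
    then obtain T' where T': "cover U T'" "T \<subseteq> T'" using cover_exists[OF Ue(1,3) T] by blast
    then have "T' \<in> ?U" using cover_univ_elem[OF fin Ue(1,3) T'(1)] coverD(1)[OF T'(1)] by simp
    then show False using U(2) coverD(2,3)[OF T'(1)] by blast
  qed
  then show ?thesis using Ue(3) by blast
qed

text \<open>A nonzero map between labels is surjective with kernel in \<open>U\<close>. The
  inclusion of this kernel is a map to the label \<open>A\<close>; if it were nonzero it would be
  surjective. So the map is an isomorphism, and a label determines its lower cover.\<close>

lemma label_hom0:
  assumes U: "torsion_class \<Lambda> U" and S: "label U S A" and T: "label U T B" and ne: "S \<noteq> T"
  shows "hom0 A B"
proof (rule ccontr)
  assume "\<not> hom0 A B"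
  then obtain h a where h: "h \<in> rhom \<Lambda> A B" "a \<in> carrier A" "h a \<noteq> \<zero>\<^bsub>B\<^esub>" unfolding hom0_def by blast
  note LS = labelD[OF S] and LT = labelD[OF T]
  note Am = modsD(1)[OF torsD(2)[OF U LS(1)]] and Bm = modsD(1)[OF torsD(2)[OF U LT(1)]]
  interpret A: right_module \<Lambda> A by (rule Am)
  have surj: "h ` carrier A = carrier B" by (rule LT(3)[OF LS(1) h])
  have K: "sub A (hker A B h) \<in> U" by (rule LT(4)[OF LS(1) h])
  have kA: "hker A B h \<subseteq> carrier A" by (auto simp: hker_def)
  have "k = \<zero>\<^bsub>A\<^esub>" if k: "k \<in> hker A B h" for k
  proof (rule ccontr)
    assume nz: "k \<noteq> \<zero>\<^bsub>A\<^esub>"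
    have "(\<lambda>x. x) ` carrier (sub A (hker A B h)) = carrier A"
      by (rule LS(3)[OF K rhom_incl'[OF kA], of k]) (use k nz in simp_all)
    then have "a \<in> hker A B h" using h(2) by simp
    then show False using h(3) by (simp add: hker_def)
  qed
  then have "hker A B h = {\<zero>\<^bsub>A\<^esub>}" using rhom_zero[OF Am Bm h(1)] by (auto simp: hker_def)
  then have inj: "inj_on h (carrier A)" using rhom_inj_iff[OF Am Bm h(1)] by simp
  have bij: "bij_betw h (carrier A) (carrier B)" using inj surj by (simp add: bij_betw_def)
  have i: "inv_into (carrier A) h \<in> rhom \<Lambda> B A" "inj_on (inv_into (carrier A) h) (carrier B)"
    using rhom_inv[OF Am h(1) bij] bij_betw_inv_into[OF bij] by (simp_all add: bij_betw_def)
  have "hom0 Y A \<longleftrightarrow> hom0 Y B" for Y :: "'a fgmod"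
    using hom0_inj[OF _ Am Bm h(1) inj] hom0_inj[OF _ Bm Am i] by blast
  then have "S = T" unfolding LS(2) LT(2) by simp
  then show False using ne by simp
qed

text \<open>Each lower cover in \<open>\<T>\<close> makes \<open>K\<close> shorter by passing to the
  kernel of a map onto its label, so \<open>lg P\<close> bounds their number. The last clause keeps
  the induction going: a map to another label that vanishes on the kernel of \<open>g1\<close> on
  \<open>K\<close> factors through \<open>B1\<close>, hence vanishes on \<open>K\<close> because
  labels are Hom-orthogonal.\<close>

lemma covers_kernel:
  assumes U: "torsion_class \<Lambda> U" and e: "univ_elem U P e" and fin: "finite \<T>" and cov: "\<And>T. T \<in> \<T> \<Longrightarrow> cover U T"
  shows "\<exists>K. rsubmodule \<Lambda> P K \<and> sub P K \<in> U \<and> lg (sub P K) + card \<T> \<le> lg P \<and>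
    (\<forall>T B g. cover U T \<longrightarrow> T \<notin> \<T> \<longrightarrow> label U T B \<longrightarrow> g \<in> rhom \<Lambda> P B \<longrightarrow> (\<forall>k\<in>K. g k = \<zero>\<^bsub>B\<^esub>) \<longrightarrow>
      (\<forall>x\<in>carrier P. g x = \<zero>\<^bsub>B\<^esub>))"
  using fin cov
proof (induction \<T> rule: finite_induct)
  have PU: "P \<in> U" by (rule univ_elemD(1)[OF e])
  have Pmods: "P \<in> mods" by (rule torsD(2)[OF U PU])
  interpret P: right_module \<Lambda> P by (rule modsD(1)[OF Pmods])
  case empty
  show ?case using P.rsub_carrier PU by (intro exI[of _ "carrier P"]) simp
next
  case (insert T1 \<T>)
  have PU: "P \<in> U" by (rule univ_elemD(1)[OF e])
  have Pmods: "P \<in> mods" by (rule torsD(2)[OF U PU])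
  note Pm = modsD(1)[OF Pmods]
  interpret P: right_module \<Lambda> P by (rule Pm)
  have c1: "cover U T1" by (rule insert.prems) simp
  have "\<exists>K. rsubmodule \<Lambda> P K \<and> sub P K \<in> U \<and> lg (sub P K) + card \<T> \<le> lg P \<and>
    (\<forall>T B g. cover U T \<longrightarrow> T \<notin> \<T> \<longrightarrow> label U T B \<longrightarrow> g \<in> rhom \<Lambda> P B \<longrightarrow> (\<forall>k\<in>K. g k = \<zero>\<^bsub>B\<^esub>) \<longrightarrow>
      (\<forall>x\<in>carrier P. g x = \<zero>\<^bsub>B\<^esub>))"
    by (rule insert.IH, rule insert.prems) simp
  then obtain K where K: "rsubmodule \<Lambda> P K" "sub P K \<in> U" "lg (sub P K) + card \<T> \<le> lg P"
    and van: "\<forall>T B g. cover U T \<longrightarrow> T \<notin> \<T> \<longrightarrow> label U T B \<longrightarrow> g \<in> rhom \<Lambda> P B \<longrightarrow> (\<forall>k\<in>K. g k = \<zero>\<^bsub>B\<^esub>) \<longrightarrow>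
      (\<forall>x\<in>carrier P. g x = \<zero>\<^bsub>B\<^esub>)" by (elim exE conjE)
  obtain B1 where l1: "label U T1 B1" using cover_label[OF U c1] by blast
  note L1 = labelD[OF l1]
  have B1m: "right_module \<Lambda> B1" by (rule modsD(1)[OF torsD(2)[OF U L1(1)]])
  have "P \<notin> T1" using univ_elem_generates[OF coverD(1)[OF c1] torsD(1)[OF U] e] coverD(2,3)[OF c1] by blast
  then have "\<not> hom0 P B1" using L1(2) PU by blast
  then obtain g1 x1 where g1: "g1 \<in> rhom \<Lambda> P B1" "x1 \<in> carrier P" "g1 x1 \<noteq> \<zero>\<^bsub>B1\<^esub>" unfolding hom0_def by blast
  have "\<not> (\<forall>k\<in>K. g1 k = \<zero>\<^bsub>B1\<^esub>)"
    using van[rule_format, OF c1 insert.hyps(2) l1 g1(1) _ g1(2)] g1(3) by blast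
  then obtain k0 where k0: "k0 \<in> K" "g1 k0 \<noteq> \<zero>\<^bsub>B1\<^esub>" by blast
  note KP = P.rsubD(1)[OF K(1)]
  have g1K: "g1 \<in> rhom \<Lambda> (sub P K) B1" by (rule rhom_restrict[OF g1(1) KP])
  have k0': "k0 \<in> carrier (sub P K)" using k0(1) by simp
  let ?K' = "hker (sub P K) B1 g1"
  have surj: "g1 ` carrier (sub P K) = carrier B1" by (rule L1(3)[OF K(2) g1K k0' k0(2)])
  have K'U: "sub P ?K' \<in> U" using L1(4)[OF K(2) g1K k0' k0(2)] by simp
  have Km: "right_module \<Lambda> (sub P K)" by (rule P.right_module_sub[OF K(1)])
  have rK': "rsubmodule \<Lambda> (sub P K) ?K'" by (rule rsub_hker[OF Km B1m g1K])
  then have rPK': "rsubmodule \<Lambda> P ?K'" and K'K: "?K' \<subseteq> K" unfolding P.rsub_sub[OF K(1)] by blast+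
  have "k0 \<notin> ?K'" using k0(2) by (simp add: hker_def)
  then have "?K' \<noteq> carrier (sub P K)" using k0' by blast
  from sub_mods(3)[OF sub_mods(1)[OF Pmods K(1)] rK' this] have lt: "lg (sub P ?K') < lg (sub P K)" by simp
  have "g x = \<zero>\<^bsub>B\<^esub>" if T: "cover U T" "T \<notin> insert T1 \<T>" and lab: "label U T B" and g: "g \<in> rhom \<Lambda> P B"
    and z: "\<forall>k\<in>?K'. g k = \<zero>\<^bsub>B\<^esub>" and x: "x \<in> carrier P" for T B g x
  proof -
    have Bm: "right_module \<Lambda> B" by (rule modsD(1)[OF torsD(2)[OF U labelD(1)[OF lab]]])
    have gK: "g \<in> rhom \<Lambda> (sub P K) B" by (rule rhom_restrict[OF g KP])
    have "g k = \<zero>\<^bsub>B\<^esub>" if "k \<in> carrier (sub P K)" "g1 k = \<zero>\<^bsub>B1\<^esub>" for k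
      using z that by (simp add: hker_def)
    then obtain d where d: "d \<in> rhom \<Lambda> B1 B" "\<And>k. k \<in> carrier (sub P K) \<Longrightarrow> d (g1 k) = g k"
      using rhom_factor[OF Km B1m Bm g1K surj gK] by blast
    have h0: "hom0 B1 B" by (rule label_hom0[OF U l1 lab]) (use T(2) in blast)
    have "g k = \<zero>\<^bsub>B\<^esub>" if k: "k \<in> K" for k
    proof -
      have kc: "k \<in> carrier (sub P K)" using k by simp
      show ?thesis using hom0D[OF h0 d(1) rhomD(1)[OF g1K kc]] d(2)[OF kc] by simp
    qed
    then have gz: "\<forall>k\<in>K. g k = \<zero>\<^bsub>B\<^esub>" by blast
    have Tn: "T \<notin> \<T>" using T(2) by blast
    show ?thesis by (rule van[rule_format, OF T(1) Tn lab g _ x]) (rule gz[rule_format])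
  qed
  moreover have "lg (sub P ?K') + card (insert T1 \<T>) \<le> lg P" using lt K(3) insert.hyps by simp
  ultimately show ?case using rPK' K'U by (intro exI[of _ ?K'] conjI allI impI ballI) simp_all
qed

lemma finite_covers:
  assumes U: "torsion_class \<Lambda> U" and e: "univ_elem U P e"
  shows "finite {T. cover U T}"
proof (rule ccontr)
  assume "infinite {T. cover U T}"
  then obtain \<T> where "finite \<T>" "card \<T> = Suc (lg P)" "\<T> \<subseteq> {T. cover U T}"
    using infinite_arbitrarily_large by blast
  then show False using covers_kernel[OF U e, of \<T>] by auto
qed

end

section \<open>Torsion-free classes and contravariant finiteness\<close>

text \<open>Vectors are functions on all natural numbers, padded with zero from \<open>n\<close> on.
  Equality of vectors is then equality of functions, and \<open>powm N n\<close> is literally the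
  kernel of the last coordinate of \<open>powm N (Suc n)\<close>.\<close>

definition powm :: "('a, 'm) rmodule \<Rightarrow> nat \<Rightarrow> ('a, nat \<Rightarrow> 'm) rmodule"
  where "powm N n = \<lparr>carrier = {v. (\<forall>i<n. v i \<in> carrier N) \<and> (\<forall>i\<ge>n. v i = \<zero>\<^bsub>N\<^esub>)},
    mult = undefined, one = undefined, zero = (\<lambda>_. \<zero>\<^bsub>N\<^esub>), add = (\<lambda>v w i. v i \<oplus>\<^bsub>N\<^esub> w i),
    ract = (\<lambda>v a i. v i \<triangleleft>\<^bsub>N\<^esub> a)\<rparr>"

lemma powm_simps:
  "v \<in> carrier (powm N n) \<longleftrightarrow> (\<forall>i<n. v i \<in> carrier N) \<and> (\<forall>i\<ge>n. v i = \<zero>\<^bsub>N\<^esub>)"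
  "\<zero>\<^bsub>powm N n\<^esub> = (\<lambda>_. \<zero>\<^bsub>N\<^esub>)" "v \<oplus>\<^bsub>powm N n\<^esub> w = (\<lambda>i. v i \<oplus>\<^bsub>N\<^esub> w i)" "v \<triangleleft>\<^bsub>powm N n\<^esub> a = (\<lambda>i. v i \<triangleleft>\<^bsub>N\<^esub> a)"
  by (simp_all add: powm_def)

context right_module
begin

lemma powm_closed: "v \<in> carrier (powm M n) \<Longrightarrow> v i \<in> carrier M"
  by (cases "i < n") (simp_all add: powm_simps)

lemma right_module_powm: "right_module \<Lambda> (powm M n)"
proof -
  have "abelian_group (powm M n)"
  proof (rule abelian_groupI)
    fix v w z assume v: "v \<in> carrier (powm M n)" and w: "w \<in> carrier (powm M n)" and z: "z \<in> carrier (powm M n)"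
    note c = powm_closed[OF v] powm_closed[OF w] powm_closed[OF z]
    show "v \<oplus>\<^bsub>powm M n\<^esub> w \<in> carrier (powm M n)" using v w by (simp add: powm_simps)
    show "v \<oplus>\<^bsub>powm M n\<^esub> w \<oplus>\<^bsub>powm M n\<^esub> z = v \<oplus>\<^bsub>powm M n\<^esub> (w \<oplus>\<^bsub>powm M n\<^esub> z)"
      using c by (simp add: powm_simps M.a_assoc)
    show "v \<oplus>\<^bsub>powm M n\<^esub> w = w \<oplus>\<^bsub>powm M n\<^esub> v" using c by (simp add: powm_simps M.a_comm)
    show "\<zero>\<^bsub>powm M n\<^esub> \<oplus>\<^bsub>powm M n\<^esub> v = v" using c by (simp add: powm_simps)
    have "(\<lambda>i. \<ominus>\<^bsub>M\<^esub> v i) \<in> carrier (powm M n)" using v c by (simp add: powm_simps neg_zero)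
    moreover have "(\<lambda>i. \<ominus>\<^bsub>M\<^esub> v i) \<oplus>\<^bsub>powm M n\<^esub> v = \<zero>\<^bsub>powm M n\<^esub>" using c by (simp add: powm_simps M.l_neg)
    ultimately show "\<exists>y\<in>carrier (powm M n). y \<oplus>\<^bsub>powm M n\<^esub> v = \<zero>\<^bsub>powm M n\<^esub>" by blast
  qed (simp add: powm_simps)
  moreover have "right_module_axioms \<Lambda> (powm M n)"
  proof
    fix v w a b assume v: "v \<in> carrier (powm M n)" and w: "w \<in> carrier (powm M n)"
      and a: "a \<in> carrier \<Lambda>" and b: "b \<in> carrier \<Lambda>"
    note c = powm_closed[OF v] powm_closed[OF w]
    show "v \<triangleleft>\<^bsub>powm M n\<^esub> a \<in> carrier (powm M n)" using v a by (simp add: powm_simps)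
    show "v \<triangleleft>\<^bsub>powm M n\<^esub> (a \<oplus>\<^bsub>\<Lambda>\<^esub> b) = v \<triangleleft>\<^bsub>powm M n\<^esub> a \<oplus>\<^bsub>powm M n\<^esub> v \<triangleleft>\<^bsub>powm M n\<^esub> b"
      using c a b by (simp add: powm_simps ract_r_distr)
    show "(v \<oplus>\<^bsub>powm M n\<^esub> w) \<triangleleft>\<^bsub>powm M n\<^esub> a = v \<triangleleft>\<^bsub>powm M n\<^esub> a \<oplus>\<^bsub>powm M n\<^esub> w \<triangleleft>\<^bsub>powm M n\<^esub> a"
      using c a by (simp add: powm_simps ract_l_distr)
    show "v \<triangleleft>\<^bsub>powm M n\<^esub> (a \<otimes>\<^bsub>\<Lambda>\<^esub> b) = (v \<triangleleft>\<^bsub>powm M n\<^esub> a) \<triangleleft>\<^bsub>powm M n\<^esub> b"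
      using c a b by (simp add: powm_simps ract_assoc)
  next
    fix v assume v: "v \<in> carrier (powm M n)"
    show "v \<triangleleft>\<^bsub>powm M n\<^esub> \<one>\<^bsub>\<Lambda>\<^esub> = v" using powm_closed[OF v] by (simp add: powm_simps)
  qed
  ultimately show ?thesis by (intro right_module.intro \<Lambda>.ring_axioms)
qed

lemma fin_len_powm:
  assumes fin: "fin_len \<Lambda> M (carrier M)"
  shows "fin_len \<Lambda> (powm M n) (carrier (powm M n)) \<and> len \<Lambda> (powm M n) (carrier (powm M n)) \<le> n * len \<Lambda> M (carrier M)"
proof (induction n)
  case 0
  have "carrier (powm M 0) = {\<zero>\<^bsub>powm M 0\<^esub>}" by (auto simp: powm_simps fun_eq_iff)
  then show ?case using len_zero[OF right_module_powm[of 0]] by simp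
next
  case (Suc n)
  let ?p = "\<lambda>v. v n"
  have p: "?p \<in> rhom \<Lambda> (powm M (Suc n)) M" by (rule rhomI) (simp_all add: powm_closed powm_simps)
  have k: "hker (powm M (Suc n)) M ?p = carrier (powm M n)"
  proof (rule Set.set_eqI)
    fix v
    have "(\<forall>i\<ge>n. v i = \<zero>\<^bsub>M\<^esub>) \<longleftrightarrow> (\<forall>i\<ge>Suc n. v i = \<zero>\<^bsub>M\<^esub>) \<and> v n = \<zero>\<^bsub>M\<^esub>"
      by (metis Suc_leD le_refl not_less_eq_eq le_antisym)
    moreover have "(\<forall>i<Suc n. v i \<in> carrier M) \<longleftrightarrow> (\<forall>i<n. v i \<in> carrier M) \<and> v n \<in> carrier M"
      by (simp add: less_Suc_eq all_conj_distrib disj_imp) (metis less_irrefl)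
    ultimately show "v \<in> hker (powm M (Suc n)) M ?p \<longleftrightarrow> v \<in> carrier (powm M n)"
      by (auto simp: hker_def powm_simps(1))
  qed
  have s: "sub (powm M (Suc n)) (carrier (powm M n)) = powm M n"
    by (simp add: sub_def powm_def)
  note add = fin_len_additive[OF right_module_powm right_module_axioms p, unfolded k]
  have r: "rsubmodule \<Lambda> (powm M (Suc n)) (carrier (powm M n))"
    using rsub_hker[OF right_module_powm right_module_axioms p] by (simp only: k)
  note fs = fin_len_sub[OF right_module_powm r order_refl, unfolded s]
  have rI: "rsubmodule \<Lambda> M (?p ` carrier (powm M (Suc n)))"
    by (rule rsub_range[OF right_module_powm right_module_axioms p])
  have IM: "?p ` carrier (powm M (Suc n)) \<subseteq> carrier M" by (rule rsubD(1)[OF rI])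
  note fI = fin_len_mono[OF fin rI IM]
  have f1: "fin_len \<Lambda> (powm M (Suc n)) (carrier (powm M (Suc n)))"
    using add(1) fs(1) Suc.IH fI(1) by simp
  have "len \<Lambda> (powm M (Suc n)) (carrier (powm M (Suc n)))
      = len \<Lambda> (powm M n) (carrier (powm M n)) + len \<Lambda> M (?p ` carrier (powm M (Suc n)))"
    using add(2)[OF f1] fs(2) by simp
  then show ?case using f1 Suc.IH fI(2) by simp
qed

end

context comm_artinian
begin

text \<open>Commutative case of the fact that essential extensions of finite length modules have bounded length:
  \<open>N/D\<close> is an essential extension of \<open>(D + A)/D\<close>.\<close>

lemma essential_bound:
  assumes N: "right_module R N" and fin: "fin_len R N (carrier N)"
    and D: "rsubmodule R N D" and A: "rsubmodule R N A"
    and max: "\<And>D'. rsubmodule R N D' \<Longrightarrow> D \<subseteq> D' \<Longrightarrow> D' \<inter> A \<subseteq> D \<Longrightarrow> D' = D"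
    and q: "len R N (right_module.msum N D A) \<le> len R N D + q" and n: "comp_series {\<zero>} n"
  shows "len R N (carrier N) \<le> len R N D + n * q"
proof -
  interpret N: right_module R N by fact
  note DA = N.rsub_msum[OF D A]
  \<comment> \<open>\<open>X I\<close> consists of the elements that \<open>I\<close> multiplies
    into \<open>D\<close>. Along a composition series of \<open>R\<close> it grows from
    \<open>D\<close> to \<open>N\<close>, and each factor contributes at most \<open>q\<close> to
    the length.\<close>
  define X where "X I = {v \<in> carrier N. \<forall>i\<in>I. v \<triangleleft>\<^bsub>N\<^esub> i \<in> D}" for I
  have rX: "rsubmodule R N (X I)" if I: "ideal I R" for I
  proof (rule N.rsubI)
    show "X I \<subseteq> carrier N" by (auto simp: X_def)
    show "\<zero>\<^bsub>N\<^esub> \<in> X I" using idealD(2)[OF I] N.rsubD(3)[OF D] by (simp add: X_def)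
    fix v assume v: "v \<in> X I"
    show "v \<oplus>\<^bsub>N\<^esub> w \<in> X I" if w: "w \<in> X I" for w
      using v w idealD(2)[OF I] N.rsubD(4)[OF D] by (simp add: X_def N.ract_l_distr)
    show "v \<triangleleft>\<^bsub>N\<^esub> s \<in> X I" if s: "s \<in> carrier R" for s
    proof -
      have "(v \<triangleleft>\<^bsub>N\<^esub> s) \<triangleleft>\<^bsub>N\<^esub> i \<in> D" if i: "i \<in> I" for i
      proof -
        have "(v \<triangleleft>\<^bsub>N\<^esub> s) \<triangleleft>\<^bsub>N\<^esub> i = v \<triangleleft>\<^bsub>N\<^esub> (s \<otimes> i)"
          using v s idealD(2)[OF I i] by (simp add: X_def N.ract_assoc)
        moreover have "s \<otimes> i \<in> I" by (rule idealD(6)[OF I i s])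
        ultimately show ?thesis using v by (simp add: X_def)
      qed
      then show ?thesis using v s by (simp add: X_def)
    qed
  qed
  have XN: "X I \<subseteq> carrier N" for I by (auto simp: X_def)
  have fX: "fin_len R N (X I)" if "ideal I R" for I by (rule fin_len_mono(1)[OF fin rX[OF that] XN])
  have fDA: "fin_len R N (N.msum D A)" by (rule fin_len_mono(1)[OF fin DA(1) N.rsubD(1)[OF DA(1)]])
  have "len R N (X I) \<le> len R N D + k * q" if "comp_series I k" for I k
    using that
  proof (induction rule: comp_series.induct)
    case base
    have "X (carrier R) = D"
    proof
      show "X (carrier R) \<subseteq> D"
      proof
        fix v assume "v \<in> X (carrier R)"
        then have vc: "v \<in> carrier N" and all: "\<forall>i\<in>carrier R. v \<triangleleft>\<^bsub>N\<^esub> i \<in> D" unfolding X_def by blast+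
        have "v \<triangleleft>\<^bsub>N\<^esub> \<one> \<in> D" using all by blast
        then show "v \<in> D" using vc by simp
      qed
      show "D \<subseteq> X (carrier R)" using N.rsubD(2,7)[OF D] by (auto simp: X_def)
    qed
    then show ?case by simp
  next
    case (step I k J r)
    note I = comp_series_ideal[OF step.hyps(1)] and J = step.hyps(2)
    have rc: "r \<in> carrier R" by (rule idealD(2)[OF I step.hyps(4)])
    let ?f = "\<lambda>v. v \<triangleleft>\<^bsub>N\<^esub> r"
    \<comment> \<open>Modulo \<open>D\<close> the element \<open>?f v\<close> generates a zero or
      simple module. If it is nonzero, maximality of \<open>D\<close> makes that module meet the
      image of \<open>A\<close> and hence lie in \<open>(D + A)/D\<close>.\<close>
    have mem: "?f v \<in> N.msum D A" if v: "v \<in> X J" for v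
    proof (cases "?f v \<in> D")
      case True
      then show ?thesis using DA(2) by blast
    next
      case False
      have vc: "v \<in> carrier N" using v by (simp add: X_def)
      let ?w = "?f v"
      have wc: "?w \<in> carrier N" using vc rc by simp
      have wa: "?w \<triangleleft>\<^bsub>N\<^esub> s = v \<triangleleft>\<^bsub>N\<^esub> (s \<otimes> r)" if "s \<in> carrier R" for s
        using vc rc that by (simp add: N.ract_assoc[symmetric] m_comm)
      note wR = N.rsub_cyclic[OF wc]
      let ?W = "(\<lambda>a. ?w \<triangleleft>\<^bsub>N\<^esub> a) ` carrier R"
      note DW = N.rsub_msum[OF D wR]
      have "?w \<in> ?W" using wc by (intro image_eqI[of _ _ \<one>]) simp_all
      then have "N.msum D ?W \<noteq> D" using DW(3) False by blast
      then have "\<not> N.msum D ?W \<inter> A \<subseteq> D" using max[OF DW(1,2)] by blast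
      then obtain y where y: "y \<in> N.msum D ?W" "y \<in> A" "y \<notin> D" by blast
      then obtain d s where ds: "d \<in> D" "s \<in> carrier R" "y = d \<oplus>\<^bsub>N\<^esub> ?w \<triangleleft>\<^bsub>N\<^esub> s" unfolding N.msum_def by blast
      have "?w \<triangleleft>\<^bsub>N\<^esub> s \<notin> D" using ds y(3) N.rsubD(4)[OF D ds(1)] by blast
      then have "s \<otimes> r \<notin> J" using v wa[OF ds(2)] by (auto simp: X_def)
      then obtain t where t: "t \<in> carrier R" "(\<one> \<ominus> t \<otimes> s) \<otimes> r \<in> J" using step.hyps(6)[OF ds(2)] by blast
      have tsc: "\<one> \<ominus> t \<otimes> s \<in> carrier R" using t ds by simp
      have w1: "?w \<triangleleft>\<^bsub>N\<^esub> (\<one> \<ominus> t \<otimes> s) \<in> D" using wa[OF tsc] v t(2) by (simp add: X_def)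
      have dc: "d \<in> carrier N" by (rule N.rsubD(2)[OF D ds(1)])
      have yc: "y \<in> carrier N" by (rule N.rsubD(2)[OF A y(2)])
      have one: "\<one> = (\<one> \<ominus> t \<otimes> s) \<oplus> s \<otimes> t" using t(1) ds(2) by algebra
      have "?w = ?w \<triangleleft>\<^bsub>N\<^esub> ((\<one> \<ominus> t \<otimes> s) \<oplus> s \<otimes> t)" using wc one by simp
      also have "\<dots> = ?w \<triangleleft>\<^bsub>N\<^esub> (\<one> \<ominus> t \<otimes> s) \<oplus>\<^bsub>N\<^esub> (?w \<triangleleft>\<^bsub>N\<^esub> s) \<triangleleft>\<^bsub>N\<^esub> t"
        using N.ract_r_distr[OF wc tsc] N.ract_assoc[OF wc ds(2) t(1)] t ds(2) by simp
      also have "?w \<triangleleft>\<^bsub>N\<^esub> s = y \<ominus>\<^bsub>N\<^esub> d"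
      proof -
        have "?w \<triangleleft>\<^bsub>N\<^esub> s \<in> carrier N" using wc ds(2) by simp
        then show ?thesis using ds(3) N.add_minus_cancel[OF _ dc] N.M.a_comm[OF dc] by simp
      qed
      finally have weq: "?w = ?w \<triangleleft>\<^bsub>N\<^esub> (\<one> \<ominus> t \<otimes> s) \<oplus>\<^bsub>N\<^esub> (y \<ominus>\<^bsub>N\<^esub> d) \<triangleleft>\<^bsub>N\<^esub> t" .
      have "y \<ominus>\<^bsub>N\<^esub> d \<in> N.msum D A" using y(2) ds(1) DA(2,3) by (intro N.rsubD(6)[OF DA(1)]) blast+
      then have "(y \<ominus>\<^bsub>N\<^esub> d) \<triangleleft>\<^bsub>N\<^esub> t \<in> N.msum D A" by (rule N.rsubD(7)[OF DA(1) _ t(1)])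
      then have "?w \<triangleleft>\<^bsub>N\<^esub> (\<one> \<ominus> t \<otimes> s) \<oplus>\<^bsub>N\<^esub> (y \<ominus>\<^bsub>N\<^esub> d) \<triangleleft>\<^bsub>N\<^esub> t \<in> N.msum D A"
        using w1 DA(2) by (intro N.rsubD(4)[OF DA(1)]) blast+
      then show ?thesis using weq by simp
    qed
    have f: "?f \<in> rhom R (sub N (X J)) (sub N (N.msum D A))"
    proof (rule rhomI)
      fix v a assume v: "v \<in> carrier (sub N (X J))" and a: "a \<in> carrier R"
      then have vc: "v \<in> carrier N" by (simp add: X_def)
      show "?f (v \<triangleleft>\<^bsub>sub N (X J)\<^esub> a) = ?f v \<triangleleft>\<^bsub>sub N (N.msum D A)\<^esub> a"
        using N.ract_assoc[OF vc a rc] N.ract_assoc[OF vc rc a] m_comm[OF a rc] by simp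
    qed (use mem rc subsetD[OF XN[of J]] in \<open>simp_all add: N.ract_l_distr\<close>)
    \<comment> \<open>As \<open>I\<close> is contained in \<open>J + R r\<close>, an element of
      \<open>X J\<close> lies in \<open>X I\<close> as soon as \<open>r\<close> multiplies it into
      \<open>D\<close>. The growth from \<open>X I\<close> to \<open>X J\<close> is therefore
      measured inside \<open>(D + A)/D\<close>.\<close>
    have pre: "{v \<in> carrier (sub N (X J)). ?f v \<in> D} = X I"
    proof
      show "{v \<in> carrier (sub N (X J)). ?f v \<in> D} \<subseteq> X I"
      proof
        fix v assume "v \<in> {v \<in> carrier (sub N (X J)). ?f v \<in> D}"
        then have v: "v \<in> X J" "v \<triangleleft>\<^bsub>N\<^esub> r \<in> D" by simp_all
        have vc: "v \<in> carrier N" using v(1) by (simp add: X_def)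
        have "v \<triangleleft>\<^bsub>N\<^esub> i \<in> D" if i: "i \<in> I" for i
        proof -
          obtain j s where js: "j \<in> J" "s \<in> carrier R" "i = j \<oplus> s \<otimes> r" using step.hyps(5)[OF i] by blast
          have jc: "j \<in> carrier R" by (rule idealD(2)[OF J js(1)])
          have "v \<triangleleft>\<^bsub>N\<^esub> i = v \<triangleleft>\<^bsub>N\<^esub> j \<oplus>\<^bsub>N\<^esub> (v \<triangleleft>\<^bsub>N\<^esub> r) \<triangleleft>\<^bsub>N\<^esub> s"
            using js vc rc jc by (simp add: N.ract_r_distr N.ract_assoc[symmetric] m_comm)
          moreover have "v \<triangleleft>\<^bsub>N\<^esub> j \<in> D" using v(1) js(1) by (simp add: X_def)
          moreover have "(v \<triangleleft>\<^bsub>N\<^esub> r) \<triangleleft>\<^bsub>N\<^esub> s \<in> D" by (rule N.rsubD(7)[OF D v(2) js(2)])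
          ultimately show ?thesis using N.rsubD(4)[OF D] by simp
        qed
        then show "v \<in> X I" using vc by (simp add: X_def)
      qed
      show "X I \<subseteq> {v \<in> carrier (sub N (X J)). ?f v \<in> D}"
        using step.hyps(3,4) by (auto simp: X_def)
    qed
    have D2: "rsubmodule R (sub N (N.msum D A)) D" unfolding N.rsub_sub[OF DA(1)] using D DA(2) by simp
    have "len R (sub N (X J)) (carrier (sub N (X J))) + len R (sub N (N.msum D A)) D
        \<le> len R (sub N (X J)) {v \<in> carrier (sub N (X J)). ?f v \<in> D} + len R (sub N (N.msum D A)) (carrier (sub N (N.msum D A)))"
      by (rule len_vimage[OF N.right_module_sub[OF rX[OF J]] N.right_module_sub[OF DA(1)] f _ _ D2])
        (simp_all add: fin_len_sub[OF N rX[OF J]] fX[OF J] fin_len_sub[OF N DA(1)] fDA)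
    then have "len R N (X J) + len R N D \<le> len R N (X I) + len R N (N.msum D A)"
      unfolding pre
    proof -
      have XIJ: "X I \<subseteq> X J" using step.hyps(3) by (auto simp: X_def)
      assume "len R (sub N (X J)) (carrier (sub N (X J))) + len R (sub N (N.msum D A)) D
        \<le> len R (sub N (X J)) (X I) + len R (sub N (N.msum D A)) (carrier (sub N (N.msum D A)))"
      then show ?thesis using fin_len_sub(2)[OF N rX[OF J]] fin_len_sub(2)[OF N DA(1)] XIJ DA(2) by simp
    qed
    then show ?case using step.IH q by simp
  qed
  from this[OF n] have "len R N (X {\<zero>}) \<le> len R N D + n * q" .
  moreover have "X {\<zero>} = carrier N" using N.rsubD(3)[OF D] by (auto simp: X_def)
  ultimately show ?thesis by simp
qed

end

section \<open>Bounded length of reduced maps to a fixed module\<close>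

context artin_algebra
begin

lemma finite_generators:
  fixes M :: "('a, 'm) rmodule"
  assumes "M \<in> fg_mods \<Lambda>"
  obtains g :: "nat \<Rightarrow> 'm" and a where "\<forall>i<a. g i \<in> carrier M"
    "\<forall>U. rsubmodule \<Lambda> M U \<longrightarrow> (\<forall>i<a. g i \<in> U) \<longrightarrow> U = carrier M"
proof -
  obtain S where S: "finite S" "S \<subseteq> carrier M" "\<forall>U. rsubmodule \<Lambda> M U \<longrightarrow> S \<subseteq> U \<longrightarrow> U = carrier M"
    using assms unfolding fg_mods_def fin_gen_def by blast
  obtain g :: "nat \<Rightarrow> 'm" and a where g: "S = g ` {i. i < a}"
    using finite_imp_nat_seg_image_inj_on[OF S(1)] by blast
  show ?thesis by (rule that[of a g]) (use S g in auto)
qed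

lemma scalar_commute:
  assumes M: "right_module \<Lambda> M" and x: "x \<in> carrier M" and r: "r \<in> carrier R" and a: "a \<in> carrier \<Lambda>"
  shows "(x \<triangleleft>\<^bsub>M\<^esub> (r \<odot>\<^bsub>\<Lambda>\<^esub> \<one>\<^bsub>\<Lambda>\<^esub>)) \<triangleleft>\<^bsub>M\<^esub> a = (x \<triangleleft>\<^bsub>M\<^esub> a) \<triangleleft>\<^bsub>M\<^esub> (r \<odot>\<^bsub>\<Lambda>\<^esub> \<one>\<^bsub>\<Lambda>\<^esub>)"
    "(x \<triangleleft>\<^bsub>M\<^esub> a) \<triangleleft>\<^bsub>M\<^esub> (r \<odot>\<^bsub>\<Lambda>\<^esub> \<one>\<^bsub>\<Lambda>\<^esub>) = x \<triangleleft>\<^bsub>M\<^esub> (r \<odot>\<^bsub>\<Lambda>\<^esub> a)"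
proof -
  interpret M: right_module \<Lambda> M by fact
  have c: "r \<odot>\<^bsub>\<Lambda>\<^esub> \<one>\<^bsub>\<Lambda>\<^esub> \<in> carrier \<Lambda>" using r by simp
  show 2: "(x \<triangleleft>\<^bsub>M\<^esub> a) \<triangleleft>\<^bsub>M\<^esub> (r \<odot>\<^bsub>\<Lambda>\<^esub> \<one>\<^bsub>\<Lambda>\<^esub>) = x \<triangleleft>\<^bsub>M\<^esub> (r \<odot>\<^bsub>\<Lambda>\<^esub> a)"
    using M.ract_assoc[OF x a c] mult_smult_one[OF r a] by simp
  show "(x \<triangleleft>\<^bsub>M\<^esub> (r \<odot>\<^bsub>\<Lambda>\<^esub> \<one>\<^bsub>\<Lambda>\<^esub>)) \<triangleleft>\<^bsub>M\<^esub> a = (x \<triangleleft>\<^bsub>M\<^esub> a) \<triangleleft>\<^bsub>M\<^esub> (r \<odot>\<^bsub>\<Lambda>\<^esub> \<one>\<^bsub>\<Lambda>\<^esub>)"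
    unfolding 2 using M.ract_assoc[OF x c a] smult_one_mult[OF r a] by simp
qed

text \<open>Every element of a module in \<open>U\<close> is the value at \<open>e\<close> of a map
  from \<open>P\<close>, so orthogonality can be tested on \<open>P\<close>.\<close>

lemma rperp_iff_univ_elem:
  assumes e: "univ_elem U P e" and X: "X \<in> mods" and h: "hom0 P X"
  shows "X \<in> rperp U"
proof -
  have "hom0 Y X" if Y: "Y \<in> U" for Y
  proof (rule hom0I)
    fix f y assume f: "f \<in> rhom \<Lambda> Y X" and y: "y \<in> carrier Y"
    obtain k where k: "k \<in> rhom \<Lambda> P Y" "k e = y" using univ_elemD(3)[OF e Y y] by blast
    show "f y = \<zero>\<^bsub>X\<^esub>" using hom0D[OF h rhom_comp[OF k(1) f] univ_elemD(2)[OF e]] k(2) by simp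
  qed
  then show ?thesis using X by (simp add: rperp_def)
qed

text \<open>\<open>rel_proj mods\<close> means projective. The surjection is assembled from maps out
  of a length-minimal universal element of \<open>mods\<close>, which reach every element of
  \<open>P\<close>.\<close>

lemma projective_cover_exists:
  assumes P: "P \<in> mods"
  shows "\<exists>G c. rel_proj mods G \<and> c \<in> rhom \<Lambda> G P \<and> c ` carrier G = carrier P"
proof -
  obtain L0 u0 where "univ_elem mods L0 u0" using mods_univ_elem by blast
  then obtain L u where L: "min_univ mods L u" using min_univ_exists[OF mods_torsion] by blast
  note uL = uP[OF mods_torsion L]
  have "\<exists>G\<in>{G. rel_proj mods G}. \<exists>c\<in>rhom \<Lambda> G P. c ` carrier G = carrier P"
  proof (rule epi_from_class[OF _ _ P])
    show "{G. rel_proj mods G} \<subseteq> mods" using rel_proj_mods[OF mods_torsion] by blast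
    show "D \<in> {G. rel_proj mods G}" if "A \<in> {G. rel_proj mods G}" "B \<in> {G. rel_proj mods G}" "biprod A B D i j p q" for A B D i j p q
      using rel_proj_biprod[OF mods_torsion _ _ that(3)] that(1,2) by blast
    show "\<exists>G\<in>{G. rel_proj mods G}. \<exists>h\<in>rhom \<Lambda> G P. y \<in> h ` carrier G" if "y \<in> carrier P" for y
      using univ_elemD(3)[OF uL P that] min_univ_rel_proj[OF mods_torsion L] univ_elemD(2)[OF uL] by blast
  qed
  then show ?thesis by blast
qed

lemma quot_hker_embeds:
  assumes M: "right_module \<Lambda> M" and N: "right_module \<Lambda> N" and f: "f \<in> rhom \<Lambda> M N"
  shows "\<exists>t\<in>rhom \<Lambda> (quot M (hker M N f)) N. inj_on t (carrier (quot M (hker M N f)))"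
proof -
  interpret M: right_module \<Lambda> M by fact
  let ?K = "hker M N f"
  have K: "rsubmodule \<Lambda> M ?K" by (rule rsub_hker[OF M N f])
  note Q = M.right_module_quot[OF K]
  have ker: "f x = \<zero>\<^bsub>N\<^esub>" if "x \<in> carrier M" "crep M ?K x = \<zero>\<^bsub>quot M ?K\<^esub>" for x
    using M.crep_zero_iff[OF K that(1)] that(2) by (simp add: hker_def)
  obtain t where t: "t \<in> rhom \<Lambda> (quot M ?K) N" "\<And>x. x \<in> carrier M \<Longrightarrow> t (crep M ?K x) = f x"
    by (rule rhom_factor[OF M Q N M.crep_hom[OF K] M.crep_surj[OF K] f]) (use ker in blast)+
  have "z = \<zero>\<^bsub>quot M ?K\<^esub>" if z: "z \<in> hker (quot M ?K) N t" for z
  proof -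
    have zc: "z \<in> carrier (quot M ?K)" "t z = \<zero>\<^bsub>N\<^esub>" using z unfolding hker_def[of "quot M ?K" N t] by blast+
    from zc(1) have "z \<in> crep M ?K ` carrier M" by (simp only: M.crep_surj[OF K])
    then obtain x where x: "x \<in> carrier M" "z = crep M ?K x" by blast
    have "f x = \<zero>\<^bsub>N\<^esub>" using t(2)[OF x(1)] zc(2) by (simp only: x(2))
    then have "x \<in> ?K" using x(1) by (simp add: hker_def)
    then show ?thesis using M.crep_zero_iff[OF K x(1)] x(2) by simp
  qed
  then have "hker (quot M ?K) N t = {\<zero>\<^bsub>quot M ?K\<^esub>}"
    using right_module.rsubD(3)[OF Q rsub_hker[OF Q N t(1)]] by blast
  then have "inj_on t (carrier (quot M ?K))" using rhom_inj_iff[OF Q N t(1)] by simp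
  then show ?thesis using t(1) by blast
qed

text \<open>\<open>V\<close> is the part of \<open>K\<close> not detected by the functionals coming from the maps \<open>P \<rightarrow> M\<close>: a map
  \<open>P \<rightarrow> X/V\<close> lands in \<open>K/V\<close>. Enlarging \<open>V\<close> by the torsion of \<open>K/V\<close> therefore makes \<open>X/V\<close>
  torsion-free.\<close>

lemma undetected_zero:
  assumes U: "torsion_class \<Lambda> U" and e: "univ_elem U P e" and P: "rel_proj U P" and X: "X \<in> mods"
    and K: "rsubmodule \<Lambda> X K" and V: "rsubmodule \<Lambda> X V" "V \<subseteq> K"
    and red: "\<And>W. rsubmodule \<Lambda> X W \<Longrightarrow> W \<subseteq> K \<Longrightarrow> quot X W \<in> rperp U \<Longrightarrow> W = {\<zero>\<^bsub>X\<^esub>}"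
    and land: "\<And>h. h \<in> rhom \<Lambda> P (quot X V) \<Longrightarrow> h ` carrier P \<subseteq> crep X V ` K"
  shows "V = {\<zero>\<^bsub>X\<^esub>}"
proof -
  note Xm = modsD(1)[OF X]
  interpret X: right_module \<Lambda> X by (rule Xm)
  let ?Q = "quot X V" and ?K = "crep X V ` K"
  have Q: "?Q \<in> mods" by (rule quot_mods(1)[OF X V(1)])
  note Qm = modsD(1)[OF Q]
  interpret Q: right_module \<Lambda> ?Q by (rule Qm)
  have rK: "rsubmodule \<Lambda> ?Q ?K" by (rule rsub_image[OF Xm Qm X.crep_hom[OF V(1)] K])
  obtain u where u: "rsubmodule \<Lambda> ?Q u" "u \<subseteq> ?K" "sub ?Q u \<in> U"
    "rsubmodule \<Lambda> (quot ?Q u) (crep ?Q u ` ?K)" "sub (quot ?Q u) (crep ?Q u ` ?K) \<in> rperp U"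
    by (rule tors_top[OF U Q rK])
  let ?Q2 = "quot ?Q u"
  have Q2: "?Q2 \<in> mods" by (rule quot_mods(1)[OF Q u(1)])
  note Q2m = modsD(1)[OF Q2]
  \<comment> \<open>A map from \<open>P\<close> lifts along \<open>X/V -> (X/V)/u\<close>, whose
    kernel is in \<open>U\<close>. By assumption the lift has values in \<open>K/V\<close>, so the
    map lands in the torsion-free \<open>(K/V)/u\<close> and vanishes.\<close>
  have "hom0 P ?Q2"
  proof (rule hom0I)
    fix h x assume h: "h \<in> rhom \<Lambda> P ?Q2" and x: "x \<in> carrier P"
    have "sub ?Q (hker ?Q ?Q2 (crep ?Q u)) \<in> U" using u(3) by (simp only: Q.hker_crep[OF u(1)])
    then obtain k where k: "k \<in> rhom \<Lambda> P ?Q" "\<forall>x\<in>carrier P. crep ?Q u (k x) = h x"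
      using rel_projD(2)[OF P Q Q2 Q.crep_hom[OF u(1)] Q.crep_surj[OF u(1)] _ h] by blast
    have "h ` carrier P \<subseteq> crep ?Q u ` ?K" using k(2) land[OF k(1)] by (metis (no_types, lifting) image_eqI image_subset_iff)
    note hK = rhom_corestrict[OF h this]
    have "hom0 P (sub ?Q2 (crep ?Q u ` ?K))" using u(5) rel_projD(1)[OF P] unfolding rperp_def by blast
    from hom0D[OF this hK x] show "h x = \<zero>\<^bsub>?Q2\<^esub>" by simp
  qed
  then have Q2F: "?Q2 \<in> rperp U" by (rule rperp_iff_univ_elem[OF e Q2])
  \<comment> \<open>The preimage of \<open>u\<close> lies in \<open>K\<close> and its quotient is
    torsion-free, so reducedness makes it zero. It contains \<open>V\<close>.\<close>
  let ?W = "{x \<in> carrier X. crep X V x \<in> u}"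
  have rW: "rsubmodule \<Lambda> X ?W" by (rule rsub_vimage[OF Xm Qm X.crep_hom[OF V(1)] u(1)])
  have WK: "?W \<subseteq> K"
  proof
    fix x assume x: "x \<in> ?W"
    then have xc: "x \<in> carrier X" by blast
    obtain k where k: "k \<in> K" "crep X V x = crep X V k" using x u(2) by blast
    have kc: "k \<in> carrier X" by (rule X.rsubD(2)[OF K k(1)])
    have "x \<ominus>\<^bsub>X\<^esub> k \<in> K" using X.crep_eq_iff[OF V(1) xc kc] k(2) V(2) by blast
    then have "(x \<ominus>\<^bsub>X\<^esub> k) \<oplus>\<^bsub>X\<^esub> k \<in> K" by (rule X.rsubD(4)[OF K _ k(1)])
    then show "x \<in> K" by (simp only: X.minus_add_cancel[OF xc kc])
  qed
  let ?c = "\<lambda>x. crep ?Q u (crep X V x)"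
  have c: "?c \<in> rhom \<Lambda> X ?Q2" by (rule rhom_comp[OF X.crep_hom[OF V(1)] Q.crep_hom[OF u(1)]])
  have c0: "?c x = \<zero>\<^bsub>?Q2\<^esub> \<longleftrightarrow> x \<in> ?W" if "x \<in> carrier X" for x
    using Q.crep_zero_iff[OF u(1) rhomD(1)[OF X.crep_hom[OF V(1)] that]] that by simp
  have "quot X (hker X ?Q2 ?c) \<in> rperp U"
    using quot_hker_embeds[OF Xm Q2m c]
      rperp_sub_closed[OF torsD(1)[OF U] Q2F quot_mods(1)[OF X rsub_hker[OF Xm Q2m c]]] by blast
  moreover have "hker X ?Q2 ?c = ?W" unfolding hker_def using c0 by blast
  ultimately have "quot X ?W \<in> rperp U" by (simp only:)
  then have W0: "?W = {\<zero>\<^bsub>X\<^esub>}" by (rule red[OF rW WK])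
  have "V \<subseteq> ?W"
  proof
    fix v assume v: "v \<in> V"
    then have vc: "v \<in> carrier X" by (rule X.rsubD(2)[OF V(1)])
    then show "v \<in> ?W" using X.crep_zero_iff[OF V(1) vc] v Q.rsubD(3)[OF u(1)] by simp
  qed
  then show ?thesis using W0 X.rsubD(3)[OF V(1)] by blast
qed

text \<open>Present \<open>P\<close> by a projective \<open>G\<close> with kernel
  \<open>\<Omega>\<close>, so that Ext^1(P, K) is Hom(\<Omega>, K) modulo the maps that extend to
  \<open>G\<close>, where \<open>K\<close> is the kernel of \<open>f\<close>. A map from
  \<open>P\<close> to \<open>X/K\<close> lifts to \<open>G\<close> and restricts to
  \<open>\<Omega>\<close>. Since Hom(P, X) vanishes, this connecting map is injective, and its
  source is a part of Hom(P, M). The part of \<open>K\<close> that functionals extending this piece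
  do not see is zero by \<open>undetected_zero\<close>, which bounds the length of
  \<open>K\<close>.\<close>

lemma reduced_bound:
  assumes U: "torsion_class \<Lambda> U" and e: "univ_elem U P e" and P: "rel_proj U P" and M: "M \<in> mods"
  shows "\<exists>c. \<forall>X f. X \<in> mods \<longrightarrow> hom0 P X \<longrightarrow> f \<in> rhom \<Lambda> X M \<longrightarrow>
    (\<forall>W. rsubmodule \<Lambda> X W \<longrightarrow> W \<subseteq> hker X M f \<longrightarrow> quot X W \<in> rperp U \<longrightarrow> W = {\<zero>\<^bsub>X\<^esub>}) \<longrightarrow> lg X \<le> c"
proof -
  have Pmods: "P \<in> mods" by (rule rel_proj_mods[OF U P])
  note Pm = modsD(1)[OF Pmods] and Mm = modsD(1)[OF M]
  interpret M: right_module \<Lambda> M by (rule Mm)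
  obtain G c where G: "rel_proj mods G" and c: "c \<in> rhom \<Lambda> G P" "c ` carrier G = carrier P"
    using projective_cover_exists[OF Pmods] by blast
  have Gmods: "G \<in> mods" by (rule rel_proj_mods[OF mods_torsion G])
  note Gm = modsD(1)[OF Gmods]
  interpret G: right_module \<Lambda> G by (rule Gm)
  define \<Omega> where "\<Omega> = hker G P c"
  have r\<Omega>: "rsubmodule \<Lambda> G \<Omega>" unfolding \<Omega>_def by (rule rsub_hker[OF Gm Pm c(1)])
  have \<Omega>G: "\<Omega> \<subseteq> carrier G" by (auto simp: \<Omega>_def hker_def)
  have \<Omega>m: "right_module \<Lambda> (sub G \<Omega>)" by (rule G.right_module_sub[OF r\<Omega>])
  obtain \<omega> and b :: nat where \<omega>: "\<forall>j<b. \<omega> j \<in> carrier (sub G \<Omega>)"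
    "\<forall>U. rsubmodule \<Lambda> (sub G \<Omega>) U \<longrightarrow> (\<forall>j<b. \<omega> j \<in> U) \<longrightarrow> U = carrier (sub G \<Omega>)"
    by (rule finite_generators[OF sub_mods(1)[OF Gmods r\<Omega>]])
  obtain g and a :: nat where g: "\<forall>i<a. g i \<in> carrier G" "\<forall>U. rsubmodule \<Lambda> G U \<longrightarrow> (\<forall>i<a. g i \<in> U) \<longrightarrow> U = carrier G"
    by (rule finite_generators[OF Gmods])
  obtain L where L: "finite L" "L \<subseteq> carrier \<Lambda>" "\<forall>U. submodule U R \<Lambda> \<longrightarrow> L \<subseteq> U \<longrightarrow> U = carrier \<Lambda>"
    using fin_gen_over_base by blast
  obtain n where n: "comp_series {\<zero>\<^bsub>R\<^esub>} n" using comp_series_zero by blast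
  \<comment> \<open>Bounds the length of Hom(G, M) over \<open>R\<close>: a map out of
    \<open>G\<close> is determined by its values at \<open>a\<close> generators.\<close>
  define q where "q = a * lg M"
  \<comment> \<open>Each of the \<open>b * card L\<close> conditions that define the undetected part
    of \<open>K\<close> costs at most \<open>n * q\<close>; the image of \<open>f\<close> adds at
    most \<open>lg M\<close>.\<close>
  have "lg X \<le> b * card L * (n * q) + lg M"
    if X: "X \<in> mods" and PX: "hom0 P X" and f: "f \<in> rhom \<Lambda> X M"
      and red: "\<And>W. rsubmodule \<Lambda> X W \<Longrightarrow> W \<subseteq> hker X M f \<Longrightarrow> quot X W \<in> rperp U \<Longrightarrow> W = {\<zero>\<^bsub>X\<^esub>}" for X f
  proof -
    note Xm = modsD(1)[OF X]
    interpret X: right_module \<Lambda> X by (rule Xm)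
    define K where "K = hker X M f"
    have rK: "rsubmodule \<Lambda> X K" unfolding K_def by (rule rsub_hker[OF Xm Mm f])
    have KX: "x \<in> carrier X" if "x \<in> K" for x by (rule X.rsubD(2)[OF rK that])
    have Kmods: "sub X K \<in> mods" by (rule sub_mods(1)[OF X rK])
    define N where "N = res (sub X K)"
    have Nm: "right_module R N" unfolding N_def by (rule right_module_res[OF modsD(1)[OF Kmods]])
    interpret N: right_module R N by (rule Nm)
    have N_simps: "carrier N = K" "\<zero>\<^bsub>N\<^esub> = \<zero>\<^bsub>X\<^esub>" "x \<oplus>\<^bsub>N\<^esub> y = x \<oplus>\<^bsub>X\<^esub> y" "x \<triangleleft>\<^bsub>N\<^esub> r = x \<triangleleft>\<^bsub>X\<^esub> (r \<odot>\<^bsub>\<Lambda>\<^esub> \<one>\<^bsub>\<Lambda>\<^esub>)" for x y r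
      by (simp_all add: N_def)
    have fN: "fin_len R N (carrier N)" unfolding N_def using modsD(2)[OF Kmods] by simp
    let ?B = "powm N b"
    note Bm = N.right_module_powm[of b]
    interpret B: right_module R ?B by (rule Bm)
    have fB: "fin_len R ?B (carrier ?B)" using N.fin_len_powm[OF fN, of b] by simp
    \<comment> \<open>\<open>H \<Omega>\<close> consists of the lifts of maps from \<open>P\<close>
      to \<open>X/K\<close>, and \<open>H (carrier G)\<close> of the maps from \<open>G\<close> to
      \<open>K\<close>. A map is recorded by \<open>\<delta>\<close> as the vector of its values at
      the generators of \<open>\<Omega>\<close>.\<close>
    define H where "H W = {x \<in> rhom \<Lambda> G X. x ` W \<subseteq> K}" for W
    define \<delta> where "\<delta> x = (\<lambda>j. if j < b then x (\<omega> j) else \<zero>\<^bsub>X\<^esub>)" for x :: "(nat \<Rightarrow> 'a) set \<Rightarrow> (nat \<Rightarrow> 'a) set"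
    have \<delta>B: "\<delta> x \<in> carrier ?B" if "x \<in> H W" "\<Omega> \<subseteq> W" for x W
      using that \<omega>(1) by (auto simp: \<delta>_def H_def powm_simps(1) N_simps)
    have H0: "(\<lambda>_. \<zero>\<^bsub>X\<^esub>) \<in> H W" for W
      using rhom_const_zero[OF Xm, of G] X.rsubD(3)[OF rK] by (auto simp: H_def)
    have Hadd: "(\<lambda>z. x z \<oplus>\<^bsub>X\<^esub> y z) \<in> H W" if "x \<in> H W" "y \<in> H W" for x y W
      using that rhom_add_fun[OF Xm, of x G y] X.rsubD(4)[OF rK] by (auto simp: H_def image_subset_iff)
    have Hsc: "(\<lambda>z. x z \<triangleleft>\<^bsub>X\<^esub> (r \<odot>\<^bsub>\<Lambda>\<^esub> \<one>\<^bsub>\<Lambda>\<^esub>)) \<in> H W" if "x \<in> H W" "r \<in> carrier R" for x r W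
      using that rhom_scalar[OF Xm, of x G r] X.rsubD(7)[OF rK] by (auto simp: H_def image_subset_iff)
    have \<delta>add: "\<delta> (\<lambda>z. x z \<oplus>\<^bsub>X\<^esub> y z) = \<delta> x \<oplus>\<^bsub>?B\<^esub> \<delta> y" for x y
      by (auto simp: \<delta>_def powm_simps N_simps fun_eq_iff)
    have \<delta>sc: "\<delta> (\<lambda>z. x z \<triangleleft>\<^bsub>X\<^esub> (r \<odot>\<^bsub>\<Lambda>\<^esub> \<one>\<^bsub>\<Lambda>\<^esub>)) = \<delta> x \<triangleleft>\<^bsub>?B\<^esub> r" if "r \<in> carrier R" for x r
      using that by (auto simp: \<delta>_def powm_simps N_simps fun_eq_iff)
    have rA: "rsubmodule R ?B (\<delta> ` H W)" if W: "\<Omega> \<subseteq> W" for W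
    proof (rule B.rsubI)
      show "\<delta> ` H W \<subseteq> carrier ?B" using \<delta>B[OF _ W] by blast
      have "\<delta> (\<lambda>_. \<zero>\<^bsub>X\<^esub>) = \<zero>\<^bsub>?B\<^esub>" by (auto simp: \<delta>_def powm_simps N_simps)
      then show "\<zero>\<^bsub>?B\<^esub> \<in> \<delta> ` H W" using H0 by (metis imageI)
      show "v \<oplus>\<^bsub>?B\<^esub> w \<in> \<delta> ` H W" if vw: "v \<in> \<delta> ` H W" "w \<in> \<delta> ` H W" for v w
      proof -
        obtain x y where xy: "x \<in> H W" "v = \<delta> x" "y \<in> H W" "w = \<delta> y" using vw by blast
        show ?thesis unfolding xy \<delta>add[symmetric] by (rule imageI[OF Hadd[OF xy(1,3)]])
      qed
      show "v \<triangleleft>\<^bsub>?B\<^esub> r \<in> \<delta> ` H W" if v: "v \<in> \<delta> ` H W" and r: "r \<in> carrier R" for v r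
      proof -
        obtain x where x: "x \<in> H W" "v = \<delta> x" using v by blast
        show ?thesis unfolding x \<delta>sc[OF r, symmetric] by (rule imageI[OF Hsc[OF x(1) r]])
      qed
    qed
    \<comment> \<open>Maps that agree on the generators of \<open>\<Omega>\<close> differ by a map
      that factors through \<open>P\<close>, and there is no nonzero map from \<open>P\<close> to
      \<open>X\<close>.\<close>
    have inj: "x z = y z" if x: "x \<in> H \<Omega>" and y: "y \<in> H \<Omega>" and eq: "\<delta> x = \<delta> y" and z: "z \<in> carrier G" for x y z
    proof -
      have xr: "x \<in> rhom \<Lambda> G X" and yr: "y \<in> rhom \<Lambda> G X" using x y by (simp_all add: H_def)
      have d: "(\<lambda>z. x z \<ominus>\<^bsub>X\<^esub> y z) \<in> rhom \<Lambda> G X" (is "?d \<in> _") by (rule rhom_minus_fun[OF Xm xr yr])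
      have dz: "?d z = \<zero>\<^bsub>X\<^esub> \<longleftrightarrow> x z = y z" if "z \<in> carrier G" for z
        by (rule X.minus_zero_iff[OF rhomD(1)[OF xr that] rhomD(1)[OF yr that]])
      have d\<Omega>: "?d \<in> rhom \<Lambda> (sub G \<Omega>) X" by (rule rhom_restrict[OF d \<Omega>G])
      have "hker (sub G \<Omega>) X ?d = carrier (sub G \<Omega>)"
      proof (rule \<omega>(2)[rule_format, OF rsub_hker[OF \<Omega>m Xm d\<Omega>]])
        fix j assume j: "j < b"
        have wj: "\<omega> j \<in> \<Omega>" using \<omega>(1) j by simp
        have "\<delta> x j = \<delta> y j" by (simp only: eq)
        then have "x (\<omega> j) = y (\<omega> j)" using j by (simp add: \<delta>_def)
        then have "?d (\<omega> j) = \<zero>\<^bsub>X\<^esub>" using dz[OF subsetD[OF \<Omega>G wj]] by simp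
        then show "\<omega> j \<in> hker (sub G \<Omega>) X ?d" using wj by (simp add: hker_def)
      qed
      then have "?d w = \<zero>\<^bsub>X\<^esub>" if "w \<in> carrier G" "c w = \<zero>\<^bsub>P\<^esub>" for w
        using that unfolding \<Omega>_def hker_def sub_simps by blast
      then obtain h where h: "h \<in> rhom \<Lambda> P X" "\<And>z. z \<in> carrier G \<Longrightarrow> h (c z) = ?d z"
        using rhom_factor[OF Gm Pm Xm c d] by blast
      have "?d z = \<zero>\<^bsub>X\<^esub>" using hom0D[OF PX h(1) rhomD(1)[OF c(1) z]] h(2)[OF z] by simp
      then show ?thesis using dz[OF z] by simp
    qed
    \<comment> \<open>\<open>A1/A0\<close> is the image of the connecting map. Composing the
      represented maps with \<open>f\<close> embeds it into Hom(G, M), whence the bound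
      \<open>q\<close> on its length.\<close>
    define A1 where "A1 = \<delta> ` H \<Omega>"
    define A0 where "A0 = \<delta> ` H (carrier G)"
    have rA1: "rsubmodule R ?B A1" unfolding A1_def by (rule rA) simp
    have rA0: "rsubmodule R ?B A0" unfolding A0_def by (rule rA[OF \<Omega>G])
    have HH: "H (carrier G) \<subseteq> H \<Omega>" using \<Omega>G by (auto simp: H_def)
    have A01: "A0 \<subseteq> A1" unfolding A0_def A1_def using HH by (rule image_mono)
    have fsub: "fin_len R ?B D" if "rsubmodule R ?B D" for D
      by (rule fin_len_mono(1)[OF fB that B.rsubD(1)[OF that]])
    have "len R ?B A1 \<le> len R ?B A0 + q"
    proof -
      interpret rM: right_module R "res M" by (rule right_module_res[OF Mm])
      let ?M = "powm (res M) a"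
      define x where "x v = inv_into (H \<Omega>) \<delta> v" for v
      have x: "x v \<in> H \<Omega>" "\<delta> (x v) = v" if "v \<in> A1" for v
        using that unfolding A1_def x_def by (rule inv_into_into, rule f_inv_into_f)
      have xr: "x v \<in> rhom \<Lambda> G X" if "v \<in> A1" for v using x(1)[OF that] by (simp add: H_def)
      define \<theta> where "\<theta> v = (\<lambda>i. if i < a then f (x v (g i)) else \<zero>\<^bsub>M\<^esub>)" for v
      have \<theta>: "\<theta> \<in> rhom R (sub ?B A1) ?M"
      proof (rule rhomI)
        fix v assume "v \<in> carrier (sub ?B A1)"
        then have v: "v \<in> A1" by simp
        have "f (x v (g i)) \<in> carrier M" if "i < a" for i
          using rhomD(1)[OF f rhomD(1)[OF xr[OF v]]] g(1) that by blast
        then show "\<theta> v \<in> carrier ?M" by (simp add: \<theta>_def powm_simps(1))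
        fix w assume "w \<in> carrier (sub ?B A1)"
        then have w: "w \<in> A1" by simp
        have vw: "v \<oplus>\<^bsub>?B\<^esub> w \<in> A1" by (rule B.rsubD(4)[OF rA1 v w])
        have "x (v \<oplus>\<^bsub>?B\<^esub> w) z = x v z \<oplus>\<^bsub>X\<^esub> x w z" if z: "z \<in> carrier G" for z
          by (rule inj[OF x(1)[OF vw] Hadd[OF x(1)[OF v] x(1)[OF w]] _ z]) (simp only: x(2)[OF vw] \<delta>add x(2)[OF v] x(2)[OF w])
        then have "f (x (v \<oplus>\<^bsub>?B\<^esub> w) (g i)) = f (x v (g i)) \<oplus>\<^bsub>M\<^esub> f (x w (g i))" if "i < a" for i
          using rhomD(2)[OF f rhomD(1)[OF xr[OF v]] rhomD(1)[OF xr[OF w]]] g(1) that by simp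
        then show "\<theta> (v \<oplus>\<^bsub>sub ?B A1\<^esub> w) = \<theta> v \<oplus>\<^bsub>?M\<^esub> \<theta> w" by (simp add: \<theta>_def powm_simps(3) fun_eq_iff)
      next
        fix v r assume "v \<in> carrier (sub ?B A1)" and r: "r \<in> carrier R"
        then have v: "v \<in> A1" by simp
        have rv: "v \<triangleleft>\<^bsub>?B\<^esub> r \<in> A1" by (rule B.rsubD(7)[OF rA1 v r])
        have "x (v \<triangleleft>\<^bsub>?B\<^esub> r) z = x v z \<triangleleft>\<^bsub>X\<^esub> (r \<odot>\<^bsub>\<Lambda>\<^esub> \<one>\<^bsub>\<Lambda>\<^esub>)" if z: "z \<in> carrier G" for z
          by (rule inj[OF x(1)[OF rv] Hsc[OF x(1)[OF v] r] _ z]) (simp only: x(2)[OF rv] \<delta>sc[OF r] x(2)[OF v])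
        moreover have "r \<odot>\<^bsub>\<Lambda>\<^esub> \<one>\<^bsub>\<Lambda>\<^esub> \<in> carrier \<Lambda>" using r by simp
        ultimately have "f (x (v \<triangleleft>\<^bsub>?B\<^esub> r) (g i)) = f (x v (g i)) \<triangleleft>\<^bsub>M\<^esub> (r \<odot>\<^bsub>\<Lambda>\<^esub> \<one>\<^bsub>\<Lambda>\<^esub>)" if "i < a" for i
          using rhomD(3)[OF f rhomD(1)[OF xr[OF v]]] g(1) that by simp
        moreover have "\<zero>\<^bsub>M\<^esub> \<triangleleft>\<^bsub>M\<^esub> (r \<odot>\<^bsub>\<Lambda>\<^esub> \<one>\<^bsub>\<Lambda>\<^esub>) = \<zero>\<^bsub>M\<^esub>" using r by simp
        ultimately show "\<theta> (v \<triangleleft>\<^bsub>sub ?B A1\<^esub> r) = \<theta> v \<triangleleft>\<^bsub>?M\<^esub> r" by (simp add: \<theta>_def powm_simps(4) fun_eq_iff)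
      qed
      have ker: "hker (sub ?B A1) ?M \<theta> \<subseteq> A0"
      proof
        fix v assume "v \<in> hker (sub ?B A1) ?M \<theta>"
        then have v: "v \<in> A1" "\<theta> v = (\<lambda>_. \<zero>\<^bsub>M\<^esub>)" by (simp_all add: hker_def powm_simps(2))
        have fx: "(\<lambda>z. f (x v z)) \<in> rhom \<Lambda> G M" by (rule rhom_comp[OF xr[OF v(1)] f])
        have "hker G M (\<lambda>z. f (x v z)) = carrier G"
        proof (rule g(2)[rule_format, OF rsub_hker[OF Gm Mm fx]])
          fix i assume i: "i < a"
          have "\<theta> v i = \<zero>\<^bsub>M\<^esub>" by (simp only: v(2))
          then show "g i \<in> hker G M (\<lambda>z. f (x v z))" using i g(1) by (simp add: \<theta>_def hker_def)
        qed
        then have "x v ` carrier G \<subseteq> K" using rhomD(1)[OF xr[OF v(1)]] unfolding K_def hker_def by blast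
        then have "x v \<in> H (carrier G)" using xr[OF v(1)] by (simp add: H_def)
        then show "v \<in> A0" unfolding A0_def by (rule rev_image_eqI) (rule sym[OF x(2)[OF v(1)]])
      qed
      note A1m = B.right_module_sub[OF rA1] and PMm = rM.right_module_powm[of a]
      have fA1: "fin_len R (sub ?B A1) (carrier (sub ?B A1))"
        using fin_len_sub(1)[OF Bm rA1 order_refl] fsub[OF rA1] by simp
      note add = fin_len_additive(2)[OF A1m PMm \<theta> fA1]
      have rk: "rsubmodule R (sub ?B A1) (hker (sub ?B A1) ?M \<theta>)" by (rule rsub_hker[OF A1m PMm \<theta>])
      then have rkB: "rsubmodule R ?B (hker (sub ?B A1) ?M \<theta>)" and kA1: "hker (sub ?B A1) ?M \<theta> \<subseteq> A1"
        unfolding B.rsub_sub[OF rA1] by blast+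
      have "len R (sub ?B A1) (hker (sub ?B A1) ?M \<theta>) \<le> len R ?B A0"
        using fin_len_sub(2)[OF Bm rA1 kA1] fin_len_mono(2)[OF fsub[OF rA0] rkB ker] by simp
      moreover have "len R ?M (\<theta> ` carrier (sub ?B A1)) \<le> q"
      proof -
        have fM: "fin_len R (res M) (carrier (res M))" using modsD(2)[OF M] by simp
        note pw = rM.fin_len_powm[OF fM, of a]
        have rI: "rsubmodule R ?M (\<theta> ` carrier (sub ?B A1))" by (rule rsub_range[OF A1m PMm \<theta>])
        have "len R ?M (\<theta> ` carrier (sub ?B A1)) \<le> len R ?M (carrier ?M)"
          by (rule fin_len_mono(2)[OF conjunct1[OF pw] rI right_module.rsubD(1)[OF PMm rI]])
        then show ?thesis using pw by (simp add: q_def lg_def)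
      qed
      moreover have "len R (sub ?B A1) (carrier (sub ?B A1)) = len R ?B A1"
        using fin_len_sub(2)[OF Bm rA1 order_refl] by simp
      ultimately show ?thesis using add by linarith
    qed
    note lenA = this
    \<comment> \<open>A maximal \<open>D\<close> with \<open>D \<inter> A1 = A0\<close> makes
      \<open>?B/D\<close> an essential extension of \<open>(D + A1)/D\<close>, whose length is at
      most \<open>q\<close>. By \<open>essential_bound\<close>, the length of \<open>?B/D\<close> is
      at most \<open>n * q\<close>.\<close>
    let ?ok = "\<lambda>D. rsubmodule R ?B D \<and> A0 \<subseteq> D \<and> D \<inter> A1 \<subseteq> A0"
    have "?ok A0" using rA0 by blast
    moreover have "\<forall>D. ?ok D \<longrightarrow> len R ?B D < Suc (len R ?B (carrier ?B))"
      using fin_len_mono(2)[OF fB] B.rsubD(1) by (simp add: less_Suc_eq_le)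
    ultimately have "\<exists>D. ?ok D \<and> (\<forall>D'. ?ok D' \<longrightarrow> len R ?B D' \<le> len R ?B D)" by (rule ex_has_greatest_nat)
    then obtain D where D: "rsubmodule R ?B D" "A0 \<subseteq> D" "D \<inter> A1 \<subseteq> A0"
      and Dmax: "\<forall>D'. ?ok D' \<longrightarrow> len R ?B D' \<le> len R ?B D" by blast
    have DA: "D \<inter> A1 = A0" using D(2,3) A01 by blast
    have max: "D' = D" if D': "rsubmodule R ?B D'" "D \<subseteq> D'" "D' \<inter> A1 \<subseteq> D" for D'
    proof (rule ccontr)
      assume ne: "D' \<noteq> D"
      have "D' \<inter> A1 \<subseteq> A0" using D'(3) D(3) by blast
      then have "len R ?B D' \<le> len R ?B D" using Dmax D' D(2) by blast
      moreover have "len R ?B D < len R ?B D'" by (rule fin_len_mono(3)[OF fsub[OF D'(1)] D(1) D'(2)]) (use ne in blast)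
      ultimately show False by simp
    qed
    have "len R ?B (right_module.msum ?B D A1) + len R ?B (D \<inter> A1) = len R ?B D + len R ?B A1"
      by (rule fin_len_msum(2)[OF Bm fsub[OF D(1)] fsub[OF rA1]])
    then have "len R ?B (right_module.msum ?B D A1) \<le> len R ?B D + q" using lenA unfolding DA by simp
    then have ess: "len R ?B (carrier ?B) \<le> len R ?B D + n * q"
      by (rule essential_bound[OF Bm fB D(1) rA1 _ _ n, rotated]) (rule max)
    define \<epsilon> where "\<epsilon> j k = (\<lambda>i. if i = j then k else \<zero>\<^bsub>X\<^esub>)" for j :: nat and k
    have \<epsilon>add: "\<epsilon> j (k \<oplus>\<^bsub>X\<^esub> l) = \<epsilon> j k \<oplus>\<^bsub>?B\<^esub> \<epsilon> j l" if "k \<in> K" "l \<in> K" for j k l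
      using that KX by (auto simp: \<epsilon>_def powm_simps(3) N_simps fun_eq_iff)
    have \<epsilon>sc: "\<epsilon> j (k \<triangleleft>\<^bsub>X\<^esub> (r \<odot>\<^bsub>\<Lambda>\<^esub> \<one>\<^bsub>\<Lambda>\<^esub>)) = \<epsilon> j k \<triangleleft>\<^bsub>?B\<^esub> r" if "r \<in> carrier R" for j k r
      using that by (auto simp: \<epsilon>_def powm_simps(4) N_simps fun_eq_iff)
    have \<epsilon>B: "\<epsilon> j k \<in> carrier ?B" if "j < b" "k \<in> K" for j k
      using that X.rsubD(3)[OF rK] by (auto simp: \<epsilon>_def powm_simps(1) N_simps)
    have Kact: "k \<triangleleft>\<^bsub>X\<^esub> l \<in> K" if "k \<in> K" "l \<in> carrier \<Lambda>" for k l by (rule X.rsubD(7)[OF rK that])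
    \<comment> \<open>Each pair \<open>(j, l)\<close> in \<open>S\<close> demands that the vector
      with the single entry \<open>k l\<close> at place \<open>j\<close> lies in \<open>D\<close>.
      This is the vanishing of an \<open>R\<close>-linear map to \<open>?B/D\<close> and costs at
      most \<open>n * q\<close>.\<close>
    define \<V> where "\<V> S = {k \<in> K. \<forall>z\<in>S. \<epsilon> (fst z) (k \<triangleleft>\<^bsub>X\<^esub> snd z) \<in> D}" for S
    have \<phi>: "(\<lambda>k. \<epsilon> j (k \<triangleleft>\<^bsub>X\<^esub> l)) \<in> rhom R N ?B" if "j < b" "l \<in> carrier \<Lambda>" for j l
    proof (rule rhomI)
      fix k assume "k \<in> carrier N"
      then have k: "k \<in> K" by (simp add: N_simps)
      show "\<epsilon> j (k \<triangleleft>\<^bsub>X\<^esub> l) \<in> carrier ?B" by (rule \<epsilon>B[OF that(1) Kact[OF k that(2)]])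
      show "\<epsilon> j ((k \<oplus>\<^bsub>N\<^esub> k') \<triangleleft>\<^bsub>X\<^esub> l) = \<epsilon> j (k \<triangleleft>\<^bsub>X\<^esub> l) \<oplus>\<^bsub>?B\<^esub> \<epsilon> j (k' \<triangleleft>\<^bsub>X\<^esub> l)" if "k' \<in> carrier N" for k'
        using that X.ract_l_distr[OF KX[OF k] KX \<open>l \<in> carrier \<Lambda>\<close>, of k'] \<epsilon>add[OF Kact[OF k \<open>l \<in> carrier \<Lambda>\<close>] Kact, of k' l]
          \<open>l \<in> carrier \<Lambda>\<close> by (simp add: N_simps)
      show "\<epsilon> j ((k \<triangleleft>\<^bsub>N\<^esub> r) \<triangleleft>\<^bsub>X\<^esub> l) = \<epsilon> j (k \<triangleleft>\<^bsub>X\<^esub> l) \<triangleleft>\<^bsub>?B\<^esub> r" if "r \<in> carrier R" for r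
        using scalar_commute(1)[OF Xm KX[OF k] that \<open>l \<in> carrier \<Lambda>\<close>] \<epsilon>sc[OF that] by (simp add: N_simps)
    qed
    have \<V>: "rsubmodule R N (\<V> S) \<and> len R N (carrier N) \<le> len R N (\<V> S) + card S * (n * q)"
      if "finite S" "S \<subseteq> {..<b} \<times> carrier \<Lambda>" for S
      using that
    proof (induction S rule: finite_induct)
      case empty
      have "\<V> {} = carrier N" by (simp add: \<V>_def N_simps)
      then show ?case using N.rsub_carrier by simp
    next
      case (insert z S)
      have IH: "rsubmodule R N (\<V> S)" "len R N (carrier N) \<le> len R N (\<V> S) + card S * (n * q)"
        using insert.IH insert.prems by auto
      obtain j l where z: "z = (j, l)" "j < b" "l \<in> carrier \<Lambda>" using insert.prems by auto
      let ?f = "\<lambda>k. \<epsilon> j (k \<triangleleft>\<^bsub>X\<^esub> l)"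
      have f: "?f \<in> rhom R (sub N (\<V> S)) ?B" by (rule rhom_restrict[OF \<phi>[OF z(2,3)] N.rsubD(1)[OF IH(1)]])
      have eq: "\<V> (insert z S) = {k \<in> carrier (sub N (\<V> S)). ?f k \<in> D}" by (auto simp: \<V>_def z(1))
      have Sm: "right_module R (sub N (\<V> S))" by (rule N.right_module_sub[OF IH(1)])
      have rV: "rsubmodule R (sub N (\<V> S)) (\<V> (insert z S))" unfolding eq by (rule rsub_vimage[OF Sm Bm f D(1)])
      have r: "rsubmodule R N (\<V> (insert z S))" and sub: "\<V> (insert z S) \<subseteq> \<V> S"
        using rV unfolding N.rsub_sub[OF IH(1)] by blast+
      have fV: "fin_len R N (\<V> S)" by (rule fin_len_mono(1)[OF fN IH(1) N.rsubD(1)[OF IH(1)]])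
      have fV': "fin_len R (sub N (\<V> S)) (carrier (sub N (\<V> S)))"
        using fin_len_sub(1)[OF Nm IH(1) order_refl] fV by simp
      have "len R (sub N (\<V> S)) (carrier (sub N (\<V> S))) + len R ?B D
          \<le> len R (sub N (\<V> S)) (\<V> (insert z S)) + len R ?B (carrier ?B)"
        unfolding eq by (rule len_vimage[OF Sm Bm f fV' fB D(1)])
      then have "len R N (\<V> S) + len R ?B D \<le> len R N (\<V> (insert z S)) + len R ?B (carrier ?B)"
        using fin_len_sub(2)[OF Nm IH(1) order_refl] fin_len_sub(2)[OF Nm IH(1) sub] by simp
      then have "len R N (\<V> S) \<le> len R N (\<V> (insert z S)) + n * q" using ess by linarith
      then show ?case using r IH(2) insert.hyps by simp
    qed
    let ?S = "{..<b} \<times> L"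
    define V where "V = \<V> ?S"
    have finS: "finite ?S" "?S \<subseteq> {..<b} \<times> carrier \<Lambda>" using L(1,2) by auto
    note V = \<V>[OF finS, folded V_def]
    have VK: "V \<subseteq> K" by (auto simp: V_def \<V>_def)
    \<comment> \<open>The \<open>l\<close> that satisfy the condition form an
      \<open>R\<close>-submodule of \<open>\<Lambda>\<close>, so the finite generating set
      \<open>L\<close> takes care of all \<open>l\<close>. This is also what makes \<open>V\<close>
      a \<open>\<Lambda>\<close>-submodule.\<close>
    have full: "\<epsilon> j (k \<triangleleft>\<^bsub>X\<^esub> l) \<in> D" if k: "k \<in> V" and j: "j < b" and l: "l \<in> carrier \<Lambda>" for j k l
    proof -
      let ?Y = "{l \<in> carrier \<Lambda>. \<epsilon> j (k \<triangleleft>\<^bsub>X\<^esub> l) \<in> D}"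
      have kK: "k \<in> K" using k VK by blast
      note kX = KX[OF kK]
      have sm: "r \<odot>\<^bsub>\<Lambda>\<^esub> l \<in> ?Y" if "l \<in> ?Y" "r \<in> carrier R" for l r
      proof -
        have l: "l \<in> carrier \<Lambda>" "\<epsilon> j (k \<triangleleft>\<^bsub>X\<^esub> l) \<in> D" using that(1) by blast+
        have "\<epsilon> j (k \<triangleleft>\<^bsub>X\<^esub> (r \<odot>\<^bsub>\<Lambda>\<^esub> l)) = \<epsilon> j (k \<triangleleft>\<^bsub>X\<^esub> l) \<triangleleft>\<^bsub>?B\<^esub> r"
          using scalar_commute(2)[OF Xm kX that(2) l(1)] \<epsilon>sc[OF that(2), of j "k \<triangleleft>\<^bsub>X\<^esub> l"] by simp
        moreover have "\<dots> \<in> D" by (rule B.rsubD(7)[OF D(1) l(2) that(2)])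
        ultimately show ?thesis using l(1) that(2) by simp
      qed
      have sg: "subgroup ?Y (add_monoid \<Lambda>)"
      proof (rule add.subgroupI)
        have "\<epsilon> j (k \<triangleleft>\<^bsub>X\<^esub> \<zero>\<^bsub>\<Lambda>\<^esub>) = \<zero>\<^bsub>?B\<^esub>" using kX by (simp add: \<epsilon>_def powm_simps(2) N_simps fun_eq_iff)
        then have "\<zero>\<^bsub>\<Lambda>\<^esub> \<in> ?Y" using B.rsubD(3)[OF D(1)] by simp
        then show "?Y \<noteq> {}" by blast
        show "\<ominus>\<^bsub>\<Lambda>\<^esub> y \<in> ?Y" if y: "y \<in> ?Y" for y
        proof -
          have "\<ominus>\<^bsub>\<Lambda>\<^esub> y = (\<ominus>\<^bsub>R\<^esub> \<one>\<^bsub>R\<^esub>) \<odot>\<^bsub>\<Lambda>\<^esub> y" using y by (simp add: smult_l_minus)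
          then show ?thesis using sm[OF y, of "\<ominus>\<^bsub>R\<^esub> \<one>\<^bsub>R\<^esub>"] by simp
        qed
        show "y \<oplus>\<^bsub>\<Lambda>\<^esub> y' \<in> ?Y" if y: "y \<in> ?Y" "y' \<in> ?Y" for y y'
        proof -
          have c: "y \<in> carrier \<Lambda>" "y' \<in> carrier \<Lambda>" using y by blast+
          have "\<epsilon> j (k \<triangleleft>\<^bsub>X\<^esub> (y \<oplus>\<^bsub>\<Lambda>\<^esub> y')) = \<epsilon> j (k \<triangleleft>\<^bsub>X\<^esub> y) \<oplus>\<^bsub>?B\<^esub> \<epsilon> j (k \<triangleleft>\<^bsub>X\<^esub> y')"
            using X.ract_r_distr[OF kX c] \<epsilon>add[OF Kact[OF kK c(1)] Kact[OF kK c(2)]] by simp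
          then show ?thesis using B.rsubD(4)[OF D(1)] y c by simp
        qed
      qed auto
      have "submodule ?Y R \<Lambda>" by (rule submodule.intro[OF sg], unfold_locales) (rule sm)
      moreover have "L \<subseteq> ?Y" using k j L(2) by (auto simp: V_def \<V>_def)
      ultimately have "?Y = carrier \<Lambda>" using L(3) by blast
      then show ?thesis using l by blast
    qed
    have rV: "rsubmodule \<Lambda> X V"
    proof (rule X.rsubI)
      show "V \<subseteq> carrier X" using VK KX by blast
      show "\<zero>\<^bsub>X\<^esub> \<in> V" using N.rsubD(3)[OF conjunct1[OF V]] by (simp add: N_simps)
      show "x \<oplus>\<^bsub>X\<^esub> y \<in> V" if "x \<in> V" "y \<in> V" for x y
        using N.rsubD(4)[OF conjunct1[OF V] that] by (simp add: N_simps)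
      show "x \<triangleleft>\<^bsub>X\<^esub> l \<in> V" if x: "x \<in> V" and l: "l \<in> carrier \<Lambda>" for x l
      proof -
        have xK: "x \<in> K" using x VK by blast
        have "\<epsilon> j ((x \<triangleleft>\<^bsub>X\<^esub> l) \<triangleleft>\<^bsub>X\<^esub> m) \<in> D" if "j < b" "m \<in> L" for j m
        proof -
          have m: "m \<in> carrier \<Lambda>" using that(2) L(2) by blast
          show ?thesis using full[OF x that(1), of "l \<otimes>\<^bsub>\<Lambda>\<^esub> m"] l m X.ract_assoc[OF KX[OF xK] l m] by simp
        qed
        then show ?thesis using Kact[OF xK l] by (auto simp: V_def \<V>_def)
      qed
    qed
    have "V = {\<zero>\<^bsub>X\<^esub>}"
    proof (rule undetected_zero[OF U e P X rK rV VK])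
      show "W = {\<zero>\<^bsub>X\<^esub>}" if "rsubmodule \<Lambda> X W" "W \<subseteq> K" "quot X W \<in> rperp U" for W
        by (rule red[OF that(1) _ that(3)]) (use that(2) in \<open>simp add: K_def\<close>)
      fix h assume h: "h \<in> rhom \<Lambda> P (quot X V)"
      let ?Q = "quot X V"
      have Q: "?Q \<in> mods" by (rule quot_mods(1)[OF X rV])
      note Qm = modsD(1)[OF Q]
      have kmods: "sub X (hker X ?Q (crep X V)) \<in> mods" using sub_mods(1)[OF X rV] by (simp only: X.hker_crep[OF rV])
      obtain x where x: "x \<in> rhom \<Lambda> G X" "\<forall>z\<in>carrier G. crep X V (x z) = h (c z)"
        using rel_projD(2)[OF G X Q X.crep_hom[OF rV] X.crep_surj[OF rV] kmods rhom_comp[OF c(1) h]] by blast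
      have x\<Omega>: "x z \<in> V" if z: "z \<in> \<Omega>" for z
      proof -
        have zc: "z \<in> carrier G" "c z = \<zero>\<^bsub>P\<^esub>" using z by (simp_all add: \<Omega>_def hker_def)
        have "crep X V (x z) = \<zero>\<^bsub>?Q\<^esub>" using x(2) zc rhom_zero[OF Pm Qm h] by simp
        then show ?thesis using X.crep_zero_iff[OF rV rhomD(1)[OF x(1) zc(1)]] by simp
      qed
      then have xH: "x \<in> H \<Omega>" using x(1) VK by (auto simp: H_def)
      \<comment> \<open>The vector \<open>\<delta> x\<close> is a sum of single-entry vectors with
        entries in \<open>V\<close>, each of which lies in \<open>D\<close>; the sum is built up
        coordinate by coordinate.\<close>
      have "(\<lambda>j. if j < m then x (\<omega> j) else \<zero>\<^bsub>X\<^esub>) \<in> D" if "m \<le> b" for m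
        using that
      proof (induction m)
        case 0
        then show ?case using B.rsubD(3)[OF D(1)] by (simp add: powm_simps(2) N_simps)
      next
        case (Suc m)
        have mb: "m < b" using Suc.prems by simp
        have xm: "x (\<omega> m) \<in> V" using x\<Omega> \<omega>(1) mb by simp
        then have xc: "x (\<omega> m) \<in> carrier X" using VK KX by blast
        have xj: "x (\<omega> j) \<in> carrier X" if "j < m" for j
          by (rule rhomD(1)[OF x(1)]) (use \<omega>(1) \<Omega>G that mb in \<open>auto simp: subset_iff\<close>)
        have "\<epsilon> m (x (\<omega> m)) \<in> D" using full[OF xm mb \<Lambda>.one_closed] xc by simp
        moreover have "(\<lambda>j. if j < Suc m then x (\<omega> j) else \<zero>\<^bsub>X\<^esub>)
            = (\<lambda>j. if j < m then x (\<omega> j) else \<zero>\<^bsub>X\<^esub>) \<oplus>\<^bsub>?B\<^esub> \<epsilon> m (x (\<omega> m))"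
          using xc xj by (auto simp: powm_simps(3) N_simps \<epsilon>_def fun_eq_iff less_Suc_eq)
        ultimately show ?case using B.rsubD(4)[OF D(1)] Suc by simp
      qed
      from this[of b] have "\<delta> x \<in> D" by (simp add: \<delta>_def)
      \<comment> \<open>Membership in both \<open>D\<close> and \<open>A1\<close> puts
        \<open>\<delta> x\<close> into \<open>A0\<close>. By injectivity of \<open>\<delta>\<close>,
        the lift \<open>x\<close> agrees on \<open>G\<close> with a map to \<open>K\<close>.\<close>
      then have "\<delta> x \<in> A0" using D(3) xH by (auto simp: A1_def)
      then obtain y where y: "y \<in> H (carrier G)" "\<delta> x = \<delta> y" by (auto simp: A0_def)
      have xK: "x z \<in> K" if z: "z \<in> carrier G" for z
        using inj[OF xH subsetD[OF HH y(1)] y(2) z] y(1) z by (auto simp: H_def)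
      show "h ` carrier P \<subseteq> crep X V ` K"
      proof
        fix w assume "w \<in> h ` carrier P"
        then obtain p where p: "p \<in> carrier P" "w = h p" by blast
        have "p \<in> c ` carrier G" using p(1) by (simp only: c(2))
        then obtain z where z: "z \<in> carrier G" "p = c z" by blast
        have "w = crep X V (x z)" using x(2) z p(2) by simp
        then show "w \<in> crep X V ` K" using xK[OF z(1)] by blast
      qed
    qed
    then have "len R N V = 0" using len_zero(2)[OF Nm] by (simp add: N_simps)
    then have "len R N (carrier N) \<le> b * card L * (n * q)" using V by (simp add: card_cartesian_product)
    then have lK: "lg (sub X K) \<le> b * card L * (n * q)" by (simp add: lg_def N_def)
    have "lg X = lg (sub X K) + lg (sub M (f ` carrier X))" unfolding K_def by (rule lg_hom(2)[OF X Mm f])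
    then show ?thesis using lK sub_mods(2)[OF M rsub_range[OF Xm Mm f]] by simp
  qed
  then show ?thesis by blast
qed


section \<open>Right approximations by torsion-free classes\<close>

definition reduced :: "'a fgmod set \<Rightarrow> 'a fgmod \<Rightarrow> 'a fgmod \<Rightarrow> ((nat \<Rightarrow> 'a) set \<Rightarrow> (nat \<Rightarrow> 'a) set) \<Rightarrow> bool"
  where "reduced U M X f \<longleftrightarrow> X \<in> rperp U \<and> f \<in> rhom \<Lambda> X M \<and>
    (\<forall>W. rsubmodule \<Lambda> X W \<longrightarrow> W \<subseteq> hker X M f \<longrightarrow> quot X W \<in> rperp U \<longrightarrow> W = {\<zero>\<^bsub>X\<^esub>})"

lemma reducedD:
  assumes "reduced U M X f"
  shows "X \<in> rperp U" "X \<in> mods" "f \<in> rhom \<Lambda> X M"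
    "rsubmodule \<Lambda> X W \<Longrightarrow> W \<subseteq> hker X M f \<Longrightarrow> quot X W \<in> rperp U \<Longrightarrow> W = {\<zero>\<^bsub>X\<^esub>}"
proof -
  show X: "X \<in> rperp U" and "f \<in> rhom \<Lambda> X M"
    and "rsubmodule \<Lambda> X W \<Longrightarrow> W \<subseteq> hker X M f \<Longrightarrow> quot X W \<in> rperp U \<Longrightarrow> W = {\<zero>\<^bsub>X\<^esub>}"
    using assms unfolding reduced_def by simp_all
  show "X \<in> mods" using X by (simp add: rperp_def)
qed

text \<open>Dividing by a nonzero \<open>W\<close> that violates reducedness shortens the module,
  and the map to \<open>M\<close> descends because \<open>W\<close> lies in its kernel.\<close>

lemma reduced_exists:
  assumes M: "right_module \<Lambda> M" and X: "X \<in> rperp U" and f: "f \<in> rhom \<Lambda> X M"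
  shows "\<exists>X' f'. reduced U M X' f' \<and> (\<exists>g\<in>rhom \<Lambda> X X'. \<forall>x\<in>carrier X. f' (g x) = f x)"
  using X f
proof (induction "lg X" arbitrary: X f rule: less_induct)
  case less
  note X = less.prems(1) and f = less.prems(2)
  have Xmods: "X \<in> mods" using X by (simp add: rperp_def)
  note Xm = modsD(1)[OF Xmods]
  interpret X: right_module \<Lambda> X by (rule Xm)
  show ?case
  proof (cases "reduced U M X f")
    case True
    have "\<exists>g\<in>rhom \<Lambda> X X. \<forall>x\<in>carrier X. f (g x) = f x" by (rule bexI[OF _ rhom_id]) simp
    then show ?thesis using True by blast
  next
    case False
    then obtain W where W: "rsubmodule \<Lambda> X W" "W \<subseteq> hker X M f" "quot X W \<in> rperp U" "W \<noteq> {\<zero>\<^bsub>X\<^esub>}"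
      unfolding reduced_def using X f by blast
    have "lg (sub X W) \<noteq> 0" using lg_eq_zero[OF sub_mods(1)[OF Xmods W(1)]] W(4) by auto
    then have lt: "lg (quot X W) < lg X" using quot_mods(2)[OF Xmods W(1)] by simp
    have ker: "f x = \<zero>\<^bsub>M\<^esub>" if "x \<in> carrier X" "crep X W x = \<zero>\<^bsub>quot X W\<^esub>" for x
      using X.crep_zero_iff[OF W(1) that(1)] that(2) W(2) by (auto simp: hker_def)
    obtain h where h: "h \<in> rhom \<Lambda> (quot X W) M" "\<And>x. x \<in> carrier X \<Longrightarrow> h (crep X W x) = f x"
      by (rule rhom_factor[OF Xm X.right_module_quot[OF W(1)] M X.crep_hom[OF W(1)] X.crep_surj[OF W(1)] f])
        (use ker in blast)+
    obtain X' f' g where g: "reduced U M X' f'" "g \<in> rhom \<Lambda> (quot X W) X'" "\<forall>x\<in>carrier (quot X W). f' (g x) = h x"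
      using less.hyps[OF lt W(3) h(1)] by blast
    have "\<exists>g'\<in>rhom \<Lambda> X X'. \<forall>x\<in>carrier X. f' (g' x) = f x"
      by (intro bexI[OF _ rhom_comp[OF X.crep_hom[OF W(1)] g(2)]] ballI)
        (simp add: g(3)[rule_format, OF rhomD(1)[OF X.crep_hom[OF W(1)]]] h(2))
    then show ?thesis using g(1) by blast
  qed
qed

lemma rperp_biprod:
  "\<X> \<subseteq> mods \<Longrightarrow> M \<in> rperp \<X> \<Longrightarrow> N \<in> rperp \<X> \<Longrightarrow> biprod M N D i j p q \<Longrightarrow> D \<in> rperp \<X>"
  by (rule subcategoryD(4)[OF IE_D(1)[OF rperp_IE]])

text \<open>Let \<open>(X, f)\<close> be reduced of maximal length and let \<open>g\<close> go from
  \<open>Y\<close> to \<open>M\<close>. Reducing the induced map on the sum of \<open>X\<close> and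
  \<open>Y\<close> yields a module \<open>X'\<close>. The map from \<open>X\<close> to
  \<open>X'\<close> is injective because \<open>f\<close> is reduced and bijective by maximality,
  and its inverse makes \<open>g\<close> factor through \<open>f\<close>.\<close>

lemma rperp_contravariantly_finite:
  assumes U: "torsion_class \<Lambda> U" and e: "univ_elem U P e" and P: "rel_proj U P"
  shows "contravariantly_finite \<Lambda> (rperp U)"
  unfolding contravariantly_finite_def
proof
  fix M :: "'a fgmod" assume M: "M \<in> mods"
  note Mm = modsD(1)[OF M] and Um = torsD(1)[OF U]
  interpret M: right_module \<Lambda> M by (rule Mm)
  obtain c where c: "\<forall>X f. X \<in> mods \<longrightarrow> hom0 P X \<longrightarrow> f \<in> rhom \<Lambda> X M \<longrightarrow>
    (\<forall>W. rsubmodule \<Lambda> X W \<longrightarrow> W \<subseteq> hker X M f \<longrightarrow> quot X W \<in> rperp U \<longrightarrow> W = {\<zero>\<^bsub>X\<^esub>}) \<longrightarrow> lg X \<le> c"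
    using reduced_bound[OF U e P M] by blast
  have bound: "lg X < Suc c" if "reduced U M X f" for X f
  proof -
    have "hom0 P X" using reducedD(1)[OF that] univ_elemD(1)[OF e] unfolding rperp_def by blast
    then have "lg X \<le> c" using c reducedD(2)[OF that] that unfolding reduced_def by blast
    then show ?thesis by simp
  qed
  let ?Z = "sub M {\<zero>\<^bsub>M\<^esub>}"
  have Z: "?Z \<in> rperp U" by (rule rperp_zero[OF sub_mods(1)[OF M M.rsub_zero]]) simp
  have idZ: "(\<lambda>x. x) \<in> rhom \<Lambda> ?Z M" by (rule rhom_incl') simp
  obtain X0 f0 where "reduced U M X0 f0" using reduced_exists[OF Mm Z idZ] by blast
  then have ex: "reduced U M (fst (X0, f0)) (snd (X0, f0))" by simp
  have bd: "\<forall>z. reduced U M (fst z) (snd z) \<longrightarrow> lg (fst z) < Suc c" using bound by blast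
  obtain z where z: "reduced U M (fst z) (snd z)"
      "\<forall>z'. reduced U M (fst z') (snd z') \<longrightarrow> lg (fst z') \<le> lg (fst z)"
    using ex_has_greatest_nat[of "\<lambda>z. reduced U M (fst z) (snd z)", OF ex bd] by blast
  obtain X f where zz: "z = (X, f)" by (cases z)
  have X: "reduced U M X f" using z(1) zz by simp
  have mx: "lg X' \<le> lg X" if "reduced U M X' f'" for X' f'
    using z(2)[rule_format, of "(X', f')"] that zz by simp
  note Xr = reducedD[OF X]
  note Xm = modsD(1)[OF Xr(2)]
  have "\<exists>h\<in>rhom \<Lambda> Y X. \<forall>y\<in>carrier Y. g y = f (h y)" if Y: "Y \<in> rperp U" and g: "g \<in> rhom \<Lambda> Y M" for Y g
  proof -
    have Ymods: "Y \<in> mods" using Y by (simp add: rperp_def)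
    note Ym = modsD(1)[OF Ymods]
    obtain D i j p q where b: "biprod X Y D i j p q" by (rule biprod_exists[OF Xr(2) Ymods])
    note B = biprodD[OF b]
    have D: "D \<in> rperp U" by (rule rperp_biprod[OF Um Xr(1) Y b])
    let ?h = "\<lambda>d. f (p d) \<oplus>\<^bsub>M\<^esub> g (q d)"
    have h: "?h \<in> rhom \<Lambda> D M" by (rule copair[OF b Mm Xr(3) g])
    obtain X' f' k where k: "reduced U M X' f'" "k \<in> rhom \<Lambda> D X'" "\<forall>d\<in>carrier D. f' (k d) = ?h d"
      using reduced_exists[OF Mm D h] by blast
    note X'r = reducedD[OF k(1)]
    note X'm = modsD(1)[OF X'r(2)]
    let ?m = "\<lambda>x. k (i x)"
    have m: "?m \<in> rhom \<Lambda> X X'" by (rule rhom_comp[OF B(3) k(2)])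
    have f'm: "f' (?m x) = f x" if x: "x \<in> carrier X" for x
      using k(3)[rule_format, OF rhomD(1)[OF B(3) x]] B(7,8)[OF x] rhom_zero[OF Ym Mm g] rhomD(1)[OF Xr(3) x] by simp
    have "hker X X' ?m \<subseteq> hker X M f"
      using f'm rhom_zero[OF X'm Mm X'r(3)] by (fastforce simp: hker_def)
    moreover have "quot X (hker X X' ?m) \<in> rperp U"
      using quot_hker_embeds[OF Xm X'm m] rperp_sub_closed[OF Um X'r(1) quot_mods(1)[OF Xr(2) rsub_hker[OF Xm X'm m]]] by blast
    ultimately have "hker X X' ?m = {\<zero>\<^bsub>X\<^esub>}" by (rule Xr(4)[OF rsub_hker[OF Xm X'm m]])
    then have "inj_on ?m (carrier X)" using rhom_inj_iff[OF Xm X'm m] by simp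
    then have bij: "bij_betw ?m (carrier X) (carrier X')"
      by (rule lg_inj(2)[OF Xr(2) X'r(2) m _ mx[OF k(1)]])
    define s where "s = inv_into (carrier X) ?m"
    have s: "s \<in> rhom \<Lambda> X' X" unfolding s_def by (rule rhom_inv[OF Xm m bij])
    have ms: "?m (s z) = z" if "z \<in> carrier X'" for z
      unfolding s_def by (rule f_inv_into_f) (use bij that in \<open>simp add: bij_betw_def\<close>)
    have kj: "(\<lambda>y. k (j y)) \<in> rhom \<Lambda> Y X'" by (rule rhom_comp[OF B(4) k(2)])
    have "f (s (k (j y))) = g y" if y: "y \<in> carrier Y" for y
    proof -
      have kjy: "k (j y) \<in> carrier X'" by (rule rhomD(1)[OF kj y])
      have "f (s (k (j y))) = f' (?m (s (k (j y))))" by (rule f'm[OF rhomD(1)[OF s kjy], symmetric])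
      also have "\<dots> = f' (k (j y))" by (simp only: ms[OF kjy])
      also have "\<dots> = g y"
        using k(3)[rule_format, OF rhomD(1)[OF B(4) y]] B(9,10)[OF y] rhom_zero[OF Xm Mm Xr(3)] rhomD(1)[OF g y] by simp
      finally show ?thesis .
    qed
    then show ?thesis by (intro bexI[OF _ rhom_comp[OF kj s]] ballI) simp
  qed
  then have "right_approx \<Lambda> (rperp U) M X f" unfolding right_approx_def using Xr(1,3) by blast
  then show "\<exists>X f. right_approx \<Lambda> (rperp U) M X f" by blast
qed

lemma finite_rperp_contravariantly_finite:
  assumes fin: "finite {T. torsion_class \<Lambda> T}" and U: "torsion_class \<Lambda> U"
  shows "contravariantly_finite \<Lambda> (rperp U)"
proof -
  obtain P e where "min_univ U P e" using finite_univ_elem[OF fin U] min_univ_exists[OF U] by blast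
  then show ?thesis using rperp_contravariantly_finite[OF U uP[OF U] min_univ_rel_proj[OF U]] by blast
qed

section \<open>Approximations by IE-closed subcategories\<close>

lemma left_approxD:
  assumes "left_approx \<Lambda> C M X f"
  shows "X \<in> C" "f \<in> rhom \<Lambda> M X" "Y \<in> C \<Longrightarrow> g \<in> rhom \<Lambda> M Y \<Longrightarrow> \<exists>h\<in>rhom \<Lambda> X Y. \<forall>x\<in>carrier M. g x = h (f x)"
  using assms by (simp_all add: left_approx_def)

lemma right_approxD:
  assumes "right_approx \<Lambda> C M X f"
  shows "X \<in> C" "f \<in> rhom \<Lambda> X M" "Y \<in> C \<Longrightarrow> g \<in> rhom \<Lambda> Y M \<Longrightarrow> \<exists>h\<in>rhom \<Lambda> Y X. \<forall>y\<in>carrier Y. g y = f (h y)"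
  using assms by (simp_all add: right_approx_def)

text \<open>A left approximation by \<open>lperp (rperp C)\<close> is divided by its torsion radical
  for \<open>lperp C\<close>; a right approximation by \<open>rperp (lperp C)\<close> is cut down to
  its torsion radical for \<open>lperp (rperp C)\<close>. Both results lie in the intersection,
  which is \<open>C\<close>.\<close>

lemma IE_functorially_finite:
  assumes fin: "finite {T. torsion_class \<Lambda> T}" and C: "IE_closed \<Lambda> C"
  shows "functorially_finite \<Lambda> C"
proof -
  define T T' where "T = lperp (rperp C)" and "T' = lperp C"
  have T: "torsion_class \<Lambda> T" unfolding T_def by (rule lperp_torsion) (simp add: rperp_def)
  have T': "torsion_class \<Lambda> T'" unfolding T'_def by (rule lperp_torsion[OF IE_D(3)[OF C]])
  have Ceq: "C = T \<inter> rperp T'" unfolding T_def T'_def by (rule IE_eq[OF C])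
  have "\<exists>X f. left_approx \<Lambda> C M X f" if M: "M \<in> mods" for M
  proof -
    obtain E e where "univ_elem T E e" using finite_univ_elem[OF fin T] by blast
    then have "covariantly_finite \<Lambda> T" by (rule cov_of_univ_elem[OF T])
    then obtain X f where la: "left_approx \<Lambda> T M X f" using M unfolding covariantly_finite_def by blast
    note X = left_approxD(1)[OF la] and f = left_approxD(2)[OF la] and fac = left_approxD(3)[OF la]
    note Xmods = torsD(2)[OF T X]
    note Xm = modsD(1)[OF Xmods] and tX = trad[OF T' Xmods]
    interpret X: right_module \<Lambda> X by (rule Xm)
    let ?V = "trad T' X"
    note Qm = X.right_module_quot[OF tX(1)] and cr = X.crep_hom[OF tX(1)] X.crep_surj[OF tX(1)]
    have "quot X ?V \<in> T" by (rule tors_quot[OF T X Qm cr])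
    then have Q: "quot X ?V \<in> C" unfolding Ceq using tX(3) by blast
    have "\<exists>h\<in>rhom \<Lambda> (quot X ?V) Y. \<forall>x\<in>carrier M. g x = h (crep X ?V (f x))"
      if Y: "Y \<in> C" and g: "g \<in> rhom \<Lambda> M Y" for Y g
    proof -
      have YT: "Y \<in> T" and YF: "Y \<in> rperp T'" using Y unfolding Ceq by blast+
      have Ym: "right_module \<Lambda> Y" by (rule modsD(1)[OF torsD(2)[OF T YT]])
      obtain h where h: "h \<in> rhom \<Lambda> X Y" "\<forall>x\<in>carrier M. g x = h (f x)" using fac[OF YT g] by blast
      have h0: "hom0 (sub X ?V) Y" using YF tX(2) unfolding rperp_def by blast
      have ker: "h x = \<zero>\<^bsub>Y\<^esub>" if "x \<in> carrier X" "crep X ?V x = \<zero>\<^bsub>quot X ?V\<^esub>" for x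
        using hom0D[OF h0 rhom_restrict[OF h(1) X.rsubD(1)[OF tX(1)]]] X.crep_zero_iff[OF tX(1) that(1)] that(2) by simp
      obtain k where k: "k \<in> rhom \<Lambda> (quot X ?V) Y" "\<And>x. x \<in> carrier X \<Longrightarrow> k (crep X ?V x) = h x"
        by (rule rhom_factor[OF Xm Qm Ym cr h(1)]) (use ker in blast)+
      show ?thesis by (intro bexI[OF _ k(1)] ballI) (simp add: k(2)[OF rhomD(1)[OF f]] h(2))
    qed
    then have "left_approx \<Lambda> C M (quot X ?V) (\<lambda>x. crep X ?V (f x))"
      unfolding left_approx_def using Q rhom_comp[OF f cr(1)] by blast
    then show ?thesis by blast
  qed
  moreover have "\<exists>X f. right_approx \<Lambda> C M X f" if M: "M \<in> mods" for M
  proof -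
    obtain X f where ra: "right_approx \<Lambda> (rperp T') M X f"
      using M finite_rperp_contravariantly_finite[OF fin T'] unfolding contravariantly_finite_def by blast
    note X = right_approxD(1)[OF ra] and f = right_approxD(2)[OF ra] and fac = right_approxD(3)[OF ra]
    have Xmods: "X \<in> mods" using X by (simp add: rperp_def)
    note tX = trad[OF T Xmods]
    let ?V = "trad T X"
    have VX: "?V \<subseteq> carrier X" by (rule right_module.rsubD(1)[OF modsD(1)[OF Xmods] tX(1)])
    have S: "sub X ?V \<in> C" unfolding Ceq using tX(2) rperp_sub[OF X tX(1)] by blast
    have "\<exists>h\<in>rhom \<Lambda> Y (sub X ?V). \<forall>y\<in>carrier Y. g y = f (h y)"
      if Y: "Y \<in> C" and g: "g \<in> rhom \<Lambda> Y M" for Y g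
    proof -
      have YT: "Y \<in> T" and YF: "Y \<in> rperp T'" using Y unfolding Ceq by blast+
      obtain h where h: "h \<in> rhom \<Lambda> Y X" "\<forall>y\<in>carrier Y. g y = f (h y)" using fac[OF YF g] by blast
      show ?thesis
        by (intro bexI[OF _ rhom_corestrict[OF h(1) trad_image[OF T Xmods YT h(1)]]]) (rule h(2))
    qed
    then have "right_approx \<Lambda> C M (sub X ?V) f"
      unfolding right_approx_def using S rhom_restrict[OF f VX] by blast
    then show ?thesis by blast
  qed
  ultimately show ?thesis
    unfolding functorially_finite_def covariantly_finite_def contravariantly_finite_def by blast
qed

section \<open>Simple modules and the test module\<close>

definition simple_or_zero :: "'a fgmod \<Rightarrow> bool"
  where "simple_or_zero S \<longleftrightarrow> S \<in> mods \<and> (\<forall>V. rsubmodule \<Lambda> S V \<longrightarrow> V = {\<zero>\<^bsub>S\<^esub>} \<or> V = carrier S)"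

lemma simple_or_zero_quot_exists:
  assumes M: "M \<in> mods" and nz: "carrier M \<noteq> {\<zero>\<^bsub>M\<^esub>}"
  shows "\<exists>A. rsubmodule \<Lambda> M A \<and> A \<noteq> carrier M \<and> simple_or_zero (quot M A)"
proof -
  note Mm = modsD(1)[OF M]
  interpret M: right_module \<Lambda> M by (rule Mm)
  let ?ok = "\<lambda>A. rsubmodule \<Lambda> M A \<and> A \<noteq> carrier M"
  have ok0: "?ok {\<zero>\<^bsub>M\<^esub>}" using M.rsub_zero nz by simp
  have bd: "\<forall>A. ?ok A \<longrightarrow> lg (sub M A) < Suc (lg M)" using sub_mods(2)[OF M] by (simp add: less_Suc_eq_le)
  obtain A where A: "rsubmodule \<Lambda> M A" "A \<noteq> carrier M" and mx: "\<forall>B. ?ok B \<longrightarrow> lg (sub M B) \<le> lg (sub M A)"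
    using ex_has_greatest_nat[of ?ok, OF ok0 bd] by blast
  note Qm = M.right_module_quot[OF A(1)] and cr = M.crep_hom[OF A(1)]
  have "V = {\<zero>\<^bsub>quot M A\<^esub>} \<or> V = carrier (quot M A)" if V: "rsubmodule \<Lambda> (quot M A) V" for V
  proof -
    let ?B = "{x \<in> carrier M. crep M A x \<in> V}"
    have B: "rsubmodule \<Lambda> M ?B" by (rule rsub_vimage[OF Mm Qm cr V])
    have V': "V \<subseteq> crep M A ` carrier M" using right_module.rsubD(1)[OF Qm V] by (simp only: M.crep_surj[OF A(1)])
    have VB: "V = crep M A ` ?B"
    proof
      show "V \<subseteq> crep M A ` ?B"
      proof
        fix v assume v: "v \<in> V"
        then obtain x where "x \<in> carrier M" "v = crep M A x" using V' by blast
        then show "v \<in> crep M A ` ?B" using v by blast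
      qed
      show "crep M A ` ?B \<subseteq> V" by blast
    qed
    have AB: "A \<subseteq> ?B"
    proof
      fix x assume x: "x \<in> A"
      then have xc: "x \<in> carrier M" by (rule M.rsubD(2)[OF A(1)])
      then show "x \<in> ?B" using M.crep_zero_iff[OF A(1) xc] x right_module.rsubD(3)[OF Qm V] by simp
    qed
    show ?thesis
    proof (cases "?B = carrier M")
      case True
      then have "V = crep M A ` carrier M" using VB by simp
      then show ?thesis using M.crep_surj[OF A(1)] by simp
    next
      case False
      then have le: "lg (sub M ?B) \<le> lg (sub M A)" using mx B by blast
      have "rsubmodule \<Lambda> (sub M ?B) A" using M.rsub_sub[OF B] A(1) AB by blast
      from sub_mods(3)[OF sub_mods(1)[OF M B] this] have "A = ?B" using le by fastforce
      then have "V = crep M A ` A" using VB by simp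
      also have "\<dots> \<subseteq> {\<zero>\<^bsub>quot M A\<^esub>}"
      proof
        fix v assume "v \<in> crep M A ` A"
        then obtain x where x: "x \<in> A" "v = crep M A x" by blast
        then show "v \<in> {\<zero>\<^bsub>quot M A\<^esub>}" using M.crep_zero_iff[OF A(1) M.rsubD(2)[OF A(1) x(1)]] by simp
      qed
      finally show ?thesis using right_module.rsubD(3)[OF Qm V] by blast
    qed
  qed
  then have "simple_or_zero (quot M A)" unfolding simple_or_zero_def using quot_mods(1)[OF M A(1)] by blast
  then show ?thesis using A by blast
qed

lemma simple_or_zero_hom0_sym:
  assumes S: "simple_or_zero S" and S': "simple_or_zero S'" and h: "hom0 S' S"
  shows "hom0 S S'"
proof -
  have m: "right_module \<Lambda> S" "right_module \<Lambda> S'" using S S' modsD(1) unfolding simple_or_zero_def by blast+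
  show ?thesis
  proof (rule hom0I)
    fix f x assume f: "f \<in> rhom \<Lambda> S S'" and x: "x \<in> carrier S"
    show "f x = \<zero>\<^bsub>S'\<^esub>"
    proof (rule ccontr)
      assume nz: "f x \<noteq> \<zero>\<^bsub>S'\<^esub>"
      have "hker S S' f \<noteq> carrier S" using nz x unfolding hker_def by blast
      then have "hker S S' f = {\<zero>\<^bsub>S\<^esub>}" using S rsub_hker[OF m f] unfolding simple_or_zero_def by blast
      then have inj: "inj_on f (carrier S)" using rhom_inj_iff[OF m f] by simp
      have "f ` carrier S \<noteq> {\<zero>\<^bsub>S'\<^esub>}" using nz x by blast
      then have surj: "f ` carrier S = carrier S'" using S' rsub_range[OF m f] unfolding simple_or_zero_def by blast
      have bij: "bij_betw f (carrier S) (carrier S')" using inj surj by (simp add: bij_betw_def)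
      have fx: "f x \<in> carrier S'" by (rule rhomD(1)[OF f x])
      have "inv_into (carrier S) f (f x) = \<zero>\<^bsub>S\<^esub>" by (rule hom0D[OF h rhom_inv[OF m(1) f bij] fx])
      then have "x = \<zero>\<^bsub>S\<^esub>" using inv_into_f_f[OF inj x] by simp
      then show False using nz rhom_zero[OF m f] by simp
    qed
  qed
qed

text \<open>\<open>Y\<close> is the direct sum of composition factors of \<open>M\<close>, built by
  splitting off one simple quotient at a time. A simple \<open>S\<close> with a nonzero map from
  \<open>M\<close> is one of these factors and hence also maps to \<open>Y\<close>; the step from
  maps out of a factor to maps into it is \<open>simple_or_zero_hom0_sym\<close>.\<close>

lemma simple_or_zero_detector:
  assumes "M \<in> mods"
  shows "\<exists>Y\<in>mods. \<forall>S. simple_or_zero S \<longrightarrow> hom0 S Y \<longrightarrow> hom0 M S"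
  using assms
proof (induction "lg M" arbitrary: M rule: less_induct)
  case less
  note M = less.prems
  note Mm = modsD(1)[OF M]
  interpret M: right_module \<Lambda> M by (rule Mm)
  show ?case
  proof (cases "carrier M = {\<zero>\<^bsub>M\<^esub>}")
    case True
    have "hom0 M S" if "simple_or_zero S" for S
      by (rule hom0_zero_dom[OF Mm modsD(1) True]) (use that in \<open>simp add: simple_or_zero_def\<close>)
    then show ?thesis using M by blast
  next
    case False
    obtain A where A: "rsubmodule \<Lambda> M A" "A \<noteq> carrier M" "simple_or_zero (quot M A)" using simple_or_zero_quot_exists[OF M False] by blast
    have Qmods: "quot M A \<in> mods" by (rule quot_mods(1)[OF M A(1)])
    note Qm = modsD(1)[OF Qmods]
    obtain Y where Y: "Y \<in> mods" "\<forall>S. simple_or_zero S \<longrightarrow> hom0 S Y \<longrightarrow> hom0 (sub M A) S"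
      using less.hyps[OF sub_mods(3)[OF M A(1,2)] sub_mods(1)[OF M A(1)]] by blast
    note Ym = modsD(1)[OF Y(1)]
    obtain D i j p q where b: "biprod Y (quot M A) D i j p q" by (rule biprod_exists[OF Y(1) Qmods])
    note B = biprodD[OF b]
    note Dm = modsD(1)[OF B(1)]
    have "hom0 M S" if S: "simple_or_zero S" and h: "hom0 S D" for S
    proof -
      have Sm: "right_module \<Lambda> S" using S modsD(1) unfolding simple_or_zero_def by blast
      have hY: "hom0 S Y"
      proof (rule hom0I)
        fix f x assume f: "f \<in> rhom \<Lambda> S Y" and x: "x \<in> carrier S"
        have "i (f x) = \<zero>\<^bsub>D\<^esub>" by (rule hom0D[OF h rhom_comp[OF f B(3)] x])
        then show "f x = \<zero>\<^bsub>Y\<^esub>" using B(7)[OF rhomD(1)[OF f x]] rhom_zero[OF Dm Ym B(5)] by simp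
      qed
      have hQ: "hom0 S (quot M A)"
      proof (rule hom0I)
        fix f x assume f: "f \<in> rhom \<Lambda> S (quot M A)" and x: "x \<in> carrier S"
        have "j (f x) = \<zero>\<^bsub>D\<^esub>" by (rule hom0D[OF h rhom_comp[OF f B(4)] x])
        then show "f x = \<zero>\<^bsub>quot M A\<^esub>" using B(9)[OF rhomD(1)[OF f x]] rhom_zero[OF Dm Qm B(6)] by simp
      qed
      have hA: "hom0 (sub M A) S" using Y(2) S hY by blast
      have "hom0 (quot M A) S" by (rule simple_or_zero_hom0_sym[OF A(3) S hQ])
      then show ?thesis
        by (rule hom0_ext_dom[OF Mm Qm Sm M.crep_hom[OF A(1)] M.crep_surj[OF A(1)], rotated])
          (simp only: M.hker_crep[OF A(1)] hA)
    qed
    then show ?thesis using B(1) by blast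
  qed
qed

text \<open>Every nonzero module has a simple quotient, and every simple module is a quotient of a
  module with a universal element of \<open>mods\<close>. The detector of the latter therefore
  receives a nonzero map from it.\<close>

lemma test_module:
  "\<exists>Y\<in>mods. \<forall>X\<in>mods. hom0 X Y \<longrightarrow> carrier X = {\<zero>\<^bsub>X\<^esub>}"
proof -
  obtain L u where L: "univ_elem mods L u" using mods_univ_elem by blast
  obtain Y where Y: "Y \<in> mods" "\<forall>S. simple_or_zero S \<longrightarrow> hom0 S Y \<longrightarrow> hom0 L S"
    using simple_or_zero_detector[OF univ_elemD(1)[OF L]] by blast
  have "carrier X = {\<zero>\<^bsub>X\<^esub>}" if X: "X \<in> mods" and h: "hom0 X Y" for X
  proof (rule ccontr)
    assume "carrier X \<noteq> {\<zero>\<^bsub>X\<^esub>}"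
    then obtain A where A: "rsubmodule \<Lambda> X A" "A \<noteq> carrier X" "simple_or_zero (quot X A)" using simple_or_zero_quot_exists[OF X] by blast
    interpret X: right_module \<Lambda> X by (rule modsD(1)[OF X])
    have Qmods: "quot X A \<in> mods" by (rule quot_mods(1)[OF X A(1)])
    have "hom0 (quot X A) Y" by (rule hom0_surj[OF h X.crep_hom[OF A(1)] X.crep_surj[OF A(1)]])
    then have hL: "hom0 L (quot X A)" using Y(2) A(3) by blast
    have "z = \<zero>\<^bsub>quot X A\<^esub>" if z: "z \<in> carrier (quot X A)" for z
    proof -
      obtain k where k: "k \<in> rhom \<Lambda> L (quot X A)" "k u = z" using univ_elemD(3)[OF L Qmods z] by blast
      show ?thesis using hom0D[OF hL k(1) univ_elemD(2)[OF L]] k(2) by simp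
    qed
    then have "carrier (quot X A) = {\<zero>\<^bsub>quot X A\<^esub>}"
      using right_module.rsubD(3)[OF modsD(1)[OF Qmods] right_module.rsub_carrier[OF modsD(1)[OF Qmods]]] by blast
    then show False using quot_zero_imp[OF modsD(1)[OF X] A(1)] A(2) by blast
  qed
  then show ?thesis using Y(1) by blast
qed

lemma chain_rperp_not_contravariantly_finite:
  assumes U: "\<And>n :: nat. torsion_class \<Lambda> (U n)" and lt: "\<And>n. U (Suc n) \<subset> U n"
  shows "IE_closed \<Lambda> (\<Union>n. rperp (U n))" "\<not> contravariantly_finite \<Lambda> (\<Union>n. rperp (U n))"
proof -
  let ?F = "\<Union>n. rperp (U n)"
  have anti: "U n \<subseteq> U m" if "m \<le> n" for m n
    by (rule lift_Suc_antimono_le[of U, OF _ that]) (use lt in blast)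
  have mono: "rperp (U m) \<subseteq> rperp (U n)" if "m \<le> n" for m n
    unfolding rperp_def using anti[OF that] by blast
  note Um = torsD(1)[OF U]
  have Fm: "?F \<subseteq> mods" by (auto simp: rperp_def)
  show IE: "IE_closed \<Lambda> ?F"
  proof (rule torsionfree_IE[OF Fm])
    show "Z \<in> ?F" if "Z \<in> mods" "carrier Z = {\<zero>\<^bsub>Z\<^esub>}" for Z using rperp_zero[OF that] by blast
    show "M \<in> ?F" if "N \<in> ?F" "M \<in> mods" "f \<in> rhom \<Lambda> M N" "inj_on f (carrier M)" for M N f
      using that(1) rperp_sub_closed[OF Um _ that(2-4)] by blast
    fix M N g assume M: "M \<in> mods" and N: "N \<in> ?F" and g: "g \<in> rhom \<Lambda> M N" and K: "sub M (hker M N g) \<in> ?F"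
    obtain m n where mn: "N \<in> rperp (U m)" "sub M (hker M N g) \<in> rperp (U n)" using N K by blast
    have "N \<in> rperp (U (max m n))" "sub M (hker M N g) \<in> rperp (U (max m n))"
      using mn mono[of m "max m n"] mono[of n "max m n"] by auto
    from rperp_ext[OF M this(1) g this(2)] show "M \<in> ?F" by blast
  qed
  show "\<not> contravariantly_finite \<Lambda> ?F"
  proof
    assume cf: "contravariantly_finite \<Lambda> ?F"
    obtain Y where Y: "Y \<in> mods" "\<forall>X\<in>mods. hom0 X Y \<longrightarrow> carrier X = {\<zero>\<^bsub>X\<^esub>}" using test_module by blast
    obtain N f where ra: "right_approx \<Lambda> ?F Y N f" using cf Y(1) unfolding contravariantly_finite_def by blast
    note N = right_approxD(1)[OF ra] and f = right_approxD(2)[OF ra] and fac = right_approxD(3)[OF ra]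
    obtain n where n: "N \<in> rperp (U n)" using N by blast
    obtain X where X: "X \<in> U n" "X \<notin> U (Suc n)" using lt[of n] by blast
    obtain B where B: "B \<in> U n" "B \<in> rperp (U (Suc n))" "carrier B \<noteq> {\<zero>\<^bsub>B\<^esub>}"
      using torsion_gap[OF U U X] by blast
    have BF: "B \<in> ?F" using B(2) by blast
    have Bm: "B \<in> mods" by (rule torsD(2)[OF U B(1)])
    have Nm: "N \<in> mods" using n by (simp add: rperp_def)
    have BN: "hom0 B N" using n B(1) unfolding rperp_def by blast
    have "hom0 B Y"
    proof (rule hom0I)
      fix g x assume g: "g \<in> rhom \<Lambda> B Y" and x: "x \<in> carrier B"
      obtain h where h: "h \<in> rhom \<Lambda> B N" "\<forall>y\<in>carrier B. g y = f (h y)" using fac[OF BF g] by blast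
      show "g x = \<zero>\<^bsub>Y\<^esub>"
        using h(2) x hom0D[OF BN h(1) x] rhom_zero[OF modsD(1)[OF Nm] modsD(1)[OF Y(1)] f] by simp
    qed
    then show False using Y(2) Bm B(3) by blast
  qed
qed

lemma finite_torsion_of_functorially_finite:
  assumes ff: "\<And>C. IE_closed \<Lambda> C \<Longrightarrow> functorially_finite \<Lambda> C"
  shows "finite {T. torsion_class \<Lambda> T}"
proof (rule ccontr)
  assume inf: "infinite {T. torsion_class \<Lambda> T}"
  define below where "below U = {T. torsion_class \<Lambda> T \<and> T \<subseteq> U}" for U
  let ?big = "\<lambda>U. torsion_class \<Lambda> U \<and> infinite (below U)"
  have univ: "\<exists>E e. univ_elem U E e" if U: "torsion_class \<Lambda> U" for U
    using univ_elem_of_cov[OF torsD(1)[OF U]] ff[OF torsion_IE[OF U]] unfolding functorially_finite_def by blast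
  have "below mods = {T. torsion_class \<Lambda> T}" unfolding below_def using torsD(1) by blast
  then have start: "?big mods" using inf mods_torsion by simp
  have step: "\<exists>T. ?big T \<and> T \<subset> U" if U: "?big U" for U
  proof -
    obtain E e where e: "univ_elem U E e" using univ U by blast
    \<comment> \<open>Every torsion class strictly below \<open>U\<close> lies below one of the
      finitely many lower covers, so one of these again has infinitely many classes below
      it.\<close>
    have "below U \<subseteq> insert U (\<Union>T\<in>{T. cover U T}. below T)"
    proof
      fix S assume S: "S \<in> below U"
      show "S \<in> insert U (\<Union>T\<in>{T. cover U T}. below T)"
      proof (cases "S = U")
        case False
        then have "torsion_class \<Lambda> S" "S \<subset> U" using S unfolding below_def by blast+
        then obtain T where "cover U T" "S \<subseteq> T" using cover_exists[OF conjunct1[OF U] e] by blast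
        then show ?thesis using S unfolding below_def by blast
      qed simp
    qed
    then have "infinite (insert U (\<Union>T\<in>{T. cover U T}. below T))" using U finite_subset by blast
    then have "\<exists>T\<in>{T. cover U T}. infinite (below T)" using finite_covers[OF conjunct1[OF U] e] by blast
    then obtain T where T: "cover U T" "infinite (below T)" by blast
    have "?big T" "T \<subset> U" using coverD(1-3)[OF T(1)] T(2) by blast+
    then show ?thesis by blast
  qed
  have "\<exists>V. \<forall>n. ?big (V n) \<and> V (Suc n) \<subset> V n"
  proof (rule dependent_nat_choice)
    show "\<exists>U. ?big U" using start by (rule exI)
    show "\<exists>T. ?big T \<and> T \<subset> U" if "?big U" for U and n :: nat by (rule step[OF that])
  qed
  then obtain V :: "nat \<Rightarrow> 'a fgmod set" where V: "\<forall>n. ?big (V n) \<and> V (Suc n) \<subset> V n" by (rule exE)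
  have VT: "torsion_class \<Lambda> (V n)" and lt: "V (Suc n) \<subset> V n" for n
    using V[rule_format, of n] by (rule conjunct1[OF conjunct1], rule conjunct2)
  note chain = chain_rperp_not_contravariantly_finite[of V, OF VT lt]
  show False using ff[OF chain(1)] chain(2) unfolding functorially_finite_def by blast
qed

end

theorem proposition1:
  fixes R :: "('r, 'q) ring_scheme" and \<Lambda> :: "('r, 'a, 'k) module_scheme"
  assumes "artin_algebra R \<Lambda>"
  shows "(tau_tilting_finite \<Lambda> \<longleftrightarrow> finite {C. IE_closed \<Lambda> C}) \<and>
    (finite {C. IE_closed \<Lambda> C} \<longleftrightarrow> (\<forall>C. IE_closed \<Lambda> C \<longrightarrow> functorially_finite \<Lambda> C))"
proof -
  interpret artin_algebra R \<Lambda> by fact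
  have 1: "finite {C. IE_closed \<Lambda> C}" if "finite {T. torsion_class \<Lambda> T}" by (rule finite_IE[OF that])
  \<comment> \<open>Torsion classes are themselves IE-closed.\<close>
  have 2: "finite {T. torsion_class \<Lambda> T}" if "finite {C. IE_closed \<Lambda> C}"
    by (rule finite_subset[OF _ that]) (use torsion_IE in blast)
  have 3: "functorially_finite \<Lambda> C" if "finite {T. torsion_class \<Lambda> T}" "IE_closed \<Lambda> C" for C
    by (rule IE_functorially_finite[OF that])
  have 4: "finite {T. torsion_class \<Lambda> T}" if "\<forall>C. IE_closed \<Lambda> C \<longrightarrow> functorially_finite \<Lambda> C"
    by (rule finite_torsion_of_functorially_finite) (use that in blast)
  show ?thesis unfolding tau_tilting_finite_def using 1 2 3 4 by blast
qed

end
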